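(* Let $G$ be a discrete group and $p$ a prime integer. (a1) Suppose that $G$ is residually finite and the map $H_2(G,\mathbb{Z})\to H_2(\widehat{G},\widehat{\mathbb{Z}})$ induced by the canonical map $G\to\widehat{G}$ is injective. Then $G\wedge G$ is residually finite. (a2) Suppose that $G$ is residually finite and the map $H_2(G,\mathbb{Z})\to\varprojlim_U H_2(G/U,\mathbb{Z})$ induced by the canonical projections $G\to G/U$, where $U$ runs over all normal subgroups of finite index in $G$, is injective. Then $G\wedge G$ is residually finite. (b) Suppose that $G$ is a finitely generated residually finite group such that $G\wedge G$ is finitely generated. Then $G\wedge G$ is residually finite if and only if the map $H_2(G,\mathbb{Z})\to H_2(\widehat{G},\widehat{\mathbb{Z}})$ induced by the canonical map $G\to\widehat{G}$ is injective. (c1) Suppose that $G$ is residually $p$-finite and the map $H_2(G,\mathbb{Z})\to\varprojlim_U H_2(G/U,\mathbb{Z})$ induced by the canonical projections $G\to G/U$, where $U$ runs over all normal subgroups of $G$ of $p$-power index, is injective. Then $G\wedge G$ is residually $p$-finite. (c2) Suppose that $G$ is residually $p$-finite and the canonical map $H_2(G,\mathbb{Z})\to H_2(\widehat{G}_p,\mathbb{Z}_p)$ induced by the canonical map $G\to\widehat{G}_p$ is injective. Then $G\wedge G$ is residually $p$-finite. (d) If $G/G'$ is finitely generated and either $G/G'$ has no $2$-torsion or $G'$ has a complement in $G$, then $G\otimes G$ is residually finite if and only if $G\wedge G$ is residually finite. (e) If $G/G'$ is finitely generated and either $G/G'$ has no $2$-torsion or $G'$ has a complement in $G$, then $G\otimes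 G$ is residually $p$-finite if and only if $G\wedge G$ is residually $p$-finite and the torsion subgroup of $\Delta(G)$ is a finite $p$-group. In particular, if $G/G'$ is finitely generated and either $G/G'$ has no $2$-torsion or $G'$ has a complement in $G$, then $G\otimes G$ is residually $p$-finite for every prime $p$ if and only if $\Delta(G)$ is torsion-free and $G\wedge G$ is residually $p$-finite for every prime $p$.
   Context: Conventions: $g^h=h^{-1}gh$, $[a,b]=a^{-1}b^{-1}ab$, $G'=[G,G]$. Let $G^{\varphi}$ be an isomorphic copy of $G$ via $g\mapsto g^{\varphi}$ and $$\nu(G)=\langle G,G^{\varphi}\mid [g_1,g_2^{\varphi}]^{g_3}=[g_1,g_2^{\varphi}]^{g_3^{\varphi}}=[g_1^{g_3},(g_2^{g_3})^{\varphi}]\ \text{for } g_1,g_2,g_3\in G\rangle.$$ The non-abelian tensor square $G\otimes G$ is identified with the (normal) subgroup $[G,G^{\varphi}]$ of $\nu(G)$, with $g\otimes h$ corresponding to $[g,h^{\varphi}]$. $\Delta(G)$ is the subgroup of $G\otimes G$ generated by $\{g\otimes g\mid g\in G\}$ (it is central in $\nu(G)$), and the non-abelian exterior square is $G\wedge G=(G\otimes G)/\Delta(G)$. $\widehat{G}$ is the profinite completion of $G$ and $\widehat{G}_p=\varprojlim G/U$ (over normal subgroups $U$ of $p$-power index) is the pro-$p$ completion; $\widehat{\mathbb{Z}}$ is the profinite completion of $\mathbb{Z}$ and $\mathbb{Z}_p$ the $p$-adic integers. $H_n(\widehat{G},-)$ and $H_n(\widehat{G}_p,-)$ denote profinite homology;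 with trivial coefficients, $H_2(\widehat{G},\widehat{\mathbb{Z}})\cong\varprojlim_{U,m}H_2(G/U,\mathbb{Z}/m\mathbb{Z})$ over normal finite-index $U$ and $m\ge 1$, and similarly $H_2(\widehat{G}_p,\mathbb{Z}_p)\cong\varprojlim_{U,k}H_2(G/U,\mathbb{Z}/p^k\mathbb{Z})$ over normal $U$ of $p$-power index. "$p$-finite" means a finite $p$-group; a group is residually $p$-finite if every non-trivial element survives in some finite $p$-group quotient. *)

theory Defs
  imports "HOL-Algebra.Product_Groups" "HOL-Algebra.FiniteProduct" "HOL-Analysis.Function_Topology"
    "HOL-Computational_Algebra.Primes"
begin

section \<open>Groups: finiteness conditions\<close>

definition finitely_generated :: "('a, 'b) monoid_scheme \<Rightarrow> bool" where
  "finitely_generated G \<longleftrightarrow> (\<exists>S. finite S \<and> S \<subseteq> carrier G \<and> generate G S = carrier G)"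

definition p_finite :: "nat \<Rightarrow> ('a, 'b) monoid_scheme \<Rightarrow> bool" where
  "p_finite p G \<longleftrightarrow> group G \<and> finite (carrier G) \<and> (\<exists>k. order G = p ^ k)"

definition fin_index_normals :: "('a, 'b) monoid_scheme \<Rightarrow> 'a set set" where
  "fin_index_normals G = {U. U \<lhd> G \<and> finite (carrier (G Mod U))}"

definition p_index_normals :: "nat \<Rightarrow> ('a, 'b) monoid_scheme \<Rightarrow> 'a set set" where
  "p_index_normals p G = {U. U \<lhd> G \<and> p_finite p (G Mod U)}"

definition residually_finite :: "('a, 'b) monoid_scheme \<Rightarrow> bool" where
  "residually_finite G \<longleftrightarrow>
     (\<forall>x \<in> carrier G. x \<noteq> \<one>\<^bsub>G\<^esub> \<longrightarrow> (\<exists>U \<in> fin_index_normals G. x \<notin> U))"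

definition residually_p_finite :: "nat \<Rightarrow> ('a, 'b) monoid_scheme \<Rightarrow> bool" where
  "residually_p_finite p G \<longleftrightarrow>
     (\<forall>x \<in> carrier G. x \<noteq> \<one>\<^bsub>G\<^esub> \<longrightarrow> (\<exists>U \<in> p_index_normals p G. x \<notin> U))"

definition torsion_elements :: "('a, 'b) monoid_scheme \<Rightarrow> 'a set" where
  "torsion_elements G = {x \<in> carrier G. \<exists>n::nat. n > 0 \<and> x [^]\<^bsub>G\<^esub> n = \<one>\<^bsub>G\<^esub>}"

definition abelianization :: "('a, 'b) monoid_scheme \<Rightarrow> 'a set monoid" where
  "abelianization G = G Mod derived G (carrier G)"

definition no_2_torsion :: "('a, 'b) monoid_scheme \<Rightarrow> bool" where
  "no_2_torsion G \<longleftrightarrow> (\<forall>x \<in> carrier G. x [^]\<^bsub>G\<^esub> (2::nat) = \<one>\<^bsub>G\<^esub> \<longrightarrow> x = \<one>\<^bsub>G\<^esub>)"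

definition has_complement :: "('a, 'b) monoid_scheme \<Rightarrow> 'a set \<Rightarrow> bool" where
  "has_complement G N \<longleftrightarrow>
     (\<exists>H. subgroup H G \<and> H \<inter> N = {\<one>\<^bsub>G\<^esub>} \<and> H <#>\<^bsub>G\<^esub> N = carrier G)"


section \<open>Presentations\<close>

text \<open>A letter \<open>(x, True)\<close> stands for the generator \<open>x\<close> and \<open>(x, False)\<close> for its
  inverse; a relation is a pair of words that are to become equal.\<close>

type_synonym 'x gword = "('x \<times> bool) list"

definition gwords :: "'x set \<Rightarrow> 'x gword set" where
  "gwords X = lists (X \<times> UNIV)"

definition inv_word :: "'x gword \<Rightarrow> 'x gword" where
  "inv_word w = rev (map (\<lambda>(x, b). (x, \<not> b)) w)"

definition conj_word :: "'x gword \<Rightarrow> 'x gword \<Rightarrow> 'x gword" where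
  "conj_word u v = inv_word v @ u @ v"

definition comm_word :: "'x gword \<Rightarrow> 'x gword \<Rightarrow> 'x gword" where
  "comm_word u v = inv_word u @ inv_word v @ u @ v"

inductive pres_eq :: "'x set \<Rightarrow> ('x gword \<times> 'x gword) set \<Rightarrow> 'x gword \<Rightarrow> 'x gword \<Rightarrow> bool"
  for X R where
  refl: "w \<in> gwords X \<Longrightarrow> pres_eq X R w w"
| sym: "pres_eq X R u v \<Longrightarrow> pres_eq X R v u"
| trans: "pres_eq X R u v \<Longrightarrow> pres_eq X R v w \<Longrightarrow> pres_eq X R u w"
| append: "pres_eq X R u u' \<Longrightarrow> pres_eq X R v v' \<Longrightarrow> pres_eq X R (u @ v) (u' @ v')"
| cancel: "x \<in> X \<Longrightarrow> pres_eq X R [(x, b), (x, \<not> b)] []"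
| rel: "(u, v) \<in> R \<Longrightarrow> u \<in> gwords X \<Longrightarrow> v \<in> gwords X \<Longrightarrow> pres_eq X R u v"

definition pres_class :: "'x set \<Rightarrow> ('x gword \<times> 'x gword) set \<Rightarrow> 'x gword \<Rightarrow> 'x gword set" where
  "pres_class X R w = {v. pres_eq X R w v}"

definition presented_group :: "'x set \<Rightarrow> ('x gword \<times> 'x gword) set \<Rightarrow> 'x gword set monoid" where
  "presented_group X R =
     \<lparr>carrier = pres_class X R ` gwords X,
      monoid.mult = (\<lambda>A B. \<Union>u\<in>A. \<Union>v\<in>B. pres_class X R (u @ v)),
      one = pres_class X R []\<rparr>"


section \<open>The group \<open>\<nu>(G)\<close>, tensor square and exterior square\<close>

text \<open>\<open>Inl g\<close> and \<open>Inr g\<close> are the copies of \<open>g\<close> in \<open>G\<close> and \<open>G\<^sup>\<phi>\<close>. The two multiplication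
  tables are part of the relations, so that the presentation is relative to the groups \<open>G\<close> and
  \<open>G\<^sup>\<phi>\<close>.\<close>

definition nu_gens :: "('a, 'b) monoid_scheme \<Rightarrow> ('a + 'a) set" where
  "nu_gens G = carrier G <+> carrier G"

abbreviation wl :: "'a \<Rightarrow> ('a + 'a) gword" where "wl g \<equiv> [(Inl g, True)]"
abbreviation wr :: "'a \<Rightarrow> ('a + 'a) gword" where "wr g \<equiv> [(Inr g, True)]"

definition conj_elt :: "('a, 'b) monoid_scheme \<Rightarrow> 'a \<Rightarrow> 'a \<Rightarrow> 'a" where
  "conj_elt G g h = inv\<^bsub>G\<^esub> h \<otimes>\<^bsub>G\<^esub> g \<otimes>\<^bsub>G\<^esub> h"

definition comm_elt :: "('a, 'b) monoid_scheme \<Rightarrow> 'a \<Rightarrow> 'a \<Rightarrow> 'a" where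
  "comm_elt G g h = inv\<^bsub>G\<^esub> g \<otimes>\<^bsub>G\<^esub> inv\<^bsub>G\<^esub> h \<otimes>\<^bsub>G\<^esub> g \<otimes>\<^bsub>G\<^esub> h"

definition nu_rels :: "('a, 'b) monoid_scheme \<Rightarrow> (('a + 'a) gword \<times> ('a + 'a) gword) set" where
  "nu_rels G =
     {(wl g @ wl h, wl (g \<otimes>\<^bsub>G\<^esub> h)) | g h. g \<in> carrier G \<and> h \<in> carrier G} \<union>
     {(wr g @ wr h, wr (g \<otimes>\<^bsub>G\<^esub> h)) | g h. g \<in> carrier G \<and> h \<in> carrier G} \<union>
     {(conj_word (comm_word (wl g1) (wr g2)) (wl g3),
       conj_word (comm_word (wl g1) (wr g2)) (wr g3)) | g1 g2 g3.
       g1 \<in> carrier G \<and> g2 \<in> carrier G \<and> g3 \<in> carrier G} \<union>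
     {(conj_word (comm_word (wl g1) (wr g2)) (wr g3),
       comm_word (wl (conj_elt G g1 g3)) (wr (conj_elt G g2 g3))) | g1 g2 g3.
       g1 \<in> carrier G \<and> g2 \<in> carrier G \<and> g3 \<in> carrier G}"

definition nu :: "('a, 'b) monoid_scheme \<Rightarrow> ('a + 'a) gword set monoid" where
  "nu G = presented_group (nu_gens G) (nu_rels G)"

definition nu_left :: "('a, 'b) monoid_scheme \<Rightarrow> 'a \<Rightarrow> ('a + 'a) gword set" where
  "nu_left G g = pres_class (nu_gens G) (nu_rels G) (wl g)"

definition nu_right :: "('a, 'b) monoid_scheme \<Rightarrow> 'a \<Rightarrow> ('a + 'a) gword set" where
  "nu_right G g = pres_class (nu_gens G) (nu_rels G) (wr g)"

definition tensor_elt :: "('a, 'b) monoid_scheme \<Rightarrow> 'a \<Rightarrow> 'a \<Rightarrow> ('a + 'a) gword set" where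
  "tensor_elt G g h = comm_elt (nu G) (nu_left G g) (nu_right G h)"

definition tensor_square :: "('a, 'b) monoid_scheme \<Rightarrow> ('a + 'a) gword set monoid" where
  "tensor_square G =
     subgroup_generated (nu G) {tensor_elt G g h | g h. g \<in> carrier G \<and> h \<in> carrier G}"

definition Delta :: "('a, 'b) monoid_scheme \<Rightarrow> ('a + 'a) gword set monoid" where
  "Delta G = subgroup_generated (tensor_square G) {tensor_elt G g g | g. g \<in> carrier G}"

definition exterior_square :: "('a, 'b) monoid_scheme \<Rightarrow> ('a + 'a) gword set set monoid" where
  "exterior_square G = tensor_square G Mod carrier (Delta G)"


section \<open>Inverse limits and profinite completions\<close>

text \<open>\<open>r i j\<close> means that there is a transition map \<open>\<phi> i j\<close> from the group at \<open>i\<close> to the group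
  at \<open>j\<close>.\<close>

definition inverse_limit ::
  "'i set \<Rightarrow> ('i \<Rightarrow> 'i \<Rightarrow> bool) \<Rightarrow> ('i \<Rightarrow> ('c, 'd) monoid_scheme) \<Rightarrow> ('i \<Rightarrow> 'i \<Rightarrow> 'c \<Rightarrow> 'c) \<Rightarrow>
   ('i \<Rightarrow> 'c) monoid" where
  "inverse_limit I r F \<phi> =
     (product_group I F)
       \<lparr>carrier := {x \<in> carrier (product_group I F).
                     \<forall>i\<in>I. \<forall>j\<in>I. r i j \<longrightarrow> \<phi> i j (x i) = x j}\<rparr>"

text \<open>For \<open>U \<subseteq> V\<close> the projection \<open>G/U \<rightarrow> G/V\<close> sends the coset \<open>X\<close> to \<open>V X\<close>.\<close>

definition coset_proj :: "('a, 'b) monoid_scheme \<Rightarrow> 'a set \<Rightarrow> 'a set \<Rightarrow> 'a set" where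
  "coset_proj G V X = V <#>\<^bsub>G\<^esub> X"

record 'a top_group = "'a monoid" +
  gtop :: "'a topology"

definition completion ::
  "('a, 'b) monoid_scheme \<Rightarrow> 'a set set \<Rightarrow> ('a set \<Rightarrow> 'a set) top_group" where
  "completion G I =
     (let L = inverse_limit I (\<subseteq>) (\<lambda>U. G Mod U) (\<lambda>U V. coset_proj G V) in
      \<lparr>carrier = carrier L, monoid.mult = monoid.mult L, one = one L,
       gtop = subtopology (product_topology (\<lambda>U. discrete_topology (carrier (G Mod U))) I)
                (carrier L)\<rparr>)"

definition to_completion ::
  "('a, 'b) monoid_scheme \<Rightarrow> 'a set set \<Rightarrow> 'a \<Rightarrow> 'a set \<Rightarrow> 'a set" where
  "to_completion G I g = (\<lambda>U\<in>I. U #>\<^bsub>G\<^esub> g)"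

definition open_normals :: "('a, 'b) top_group_scheme \<Rightarrow> 'a set set" where
  "open_normals P = {V. V \<lhd> P \<and> openin (gtop P) V}"

abbreviation profinite_completion :: "('a, 'b) monoid_scheme \<Rightarrow> ('a set \<Rightarrow> 'a set) top_group" where
  "profinite_completion G \<equiv> completion G (fin_index_normals G)"

abbreviation pro_p_completion :: "nat \<Rightarrow> ('a, 'b) monoid_scheme \<Rightarrow> ('a set \<Rightarrow> 'a set) top_group" where
  "pro_p_completion p G \<equiv> completion G (p_index_normals p G)"

text \<open>The \<open>p\<close>-adic integers are obtained as \<open>pro_p_completion p integer_group\<close>, since the subgroups
  of \<open>\<int>\<close> of \<open>p\<close>-power index are the \<open>p\<^sup>k\<int>\<close>.\<close>


section \<open>Homology of discrete groups with trivial coefficients\<close>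

text \<open>The \<open>n\<close>-chains of the inhomogeneous bar complex of \<open>G\<close> with trivial coefficients in the
  abelian group \<open>A\<close> (written multiplicatively) are the finitely supported functions from
  \<open>n\<close>-tuples to \<open>A\<close>, and
  \<open>d [g\<^sub>1|...|g\<^sub>n] = [g\<^sub>2|...|g\<^sub>n] + (\<Sum>0<i<n. (-1)\<^sup>i [g\<^sub>1|...|g\<^sub>i g\<^sub>i\<^sub>+\<^sub>1|...|g\<^sub>n]) + (-1)\<^sup>n [g\<^sub>1|...|g\<^sub>n\<^sub>-\<^sub>1]\<close>.\<close>

definition tuples :: "nat \<Rightarrow> ('g, 'b) monoid_scheme \<Rightarrow> 'g list set" where
  "tuples n G = {xs. length xs = n \<and> set xs \<subseteq> carrier G}"

definition bar_face :: "('g, 'b) monoid_scheme \<Rightarrow> nat \<Rightarrow> 'g list \<Rightarrow> 'g list" where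
  "bar_face G i xs =
     (if i = 0 then tl xs
      else if i = length xs then butlast xs
      else take (i - 1) xs @ [xs ! (i - 1) \<otimes>\<^bsub>G\<^esub> xs ! i] @ drop (i + 1) xs)"

definition pushforward ::
  "('a, 'm) monoid_scheme \<Rightarrow> 'x set \<Rightarrow> 'y set \<Rightarrow> ('x \<Rightarrow> 'y) \<Rightarrow> ('x \<Rightarrow> 'a) \<Rightarrow> 'y \<Rightarrow> 'a" where
  "pushforward A X Y f c = (\<lambda>y\<in>Y. finprod A c {x \<in> X. f x = y \<and> c x \<noteq> \<one>\<^bsub>A\<^esub>})"

definition bar_chains ::
  "('g, 'b) monoid_scheme \<Rightarrow> ('a, 'm) monoid_scheme \<Rightarrow> nat \<Rightarrow> ('g list \<Rightarrow> 'a) monoid" where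
  "bar_chains G A n = sum_group (tuples n G) (\<lambda>_. A)"

text \<open>\<open>bar_boundary G A n\<close> goes from \<open>n\<close>-chains to \<open>(n - 1)\<close>-chains; for \<open>n = 0\<close> it is trivial.\<close>

definition bar_boundary ::
  "('g, 'b) monoid_scheme \<Rightarrow> ('a, 'm) monoid_scheme \<Rightarrow> nat \<Rightarrow> ('g list \<Rightarrow> 'a) \<Rightarrow> 'g list \<Rightarrow> 'a" where
  "bar_boundary G A n c =
     (\<lambda>y \<in> tuples (n - 1) G.
        finprod A
          (\<lambda>i. pushforward A (tuples n G) (tuples (n - 1) G) (bar_face G i) c y
                 [^]\<^bsub>A\<^esub> ((-1) ^ i :: int))
          (if n = 0 then {} else {..n}))"

text \<open>The chain map induced by homomorphisms \<open>f\<close> of groups and \<open>\<alpha>\<close> of coefficients.\<close>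

definition bar_map ::
  "('g, 'b) monoid_scheme \<Rightarrow> ('a, 'm) monoid_scheme \<Rightarrow> ('h, 'c) monoid_scheme \<Rightarrow>
   ('g \<Rightarrow> 'h) \<Rightarrow> ('a \<Rightarrow> 'e) \<Rightarrow> nat \<Rightarrow> ('g list \<Rightarrow> 'a) \<Rightarrow> 'h list \<Rightarrow> 'e" where
  "bar_map G A H f \<alpha> n c =
     (\<lambda>y \<in> tuples n H. \<alpha> (pushforward A (tuples n G) (tuples n H) (map f) c y))"

text \<open>Homology at \<open>C n\<close> of a complex with groups \<open>C n\<close> and differentials \<open>d n : C n \<rightarrow> C (n - 1)\<close>,
  and the map on homology induced by a map of \<open>n\<close>-chains.\<close>

definition homology ::
  "(nat \<Rightarrow> ('c, 'm) monoid_scheme) \<Rightarrow> (nat \<Rightarrow> 'c \<Rightarrow> 'c) \<Rightarrow> nat \<Rightarrow> 'c set monoid" where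
  "homology C d n =
     (C n)\<lparr>carrier := kernel (C n) (C (n - 1)) (d n)\<rparr> Mod (d (Suc n) ` carrier (C (Suc n)))"

definition homology_map ::
  "(nat \<Rightarrow> ('e, 'm) monoid_scheme) \<Rightarrow> (nat \<Rightarrow> 'e \<Rightarrow> 'e) \<Rightarrow> nat \<Rightarrow> ('c \<Rightarrow> 'e) \<Rightarrow> 'c set \<Rightarrow> 'e set" where
  "homology_map C' d' n f X =
     (d' (Suc n) ` carrier (C' (Suc n))) <#>\<^bsub>C' n\<^esub> (f ` X)"

definition group_homology ::
  "nat \<Rightarrow> ('g, 'b) monoid_scheme \<Rightarrow> ('a, 'm) monoid_scheme \<Rightarrow> ('g list \<Rightarrow> 'a) set monoid" where
  "group_homology n G A = homology (bar_chains G A) (bar_boundary G A) n"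

text \<open>The map \<open>H\<^sub>n(G, A) \<rightarrow> H\<^sub>n(H, A)\<close> induced by \<open>f : G \<rightarrow> H\<close>.\<close>

definition group_homology_map ::
  "nat \<Rightarrow> ('g, 'b) monoid_scheme \<Rightarrow> ('h, 'c) monoid_scheme \<Rightarrow> ('a, 'm) monoid_scheme \<Rightarrow>
   ('g \<Rightarrow> 'h) \<Rightarrow> ('g list \<Rightarrow> 'a) set \<Rightarrow> ('h list \<Rightarrow> 'a) set" where
  "group_homology_map n G H A f =
     homology_map (bar_chains H A) (bar_boundary H A) n (bar_map G A H f id n)"


section \<open>Limits of the homology of quotients\<close>

definition lim_homology ::
  "nat \<Rightarrow> ('g, 'b) monoid_scheme \<Rightarrow> 'g set set \<Rightarrow> ('a, 'm) monoid_scheme \<Rightarrow>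
   ('g set \<Rightarrow> ('g set list \<Rightarrow> 'a) set) monoid" where
  "lim_homology n G I A =
     inverse_limit I (\<subseteq>) (\<lambda>U. group_homology n (G Mod U) A)
       (\<lambda>U V. group_homology_map n (G Mod U) (G Mod V) A (coset_proj G V))"

definition to_lim_homology ::
  "nat \<Rightarrow> ('g, 'b) monoid_scheme \<Rightarrow> 'g set set \<Rightarrow> ('a, 'm) monoid_scheme \<Rightarrow>
   ('g list \<Rightarrow> 'a) set \<Rightarrow> 'g set \<Rightarrow> ('g set list \<Rightarrow> 'a) set" where
  "to_lim_homology n G I A X =
     (\<lambda>U\<in>I. group_homology_map n G (G Mod U) A (\<lambda>g. U #>\<^bsub>G\<^esub> g) X)"


section \<open>Profinite homology with trivial coefficients\<close>

text \<open>For a profinite group \<open>P\<close> and a profinite abelian group \<open>A\<close> with trivial action, the homology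
  is computed by the completed bar complex, whose \<open>n\<close>-chains are the completed tensor product of \<open>A\<close>
  with the free profinite module on the space \<open>P\<^sup>n\<close>, that is, the inverse limit of the \<open>n\<close>-chains
  of \<open>P/V\<close> with coefficients in \<open>A/W\<close> over the open normal subgroups \<open>V\<close> of \<open>P\<close> and \<open>W\<close> of \<open>A\<close>.\<close>

definition prof_index ::
  "('p, 'b) top_group_scheme \<Rightarrow> ('a, 'm) top_group_scheme \<Rightarrow> ('p set \<times> 'a set) set" where
  "prof_index P A = open_normals P \<times> open_normals A"

definition prof_chains ::
  "('p, 'b) top_group_scheme \<Rightarrow> ('a, 'm) top_group_scheme \<Rightarrow> nat \<Rightarrow>
   ('p set \<times> 'a set \<Rightarrow> 'p set list \<Rightarrow> 'a set) monoid" where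
  "prof_chains P A n =
     inverse_limit (prof_index P A)
       (\<lambda>(V, W) (V', W'). V \<subseteq> V' \<and> W \<subseteq> W')
       (\<lambda>(V, W). bar_chains (P Mod V) (A Mod W) n)
       (\<lambda>(V, W) (V', W').
          bar_map (P Mod V) (A Mod W) (P Mod V') (coset_proj P V') (coset_proj A W') n)"

definition prof_boundary ::
  "('p, 'b) top_group_scheme \<Rightarrow> ('a, 'm) top_group_scheme \<Rightarrow> nat \<Rightarrow>
   ('p set \<times> 'a set \<Rightarrow> 'p set list \<Rightarrow> 'a set) \<Rightarrow> 'p set \<times> 'a set \<Rightarrow> 'p set list \<Rightarrow> 'a set" where
  "prof_boundary P A n c =
     (\<lambda>(V, W) \<in> prof_index P A. bar_boundary (P Mod V) (A Mod W) n (c (V, W)))"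

definition prof_homology ::
  "nat \<Rightarrow> ('p, 'b) top_group_scheme \<Rightarrow> ('a, 'm) top_group_scheme \<Rightarrow>
   ('p set \<times> 'a set \<Rightarrow> 'p set list \<Rightarrow> 'a set) set monoid" where
  "prof_homology n P A = homology (prof_chains P A) (prof_boundary P A) n"

text \<open>The map \<open>H\<^sub>n(G, B) \<rightarrow> H\<^sub>n(P, A)\<close> from discrete to profinite homology induced by homomorphisms
  \<open>f : G \<rightarrow> P\<close> and \<open>\<alpha> : B \<rightarrow> A\<close>.\<close>

definition to_prof_chains ::
  "nat \<Rightarrow> ('g, 'c) monoid_scheme \<Rightarrow> ('e, 'd) monoid_scheme \<Rightarrow>
   ('p, 'b) top_group_scheme \<Rightarrow> ('a, 'm) top_group_scheme \<Rightarrow> ('g \<Rightarrow> 'p) \<Rightarrow> ('e \<Rightarrow> 'a) \<Rightarrow>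
   ('g list \<Rightarrow> 'e) \<Rightarrow> 'p set \<times> 'a set \<Rightarrow> 'p set list \<Rightarrow> 'a set" where
  "to_prof_chains n G B P A f \<alpha> c =
     (\<lambda>(V, W) \<in> prof_index P A.
        bar_map G B (P Mod V) (\<lambda>g. V #>\<^bsub>P\<^esub> f g) (\<lambda>b. W #>\<^bsub>A\<^esub> \<alpha> b) n c)"

definition to_prof_homology ::
  "nat \<Rightarrow> ('g, 'c) monoid_scheme \<Rightarrow> ('e, 'd) monoid_scheme \<Rightarrow>
   ('p, 'b) top_group_scheme \<Rightarrow> ('a, 'm) top_group_scheme \<Rightarrow> ('g \<Rightarrow> 'p) \<Rightarrow> ('e \<Rightarrow> 'a) \<Rightarrow>
   ('g list \<Rightarrow> 'e) set \<Rightarrow> ('p set \<times> 'a set \<Rightarrow> 'p set list \<Rightarrow> 'a set) set" where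
  "to_prof_homology n G B P A f \<alpha> =
     homology_map (prof_chains P A) (prof_boundary P A) n (to_prof_chains n G B P A f \<alpha>)"


section \<open>The canonical comparison maps on second homology with integer coefficients\<close>

abbreviation H2Z :: "('g, 'b) monoid_scheme \<Rightarrow> ('g list \<Rightarrow> int) set monoid" where
  "H2Z G \<equiv> group_homology 2 G integer_group"

definition H2_to_profinite_injective :: "('g, 'b) monoid_scheme \<Rightarrow> bool" where
  "H2_to_profinite_injective G \<longleftrightarrow>
     to_prof_homology 2 G integer_group
       (profinite_completion G) (profinite_completion integer_group)
       (to_completion G (fin_index_normals G))
       (to_completion integer_group (fin_index_normals integer_group))
     \<in> mon (H2Z G)
           (prof_homology 2 (profinite_completion G) (profinite_completion integer_group))"

definition H2_to_pro_p_injective :: "nat \<Rightarrow> ('g, 'b) monoid_scheme \<Rightarrow> bool" where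
  "H2_to_pro_p_injective p G \<longleftrightarrow>
     to_prof_homology 2 G integer_group
       (pro_p_completion p G) (pro_p_completion p integer_group)
       (to_completion G (p_index_normals p G))
       (to_completion integer_group (p_index_normals p integer_group))
     \<in> mon (H2Z G)
           (prof_homology 2 (pro_p_completion p G) (pro_p_completion p integer_group))"

definition H2_to_limit_injective :: "('g, 'b) monoid_scheme \<Rightarrow> 'g set set \<Rightarrow> bool" where
  "H2_to_limit_injective G I \<longleftrightarrow>
     to_lim_homology 2 G I integer_group \<in> mon (H2Z G) (lim_homology 2 G I integer_group)"

end

theory Submission
  imports Defs "HOL-Algebra.Sylow" "HOL-Algebra.Multiplicative_Group" "HOL-Algebra.Elementary_Groups" "HOL-Algebra.Bij"
begin

text \<open>An element of the kernel of \<open>G \<and> G \<rightarrow> G\<close> is given by a cycle \<open>z\<close>, and every central extension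
  of \<open>G\<close> maps it to the value at \<open>z\<close> of the defining cocycle. The chains of a finite quotient of \<open>G\<close>
  modulo boundaries define a tautological central extension, which detects the element as soon as the
  class of \<open>z\<close> survives in the homology of the quotient; with integral coefficients the transfer bounds
  the order of that class, so that a finite quotient of the chains suffices. Conversely, \<open>G \<and> G\<close> is the
  derived subgroup of a central extension \<open>P\<close> of \<open>G\<close> (Miller). A finitely generated subgroup of \<open>P\<close>
  covering \<open>G\<close>, modulo a characteristic subgroup of finite index of \<open>G \<and> G\<close>, is finite-by-abelian,
  hence residually finite, and its finite quotients are central extensions of finite quotients of \<open>G\<close>
  whose cocycles detect \<open>z\<close>. Finally, \<open>g \<mapsto> g \<otimes> g\<close> is a quadratic map on the abelianization; it is the
  diagonal of a bilinear map, and this makes \<open>\<Delta>(G)\<close> a retract of \<open>G \<otimes> G\<close>.\<close>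

\<comment> \<open>Finite and p-finite separation are handled together by prescribing the set
  \<open>ps\<close> of primes that may divide the order of a quotient. Evaluating cocycles needs a
  central extension of G in which the exterior square survives. Miller's model is [F, F]/[F, R] for
  G = F/R with F free; in place of a normal form theorem for F/[F, R], the letters act by
  permutations on sorted monomials with coefficients in the exterior square, and its faithful
  embedding is visible in the action. For integral coefficients the chains of a finite quotient
  modulo boundaries form an infinite group, whose residual finiteness alone would not control the
  primes; what counts is that the order of the class involves only primes of \<open>ps\<close>. The
  condition on 2-torsion or a complement has one source. If q(g) is the diagonal element of g and
  g^n lies in G', a bilinear form with diagonal q forces q(g)^n = 1. Quadraticity yields q(g)^(2n) =
  1 and q(g)^(n^2) = 1, which is enough for odd n and leaves a factor 2 open for even n.\<close>
syntax "_index" :: "logic \<Rightarrow> index" ("({:_:})")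

lemmas group_hom_defs = group_hom_def group_hom_axioms_def

lemma (in group) l_cancel_inv [simp]:
 assumes "x : carrier G" "y : carrier G"
 shows "inv x \<otimes> (x \<otimes> y) = y" "x \<otimes> (inv x \<otimes> y) = y"
 using assms by (simp_all flip: m_assoc)

lemmas (in group) group_word_simps = m_assoc inv_mult_group

section \<open>Factor groups by normal subgroups\<close>

lemma FactGroup_hom_universal:
 assumes "h : hom G H" "N \<lhd> G" "group H" "!!x. x : N ==> h x = \<one>{:H:}"
 obtains g where "g : hom (G Mod N) H" "!!x. x : carrier G ==> g (N #>{:G:} x) = h x"
proof -
 interpret N: normal N G by fact
 interpret h: group_hom G H h
  using assms N.is_group by (simp add: group_hom_defs)
 have "h x = h y" if "x : carrier G" "y : carrier G" "N #>{:G:} x = N #>{:G:} y" for x y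
 proof -
  have "x : N #>{:G:} y"
  using that by (metis N.rcos_self N.subgroup_axioms)
  then obtain n where "n : N" "x = n \<otimes>{:G:} y"
  by (auto simp: r_coset_def)
  then show ?thesis
  using assms(4) that by (auto dest: N.subset[THEN subsetD])
 qed
 then show ?thesis
  using FactGroup_universal[OF assms(1,2)] that by blast
qed

lemma (in normal) rcos_eq_iff:
 assumes "x : carrier G" "y : carrier G"
 shows "H #> x = H #> y \<longleftrightarrow> x \<otimes> inv y : H"
 using assms by (metis rcos_module is_subgroup repr_independence rcos_self is_group)

lemma (in normal) rcos_eq_one_iff:
 assumes "x : carrier G"
 shows "H #> x = H \<longleftrightarrow> x : H"
 using assms by (metis coset_join1 coset_join2 is_subgroup)

section \<open>Finite groups whose order involves only given primes\<close>

text \<open>With \<open>UNIV\<close> for \<open>ps\<close> the notions below describe finite groups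
  and with \<open>{p}\<close> finite p-groups, so one development covers both cases. Groups and
  numbers involving only primes of \<open>ps\<close> are called pi-finite and pi-numbers.\<close>

definition pi_number :: "nat set => nat => bool" where
 "pi_number ps n \<longleftrightarrow> n > 0 & (ALL q. Factorial_Ring.prime q --> q dvd n --> q : ps)"

definition pi_finite :: "nat set => ('a, 'b) monoid_scheme => bool" where
 "pi_finite ps G \<longleftrightarrow> group G & finite (carrier G) & pi_number ps (order G)"

definition pi_normals :: "nat set => ('a, 'b) monoid_scheme => 'a set set" where
 "pi_normals ps G = {U. U \<lhd> G & pi_finite ps (G Mod U)}"

definition residually_pi :: "nat set => ('a, 'b) monoid_scheme => bool" where
 "residually_pi ps G \<longleftrightarrow>
  (ALL x : carrier G. x ~= \<one>{:G:} --> (EX U : pi_normals ps G. x ~: U))"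

lemma pi_number_dvd: "pi_number ps n ==> m dvd n ==> pi_number ps m"
 by (auto simp: pi_number_def intro: dvd_pos_nat dvd_trans)

lemma pi_number_mult: "pi_number ps n ==> pi_number ps m ==> pi_number ps (n * m)"
 by (auto simp: pi_number_def prime_dvd_mult_iff)

lemma pi_number_1 [simp]: "pi_number ps 1" "pi_number ps (Suc 0)"
 by (auto simp: pi_number_def)

lemma pi_number_power: "pi_number ps n ==> pi_number ps (n ^ k)"
 by (induction k) (auto intro: pi_number_mult)

lemma pi_number_pos: "pi_number ps n ==> n > 0"
 by (simp add: pi_number_def)

lemma pi_number_prime: "Factorial_Ring.prime p ==> p : ps ==> pi_number ps p"
 by (metis pi_number_def prime_gt_0_nat primes_dvd_imp_eq)

text \<open>Split off the full power of p; a cofactor other than 1 would have a prime factor, which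
  could only be p.\<close>

lemma pi_number_singleton:
 assumes "Factorial_Ring.prime p"
 shows "pi_number {p} n \<longleftrightarrow> (EX k. n = p ^ k)"
proof
 assume n: "pi_number {p} n"
 then have "n ~= 0" "~ is_unit p"
  using assms by (auto simp: pi_number_def)
 then obtain m where m: "n = p ^ multiplicity p n * m" "~ p dvd m"
  by (metis multiplicity_decompose')
 have "m = 1"
 proof (rule ccontr)
  assume "m ~= 1"
  then obtain q where q: "Factorial_Ring.prime q" "q dvd m"
  using prime_factor_nat by blast
  then have "q dvd n"
  using m(1) by (metis dvd_mult)
  then show False
  using n q m(2) by (auto simp: pi_number_def)
 qed
 then show "EX k. n = p ^ k"
  using m(1) by auto
next
 assume "EX k. n = p ^ k"
 then show "pi_number {p} n"
  using assms by (auto intro: pi_number_power pi_number_prime)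
qed

lemma pi_finite_UNIV: "pi_finite UNIV G \<longleftrightarrow> group G & finite (carrier G)"
 by (auto simp: pi_finite_def pi_number_def) (metis card.empty card_gt_0_iff empty_iff group.is_monoid monoid.one_closed order_def)

lemma pi_finite_singleton: "Factorial_Ring.prime p ==> pi_finite {p} G \<longleftrightarrow> p_finite p G"
 by (auto simp: pi_finite_def p_finite_def pi_number_singleton)

lemma fin_index_normals_eq: "fin_index_normals G = pi_normals UNIV G"
 by (auto simp: fin_index_normals_def pi_normals_def pi_finite_UNIV normal.factorgroup_is_group)

lemma p_index_normals_eq: "Factorial_Ring.prime p ==> p_index_normals p G = pi_normals {p} G"
 by (auto simp: p_index_normals_def pi_normals_def pi_finite_singleton)

lemma residually_finite_eq: "residually_finite G \<longleftrightarrow> residually_pi UNIV G"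
 by (simp add: residually_finite_def residually_pi_def fin_index_normals_eq)

lemma residually_p_finite_eq:
 "Factorial_Ring.prime p ==> residually_p_finite p G \<longleftrightarrow> residually_pi {p} G"
 by (simp add: residually_p_finite_def residually_pi_def p_index_normals_eq)

lemma pi_finite_mono_inj:
 assumes "h : hom G H" "inj_on h (carrier G)" "group G" "pi_finite ps H"
 shows "pi_finite ps G"
proof -
 interpret h: group_hom G H h
  using assms by (simp add: group_hom_defs pi_finite_def)
 have fin: "finite (carrier H)" and o: "pi_number ps (order H)"
  using assms by (auto simp: pi_finite_def)
 have "finite (carrier G)"
  using assms fin by (meson h.homh hom_in_carrier image_subsetI inj_on_finite)
 moreover have "subgroup (h ` carrier G) H"
  by (rule h.img_is_subgroup)
 then have "card (h ` carrier G) dvd order H"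
  using fin by (metis h.H.lagrange dvd_triv_right)
 then have "order G dvd order H"
  using assms(2) by (simp add: order_def card_image)
 ultimately show ?thesis
  using assms o by (auto simp: pi_finite_def intro: pi_number_dvd)
qed

lemma pi_finite_surj:
 assumes "h : hom G H" "h ` carrier G = carrier H" "group H" "pi_finite ps G"
 shows "pi_finite ps H"
proof -
 interpret h: group_hom G H h
  using assms by (simp add: group_hom_defs pi_finite_def)
 have "order (G Mod kernel G H h) = order H"
  using h.FactGroup_iso[OF assms(2)] by (auto simp: is_iso_def intro: iso_same_order)
 moreover have "order (G Mod kernel G H h) dvd order G"
  using h.G.lagrange[OF h.subgroup_kernel] by (metis dvd_triv_left order_def FactGroup_def partial_object.simps(1))
 ultimately show ?thesis
  using assms by (auto simp: pi_finite_def intro: pi_number_dvd finite_surj)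
qed

lemma kernel_in_pi_normals:
 assumes "h : hom G H" "group G" "pi_finite ps H"
 shows "kernel G H h : pi_normals ps G"
proof -
 interpret h: group_hom G H h
  using assms by (simp add: group_hom_defs pi_finite_def)
 have "pi_finite ps (G Mod kernel G H h)"
  by (rule pi_finite_mono_inj[OF h.FactGroup_hom h.FactGroup_inj_on])
   (use assms h.normal_kernel normal.factorgroup_is_group in auto)
 then show ?thesis
  using h.normal_kernel by (simp add: pi_normals_def)
qed

lemma not_in_pi_normal:
 assumes "h : hom G H" "group G" "pi_finite ps H" "x : carrier G" "h x ~= \<one>{:H:}"
 shows "EX U : pi_normals ps G. x ~: U"
 by (rule bexI[OF _ kernel_in_pi_normals[OF assms(1-3)]]) (use assms(5) in \<open>auto simp: kernel_def\<close>)

lemma residually_pi_pullback: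
 assumes "residually_pi ps H" "h : hom G H" "group G" "x : carrier G" "h x ~= \<one>{:H:}"
 shows "EX U : pi_normals ps G. x ~: U"
proof -
 have "h x : carrier H"
  using assms hom_in_carrier by fastforce
 then obtain U where U: "U : pi_normals ps H" "h x ~: U"
  using assms by (auto simp: residually_pi_def)
 then interpret U: normal U H by (simp add: pi_normals_def)
 have "(%y. U #>{:H:} h y) : hom G (H Mod U)"
  using hom_compose[OF assms(2) U.r_coset_hom_Mod] by (simp add: comp_def)
 then show ?thesis
  using U \<open>h x : carrier H\<close> U.rcos_eq_one_iff assms
  by (intro not_in_pi_normal[where H = "H Mod U"]) (auto simp: pi_normals_def)
qed

lemma residually_pi_inj:
 assumes "residually_pi ps H" "h : hom G H" "group G" "group H" "inj_on h (carrier G)"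
 shows "residually_pi ps G"
 unfolding residually_pi_def
proof (intro ballI impI)
 fix x assume x: "x : carrier G" "x ~= \<one>{:G:}"
 then have "h x ~= \<one>{:H:}"
  using inj_on_one_iff'[OF assms(2,3,4)] assms(5) by auto
 then show "EX U : pi_normals ps G. x ~: U"
  by (rule residually_pi_pullback[OF assms(1-3) x(1)])
qed

lemma pi_finite_DirProd:
 assumes "pi_finite ps G" "pi_finite ps H"
 shows "pi_finite ps (G \<times>\<times> H)"
 using assms by (auto simp: pi_finite_def DirProd_group order_def card_cartesian_product intro: pi_number_mult)

lemma carrier_in_pi_normals:
 assumes "group G" shows "carrier G : pi_normals ps G"
proof -
 have "(%x. \<one>{:G:}) : hom G (singleton_group \<one>{:G:})"
  by (auto simp: hom_def singleton_group_def)
 moreover have "pi_finite ps (singleton_group \<one>{:G:})"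
  by (simp add: pi_finite_def order_def)
 ultimately show ?thesis
  using kernel_in_pi_normals[OF _ assms] by (fastforce simp: kernel_def singleton_group_def)
qed

lemma pi_normals_Int:
 assumes "U : pi_normals ps G" "V : pi_normals ps G"
 shows "U \<inter> V : pi_normals ps G"
proof -
 interpret U: normal U G using assms by (simp add: pi_normals_def)
 interpret V: normal V G using assms by (simp add: pi_normals_def)
 let ?h = "%x. (U #>{:G:} x, V #>{:G:} x)"
 have "?h : hom G ((G Mod U) \<times>\<times> (G Mod V))"
  using U.r_coset_hom_Mod V.r_coset_hom_Mod by (auto simp: hom_def)
 then have "kernel G ((G Mod U) \<times>\<times> (G Mod V)) ?h : pi_normals ps G"
  by (rule kernel_in_pi_normals[OF _ U.is_group pi_finite_DirProd]) (use assms in \<open>simp_all add: pi_normals_def\<close>)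
 moreover have "kernel G ((G Mod U) \<times>\<times> (G Mod V)) ?h = U \<inter> V"
 proof -
  have "kernel G ((G Mod U) \<times>\<times> (G Mod V)) ?h
    = {x : carrier G. U #>{:G:} x = U & V #>{:G:} x = V}"
  by (simp add: kernel_def)
  also have "\<dots> = {x : carrier G. x : U & x : V}"
  by (rule Collect_cong) (metis U.rcos_eq_one_iff V.rcos_eq_one_iff)
  also have "\<dots> = U \<inter> V"
  using U.mem_carrier by blast
  finally show ?thesis .
 qed
 ultimately show ?thesis by simp
qed

text \<open>The factor \<open>carrier G\<close> takes care of the empty family, whose bare
  intersection would be \<open>UNIV\<close>.\<close>

lemma pi_normals_Inter:
 assumes "group G" "finite F" "F \<subseteq> pi_normals ps G"
 shows "carrier G \<inter> \<Inter> F : pi_normals ps G"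
 using assms(2,3)
proof (induction F)
 case empty
 then show ?case using carrier_in_pi_normals[OF assms(1)] by simp
next
 case (insert U F)
 then have "U \<inter> (carrier G \<inter> \<Inter> F) : pi_normals ps G"
  by (intro pi_normals_Int insert.IH) auto
 then show ?case by (simp only: Inter_insert Int_left_commute)
qed

text \<open>Sylow's theorem for the exponent 1 gives a subgroup of prime order q, and every
  non-trivial element of it has order q.\<close>

lemma (in group) cauchy:
 assumes "finite (carrier G)" "Factorial_Ring.prime q" "q dvd order G"
 obtains x where "x : carrier G" "ord x = q"
proof -
 obtain m where m: "order G = q ^ 1 * m"
  using assms by auto
 obtain H where H: "subgroup H G" "card H = q"
  using sylow_thm[OF assms(2) is_group m assms(1)] by auto
 then have "H ~= {\<one>}"
  using assms(2) by auto
 then obtain x where x: "x : H" "x ~= \<one>"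
  using subgroup.one_closed[OF H(1)] by blast
 then have xc: "x : carrier G"
  using subgroup.mem_carrier[OF H(1)] by simp
 interpret H: group "G\<lparr>carrier := H\<rparr>"
  using subgroup_imp_group[OF H(1)] .
 have "x [^]{:G\<lparr>carrier := H\<rparr>:} card H = \<one>"
  using H.pow_order_eq_1[of x] x by (simp add: order_def)
 then have "x [^] q = \<one>"
  using H(2) by (simp add: nat_pow_def)
 then have "ord x dvd q"
  using xc by (simp add: pow_eq_id)
 moreover have "ord x ~= 1"
  using x xc ord_eq_1 by blast
 ultimately show ?thesis
  using that xc assms(2) by (metis prime_nat_iff)
qed

text \<open>By Cauchy a prime dividing the order is itself the order of an element, hence divides
  the exponent n.\<close>

lemma (in group) pi_finite_exponent:
 assumes "finite (carrier G)" "pi_number ps n" "!!x. x : carrier G ==> x [^] n = \<one>"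
 shows "pi_finite ps G"
proof -
 have "q : ps" if q: "Factorial_Ring.prime q" "q dvd order G" for q
 proof -
  obtain x where "x : carrier G" "ord x = q"
  using cauchy[OF assms(1) q] .
  then have "q dvd n"
  using assms(3) by (metis pow_eq_id)
  then show ?thesis
  using assms(2) q by (auto simp: pi_number_def)
 qed
 then show ?thesis
  using assms by (auto simp: pi_finite_def pi_number_def order_gt_0_iff_finite)
qed

text \<open>A prime q outside \<open>ps\<close> dividing the order would give an element of order q.
  A pi-finite quotient separating it from the identity would contain an element of order q, against
  Lagrange.\<close>

lemma residually_pi_torsion:
 assumes "group G" "residually_pi ps G" "x : carrier G" "n > 0" "x [^]{:G:} (n::nat) = \<one>{:G:}"
 shows "pi_number ps (group.ord G x)"
proof -
 interpret G: group G by fact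
 have o: "G.ord x > 0"
  using assms by (metis G.ord_eq_0 bot_nat_0.not_eq_extremum)
 have "q : ps" if q: "Factorial_Ring.prime q" "q dvd G.ord x" for q
 proof (rule ccontr)
  assume "q ~: ps"
  obtain k where k: "G.ord x = q * k"
  using q by auto
  define y where "y = x [^]{:G:} k"
  have y: "y : carrier G"
  using assms by (simp add: y_def)
  have yq: "y [^]{:G:} q = \<one>{:G:}"
  using assms k G.pow_ord_eq_1[of x] by (simp add: y_def G.nat_pow_pow mult.commute)
  have "~ G.ord x dvd k"
  using k o q(1) by (metis dvd_mult_cancel2 dvd_refl mult_eq_0_iff mult.commute not_prime_unit
    bot_nat_0.not_eq_extremum)
  then have "y ~= \<one>{:G:}"
  using assms by (simp add: y_def G.pow_eq_id)
  then obtain U where U: "U : pi_normals ps G" "y ~: U"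
  using assms(2) y by (auto simp: residually_pi_def)
  interpret U: normal U G using U by (simp add: pi_normals_def)
  interpret Q: group "G Mod U" by (rule U.factorgroup_is_group)
  let ?Y = "U #>{:G:} y"
  have Y: "?Y : carrier (G Mod U)"
  using y by (auto simp: carrier_FactGroup)
  have "?Y [^]{:G Mod U:} q = \<one>{:G Mod U:}"
  using y yq U.rcos_eq_one_iff[of "\<one>{:G:}"] by (simp add: U.FactGroup_pow)
  then have "Q.ord ?Y dvd q"
  using Q.pow_eq_id[OF Y] by blast
  moreover have "Q.ord ?Y ~= 1"
  using Q.ord_eq_1[OF Y] U(2) y by (simp add: U.rcos_eq_one_iff)
  ultimately have "Q.ord ?Y = q"
  using q(1) by (metis prime_nat_iff)
  moreover have "Q.ord ?Y dvd order (G Mod U)"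
  using Q.ord_dvd_group_order[OF Y] .
  ultimately show False
  using U(1) q(1) \<open>q ~: ps\<close> by (auto simp: pi_normals_def pi_finite_def pi_number_def)
 qed
 with o show ?thesis by (auto simp: pi_number_def)
qed

section \<open>Finitely generated abelian groups\<close>

context comm_group
begin

lemma generate_insert_comm:
 assumes "S \<subseteq> carrier G" "s : carrier G"
 shows "generate G (insert s S) = {s [^] (i::int) \<otimes> k | i k. k : generate G S}" (is "?L = ?R")
proof
 have sub: "subgroup (generate G S) G"
  by (rule generate_is_subgroup) fact
 note gc = subgroup.mem_carrier[OF sub]
 have "subgroup ?R G"
 proof (rule subgroup.intro)
  show "?R \<subseteq> carrier G" using gc assms by auto
  show "\<one> : ?R"
  using subgroup.one_closed[OF sub] by (force intro!: exI[of _ "0::int"])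
  show "x \<otimes> y : ?R" if "x : ?R" "y : ?R" for x y
  proof -
  obtain i k j l where x: "x = s [^] (i::int) \<otimes> k" "k : generate G S"
   and y: "y = s [^] (j::int) \<otimes> l" "l : generate G S"
   using \<open>x : ?R\<close> \<open>y : ?R\<close> by auto
  have "x \<otimes> y = s [^] (i + j) \<otimes> (k \<otimes> l)"
   using x y gc assms by (simp add: int_pow_mult m_ac)
  moreover have "k \<otimes> l : generate G S"
   using x y subgroup.m_closed[OF sub] by simp
  ultimately show ?thesis by blast
  qed
  show "inv x : ?R" if "x : ?R" for x
  proof -
  obtain i k where x: "x = s [^] (i::int) \<otimes> k" "k : generate G S"
   using \<open>x : ?R\<close> by auto
  have "inv x = s [^] (- i) \<otimes> inv k"
   using x gc assms by (simp add: int_pow_neg inv_mult)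
  moreover have "inv k : generate G S"
   using x subgroup.m_inv_closed[OF sub] by simp
  ultimately show ?thesis by blast
  qed
 qed
 moreover have "insert s S \<subseteq> ?R"
 proof -
  have "s [^] (1::int) \<otimes> \<one> : ?R" "!!x. x : S ==> s [^] (0::int) \<otimes> x : ?R"
  using subgroup.one_closed[OF sub] generate.incl[of _ S G] by blast+
  then show ?thesis
  using assms by (auto simp: subset_iff)
 qed
 ultimately show "?L \<subseteq> ?R"
  by (rule generate_subgroup_incl[rotated])
next
 have sub: "subgroup ?L G"
  using assms by (intro generate_is_subgroup) auto
 show "?R \<subseteq> ?L"
 proof clarify
  fix i :: int and k assume "k : generate G S"
  then have "k : ?L" using mono_generate[of S "insert s S"] by auto
  moreover have "s [^] i : ?L"
  by (rule subgroup_int_pow_closed[OF sub]) (auto intro: generate.incl)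
  ultimately show "s [^] i \<otimes> k : ?L"
  by (rule subgroup.m_closed[OF sub, rotated])
 qed
qed

text \<open>Induction on the generators, as for modules over the integers: the exponents of s
  occurring in H form an ideal with a generator d. An element of H with exponent d, together with
  generators of the part of H in the span of S, generates H.\<close>

lemma subgroup_of_fin_gen:
 assumes "finite S" "S \<subseteq> carrier G" "subgroup H G" "H \<subseteq> generate G S"
 shows "EX S'. finite S' & S' \<subseteq> H & generate G S' = H"
 using assms
proof (induction S arbitrary: H rule: finite_induct)
 case empty
 then have "H = {\<one>}"
  using subgroup.one_closed by (auto simp: generate_empty)
 then show ?case by (intro exI[of _ "{}"]) (auto simp: generate_empty)
next
 case (insert s S)
 interpret H: subgroup H G by fact
 have S: "S \<subseteq> carrier G" "s : carrier G" using insert.prems by auto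
 let ?K = "generate G S"
 interpret K: subgroup ?K G by (rule generate_is_subgroup) fact
 have HK: "subgroup (H \<inter> ?K) G"
  by (rule subgroups_Inter_pair) unfold_locales
 obtain S1 where S1: "finite S1" "S1 \<subseteq> H \<inter> ?K" "generate G S1 = H \<inter> ?K"
  using insert.IH[OF S(1) HK] by auto
 define I where "I = {i::int. EX k : ?K. s [^] i \<otimes> k : H}"
 \<comment> \<open>This one closure property yields both negation and division with
   remainder.\<close>
 have I_diff: "i - j * d : I" if "i : I" "d : I" for i j d
 proof -
  obtain k l where k: "k : ?K" "s [^] i \<otimes> k : H" and l: "l : ?K" "s [^] d \<otimes> l : H"
  using \<open>i : I\<close> \<open>d : I\<close> by (auto simp: I_def)
  have "s [^] (i - j * d) \<otimes> (k \<otimes> (l [^] (- j))) = (s [^] i \<otimes> k) \<otimes> (s [^] d \<otimes> l) [^] (- j)"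
  using S k l by (simp add: int_pow_distrib int_pow_pow diff_conv_add_uminus int_pow_mult m_ac
    mult.commute del: add_uminus_conv_diff)
  moreover have "(s [^] i \<otimes> k) \<otimes> (s [^] d \<otimes> l) [^] (- j) : H"
  using k l subgroup_int_pow_closed[OF H.subgroup_axioms] by blast
  moreover have "k \<otimes> (l [^] (- j)) : ?K"
  using k l subgroup_int_pow_closed[OF K.subgroup_axioms] by blast
  ultimately show ?thesis by (simp only: I_def mem_Collect_eq) metis
 qed
 have "0 : I"
  using H.one_closed K.one_closed by (auto simp: I_def intro!: bexI[of _ "\<one>"])
 obtain d where d: "d : I" "!!i. i : I ==> d dvd i"
 proof (cases "I = {0}")
  case True
  then show ?thesis using that[of 0] by auto
 next
  case False
  then obtain i where i: "i : I" "i ~= 0" using \<open>0 : I\<close> by auto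
  have "- i : I" using I_diff[OF \<open>0 : I\<close> i(1), of 1] by simp
  then have ex: "EX n::nat. n > 0 & int n : I"
  using i by (cases "i > 0") (auto intro: exI[of _ "nat i"] exI[of _ "nat (- i)"])
  define n where "n = (LEAST n::nat. n > 0 & int n : I)"
  have n: "n > 0" "int n : I" "!!m. m < n ==> ~ (m > 0 & int m : I)"
  using LeastI_ex[OF ex] not_less_Least unfolding n_def by auto
  show ?thesis
  proof (rule that[OF n(2)])
  fix j assume "j : I"
  then have "j mod int n : I"
   using I_diff[OF _ n(2), of j "j div int n"] by (simp add: minus_div_mult_eq_mod)
  moreover have r: "0 <= j mod int n" "j mod int n < int n"
   using n(1) by auto
  moreover have "nat (j mod int n) < n" "int (nat (j mod int n)) = j mod int n"
   using r by linarith+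
  ultimately have "~ nat (j mod int n) > 0"
   using n(3)[of "nat (j mod int n)"] by simp
  then show "int n dvd j"
   using r by (simp add: dvd_eq_mod_eq_0)
  qed
 qed
 then obtain k0 where k0: "k0 : ?K" "s [^] d \<otimes> k0 : H" by (auto simp: I_def)
 let ?h = "s [^] d \<otimes> k0"
 have S1c: "S1 \<subseteq> carrier G" using S1 by auto
 have h: "?h : carrier G" using S k0 by simp
 have "generate G (insert ?h S1) = H"
 proof
  show "generate G (insert ?h S1) \<subseteq> H"
  by (rule generate_subgroup_incl[OF _ H.subgroup_axioms]) (use S1 k0 in auto)
  show "H \<subseteq> generate G (insert ?h S1)"
  proof
  fix x assume x: "x : H"
  then obtain i k where ik: "x = s [^] (i::int) \<otimes> k" "k : ?K"
   using insert.prems(3) generate_insert_comm[OF S] by auto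
  then have "i : I" using x by (auto simp: I_def)
  then obtain j where j: "i = d * j" using d(2) by (auto simp: dvd_def)
  let ?y = "k \<otimes> inv (k0 [^] j)"
  have xj: "x = ?h [^] j \<otimes> ?y"
   using ik j S k0 by (simp add: int_pow_distrib int_pow_pow m_ac)
  have "?y : ?K"
   using ik k0 subgroup_int_pow_closed[OF K.subgroup_axioms] by simp
  moreover have "?y = inv (?h [^] j) \<otimes> x"
   using xj h ik k0 by (simp flip: m_assoc)
  then have "?y : H"
   using x k0 subgroup_int_pow_closed[OF H.subgroup_axioms] by simp
  ultimately show "x : generate G (insert ?h S1)"
   unfolding generate_insert_comm[OF S1c h] S1(3) using xj by blast
  qed
 qed
 moreover have "insert ?h S1 \<subseteq> H" "finite (insert ?h S1)"
  using S1 k0 by auto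
 ultimately show ?case by blast
qed

lemma common_exponent:
 assumes "finite S" "S \<subseteq> carrier G" "!!s. s : S ==> EX n::nat. pi_number ps n & s [^] n = \<one>"
 shows "EX n::nat. pi_number ps n & (ALL x : generate G S. x [^] n = \<one>)"
proof -
 have "EX n::nat. pi_number ps n & (ALL x : S. x [^] n = \<one>)"
  using assms
 proof (induction S)
  case empty then show ?case by (auto intro: exI[of _ 1])
 next
  case (insert s S)
  then obtain n m where n: "pi_number ps n" "ALL x : S. x [^] n = \<one>"
  and m: "pi_number ps m" "s [^] m = \<one>" by (metis insert_iff insert_subset)
  have "x [^] (n * m) = \<one>" if "x : insert s S" for x
  using that n m insert.prems by (metis insert_iff insert_subset mult.commute nat_pow_one nat_pow_pow subsetD)
  then show ?case using pi_number_mult n m by blast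
 qed
 then obtain n where n: "pi_number ps n" "ALL x : S. x [^] n = \<one>" by auto
 have "subgroup {x : carrier G. x [^] n = \<one>} G"
  by (rule subgroup.intro) (auto simp: nat_pow_distrib nat_pow_inv)
 then have "generate G S \<subseteq> {x : carrier G. x [^] n = \<one>}"
  using assms n by (intro generate_subgroup_incl) auto
 then show ?thesis using n by blast
qed

lemma finite_of_exponent:
 assumes "finite S" "S \<subseteq> carrier G" "n > 0" "!!s. s : S ==> s [^] (n::nat) = \<one>"
 shows "finite (generate G S)"
 using assms
proof (induction S)
 case empty then show ?case by (simp add: generate_empty)
next
 case (insert s S)
 then have s: "s : carrier G" "S \<subseteq> carrier G" "s [^] n = \<one>" by auto
 have gc: "generate G S \<subseteq> carrier G" using s(2) by (rule generate_incl)
 have "generate G (insert s S) \<subseteq> (%(i, k). s [^] (i::int) \<otimes> k) ` ({0..<int n} \<times> generate G S)"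
 proof
  fix x assume "x : generate G (insert s S)"
  then obtain i k where x: "x = s [^] (i::int) \<otimes> k" "k : generate G S"
  using generate_insert_comm[OF s(2,1)] by auto
  have "s [^] i = s [^] (int n * (i div int n) + i mod int n)"
  by simp
  also have "\<dots> = (s [^] int n) [^] (i div int n) \<otimes> s [^] (i mod int n)"
  using s(1) by (simp only: int_pow_mult int_pow_pow)
  also have "s [^] int n = \<one>" using s(3) by (simp add: int_pow_int)
  finally have "s [^] i = s [^] (i mod int n)"
  using s(1) by simp
  then show "x : (%(i, k). s [^] (i::int) \<otimes> k) ` ({0..<int n} \<times> generate G S)"
  using x insert.prems(2) by (intro image_eqI[of _ _ "(i mod int n, k)"]) auto
 qed
 moreover have "finite (generate G S)"
  using insert by auto
 ultimately show ?case
  by (meson finite_SigmaI finite_atLeastLessThan_int finite_imageI finite_subset)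
qed

lemma torsion_subgroup: "subgroup (torsion_elements G) G"
proof (rule subgroup.intro)
 show "torsion_elements G \<subseteq> carrier G" by (auto simp: torsion_elements_def)
 show "\<one> : torsion_elements G" by (auto simp: torsion_elements_def)
 show "x \<otimes> y : torsion_elements G" if xy: "x : torsion_elements G" "y : torsion_elements G" for x y
 proof -
  obtain n where n: "n > 0" "x [^] (n::nat) = \<one>" "x : carrier G"
  using xy(1) by (auto simp: torsion_elements_def)
  moreover obtain m where "m > 0" "y [^] (m::nat) = \<one>" "y : carrier G"
  using xy(2) by (auto simp: torsion_elements_def)
  ultimately have "n * m > 0" "(x \<otimes> y) [^] (n * m) = \<one>"
  by (auto simp: nat_pow_distrib simp flip: nat_pow_pow) (metis mult.commute nat_pow_one nat_pow_pow)
  then show ?thesis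
  using n \<open>y : carrier G\<close> unfolding torsion_elements_def by blast
 qed
 show "inv x : torsion_elements G" if "x : torsion_elements G" for x
  using that by (auto simp: torsion_elements_def nat_pow_inv)
qed

text \<open>The torsion subgroup is finitely generated, being a subgroup of a finitely generated
  abelian group, so the exponents of finitely many of its elements bound all of them.\<close>

lemma torsion_exponent:
 assumes "finitely_generated G" "!!x. x : torsion_elements G ==> EX n::nat. pi_number ps n & x [^] n = \<one>"
 obtains n :: nat where "pi_number ps n" "!!x. x : torsion_elements G ==> x [^] n = \<one>"
  "finite (torsion_elements G)"
proof -
 obtain S where S: "finite S" "S \<subseteq> carrier G" "generate G S = carrier G"
  using assms(1) by (auto simp: finitely_generated_def)
 obtain S' where S': "finite S'" "S' \<subseteq> torsion_elements G" "generate G S' = torsion_elements G"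
  using subgroup_of_fin_gen[OF S(1,2) torsion_subgroup] S(3) subgroup.subset[OF torsion_subgroup] by auto
 have S'c: "S' \<subseteq> carrier G" using S'(2) by (auto simp: torsion_elements_def)
 obtain n where n: "pi_number ps n" "ALL x : generate G S'. x [^] n = \<one>"
  using common_exponent[OF S'(1) S'c, of ps] assms(2) S'(2) by blast
 have "finite (generate G S')"
  by (rule finite_of_exponent[OF S'(1) S'c pi_number_pos[OF n(1)]]) (use n(2) in \<open>auto intro: generate.incl\<close>)
 then show ?thesis
  using that n S'(3) by auto
qed

lemma subgroup_powers: "subgroup ((%y. y [^] (n::nat)) ` carrier G) G"
proof (rule subgroup.intro)
 show "x \<otimes> y : (%y. y [^] n) ` carrier G"
  if "x : (%y. y [^] n) ` carrier G" "y : (%y. y [^] n) ` carrier G" for x y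
  using that by (auto simp flip: nat_pow_distrib)
 show "inv x : (%y. y [^] n) ` carrier G" if "x : (%y. y [^] n) ` carrier G" for x
  using that by (auto simp flip: nat_pow_inv)
 show "\<one> : (%y. y [^] n) ` carrier G"
  by (rule image_eqI[of _ _ "\<one>"]) auto
qed auto

text \<open>This supplies the separating subgroups: the quotient is finitely generated abelian and
  killed by n, hence finite and involving only primes of n.\<close>

lemma powers_in_pi_normals:
 assumes "finitely_generated G" "pi_number ps n" "subgroup L G" "(%y. y [^] n) ` carrier G \<subseteq> L"
 shows "L : pi_normals ps G"
proof -
 interpret L: normal L G
  using subgroup_imp_normal assms(3) by blast
 interpret Q: comm_group "G Mod L"
  by (rule abelian_FactGroup) fact
 have pw: "X [^]{:G Mod L:} n = \<one>{:G Mod L:}" if X: "X : carrier (G Mod L)" for X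
 proof -
  obtain y where y: "y : carrier G" "X = L #> y" using X by (auto simp: carrier_FactGroup)
  then have "y [^] n : L" using assms by auto
  then show ?thesis using y by (simp add: L.FactGroup_pow L.rcos_eq_one_iff)
 qed
 obtain S where S: "finite S" "S \<subseteq> carrier G" "generate G S = carrier G"
  using assms(1) by (auto simp: finitely_generated_def)
 interpret h: group_hom G "G Mod L" "%x. L #> x"
  using L.r_coset_hom_Mod by unfold_locales
 have "carrier (G Mod L) = generate (G Mod L) ((%x. L #> x) ` S)"
  using h.generate_img[OF S(2)] S(3) by (simp add: carrier_FactGroup)
 moreover have "finite (generate (G Mod L) ((%x. L #> x) ` S))"
  by (rule Q.finite_of_exponent[of _ n]) (use S pw pi_number_pos[OF assms(2)] in \<open>auto simp: carrier_FactGroup\<close>)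
 ultimately have "finite (carrier (G Mod L))" by simp
 then show ?thesis
  using Q.pi_finite_exponent[OF _ assms(2) pw] L.normal_axioms by (simp add: pi_normals_def)
qed

text \<open>The elements with a positive power in the cyclic group of x form a finitely generated
  subgroup \<open>I\<close>, so one k brings all of them into that cyclic group at once. If x = y^n
  with n > 0, then y lies in \<open>I\<close> and y^k = x^j, whence x^k = x^(jn); infinite order
  forces n to divide k.\<close>

lemma infinite_order_not_power:
 assumes "finitely_generated G" "x : carrier G" "x ~: torsion_elements G"
 obtains k :: nat where "k > 0" "!!n. n > k ==> x ~: (%y. y [^] n) ` carrier G"
proof -
 define I where "I = {y : carrier G. EX k::nat. k > 0 & (EX j::int. y [^] k = x [^] j)}"
 have sub: "subgroup I G"
 proof (rule subgroup.intro)
  show "I \<subseteq> carrier G" by (auto simp: I_def)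
  show "\<one> : I" using assms(2) by (auto simp: I_def intro!: exI[of _ "1::nat"] exI[of _ "0::int"])
  show "a \<otimes> b : I" if ab: "a : I" "b : I" for a b
  proof -
  obtain k i l j where k: "k > 0" "a [^] (k::nat) = x [^] (i::int)"
   and l: "l > 0" "b [^] (l::nat) = x [^] (j::int)" and c: "a : carrier G" "b : carrier G"
   using ab by (auto simp: I_def)
  have "(a \<otimes> b) [^] (k * l) = (a [^] k) [^] l \<otimes> (b [^] l) [^] k"
   using c by (simp add: nat_pow_distrib nat_pow_pow mult.commute)
  also have "\<dots> = (x [^] i) [^] int l \<otimes> (x [^] j) [^] int k"
   by (simp only: k(2) l(2) int_pow_int)
  also have "\<dots> = x [^] (i * int l + j * int k)"
   using assms(2) by (simp only: int_pow_mult int_pow_pow)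
  finally show ?thesis
   using c k(1) l(1) by (auto simp: I_def intro!: exI[of _ "k * l"])
  qed
  show "inv a : I" if a: "a : I" for a
  proof -
  obtain k i where k: "k > 0" "a [^] (k::nat) = x [^] (i::int)" and c: "a : carrier G"
   using a by (auto simp: I_def)
  have "(inv a) [^] k = x [^] (- i)"
   using c k assms(2) by (simp add: nat_pow_inv int_pow_neg)
  then show ?thesis using c k by (auto simp: I_def)
  qed
 qed
 obtain S where S: "finite S" "S \<subseteq> carrier G" "generate G S = carrier G"
  using assms(1) by (auto simp: finitely_generated_def)
 obtain S' where S': "finite S'" "S' \<subseteq> I" "generate G S' = I"
  using subgroup_of_fin_gen[OF S(1,2) sub] S(3) subgroup.subset[OF sub] by auto
 have "EX k::nat. k > 0 & (ALL y : S'. EX j::int. y [^] k = x [^] j)"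
  using S'(1,2)
 proof (induction S')
  case empty then show ?case by auto
 next
  case (insert s S')
  then obtain k where k: "k > 0" "ALL y : S'. EX j::int. y [^] (k::nat) = x [^] j" by auto
  obtain l j where l: "l > 0" "s [^] (l::nat) = x [^] (j::int)" "s : carrier G"
  using insert.prems by (auto simp: I_def)
  have "EX j::int. y [^] (k * l) = x [^] j" if y: "y : insert s S'" for y
  proof (cases "y = s")
  case True
  then have "y [^] (k * l) = (x [^] j) [^] k"
   using True l by (metis mult.commute nat_pow_pow)
  also have "\<dots> = x [^] (j * int k)"
   using assms(2) by (metis int_pow_int int_pow_pow)
  finally have "y [^] (k * l) = x [^] (j * int k)" .
  then show ?thesis by blast
  next
  case False
  then obtain i where "y [^] k = x [^] (i::int)" "y : carrier G" using k y insert.prems unfolding I_def by blast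
  then have "y [^] (k * l) = x [^] (i * int l)"
   using assms(2) by (metis int_pow_int int_pow_pow nat_pow_pow)
  then show ?thesis by blast
  qed
  then show ?case using k l by (intro exI[of _ "k * l"]) auto
 qed
 then obtain k where k: "k > 0" "ALL y : S'. EX j::int. y [^] (k::nat) = x [^] j" by auto
 have "subgroup {y : carrier G. EX j::int. y [^] k = x [^] j} G"
 proof (rule subgroup.intro)
  show "\<one> : {y : carrier G. EX j::int. y [^] k = x [^] j}"
  using assms by (auto intro!: exI[of _ "0::int"])
  show "a \<otimes> b : {y : carrier G. EX j::int. y [^] k = x [^] j}"
  if "a : {y : carrier G. EX j::int. y [^] k = x [^] j}" "b : {y : carrier G. EX j::int. y [^] k = x [^] j}" for a b
  using that assms(2) by (auto simp: nat_pow_distrib simp flip: int_pow_mult)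
  show "inv a : {y : carrier G. EX j::int. y [^] k = x [^] j}"
  if "a : {y : carrier G. EX j::int. y [^] k = x [^] j}" for a
  using that assms(2) by (auto simp: nat_pow_inv simp flip: int_pow_neg)
 qed auto
 then have "generate G S' \<subseteq> {y : carrier G. EX j::int. y [^] k = x [^] j}"
  using k S'(2) subgroup.subset[OF sub] by (intro generate_subgroup_incl) auto
 then have kI: "EX j::int. y [^] k = x [^] j" if "y : I" for y
  using S'(3) that by auto
 show ?thesis
 proof (rule that[OF k(1)])
  fix n :: nat assume n: "n > k"
  show "x ~: (%y. y [^] n) ` carrier G"
  proof
  assume "x : (%y. y [^] n) ` carrier G"
  then obtain y where y: "y : carrier G" "x = y [^] n" by auto
  then have "y : I" using n assms(2)
   by (auto simp: I_def intro!: exI[of _ n] exI[of _ "1::int"])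
  then obtain j where j: "y [^] k = x [^] (j::int)" using kI by auto
  have "x [^] int k = (y [^] k) [^] n"
   using y by (simp add: int_pow_int nat_pow_pow mult.commute)
  also have "\<dots> = x [^] (j * int n)"
   using j assms(2) by (simp add: int_pow_pow flip: int_pow_int)
  finally have "x [^] (int k - j * int n) = \<one>"
   using assms(2) by (simp add: int_pow_diff)
  then have "int (ord x) dvd int k - j * int n"
   using assms(2) by (simp add: int_pow_eq_id)
  moreover have "ord x = 0"
   
  proof -
   have "x [^] m ~= \<one>" if "m ~= 0" for m :: nat
   proof
    assume "x [^] m = \<one>"
    then have "x : torsion_elements G"
    using that assms(2) unfolding torsion_elements_def by blast
    then show False using assms(3) by simp
   qed
   then show ?thesis using ord_eq_0[OF assms(2)] by blast
  qed
  ultimately have "int k = j * int n" by simp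
  then have "int n dvd int k" by simp
  then have "n dvd k" by simp
  then show False using n k(1) by (simp add: nat_dvd_not_less)
  qed
 qed
qed

text \<open>Let t kill the torsion and take n = m^t. If x = y^n, the order of y divides both t and
  m^(t+1). For a prime q dividing m, the multiplicity of q in t is below t, hence below that in m^t;
  so the order of y divides m^t and x = 1. This replaces the primary decomposition.\<close>

lemma torsion_not_power:
 assumes "finitely_generated G" "x : carrier G" "x ~= \<one>" "pi_number ps m" "x [^] (m::nat) = \<one>"
 obtains n :: nat where "pi_number ps n" "x ~: (%y. y [^] n) ` carrier G"
proof -
 have "EX n. pi_number UNIV n & y [^] n = \<one>" if "y : torsion_elements G" for y
  using that by (auto simp: torsion_elements_def pi_number_def)
 then obtain t :: nat where t: "pi_number UNIV t" "!!y. y : torsion_elements G ==> y [^] t = \<one>"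
  using torsion_exponent[OF assms(1), of UNIV] by metis
 have "t > 0" using t(1) pi_number_pos by blast
 have "x ~: (%y. y [^] (m ^ t)) ` carrier G"
 proof
  assume "x : (%y. y [^] (m ^ t)) ` carrier G"
  then obtain y where y: "y : carrier G" "x = y [^] (m ^ t)" by auto
  have ym: "y [^] (m ^ t * m) = \<one>"
  using y assms(5) by (simp flip: nat_pow_pow)
  moreover have "m ^ t * m > 0"
  using pi_number_pos[OF assms(4)] by simp
  ultimately have "y : torsion_elements G"
  using y unfolding torsion_elements_def by blast
  then have "ord y dvd t" "ord y dvd m ^ t * m"
  using t(2) y ym by (simp_all flip: pow_eq_id)
  have "ord y dvd m ^ t"
  proof (rule multiplicity_le_imp_dvd)
  show "ord y ~= 0" using \<open>ord y dvd t\<close> \<open>t > 0\<close> by auto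
  fix q :: nat assume q: "Factorial_Ring.prime q"
  show "multiplicity q (ord y) <= multiplicity q (m ^ t)"
  proof (cases "q dvd m")
   case True
   have "m > 0" using pi_number_pos[OF assms(4)] .
   then have "multiplicity q m >= 1"
    using True q by (intro multiplicity_geI) auto
   then have "t <= multiplicity q (m ^ t)"
    using q \<open>m > 0\<close> by (simp add: prime_elem_multiplicity_power_distrib)
   moreover have "multiplicity q (ord y) <= multiplicity q t"
    using \<open>ord y dvd t\<close> \<open>t > 0\<close> by (intro dvd_imp_multiplicity_le) auto
   moreover have "multiplicity q t < t"
   proof -
    have "q ^ multiplicity q t <= t"
    using \<open>t > 0\<close> by (intro dvd_imp_le multiplicity_dvd)
    moreover have "multiplicity q t < q ^ multiplicity q t"
    using q by (intro power_gt_expt prime_gt_Suc_0_nat)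
    ultimately show ?thesis by linarith
   qed
   ultimately show ?thesis by linarith
  next
   case False
   then have "~ q dvd ord y"
    using \<open>ord y dvd m ^ t * m\<close> q by (metis dvd_trans prime_dvd_mult_iff prime_dvd_power)
   then show ?thesis by (simp add: not_dvd_imp_multiplicity_0)
  qed
  qed
  then show False using y assms(3) by (simp add: pow_eq_id)
 qed
 then show ?thesis using that pi_number_power[OF assms(4)] by blast
qed

text \<open>Elements of infinite order are separated by a high power of a prime in
  \<open>ps\<close>, which is why one such prime is assumed; torsion elements are left to
  \<open>torsion_not_power\<close>.\<close>

lemma residually_pi_iff_torsion:
 assumes "finitely_generated G" "Factorial_Ring.prime p" "p : ps"
 shows "residually_pi ps G \<longleftrightarrow> (ALL x : torsion_elements G. EX n::nat. pi_number ps n & x [^] n = \<one>)"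
proof
 assume "residually_pi ps G"
 then show "ALL x : torsion_elements G. EX n::nat. pi_number ps n & x [^] n = \<one>"
  using residually_pi_torsion[OF is_group] pow_ord_eq_1 unfolding torsion_elements_def by blast
next
 assume tors: "ALL x : torsion_elements G. EX n::nat. pi_number ps n & x [^] n = \<one>"
 show "residually_pi ps G"
  unfolding residually_pi_def
 proof (intro ballI impI)
  fix x assume x: "x : carrier G" "x ~= \<one>"
  have "EX n. pi_number ps n & x ~: (%y. y [^] n) ` carrier G"
  proof (cases "x : torsion_elements G")
  case True
  then show ?thesis using tors torsion_not_power[OF assms(1) x] by metis
  next
  case False
  then obtain k where "k > 0" "!!n. n > k ==> x ~: (%y. y [^] (n::nat)) ` carrier G"
   using infinite_order_not_power[OF assms(1) x(1)] by metis
  moreover have "p ^ k > k"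
   using assms(2) by (intro power_gt_expt prime_gt_Suc_0_nat)
  ultimately show ?thesis
   using pi_number_power pi_number_prime assms by blast
  qed
  then show "EX U:pi_normals ps G. x ~: U"
  using powers_in_pi_normals[OF assms(1) _ subgroup_powers] by blast
 qed
qed

end

text \<open>The torsion subgroup is finite with a pi-number as exponent, and Cauchy turns the
  exponent into a statement on the order; conversely the order serves as exponent.\<close>

lemma (in comm_group) residually_pi_iff_pi_finite_torsion:
 assumes "finitely_generated G" "Factorial_Ring.prime p" "p : ps"
 shows "residually_pi ps G \<longleftrightarrow> pi_finite ps (G\<lparr>carrier := torsion_elements G\<rparr>)"
proof
 assume "residually_pi ps G"
 then obtain n where n: "pi_number ps n" "!!x. x : torsion_elements G ==> x [^] n = \<one>"
  "finite (torsion_elements G)"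
  using torsion_exponent[OF assms(1)] residually_pi_iff_torsion[OF assms] by metis
 interpret T: group "G\<lparr>carrier := torsion_elements G\<rparr>"
  by (rule subgroup_imp_group[OF torsion_subgroup])
 have pow: "x [^]{:G\<lparr>carrier := torsion_elements G\<rparr>:} k = x [^] k" for x and k :: nat
  by (simp add: nat_pow_def)
 show "pi_finite ps (G\<lparr>carrier := torsion_elements G\<rparr>)"
  by (rule T.pi_finite_exponent[OF _ n(1)]) (use n pow in auto)
next
 assume fin: "pi_finite ps (G\<lparr>carrier := torsion_elements G\<rparr>)"
 interpret T: group "G\<lparr>carrier := torsion_elements G\<rparr>"
  by (rule subgroup_imp_group[OF torsion_subgroup])
 let ?n = "order (G\<lparr>carrier := torsion_elements G\<rparr>)"
 have "x [^] ?n = \<one>" if "x : torsion_elements G" for x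
  using T.pow_order_eq_1[of x] that by (simp add: nat_pow_def)
 then show "residually_pi ps G"
  using fin residually_pi_iff_torsion[OF assms] by (auto simp: pi_finite_def)
qed

section \<open>Presented groups\<close>

lemma gwords_simps [simp]:
 "[] : gwords X" "x # w : gwords X \<longleftrightarrow> fst x : X & w : gwords X"
 "u @ v : gwords X \<longleftrightarrow> u : gwords X & v : gwords X"
 "inv_word w : gwords X \<longleftrightarrow> w : gwords X"
proof -
 show "[] : gwords X" "x # w : gwords X \<longleftrightarrow> fst x : X & w : gwords X"
  "u @ v : gwords X \<longleftrightarrow> u : gwords X & v : gwords X"
  by (auto simp: gwords_def mem_Times_iff)
 show "inv_word w : gwords X \<longleftrightarrow> w : gwords X"
  by (force simp: gwords_def inv_word_def)
qed

lemma inv_word_simps [simp]: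
 "inv_word [] = []" "inv_word (u @ v) = inv_word v @ inv_word u"
 "inv_word ((x, b) # w) = inv_word w @ [(x, ~ b)]"
 by (auto simp: inv_word_def)

lemma pres_eq_gwords: "pres_eq X R u v ==> u : gwords X & v : gwords X"
 by (induction rule: pres_eq.induct) auto

lemma pres_eq_class:
 assumes u: "u : gwords X"
 shows "pres_eq X R u v \<longleftrightarrow> pres_class X R u = pres_class X R v"
proof (rule iffI)
 show "pres_class X R u = pres_class X R v" if "pres_eq X R u v"
  using that unfolding pres_class_def by (blast intro: pres_eq.trans pres_eq.sym)
 show "pres_eq X R u v" if "pres_class X R u = pres_class X R v"
 proof -
  have "u : pres_class X R v"
  using pres_eq.refl[OF u, of R] that by (auto simp: pres_class_def)
  then show ?thesis by (simp add: pres_class_def pres_eq.sym)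
 qed
qed

lemma pres_class_self: "u : gwords X ==> u : pres_class X R u"
 by (simp add: pres_class_def pres_eq.refl)

lemma pres_class_mult:
 assumes "u : gwords X" "v : gwords X"
 shows "pres_class X R u \<otimes>{:presented_group X R:} pres_class X R v = pres_class X R (u @ v)"
proof -
 have *: "pres_class X R (u' @ v') = pres_class X R (u @ v)"
  if "u' : pres_class X R u" "v' : pres_class X R v" for u' v'
 proof -
  have "pres_eq X R (u @ v) (u' @ v')"
  using that by (auto simp: pres_class_def intro: pres_eq.append)
  then show ?thesis using pres_eq_class[of "u @ v" X R "u' @ v'"] assms by simp
 qed
 have "(UN u':pres_class X R u. UN v':pres_class X R v. pres_class X R (u' @ v')) = pres_class X R (u @ v)"
  (is "?L = ?C")
 proof -
  have "?L = (UN u':pres_class X R u. UN v':pres_class X R v. ?C)"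
  by (intro SUP_cong[OF HOL.refl] *)
  also have "\<dots> = ?C"
  using pres_class_self[OF assms(1), of R] pres_class_self[OF assms(2), of R] by auto
  finally show ?thesis .
 qed
 then show ?thesis by (simp add: presented_group_def)
qed

lemma carrier_presented_group: "carrier (presented_group X R) = pres_class X R ` gwords X"
 by (simp add: presented_group_def)

lemma one_presented_group: "\<one>{:presented_group X R:} = pres_class X R []"
 by (simp add: presented_group_def)

lemma pres_eq_inv_word: "w : gwords X ==> pres_eq X R (inv_word w @ w) []"
proof (induction w)
 case Nil
 then show ?case by (simp add: pres_eq.refl)
next
 case (Cons a w)
 obtain x b where a: "a = (x, b)" by fastforce
 have "pres_eq X R ([(x, ~ b), (x, b)] @ w) ([] @ w)"
  using Cons a pres_eq.cancel[of x X R "~ b"] by (intro pres_eq.append) (auto intro: pres_eq.refl)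
 then have "pres_eq X R (inv_word w @ ([(x, ~ b), (x, b)] @ w)) (inv_word w @ w)"
  using Cons by (intro pres_eq.append) (auto intro: pres_eq.refl)
 then show ?case using Cons a by (auto intro: pres_eq.trans)
qed

lemma group_presented_group: "group (presented_group X R)"
proof (rule groupI)
 let ?P = "presented_group X R"
 show "x \<otimes>{:?P:} y : carrier ?P" if "x : carrier ?P" "y : carrier ?P" for x y
  using that by (auto simp: carrier_presented_group pres_class_mult)
 show "\<one>{:?P:} : carrier ?P"
  by (auto simp: carrier_presented_group one_presented_group)
 show "x \<otimes>{:?P:} y \<otimes>{:?P:} z = x \<otimes>{:?P:} (y \<otimes>{:?P:} z)"
  if "x : carrier ?P" "y : carrier ?P" "z : carrier ?P" for x y z
  using that by (auto simp: carrier_presented_group pres_class_mult)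
 show "\<one>{:?P:} \<otimes>{:?P:} x = x" if "x : carrier ?P" for x
  using that by (auto simp: carrier_presented_group pres_class_mult one_presented_group)
 show "EX y:carrier ?P. y \<otimes>{:?P:} x = \<one>{:?P:}" if "x : carrier ?P" for x
 proof -
  obtain w where w: "w : gwords X" "x = pres_class X R w"
  using \<open>x : carrier ?P\<close> by (auto simp: carrier_presented_group)
  then have "pres_class X R (inv_word w) \<otimes>{:?P:} x = \<one>{:?P:}"
  using pres_eq_inv_word[OF w(1), of R] pres_eq_class[of "inv_word w @ w" X R "[]"]
  by (simp add: pres_class_mult one_presented_group)
  then show ?thesis using w by (auto simp: carrier_presented_group)
 qed
qed

lemma inv_presented_group:
 assumes "w : gwords X"
 shows "inv{:presented_group X R:} pres_class X R w = pres_class X R (inv_word w)"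
proof -
 have "pres_class X R (inv_word w) \<otimes>{:presented_group X R:} pres_class X R w = \<one>{:presented_group X R:}"
  using assms pres_eq_inv_word[OF assms, of R] pres_eq_class[of "inv_word w @ w" X R "[]"]
  by (simp add: pres_class_mult one_presented_group)
 then show ?thesis
  using assms by (intro group.inv_equality group_presented_group) (auto simp: carrier_presented_group)
qed

primrec word_eval :: "('c, 'd) monoid_scheme => ('x => 'c) => 'x gword => 'c" where
 "word_eval H f [] = \<one>{:H:}"
| "word_eval H f (a # w) = (if snd a then f (fst a) else inv{:H:} f (fst a)) \<otimes>{:H:} word_eval H f w"

section \<open>Evaluation of words in a group\<close>

context group
begin

lemma word_eval_closed: "f : X \<rightarrow> carrier G ==> w : gwords X ==> word_eval G f w : carrier G"
 by (induction w) auto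

lemma word_eval_append:
 "f : X \<rightarrow> carrier G ==> u : gwords X ==> v : gwords X ==>
  word_eval G f (u @ v) = word_eval G f u \<otimes> word_eval G f v"
 by (induction u) (auto simp: word_eval_closed m_assoc Pi_iff)

lemma word_eval_inv:
 "f : X \<rightarrow> carrier G ==> w : gwords X ==> word_eval G f (inv_word w) = inv word_eval G f w"
proof (induction w)
 case (Cons a w)
 then have c: "f (fst a) : carrier G" "word_eval G f w : carrier G"
  by (auto simp: word_eval_closed)
 obtain x b where a: "a = (x, b)" by fastforce
 have "word_eval G f (inv_word (a # w)) = word_eval G f (inv_word w) \<otimes> word_eval G f [(x, ~ b)]"
  using Cons.prems a by (simp add: word_eval_append del: word_eval.simps)
 then show ?case using Cons c a by (auto simp: inv_mult_group)
qed simp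

end

lemma presented_group_hom:
 assumes "group H" "f : X \<rightarrow> carrier H"
  and R: "!!u v. (u, v) : R ==> u : gwords X ==> v : gwords X ==> word_eval H f u = word_eval H f v"
 obtains h where "h : hom (presented_group X R) H" "!!x. x : X ==> h (pres_class X R [(x, True)]) = f x"
proof -
 interpret H: group H by fact
 have eq: "word_eval H f u = word_eval H f v" if "pres_eq X R u v" for u v
  using that
 proof (induction rule: pres_eq.induct)
  case (append u u' v v')
  then show ?case
  using pres_eq_gwords by (metis H.word_eval_append assms(2))
 next
  case (cancel x b)
  then show ?case using assms(2) by (auto simp: Pi_iff)
 qed (use R in auto)
 \<comment> \<open>The value on a class is computed at an arbitrary representative, and
   \<open>eq\<close> makes it independent of that choice.\<close>
 define h where "h A = word_eval H f (SOME w. w : A)" for A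
 have h: "h (pres_class X R w) = word_eval H f w" if "w : gwords X" for w
 proof -
  have "(SOME v. v : pres_class X R w) : pres_class X R w"
  using pres_class_self[OF that] by (rule someI)
  then have "pres_eq X R w (SOME v. v : pres_class X R w)"
  by (simp add: pres_class_def)
  from eq[OF this] show ?thesis by (simp add: h_def)
 qed
 show ?thesis
 proof
  show "h : hom (presented_group X R) H"
  using assms(2) by (auto simp: hom_def carrier_presented_group pres_class_mult h
    H.word_eval_closed H.word_eval_append)
  show "h (pres_class X R [(x, True)]) = f x" if "x : X" for x
  using that assms(2) by (simp add: h Pi_iff)
 qed
qed

lemma presented_group_generated:
 "carrier (presented_group X R) = generate (presented_group X R) ((%x. pres_class X R [(x, True)]) ` X)"
  (is "_ = generate ?P ?S")
proof
 interpret P: group "presented_group X R" by (rule group_presented_group)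
 have S: "?S \<subseteq> carrier ?P" by (auto simp: carrier_presented_group)
 show "generate ?P ?S \<subseteq> carrier ?P" by (rule P.generate_incl[OF S])
 have sub: "subgroup (generate ?P ?S) ?P" by (rule P.generate_is_subgroup[OF S])
 have "pres_class X R w : generate ?P ?S" if "w : gwords X" for w
  using that
 proof (induction w)
  case Nil
  then show ?case using subgroup.one_closed[OF sub] by (simp add: one_presented_group)
 next
  case (Cons a w)
  obtain x b where a: "a = (x, b)" by fastforce
  then have x: "x : X" "w : gwords X" using Cons by auto
  have g: "pres_class X R [(x, True)] : generate ?P ?S"
  using x by (auto intro: generate.incl)
  have "pres_class X R [(x, b)] : generate ?P ?S"
  using g subgroup.m_inv_closed[OF sub g] x by (cases b) (auto simp: inv_presented_group)
  then have "pres_class X R [(x, b)] \<otimes>{:?P:} pres_class X R w : generate ?P ?S"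
  using Cons.IH x subgroup.m_closed[OF sub] by blast
  then show ?case using x a by (simp add: pres_class_mult)
 qed
 then show "carrier ?P \<subseteq> generate ?P ?S"
  by (auto simp: carrier_presented_group)
qed

section \<open>Commutators and conjugates\<close>

context group
begin

lemma inv_mult_eq_one_iff: "a : carrier G ==> b : carrier G ==> inv a \<otimes> b = \<one> \<longleftrightarrow> b = a"
 by (metis inv_closed l_cancel_inv(2) l_inv r_one)

lemma conj_closed [simp]: "a : carrier G ==> b : carrier G ==> conj_elt G a b : carrier G"
 by (simp add: conj_elt_def)

lemma comm_closed [simp]: "a : carrier G ==> b : carrier G ==> comm_elt G a b : carrier G"
 by (simp add: comm_elt_def)

lemma comm_mult_left:
 "a : carrier G ==> b : carrier G ==> c : carrier G ==>
  comm_elt G (a \<otimes> b) c = conj_elt G (comm_elt G a c) b \<otimes> comm_elt G b c"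
 by (simp add: comm_elt_def conj_elt_def group_word_simps)

lemma comm_mult_right:
 "a : carrier G ==> b : carrier G ==> c : carrier G ==>
  comm_elt G a (b \<otimes> c) = comm_elt G a c \<otimes> conj_elt G (comm_elt G a b) c"
 by (simp add: comm_elt_def conj_elt_def group_word_simps)

lemma conj_mult:
 "a : carrier G ==> b : carrier G ==> c : carrier G ==>
  conj_elt G (a \<otimes> b) c = conj_elt G a c \<otimes> conj_elt G b c"
 by (simp add: conj_elt_def group_word_simps)

lemma conj_conj:
 "a : carrier G ==> b : carrier G ==> c : carrier G ==>
  conj_elt G (conj_elt G a b) c = conj_elt G a (b \<otimes> c)"
 by (simp add: conj_elt_def group_word_simps)

lemma conj_inv: "a : carrier G ==> b : carrier G ==> conj_elt G (inv a) b = inv conj_elt G a b"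
 by (simp add: conj_elt_def group_word_simps)

lemma conj_by_one [simp]: "a : carrier G ==> conj_elt G a \<one> = a"
 by (simp add: conj_elt_def)

lemma conj_one [simp]: "a : carrier G ==> conj_elt G \<one> a = \<one>"
 by (simp add: conj_elt_def)

lemma comm_one [simp]:
 "a : carrier G ==> comm_elt G \<one> a = \<one>" "a : carrier G ==> comm_elt G a \<one> = \<one>"
 by (simp_all add: comm_elt_def)

lemma conj_eq_iff: "a : carrier G ==> b : carrier G ==> conj_elt G a b = a \<longleftrightarrow> a \<otimes> b = b \<otimes> a"
 unfolding conj_elt_def by (metis inv_closed inv_solve_left m_assoc m_closed)

lemma conj_cancel [simp]:
 "a : carrier G ==> b : carrier G ==> conj_elt G (conj_elt G a b) (inv b) = a"
 "a : carrier G ==> b : carrier G ==> conj_elt G (conj_elt G a (inv b)) b = a"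
 by (simp_all add: conj_conj)

end

lemma hom_conj:
 assumes "h : hom G H" "group G" "group H" "a : carrier G" "b : carrier G"
 shows "h (conj_elt G a b) = conj_elt H (h a) (h b)"
proof -
 interpret h: group_hom G H h using assms by (simp add: group_hom_defs)
 show ?thesis using assms by (simp add: conj_elt_def)
qed

lemma hom_comm:
 assumes "h : hom G H" "group G" "group H" "a : carrier G" "b : carrier G"
 shows "h (comm_elt G a b) = comm_elt H (h a) (h b)"
proof -
 interpret h: group_hom G H h using assms by (simp add: group_hom_defs)
 show ?thesis using assms by (simp add: comm_elt_def)
qed

section \<open>Pairs of homomorphisms with the defining relations of the tensor square\<close>

text \<open>\<open>V\<close> stands for \<open>\<nu>(G)\<close> or its quotient by \<open>\<Delta>(G)\<close>, and \<open>e\<close> identifies both copies of \<open>G\<close>.\<close>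

locale tensor_context = G: group G + V: group V
 for G :: "('a, 'b) monoid_scheme" and V :: "('v, 'c) monoid_scheme" +
 fixes l r :: "'a => 'v" and e :: "'v => 'a"
 assumes l_hom: "l : hom G V" and r_hom: "r : hom G V" and e_hom: "e : hom V G"
  and e_l [simp]: "g : carrier G ==> e (l g) = g"
  and e_r [simp]: "g : carrier G ==> e (r g) = g"
  and gen: "carrier V = generate V (l ` carrier G \<union> r ` carrier G)"
  and rel_lr: "[|g1 : carrier G; g2 : carrier G; g3 : carrier G|] ==>
  conj_elt V (comm_elt V (l g1) (r g2)) (l g3) = conj_elt V (comm_elt V (l g1) (r g2)) (r g3)"
  and rel_conj: "[|g1 : carrier G; g2 : carrier G; g3 : carrier G|] ==>
  conj_elt V (comm_elt V (l g1) (r g2)) (r g3) = comm_elt V (l (conj_elt G g1 g3)) (r (conj_elt G g2 g3))"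
begin

definition w :: "'a => 'a => 'v" where "w g h = comm_elt V (l g) (r h)"

definition T :: "'v set" where
 "T = generate V {w g h | g h. g : carrier G & h : carrier G}"

sublocale l: group_hom G V l by unfold_locales (rule l_hom)
sublocale r: group_hom G V r by unfold_locales (rule r_hom)
sublocale e: group_hom V G e by unfold_locales (rule e_hom)

lemma w_closed [simp]: "g : carrier G ==> h : carrier G ==> w g h : carrier V"
 by (simp add: w_def)

lemma w_sub: "{w g h | g h. g : carrier G & h : carrier G} \<subseteq> carrier V"
 by auto

lemma T_subgroup: "subgroup T V"
 unfolding T_def by (rule V.generate_is_subgroup[OF w_sub])

lemma T_closed [simp]: "t : T ==> t : carrier V"
 using T_subgroup subgroup.mem_carrier by metis

lemma T_one [simp]: "\<one>{:V:} : T"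
 using T_subgroup subgroup.one_closed by metis

lemma T_mult [simp]: "s : T ==> t : T ==> s \<otimes>{:V:} t : T"
 using T_subgroup subgroup.m_closed by metis

lemma T_inv [simp]: "t : T ==> inv{:V:} t : T"
 using T_subgroup subgroup.m_inv_closed by metis

lemma w_T [simp]: "g : carrier G ==> h : carrier G ==> w g h : T"
 unfolding T_def by (rule generate.incl) auto

lemma T_induct [consumes 1, case_names w one mult inv]:
 assumes "t : T"
  and "!!g h. g : carrier G ==> h : carrier G ==> P (w g h)" "P \<one>{:V:}"
  and "!!s t. s : T ==> t : T ==> P s ==> P t ==> P (s \<otimes>{:V:} t)"
  and "!!t. t : T ==> P t ==> P (inv{:V:} t)"
 shows "P t"
proof -
 have "subgroup {t : T. P t} V"
  by (rule subgroup.intro) (use assms in auto)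
 then have "T \<subseteq> {t : T. P t}"
  unfolding T_def by (rule V.generate_subgroup_incl[rotated]) (use assms(2) w_T in \<open>auto simp: T_def\<close>)
 then show ?thesis using assms(1) by auto
qed

lemma V_induct [consumes 1, case_names l r mult inv]:
 assumes "v : carrier V"
  and l: "!!g. g : carrier G ==> P (l g)" and r: "!!g. g : carrier G ==> P (r g)"
  and m: "!!s t. s : carrier V ==> t : carrier V ==> P s ==> P t ==> P (s \<otimes>{:V:} t)"
  and i: "!!t. t : carrier V ==> P t ==> P (inv{:V:} t)"
 shows "P v"
proof -
 have "P \<one>{:V:}" using l[of "\<one>{:G:}"] by simp
 then have "subgroup {v : carrier V. P v} V"
  by (intro subgroup.intro) (use m i in auto)
 then have "carrier V \<subseteq> {v : carrier V. P v}"
  by (subst gen, intro V.generate_subgroup_incl) (use l r in auto)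
 then show ?thesis using assms(1) by auto
qed

lemma w_conj:
 assumes "g : carrier G" "h : carrier G" "s : carrier G"
 shows "conj_elt V (w g h) (l s) = w (conj_elt G g s) (conj_elt G h s)"
  and "conj_elt V (w g h) (r s) = w (conj_elt G g s) (conj_elt G h s)"
 using assms rel_lr rel_conj by (auto simp: w_def)

lemma conj_T_l: "t : T ==> s : carrier G ==> conj_elt V t (l s) : T"
 by (induction rule: T_induct) (auto simp: w_conj V.conj_mult V.conj_inv)

lemma conj_T_r: "t : T ==> s : carrier G ==> conj_elt V t (r s) = conj_elt V t (l s)"
 by (induction rule: T_induct) (auto simp: w_conj V.conj_mult V.conj_inv)

text \<open>The two copies of G act on \<open>T\<close> in the same way by \<open>rel_lr\<close>,
  and together they generate V; so V acts on \<open>T\<close> through \<open>e\<close>.\<close>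

lemma conj_T:
 assumes "v : carrier V" "t : T"
 shows "conj_elt V t v = conj_elt V t (l (e v))"
 using assms
proof (induction arbitrary: t rule: V_induct)
 case (mult u v)
 have "conj_elt V t (u \<otimes>{:V:} v) = conj_elt V (conj_elt V t (l (e u))) v"
  using mult by (simp flip: V.conj_conj)
 also have "\<dots> = conj_elt V (conj_elt V t (l (e u))) (l (e v))"
  using mult by (simp add: conj_T_l)
 finally show ?case using mult by (simp add: V.conj_conj)
next
 case (inv v)
 \<comment> \<open>The candidate for the conjugate of t by the inverse of v: conjugating it by v,
   which the induction hypothesis controls, returns t.\<close>
 let ?s = "conj_elt V t (l (e (inv{:V:} v)))"
 have "conj_elt V ?s v = conj_elt V ?s (l (e v))"
  using inv by (intro inv.IH conj_T_l) auto
 also have "\<dots> = t" using inv by (simp add: V.conj_conj)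
 finally have "conj_elt V (conj_elt V ?s v) (inv{:V:} v) = conj_elt V t (inv{:V:} v)" by simp
 moreover have "conj_elt V (conj_elt V ?s v) (inv{:V:} v) = ?s"
  using inv by simp
 ultimately show ?case by simp
qed (auto simp: conj_T_r)

lemma conj_T_closed: "v : carrier V ==> t : T ==> conj_elt V t v : T"
 by (metis conj_T conj_T_l e.hom_closed)

lemma conj_T_e: "u : carrier V ==> v : carrier V ==> e u = e v ==> t : T ==> conj_elt V t u = conj_elt V t v"
 by (metis conj_T)

lemma e_w [simp]: "g : carrier G ==> h : carrier G ==> e (w g h) = comm_elt G g h"
 unfolding w_def using hom_comm[OF e_hom] by simp

lemma w_mult_left:
 assumes "g : carrier G" "h : carrier G" "k : carrier G"
 shows "w (g \<otimes>{:G:} h) k = conj_elt V (w g k) (l h) \<otimes>{:V:} w h k"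
 using assms by (simp add: w_def V.comm_mult_left)

lemma w_mult_right:
 assumes "g : carrier G" "h : carrier G" "k : carrier G"
 shows "w g (h \<otimes>{:G:} k) = w g k \<otimes>{:V:} conj_elt V (w g h) (l k)"
 using assms w_conj by (simp add: w_def V.comm_mult_right)

lemma w_one [simp]: "s : carrier G ==> w \<one>{:G:} s = \<one>{:V:}" "s : carrier G ==> w s \<one>{:G:} = \<one>{:V:}"
 by (simp_all add: w_def)

lemma w_inv_left:
 assumes "g : carrier G" "s : carrier G"
 shows "w (inv{:G:} g) s = conj_elt V (inv{:V:} w g s) (l (inv{:G:} g))"
proof -
 have "conj_elt V (w (inv{:G:} g) s) (l g) \<otimes>{:V:} w g s = \<one>{:V:}"
  using w_mult_left[of "inv{:G:} g" g s] assms by simp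
 then have "inv{:V:} w g s = conj_elt V (w (inv{:G:} g) s) (l g)"
  using assms by (intro V.inv_equality) auto
 then show ?thesis using assms by simp
qed

text \<open>This is the crossed module property of \<open>e\<close>: the pairing with an element
  coming from \<open>T\<close> is a commutator formed with that element of \<open>T\<close>. On a
  generator it follows by expanding w g (h s) in two ways, once directly and once through h s = s'
  h, where s' is the conjugate of s by the inverse of h.\<close>

lemma w_e_left:
 assumes "t : T" "s : carrier G"
 shows "w (e t) s = inv{:V:} t \<otimes>{:V:} conj_elt V t (l s)"
 using assms
proof (induction rule: T_induct)
 case (w g h)
 let ?c = "comm_elt G g h" and ?t = "w g h" and ?A = "w g s"
 have c: "conj_elt G g h = g \<otimes>{:G:} ?c"
  using w by (simp add: conj_elt_def comm_elt_def G.group_word_simps)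
 have c': "?c = inv{:G:} g \<otimes>{:G:} conj_elt G g h"
  using w by (simp add: c)
 have "w ?c s = conj_elt V (w (inv{:G:} g) s) (l (g \<otimes>{:G:} ?c)) \<otimes>{:V:} w (conj_elt G g h) s"
  using w_mult_left[of "inv{:G:} g" "conj_elt G g h" s] w by (simp only: c'[symmetric] c[symmetric] G.inv_closed G.conj_closed)
 also have "conj_elt V (w (inv{:G:} g) s) (l (g \<otimes>{:G:} ?c)) = conj_elt V (inv{:V:} ?A) (l ?c)"
  using w by (simp add: w_inv_left V.conj_conj)
 also have "\<dots> = conj_elt V (inv{:V:} ?A) ?t"
  using w by (intro conj_T_e) auto
 finally have 1: "w ?c s = conj_elt V (inv{:V:} ?A) ?t \<otimes>{:V:} w (conj_elt G g h) s" .
 let ?s = "conj_elt G s (inv{:G:} h)"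
 have "?A \<otimes>{:V:} conj_elt V ?t (l s) = w g (h \<otimes>{:G:} s)"
  using w by (simp add: w_mult_right)
 also have "h \<otimes>{:G:} s = ?s \<otimes>{:G:} h"
  using w by (simp add: conj_elt_def G.group_word_simps)
 also have "w g (?s \<otimes>{:G:} h) = ?t \<otimes>{:V:} w (conj_elt G g h) s"
  using w by (simp add: w_mult_right w_conj)
 finally have 2: "?A \<otimes>{:V:} conj_elt V ?t (l s) = ?t \<otimes>{:V:} w (conj_elt G g h) s" .
 have "w ?c s = inv{:V:} ?t \<otimes>{:V:} (inv{:V:} ?A \<otimes>{:V:} (?t \<otimes>{:V:} w (conj_elt G g h) s))"
  using w by (simp add: 1 conj_elt_def[of V] V.group_word_simps)
 also have "\<dots> = inv{:V:} ?t \<otimes>{:V:} conj_elt V ?t (l s)"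
  using w by (simp flip: 2)
 finally show ?case using w by simp
next
 case (mult u v)
 have "w (e (u \<otimes>{:V:} v)) s = conj_elt V (w (e u) s) (l (e v)) \<otimes>{:V:} w (e v) s"
  using mult by (simp add: w_mult_left)
 also have "conj_elt V (w (e u) s) (l (e v)) = conj_elt V (w (e u) s) v"
  by (rule conj_T_e) (use mult.hyps mult.prems in auto)
 finally show ?case
  using mult by (simp add: conj_elt_def V.group_word_simps)
next
 case (inv t)
 have "w (e (inv{:V:} t)) s = conj_elt V (inv{:V:} w (e t) s) (l (inv{:G:} e t))"
  using inv by (simp add: w_inv_left)
 also have "\<dots> = conj_elt V (inv{:V:} w (e t) s) (inv{:V:} t)"
  by (rule conj_T_e) (use inv.hyps inv.prems in auto)
 finally show ?case
  using inv by (simp add: conj_elt_def V.group_word_simps)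
qed simp

text \<open>For e t = 1 the identity \<open>w_e_left\<close> reads 1 = t^-1 t^s, so t is fixed by
  the whole action.\<close>

lemma q_conj:
 assumes "t : T" "e t = \<one>{:G:}" "v : carrier V"
 shows "conj_elt V t v = t"
proof -
 have "inv{:V:} t \<otimes>{:V:} conj_elt V t (l (e v)) = \<one>{:V:}"
  using w_e_left[of t "e v"] assms by simp
 then have "conj_elt V t (l (e v)) = t"
  using assms by (subst (asm) V.inv_mult_eq_one_iff) auto
 then show ?thesis by (metis conj_T assms(1,3))
qed

lemma q_central:
 assumes "t : T" "e t = \<one>{:G:}" "v : carrier V"
 shows "t \<otimes>{:V:} v = v \<otimes>{:V:} t"
 using q_conj[OF assms] assms by (simp add: V.conj_eq_iff)

end

definition group_center :: "('a, 'b) monoid_scheme => 'a set" where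
 "group_center H = {z : carrier H. ALL x : carrier H. z \<otimes>{:H:} x = x \<otimes>{:H:} z}"

lemma group_centerD:
 "z : group_center H ==> z : carrier H"
 "z : group_center H ==> x : carrier H ==> z \<otimes>{:H:} x = x \<otimes>{:H:} z"
 by (auto simp: group_center_def)

lemma (in group) subgroup_center: "subgroup (group_center G) G"
proof (rule subgroup.intro)
 show "x \<otimes> y : group_center G" if "x : group_center G" "y : group_center G" for x y
 proof -
  have c: "x : carrier G" "y : carrier G"
  using that by (auto simp: group_center_def)
  have "x \<otimes> y \<otimes> v = v \<otimes> (x \<otimes> y)" if v: "v : carrier G" for v
  proof -
  have "x \<otimes> y \<otimes> v = x \<otimes> (v \<otimes> y)"
   using c v group_centerD(2)[OF \<open>y : group_center G\<close> v] by (simp add: m_assoc)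
  also have "\<dots> = v \<otimes> x \<otimes> y"
   using c v group_centerD(2)[OF \<open>x : group_center G\<close> v] by (simp flip: m_assoc)
  finally show ?thesis using c v by (simp add: m_assoc)
  qed
  then show ?thesis using c by (simp add: group_center_def)
 qed
 show "inv x : group_center G" if x: "x : group_center G" for x
 proof -
  have "inv x \<otimes> y = y \<otimes> inv x" if y: "y : carrier G" for y
  proof -
  have "inv (x \<otimes> inv y) = inv (inv y \<otimes> x)"
   using x y group_centerD(2)[OF x, of "inv y"] by simp
  then show ?thesis using group_centerD(1)[OF x] y by (simp add: inv_mult_group)
  qed
  then show ?thesis using x by (auto simp: group_center_def)
 qed
qed (auto simp: group_center_def)

section \<open>The group \<open>\<nu>(G)\<close> and its quotient by \<open>\<Delta>(G)\<close>\<close>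

lemma pres_class_comm:
 assumes "u : gwords X" "v : gwords X"
 shows "comm_elt (presented_group X R) (pres_class X R u) (pres_class X R v) = pres_class X R (comm_word u v)"
 using assms by (simp add: comm_elt_def comm_word_def inv_presented_group pres_class_mult)

lemma pres_class_conj:
 assumes "u : gwords X" "v : gwords X"
 shows "conj_elt (presented_group X R) (pres_class X R u) (pres_class X R v) = pres_class X R (conj_word u v)"
 using assms by (simp add: conj_elt_def conj_word_def inv_presented_group pres_class_mult)

lemma comm_conj_gwords [simp]:
 "comm_word u v : gwords X \<longleftrightarrow> u : gwords X & v : gwords X"
 "conj_word u v : gwords X \<longleftrightarrow> u : gwords X & v : gwords X"
 by (auto simp: comm_word_def conj_word_def)

lemma (in group) word_eval_comm:
 "f : X \<rightarrow> carrier G ==> u : gwords X ==> v : gwords X ==>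
  word_eval G f (comm_word u v) = comm_elt G (word_eval G f u) (word_eval G f v)"
 by (simp add: comm_word_def comm_elt_def word_eval_append word_eval_inv word_eval_closed m_assoc)

lemma (in group) word_eval_conj:
 "f : X \<rightarrow> carrier G ==> u : gwords X ==> v : gwords X ==>
  word_eval G f (conj_word u v) = conj_elt G (word_eval G f u) (word_eval G f v)"
 by (simp add: conj_word_def conj_elt_def word_eval_append word_eval_inv word_eval_closed m_assoc)

lemma nu_gens_simps [simp]:
 "Inl g : nu_gens G \<longleftrightarrow> g : carrier G" "Inr g : nu_gens G \<longleftrightarrow> g : carrier G"
 by (auto simp: nu_gens_def)

lemma group_nu [simp]: "group (nu G)"
 by (simp add: nu_def group_presented_group)

lemma nu_closed [simp]:
 "g : carrier G ==> nu_left G g : carrier (nu G)"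
 "g : carrier G ==> nu_right G g : carrier (nu G)"
 by (auto simp: nu_def nu_left_def nu_right_def carrier_presented_group)

lemma nu_hom:
 assumes "group G" "group H" "a : hom G H" "b : hom G H"
  and r1: "!!g1 g2 g3. [|g1 : carrier G; g2 : carrier G; g3 : carrier G|] ==>
  conj_elt H (comm_elt H (a g1) (b g2)) (a g3) = conj_elt H (comm_elt H (a g1) (b g2)) (b g3)"
  and r2: "!!g1 g2 g3. [|g1 : carrier G; g2 : carrier G; g3 : carrier G|] ==>
  conj_elt H (comm_elt H (a g1) (b g2)) (b g3) = comm_elt H (a (conj_elt G g1 g3)) (b (conj_elt G g2 g3))"
 obtains h where "h : hom (nu G) H" "!!g. g : carrier G ==> h (nu_left G g) = a g"
  "!!g. g : carrier G ==> h (nu_right G g) = b g"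
proof -
 interpret G: group G by fact
 interpret H: group H by fact
 interpret a: group_hom G H a using assms by unfold_locales
 interpret b: group_hom G H b using assms by unfold_locales
 let ?f = "case_sum a b"
 have f: "?f : nu_gens G \<rightarrow> carrier H"
  by (auto simp: nu_gens_def)
 have "word_eval H ?f u = word_eval H ?f v"
  if "(u, v) : nu_rels G" "u : gwords (nu_gens G)" "v : gwords (nu_gens G)" for u v
  using that unfolding nu_rels_def
  by (auto simp: H.word_eval_conj[OF f] H.word_eval_comm[OF f] r1 r2)
 then obtain h where h: "h : hom (presented_group (nu_gens G) (nu_rels G)) H"
  "!!x. x : nu_gens G ==> h (pres_class (nu_gens G) (nu_rels G) [(x, True)]) = ?f x"
  using presented_group_hom[OF H.is_group f, of "nu_rels G"] by metis
 show thesis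
  by (rule that[of h]) (simp_all add: h nu_def nu_left_def nu_right_def)
qed

lemma nu_left_hom: "group G ==> nu_left G : hom G (nu G)"
proof (rule homI)
 assume "group G"
 then interpret G: group G .
 fix g h assume gh: "g : carrier G" "h : carrier G"
 then have "pres_eq (nu_gens G) (nu_rels G) (wl g @ wl h) (wl (g \<otimes>{:G:} h))"
  by (intro pres_eq.rel) (auto simp: nu_rels_def)
 then show "nu_left G (g \<otimes>{:G:} h) = nu_left G g \<otimes>{:nu G:} nu_left G h"
  using gh pres_eq_class[of "wl g @ wl h" "nu_gens G" "nu_rels G"]
  by (simp add: nu_left_def nu_def pres_class_mult)
qed simp

lemma nu_right_hom: "group G ==> nu_right G : hom G (nu G)"
proof (rule homI)
 assume "group G"
 then interpret G: group G .
 fix g h assume gh: "g : carrier G" "h : carrier G"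
 then have "pres_eq (nu_gens G) (nu_rels G) (wr g @ wr h) (wr (g \<otimes>{:G:} h))"
  by (intro pres_eq.rel) (auto simp: nu_rels_def)
 then show "nu_right G (g \<otimes>{:G:} h) = nu_right G g \<otimes>{:nu G:} nu_right G h"
  using gh pres_eq_class[of "wr g @ wr h" "nu_gens G" "nu_rels G"]
  by (simp add: nu_right_def nu_def pres_class_mult)
qed simp

definition nu_fold :: "('a, 'b) monoid_scheme => ('a + 'a) gword set => 'a" where
 "nu_fold G = (SOME h. h : hom (nu G) G &
  (ALL g : carrier G. h (nu_left G g) = g & h (nu_right G g) = g))"

lemma nu_fold:
 assumes "group G"
 shows "nu_fold G : hom (nu G) G" "g : carrier G ==> nu_fold G (nu_left G g) = g"
  "g : carrier G ==> nu_fold G (nu_right G g) = g"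
proof -
 interpret G: group G by fact
 have "EX h. h : hom (nu G) G & (ALL g : carrier G. h (nu_left G g) = g & h (nu_right G g) = g)"
  by (rule nu_hom[OF assms assms, of id id])
   (auto simp: hom_def comm_elt_def conj_elt_def G.group_word_simps)
 from someI_ex[OF this, folded nu_fold_def]
 show "nu_fold G : hom (nu G) G" "g : carrier G ==> nu_fold G (nu_left G g) = g"
  "g : carrier G ==> nu_fold G (nu_right G g) = g" by auto
qed

lemma nu_context:
 assumes "group G"
 shows "tensor_context G (nu G) (nu_left G) (nu_right G) (nu_fold G)"
proof -
 interpret G: group G by fact
 interpret N: group "nu G" by simp
 have cls: "pres_class (nu_gens G) (nu_rels G) u = pres_class (nu_gens G) (nu_rels G) v"
  if "(u, v) : nu_rels G" "u : gwords (nu_gens G)" "v : gwords (nu_gens G)" for u v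
  using pres_eq_class[of u] pres_eq.rel that by metis
 show ?thesis
 proof (unfold_locales)
  have "(%x. pres_class (nu_gens G) (nu_rels G) [(x, True)]) ` nu_gens G
   = nu_left G ` carrier G \<union> nu_right G ` carrier G"
  by (auto simp: nu_gens_def nu_left_def nu_right_def)
  then show "carrier (nu G) = generate (nu G) (nu_left G ` carrier G \<union> nu_right G ` carrier G)"
  using presented_group_generated[of "nu_gens G" "nu_rels G"] by (simp add: nu_def)
  show "conj_elt (nu G) (comm_elt (nu G) (nu_left G g1) (nu_right G g2)) (nu_left G g3) =
    conj_elt (nu G) (comm_elt (nu G) (nu_left G g1) (nu_right G g2)) (nu_right G g3)"
  if "g1 : carrier G" "g2 : carrier G" "g3 : carrier G" for g1 g2 g3
  using that unfolding nu_def nu_left_def nu_right_def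
  by (simp add: pres_class_comm pres_class_conj) (rule cls, unfold nu_rels_def, rule UnI1, rule UnI2, blast, auto)
  show "conj_elt (nu G) (comm_elt (nu G) (nu_left G g1) (nu_right G g2)) (nu_right G g3) =
    comm_elt (nu G) (nu_left G (conj_elt G g1 g3)) (nu_right G (conj_elt G g2 g3))"
  if "g1 : carrier G" "g2 : carrier G" "g3 : carrier G" for g1 g2 g3
  using that unfolding nu_def nu_left_def nu_right_def
  by (simp add: pres_class_comm pres_class_conj) (rule cls, unfold nu_rels_def, rule UnI2, blast, auto)
 qed (simp_all add: nu_left_hom[OF assms] nu_right_hom[OF assms] nu_fold[OF assms])
qed

section \<open>The central subgroup generated by the diagonal elements\<close>

context tensor_context
begin

definition D :: "'v set" where "D = generate V {w g g | g. g : carrier G}"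

lemma D_sub: "{w g g | g. g : carrier G} \<subseteq> carrier V" by auto

lemma D_central: "d : D ==> v : carrier V ==> d \<otimes>{:V:} v = v \<otimes>{:V:} d"
proof -
 assume "d : D" and v: "v : carrier V"
 have "subgroup (group_center V) V" by (rule V.subgroup_center)
 moreover have "w g g \<otimes>{:V:} v = v \<otimes>{:V:} w g g" if "g : carrier G" "v : carrier V" for g v
  using that by (intro q_central) (auto simp: comm_elt_def G.group_word_simps)
 ultimately have "D \<subseteq> group_center V"
  unfolding D_def by (intro V.generate_subgroup_incl) (auto simp: group_center_def)
 then show ?thesis using \<open>d : D\<close> v by (auto simp: group_center_def)
qed

lemma D_subgroup: "subgroup D V"
 unfolding D_def by (rule V.generate_is_subgroup[OF D_sub])

lemma D_closed [simp]: "d : D ==> d : carrier V"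
 using D_subgroup subgroup.mem_carrier by metis

lemma D_normal: "D \<lhd> V"
proof -
 have "v \<otimes>{:V:} d \<otimes>{:V:} inv{:V:} v : D" if "v : carrier V" "d : D" for v d
 proof -
  have "v \<otimes>{:V:} d \<otimes>{:V:} inv{:V:} v = d"
  using that by (simp add: V.m_assoc flip: D_central)
  then show ?thesis using that by simp
 qed
 then show ?thesis using D_subgroup by (simp add: V.normal_inv_iff)
qed

lemma D_T: "D \<subseteq> T"
 unfolding D_def T_def by (rule V.mono_generate) auto

lemma e_D: "d : D ==> e d = \<one>{:G:}"
proof -
 have "subgroup (kernel V G e) V" by (rule e.subgroup_kernel)
 then have "D \<subseteq> kernel V G e"
  unfolding D_def by (rule V.generate_subgroup_incl[rotated])
  (auto simp: kernel_def comm_elt_def G.group_word_simps)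
 then show "d : D ==> e d = \<one>{:G:}" by (auto simp: kernel_def)
qed

end

lemma group_hom_mod_intro:
 "N \<lhd> V ==> group_hom V (V Mod N) (%x. N #>{:V:} x)"
 by (simp add: group_hom_defs normal.r_coset_hom_Mod normal.factorgroup_is_group
  normal.axioms(2))

locale exterior_context = tensor_context G V l r e
 for G :: "('a, 'b) monoid_scheme" and V :: "('v, 'c) monoid_scheme"
  and l r :: "'a => 'v" and e :: "'v => 'a" +
 assumes w_diag [simp]: "g : carrier G ==> w g g = \<one>{:V:}"

lemma (in tensor_context) quotient_context:
 obtains e' where "exterior_context G (V Mod D) (%g. D #>{:V:} l g) (%g. D #>{:V:} r g) e'"
  "tensor_context.w (V Mod D) (%g. D #>{:V:} l g) (%g. D #>{:V:} r g) = (%g h. comm_elt (V Mod D) (D #>{:V:} l g) (D #>{:V:} r h))"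
  "tensor_context.T G (V Mod D) (%g. D #>{:V:} l g) (%g. D #>{:V:} r g) = (%t. D #>{:V:} t) ` T"
  "!!v. v : carrier V ==> e' (D #>{:V:} v) = e v"
proof -
 interpret D: normal D V by (rule D_normal)
 interpret Q: group "V Mod D" by (rule D.factorgroup_is_group)
 interpret c: group_hom V "V Mod D" "%x. D #>{:V:} x" by (rule group_hom_mod_intro[OF D_normal])
 obtain e' where e': "e' : hom (V Mod D) G" "!!v. v : carrier V ==> e' (D #>{:V:} v) = e v"
  using FactGroup_hom_universal[OF e_hom D_normal G.is_group e_D] by blast
 let ?l = "%g. D #>{:V:} l g" and ?r = "%g. D #>{:V:} r g"
 have cm: "comm_elt (V Mod D) (?l g) (?r h) = D #>{:V:} w g h" if "g : carrier G" "h : carrier G" for g h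
  using that hom_comm[OF c.homh V.is_group Q.is_group] by (simp add: w_def)
 have cj: "conj_elt (V Mod D) (D #>{:V:} u) (D #>{:V:} v) = D #>{:V:} conj_elt V u v"
  if "u : carrier V" "v : carrier V" for u v
  using that hom_conj[OF c.homh V.is_group Q.is_group] by simp
 have tc: "tensor_context G (V Mod D) ?l ?r e'"
 proof (unfold_locales)
  show "?l : hom G (V Mod D)" "?r : hom G (V Mod D)"
  using hom_compose[OF l_hom c.homh] hom_compose[OF r_hom c.homh] by (auto simp: comp_def)
  have "(%x. D #>{:V:} x) ` generate V (l ` carrier G \<union> r ` carrier G)
   = generate (V Mod D) ((%x. D #>{:V:} x) ` (l ` carrier G \<union> r ` carrier G))"
  by (rule c.generate_img[symmetric]) auto
  then show "carrier (V Mod D) = generate (V Mod D) (?l ` carrier G \<union> ?r ` carrier G)"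
  using gen by (simp add: carrier_FactGroup image_Un image_image)
 qed (use e' in \<open>auto simp: cm cj rel_lr rel_conj w_conj\<close>)
 then interpret X: tensor_context G "V Mod D" ?l ?r e' .
 have wX: "X.w g h = D #>{:V:} w g h" if "g : carrier G" "h : carrier G" for g h
  using that cm by (simp add: X.w_def)
 have "w g g : D" if "g : carrier G" for g
  unfolding D_def using that by (intro generate.incl) auto
 then have "exterior_context G (V Mod D) ?l ?r e'"
  using D.rcos_eq_one_iff by unfold_locales (simp add: wX)
 moreover have "X.T = (%t. D #>{:V:} t) ` T"
 proof -
  have "{X.w g h | g h. g : carrier G & h : carrier G}
   = (%t. D #>{:V:} t) ` {w g h | g h. g : carrier G & h : carrier G}"
  using wX by (auto simp: image_iff) metis
  then show ?thesis
  unfolding X.T_def T_def using c.generate_img[OF w_sub] by simp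
 qed
 moreover have "X.w = (%g h. comm_elt (V Mod D) (?l g) (?r h))"
  by (intro ext) (rule X.w_def)
 ultimately show thesis
  by (intro that[OF _ _ _ e'(2)])
qed

text \<open>The quotient is formed in \<open>nu G\<close> and not just in the tensor square, so that
  both copies of G survive and the abstract setting \<open>tensor_context\<close> applies to
  it.\<close>

definition ext_nu :: "('a, 'b) monoid_scheme => ('a + 'a) gword set set monoid" where
 "ext_nu G = nu G Mod carrier (Delta G)"

definition ext_left :: "('a, 'b) monoid_scheme => 'a => ('a + 'a) gword set set" where
 "ext_left G g = carrier (Delta G) #>{:nu G:} nu_left G g"

definition ext_right :: "('a, 'b) monoid_scheme => 'a => ('a + 'a) gword set set" where
 "ext_right G g = carrier (Delta G) #>{:nu G:} nu_right G g"

definition wedge :: "('a, 'b) monoid_scheme => 'a => 'a => ('a + 'a) gword set set" where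
 "wedge G g h = comm_elt (ext_nu G) (ext_left G g) (ext_right G h)"

lemma tensor_square_eq:
 assumes "group G"
 shows "tensor_square G = (nu G)\<lparr>carrier := tensor_context.T G (nu G) (nu_left G) (nu_right G)\<rparr>"
  and "Delta G = (nu G)\<lparr>carrier := tensor_context.D G (nu G) (nu_left G) (nu_right G)\<rparr>"
proof -
 interpret N: tensor_context G "nu G" "nu_left G" "nu_right G" "nu_fold G"
  by (rule nu_context[OF assms])
 have w: "tensor_elt G g h = N.w g h" for g h
  by (simp add: tensor_elt_def N.w_def)
 show 1: "tensor_square G = (nu G)\<lparr>carrier := N.T\<rparr>"
  using N.w_sub by (simp add: tensor_square_def subgroup_generated_def N.T_def w Int_absorb1)
 have "generate ((nu G)\<lparr>carrier := N.T\<rparr>) {N.w g g | g. g : carrier G} = N.D"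
  unfolding N.D_def by (rule N.V.generate_consistent[OF _ N.T_subgroup]) auto
 moreover have "N.T \<inter> {N.w g g | g. g : carrier G} = {N.w g g | g. g : carrier G}"
  by auto
 ultimately show "Delta G = (nu G)\<lparr>carrier := N.D\<rparr>"
  by (simp add: Delta_def 1 w subgroup_generated_def)
qed

lemma exterior_context_ex:
 assumes "group G"
 obtains e where "exterior_context G (ext_nu G) (ext_left G) (ext_right G) e"
  "exterior_square G = (ext_nu G)\<lparr>carrier := tensor_context.T G (ext_nu G) (ext_left G) (ext_right G)\<rparr>"
proof -
 interpret N: tensor_context G "nu G" "nu_left G" "nu_right G" "nu_fold G"
  by (rule nu_context[OF assms])
 have "carrier (Delta G) = N.D"
  by (simp add: tensor_square_eq(2)[OF assms])
 then have eqs: "ext_nu G = nu G Mod N.D" "ext_left G = (%g. N.D #>{:nu G:} nu_left G g)"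
  "ext_right G = (%g. N.D #>{:nu G:} nu_right G g)"
  by (auto simp: ext_nu_def ext_left_def ext_right_def)
 obtain e where e: "exterior_context G (ext_nu G) (ext_left G) (ext_right G) e"
  "tensor_context.T G (ext_nu G) (ext_left G) (ext_right G) = (%t. N.D #>{:nu G:} t) ` N.T"
  unfolding eqs by (rule N.quotient_context)
 \<comment> \<open>A coset of \<open>N.D\<close> in \<open>N.T\<close> is the same set as its coset
   in \<open>nu G\<close>, so the factor group is literally a subgroup of
   \<open>ext_nu G\<close>.\<close>
 have "exterior_square G = (ext_nu G)\<lparr>carrier := (%t. N.D #>{:nu G:} t) ` N.T\<rparr>"
  unfolding exterior_square_def ext_nu_def tensor_square_eq[OF assms]
  by (auto simp: FactGroup_def RCOSETS_def set_mult_def r_coset_def fun_eq_iff)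
 then show thesis using that e by simp
qed

definition ext_fold :: "('a, 'b) monoid_scheme => ('a + 'a) gword set set => 'a" where
 "ext_fold G = (SOME e. exterior_context G (ext_nu G) (ext_left G) (ext_right G) e)"

lemma ext_context:
 assumes "group G"
 shows "exterior_context G (ext_nu G) (ext_left G) (ext_right G) (ext_fold G)"
proof -
 have "EX e. exterior_context G (ext_nu G) (ext_left G) (ext_right G) e"
  using exterior_context_ex[OF assms] by metis
 then show ?thesis unfolding ext_fold_def by (rule someI_ex)
qed

lemma exterior_square_eq:
 assumes "group G"
 shows "exterior_square G = (ext_nu G)\<lparr>carrier := tensor_context.T G (ext_nu G) (ext_left G) (ext_right G)\<rparr>"
 by (metis exterior_context_ex[OF assms])

section \<open>Central lifts\<close>

text \<open>A map that becomes a homomorphism modulo the centre of E. It is not tied to a surjection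
  from E to G: a section of a central extension of a quotient of G, composed with the projection
  from G, is included.\<close>

definition central_lift :: "('a, 'b) monoid_scheme => ('e, 'c) monoid_scheme => ('a => 'e) => bool" where
 "central_lift G E s \<longleftrightarrow> s : carrier G \<rightarrow> carrier E &
  (ALL g : carrier G. ALL h : carrier G. EX z : group_center E. s g \<otimes>{:E:} s h = z \<otimes>{:E:} s (g \<otimes>{:G:} h))"

lemma (in group) comm_central_left:
 assumes "z : group_center G" "a : carrier G" "b : carrier G"
 shows "comm_elt G (z \<otimes> a) b = comm_elt G a b" "comm_elt G b (z \<otimes> a) = comm_elt G b a"
  "conj_elt G b (z \<otimes> a) = conj_elt G b a"
proof -
 have [simp]: "z : carrier G" using assms(1) by (rule group_centerD)
 have 1: "conj_elt G b z = b" if "b : carrier G" for b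
  using that group_centerD(2)[OF assms(1)] by (simp add: conj_eq_iff)
 have 2: "conj_elt G z b = z" if "b : carrier G" for b
  using that group_centerD(2)[OF assms(1)] by (simp add: conj_eq_iff)
 have 3: "comm_elt G z b = \<one>"
  using 2[OF assms(3)] assms(3) by (simp add: comm_elt_def conj_elt_def m_assoc)
 have 4: "comm_elt G b z = \<one>"
  using 1[of "b"] assms(3) by (simp add: comm_elt_def conj_elt_def m_assoc)
 show "comm_elt G (z \<otimes> a) b = comm_elt G a b"
  using assms 3 by (simp add: comm_mult_left)
 show "comm_elt G b (z \<otimes> a) = comm_elt G b a"
  using assms 4 by (simp add: comm_mult_right)
 show "conj_elt G b (z \<otimes> a) = conj_elt G b a"
  using assms 1[OF assms(3)] by (simp flip: conj_conj)
qed

text \<open>Since h g^h = g h, the products s h s(g^h) and s g s h lift the same element and thus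
  differ by a central factor.\<close>

lemma central_lift_conj:
 assumes "group G" "group E" "central_lift G E s" "g : carrier G" "h : carrier G"
 obtains z where "z : group_center E" "s (conj_elt G g h) = z \<otimes>{:E:} conj_elt E (s g) (s h)"
proof -
 interpret G: group G by fact
 interpret E: group E by fact
 have s: "s x : carrier E" if "x : carrier G" for x
  using assms(3) that by (auto simp: central_lift_def)
 obtain z1 where z1: "z1 : group_center E" "s g \<otimes>{:E:} s h = z1 \<otimes>{:E:} s (g \<otimes>{:G:} h)"
  using assms unfolding central_lift_def by blast
 obtain z2 where z2: "z2 : group_center E"
  "s h \<otimes>{:E:} s (conj_elt G g h) = z2 \<otimes>{:E:} s (h \<otimes>{:G:} conj_elt G g h)"
  using assms unfolding central_lift_def by (metis G.conj_closed)
 have hc: "h \<otimes>{:G:} conj_elt G g h = g \<otimes>{:G:} h"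
  using assms by (simp add: conj_elt_def G.m_assoc)
 let ?z = "z2 \<otimes>{:E:} inv{:E:} z1"
 have zc: "z1 : carrier E" "z2 : carrier E" "?z : group_center E"
  using z1(1) z2(1) E.subgroup_center by (auto dest: group_centerD simp: subgroup.m_closed subgroup.m_inv_closed)
 have "s (g \<otimes>{:G:} h) = inv{:E:} z1 \<otimes>{:E:} (s g \<otimes>{:E:} s h)"
  using z1(2) zc(1) s assms by simp
 then have "s h \<otimes>{:E:} s (conj_elt G g h) = ?z \<otimes>{:E:} (s g \<otimes>{:E:} s h)"
  using z2(2) hc zc s assms by (simp add: E.m_assoc)
 then have "s (conj_elt G g h) = inv{:E:} s h \<otimes>{:E:} (?z \<otimes>{:E:} (s g \<otimes>{:E:} s h))"
  using s assms by (metis E.l_cancel_inv(1) G.conj_closed)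
 also have "\<dots> = ?z \<otimes>{:E:} conj_elt E (s g) (s h)"
 proof -
  have "inv{:E:} s h \<otimes>{:E:} (?z \<otimes>{:E:} y) = ?z \<otimes>{:E:} (inv{:E:} s h \<otimes>{:E:} y)" if "y : carrier E" for y
  using group_centerD(1)[OF zc(3)] group_centerD(2)[OF zc(3), of "inv{:E:} s h"] s assms that
  by (metis E.inv_closed E.m_assoc)
  then show ?thesis
  using s assms by (simp add: conj_elt_def E.m_assoc)
 qed
 finally show thesis using that zc(3) by blast
qed

lemma (in group) mult_conj: "a : carrier G ==> b : carrier G ==> b \<otimes> conj_elt G a b = a \<otimes> b"
 by (simp add: conj_elt_def m_assoc)

lemma DirProd_simps3:
 assumes "group E"
 shows "group (E \<times>\<times> (E \<times>\<times> E))"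
  and "a : carrier E ==> b : carrier E ==> c : carrier E ==>
  inv{:E \<times>\<times> (E \<times>\<times> E):} (a, b, c) = (inv{:E:} a, inv{:E:} b, inv{:E:} c)"
 using assms by (simp_all add: DirProd_group)

lemma hom_through_mono:
 assumes "k : hom E X" "inj_on k (carrier E)" "h : hom T X" "h ` carrier T \<subseteq> k ` carrier E" "group E"
 obtains f where "f : hom T E" "!!t. t : carrier T ==> k (f t) = h t"
proof -
 interpret E: group E by fact
 let ?f = "%t. inv_into (carrier E) k (h t)"
 have f: "?f t : carrier E" "k (?f t) = h t" if "t : carrier T" for t
  using assms(4) that by (auto simp: inv_into_into f_inv_into_f image_subset_iff)
 have "?f (s \<otimes>{:T:} t) = ?f s \<otimes>{:E:} ?f t" if "s : carrier T" "t : carrier T" for s t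
 proof -
  have "h (s \<otimes>{:T:} t) = k (?f s \<otimes>{:E:} ?f t)"
  using f that hom_mult[OF assms(1)] hom_mult[OF assms(3)] by metis
  then show ?thesis
  using inv_into_f_f[OF assms(2)] f that by (metis E.m_closed)
 qed
 then have "?f : hom T E" using f(1) by (auto intro: homI)
 then show thesis using that f(2) by blast
qed

text \<open>In \<open>E\<^sup>3\<close> modulo \<open>{(ab, a, b) | a b central}\<close> the maps \<open>g \<mapsto> (s g, s g, 1)\<close> and \<open>g \<mapsto> (s g, 1, s g)\<close>
 are homomorphisms although \<open>s\<close> is not, and the commutators of their values lie in the first factor,
 which embeds.\<close>

lemma central_lift_hom:
 assumes "group G" "group E" "central_lift G E s"
 obtains f where "f : hom (exterior_square G) E"
  "!!g h. g : carrier G ==> h : carrier G ==> f (wedge G g h) = comm_elt E (s g) (s h)"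
proof -
 interpret G: group G by fact
 interpret E: group E by fact
 interpret N: tensor_context G "nu G" "nu_left G" "nu_right G" "nu_fold G"
  by (rule nu_context[OF assms(1)])
 interpret X: exterior_context G "ext_nu G" "ext_left G" "ext_right G" "ext_fold G"
  by (rule ext_context[OF assms(1)])
 have s [simp]: "s x : carrier E" if "x : carrier G" for x
  using assms(3) that by (auto simp: central_lift_def)
 let ?Z = "group_center E"
 have Zc [simp]: "z : carrier E" if "z : ?Z" for z using that by (rule group_centerD)
 have Zm [simp]: "z \<otimes>{:E:} z' : ?Z" if "z : ?Z" "z' : ?Z" for z z'
  using that by (rule subgroup.m_closed[OF E.subgroup_center])
 have Zi [simp]: "inv{:E:} z : ?Z" if "z : ?Z" for z
  using that by (rule subgroup.m_inv_closed[OF E.subgroup_center])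
 have Z1 [simp]: "\<one>{:E:} : ?Z"
  by (rule subgroup.one_closed[OF E.subgroup_center])
 let ?E3 = "E \<times>\<times> (E \<times>\<times> E)"
 interpret E3: group ?E3 by (rule DirProd_simps3(1)[OF assms(2)])
 note inv3 = DirProd_simps3(2)[OF assms(2)]
 define K where "K = {(a \<otimes>{:E:} b, a, b) | a b. a : ?Z & b : ?Z}"
 have Kz: "k \<otimes>{:?E3:} x = x \<otimes>{:?E3:} k" if kx: "k : K" "x : carrier ?E3" for k x
 proof -
  obtain a b u v w where k: "k = (a \<otimes>{:E:} b, a, b)" "a : ?Z" "b : ?Z"
  and x: "x = (u, v, w)" "u : carrier E" "v : carrier E" "w : carrier E"
  using kx by (auto simp: K_def)
  show ?thesis
  using k x group_centerD(2)[OF Zm[OF k(2,3)], of u] group_centerD(2)[OF k(2), of v]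
   group_centerD(2)[OF k(3), of w] by simp
 qed
 have K_sub: "subgroup K ?E3"
 proof (rule subgroup.intro)
  show "x \<otimes>{:?E3:} y : K" if xy: "x : K" "y : K" for x y
  proof -
  obtain a b a' b' where ab: "x = (a \<otimes>{:E:} b, a, b)" "a : ?Z" "b : ?Z"
   "y = (a' \<otimes>{:E:} b', a', b')" "a' : ?Z" "b' : ?Z"
   using xy by (auto simp: K_def)
  have "(a \<otimes>{:E:} b) \<otimes>{:E:} (a' \<otimes>{:E:} b') = (a \<otimes>{:E:} a') \<otimes>{:E:} (b \<otimes>{:E:} b')"
   using ab group_centerD(2)[OF ab(3), of a'] by (simp add: E.m_assoc) (metis E.m_assoc Zc)
  then show ?thesis using ab by (auto simp: K_def)
  qed
  show "inv{:?E3:} x : K" if xK: "x : K" for x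
  proof -
  obtain a b where ab: "x = (a \<otimes>{:E:} b, a, b)" "a : ?Z" "b : ?Z"
   using xK by (auto simp: K_def)
  then have "inv{:E:} (a \<otimes>{:E:} b) = inv{:E:} a \<otimes>{:E:} inv{:E:} b"
   using group_centerD(2)[OF ab(2), of b] by (metis E.inv_mult_group Zc)
  then show ?thesis using ab by (auto simp: K_def inv3)
  qed
  show "\<one>{:?E3:} : K" using Z1 E.l_one by (force simp: K_def)
 qed (auto simp: K_def)
 have K_normal: "K \<lhd> ?E3"
 proof -
  have "x \<otimes>{:?E3:} k \<otimes>{:?E3:} inv{:?E3:} x : K" if "x : carrier ?E3" "k : K" for x k
  proof -
  have "k : carrier ?E3" using that K_sub subgroup.mem_carrier by metis
  then have "x \<otimes>{:?E3:} k \<otimes>{:?E3:} inv{:?E3:} x = k"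
   using Kz[OF that(2,1)] that by (metis E3.inv_closed E3.m_assoc E3.r_inv E3.r_one)
  then show ?thesis using that by simp
  qed
  then show ?thesis using K_sub by (simp only: E3.normal_inv_iff) blast
 qed
 interpret K: normal K ?E3 by (rule K_normal)
 interpret Q: group "?E3 Mod K" by (rule K.factorgroup_is_group)
 interpret c: group_hom ?E3 "?E3 Mod K" "%x. K #>{:?E3:} x"
  by (rule group_hom_mod_intro[OF K_normal])
 let ?c = "%x. K #>{:?E3:} x"
 let ?a = "%g. ?c (s g, s g, \<one>{:E:})" and ?b = "%g. ?c (s g, \<one>{:E:}, s g)"
 let ?k = "%x. ?c (x, \<one>{:E:}, \<one>{:E:})"
 have absorb: "?c (k \<otimes>{:?E3:} x) = ?c x" if "k : K" "x : carrier ?E3" for k x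
 proof -
  have k: "k : carrier ?E3" using that(1) by (rule K.mem_carrier)
  have "k \<otimes>{:?E3:} x \<otimes>{:?E3:} inv{:?E3:} x = k"
  by (simp only: E3.m_assoc[OF k that(2) E3.inv_closed[OF that(2)]] E3.r_inv[OF that(2)] E3.r_one[OF k])
  then show ?thesis
  using that(1) by (simp only: K.rcos_eq_iff[OF E3.m_closed[OF k that(2)] that(2)])
 qed
 \<comment> \<open>The central defect z of \<open>s\<close> disappears because (z, z, 1) and (z, 1,
   z) lie in \<open>K\<close>; this dictates the shape of \<open>K\<close>.\<close>
 have lift: "?c (s g \<otimes>{:E:} s h, s g \<otimes>{:E:} s h, \<one>{:E:}) = ?a (g \<otimes>{:G:} h)"
  "?c (s g \<otimes>{:E:} s h, \<one>{:E:}, s g \<otimes>{:E:} s h) = ?b (g \<otimes>{:G:} h)"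
  if gh: "g : carrier G" "h : carrier G" for g h
 proof -
  obtain z where z: "z : ?Z" "s g \<otimes>{:E:} s h = z \<otimes>{:E:} s (g \<otimes>{:G:} h)"
  using assms(3) gh unfolding central_lift_def by blast
  have "(z \<otimes>{:E:} \<one>{:E:}, z, \<one>{:E:}) : K" "(\<one>{:E:} \<otimes>{:E:} z, \<one>{:E:}, z) : K"
  using z(1) Z1 unfolding K_def by blast+
  then have "(z, z, \<one>{:E:}) : K" "(z, \<one>{:E:}, z) : K"
  using z(1) by simp_all
  from absorb[OF this(1), of "(s (g \<otimes>{:G:} h), s (g \<otimes>{:G:} h), \<one>{:E:})"]
  absorb[OF this(2), of "(s (g \<otimes>{:G:} h), \<one>{:E:}, s (g \<otimes>{:G:} h))"]
  show "?c (s g \<otimes>{:E:} s h, s g \<otimes>{:E:} s h, \<one>{:E:}) = ?a (g \<otimes>{:G:} h)"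
  "?c (s g \<otimes>{:E:} s h, \<one>{:E:}, s g \<otimes>{:E:} s h) = ?b (g \<otimes>{:G:} h)"
  using gh z by simp_all
 qed
 have a_hom: "?a : hom G (?E3 Mod K)" and b_hom: "?b : hom G (?E3 Mod K)"
  using lift by (auto intro!: homI simp: c.hom_mult[symmetric] simp del: mult_FactGroup) 
 have k_hom: "?k : hom E (?E3 Mod K)"
  by (auto intro!: homI simp: c.hom_mult[symmetric] simp del: mult_FactGroup)
 have k_inj: "inj_on ?k (carrier E)"
 proof -
  have "x = \<one>{:E:}" if "x : carrier E" "?k x = \<one>{:?E3 Mod K:}" for x
  proof -
  have "(x, \<one>{:E:}, \<one>{:E:}) : K" using that by (simp add: K.rcos_eq_one_iff)
  then show ?thesis by (auto simp: K_def)
  qed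
  then show ?thesis using inj_on_one_iff'[OF k_hom E.is_group Q.is_group] by blast
 qed
 have cm: "comm_elt (?E3 Mod K) (?a g) (?b h) = ?k (comm_elt E (s g) (s h))"
  if "g : carrier G" "h : carrier G" for g h
 proof -
  have "comm_elt (?E3 Mod K) (?a g) (?b h) = ?c (comm_elt ?E3 (s g, s g, \<one>{:E:}) (s h, \<one>{:E:}, s h))"
  using that hom_comm[OF c.homh E3.is_group Q.is_group] by simp
  also have "comm_elt ?E3 (s g, s g, \<one>{:E:}) (s h, \<one>{:E:}, s h) = (comm_elt E (s g) (s h), \<one>{:E:}, \<one>{:E:})"
  using that by (simp add: comm_elt_def inv3)
  finally show ?thesis .
 qed
 have cj: "conj_elt (?E3 Mod K) (?k x) (?a h) = ?k (conj_elt E x (s h))"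
  "conj_elt (?E3 Mod K) (?k x) (?b h) = ?k (conj_elt E x (s h))"
  if "x : carrier E" "h : carrier G" for x h
 proof -
  have "conj_elt (?E3 Mod K) (?k x) (?a h) = ?c (conj_elt ?E3 (x, \<one>{:E:}, \<one>{:E:}) (s h, s h, \<one>{:E:}))"
  "conj_elt (?E3 Mod K) (?k x) (?b h) = ?c (conj_elt ?E3 (x, \<one>{:E:}, \<one>{:E:}) (s h, \<one>{:E:}, s h))"
  using that hom_conj[OF c.homh E3.is_group Q.is_group] by simp_all
  moreover have "conj_elt ?E3 (x, \<one>{:E:}, \<one>{:E:}) (s h, s h, \<one>{:E:}) = (conj_elt E x (s h), \<one>{:E:}, \<one>{:E:})"
  "conj_elt ?E3 (x, \<one>{:E:}, \<one>{:E:}) (s h, \<one>{:E:}, s h) = (conj_elt E x (s h), \<one>{:E:}, \<one>{:E:})"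
  using that by (simp_all add: conj_elt_def inv3)
  ultimately show "conj_elt (?E3 Mod K) (?k x) (?a h) = ?k (conj_elt E x (s h))"
  "conj_elt (?E3 Mod K) (?k x) (?b h) = ?k (conj_elt E x (s h))" by simp_all
 qed
 obtain h where h: "h : hom (nu G) (?E3 Mod K)"
  "!!g. g : carrier G ==> h (nu_left G g) = ?a g" "!!g. g : carrier G ==> h (nu_right G g) = ?b g"
 proof (rule nu_hom[OF assms(1) Q.is_group a_hom b_hom])
  fix g1 g2 g3 assume g: "g1 : carrier G" "g2 : carrier G" "g3 : carrier G"
  then show "conj_elt (?E3 Mod K) (comm_elt (?E3 Mod K) (?a g1) (?b g2)) (?a g3)
   = conj_elt (?E3 Mod K) (comm_elt (?E3 Mod K) (?a g1) (?b g2)) (?b g3)"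
  by (simp only: cm cj E.comm_closed s)
  obtain z1 where z1: "z1 : ?Z" "s (conj_elt G g1 g3) = z1 \<otimes>{:E:} conj_elt E (s g1) (s g3)"
  using central_lift_conj[OF assms g(1,3)] by blast
  obtain z2 where z2: "z2 : ?Z" "s (conj_elt G g2 g3) = z2 \<otimes>{:E:} conj_elt E (s g2) (s g3)"
  using central_lift_conj[OF assms g(2,3)] by blast
  have "conj_elt E (comm_elt E (s g1) (s g2)) (s g3)
   = comm_elt E (conj_elt E (s g1) (s g3)) (conj_elt E (s g2) (s g3))"
  using g by (simp add: conj_elt_def comm_elt_def E.group_word_simps)
  also have "\<dots> = comm_elt E (s (conj_elt G g1 g3)) (s (conj_elt G g2 g3))"
  using z1 z2 g by (simp add: E.comm_central_left)
  finally show "conj_elt (?E3 Mod K) (comm_elt (?E3 Mod K) (?a g1) (?b g2)) (?b g3)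
   = comm_elt (?E3 Mod K) (?a (conj_elt G g1 g3)) (?b (conj_elt G g2 g3))"
  using g by (simp only: cm cj E.comm_closed s G.conj_closed)
 qed blast
 interpret h: group_hom "nu G" "?E3 Mod K" h using h(1) by unfold_locales
 have hw: "h (N.w g g') = ?k (comm_elt E (s g) (s g'))" if "g : carrier G" "g' : carrier G" for g g'
  using that hom_comm[OF h(1) N.V.is_group Q.is_group] h(2,3) cm by (simp add: N.w_def)
 have "subgroup (kernel (nu G) (?E3 Mod K) h) (nu G)" by (rule h.subgroup_kernel)
 moreover have "N.w g g : kernel (nu G) (?E3 Mod K) h" if "g : carrier G" for g
 proof -
  have "comm_elt E (s g) (s g) = \<one>{:E:}"
  using that by (simp add: comm_elt_def E.group_word_simps)
  moreover have "?k \<one>{:E:} = \<one>{:?E3 Mod K:}"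
  using c.hom_one by simp
  ultimately show ?thesis
  using that hw[OF that that] by (simp add: kernel_def)
 qed
 ultimately have "N.D \<subseteq> kernel (nu G) (?E3 Mod K) h"
  unfolding N.D_def by (intro N.V.generate_subgroup_incl) auto
 then have hD: "h d = \<one>{:?E3 Mod K:}" if "d : N.D" for d
  using that unfolding kernel_def by blast
 have De: "carrier (Delta G) = N.D"
  by (simp add: tensor_square_eq(2)[OF assms(1)])
 obtain h' where h': "h' : hom (ext_nu G) (?E3 Mod K)"
  "!!x. x : carrier (nu G) ==> h' (N.D #>{:nu G:} x) = h x"
  using FactGroup_hom_universal[OF h(1) N.D_normal Q.is_group hD] by (auto simp: ext_nu_def De)
 have h'w: "h' (wedge G g g') = ?k (comm_elt E (s g) (s g'))" if "g : carrier G" "g' : carrier G" for g g'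
 proof -
  have "h' (ext_left G g) = ?a g" "h' (ext_right G g') = ?b g'"
  using that h' h by (auto simp: ext_left_def ext_right_def De)
  then show ?thesis
  using that hom_comm[OF h'(1) X.V.is_group Q.is_group] cm by (simp add: wedge_def)
 qed
 interpret h': group_hom "ext_nu G" "?E3 Mod K" h' using h'(1) by unfold_locales
 interpret k: group_hom E "?E3 Mod K" ?k using k_hom by unfold_locales
 have wX: "X.w = wedge G" by (intro ext) (simp add: X.w_def wedge_def)
 \<comment> \<open>Wedges go to elements of the embedded first factor, hence so does everything they
   generate, and the map can be pulled back to E.\<close>
 have hT: "h' t : ?k ` carrier E" if "t : X.T" for t
  using that
 proof (induction rule: X.T_induct)
  case (w g h) then show ?case by (simp add: wX h'w)
 next
  case one show ?case using k.img_is_subgroup subgroup.one_closed h'.hom_one by metis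
 next
  case (mult s t) then show ?case
  using k.img_is_subgroup subgroup.m_closed h'.hom_mult X.T_closed by metis
 next
  case (inv t) then show ?case
  using k.img_is_subgroup subgroup.m_inv_closed h'.hom_inv X.T_closed by metis
 qed
 have "h' : hom (exterior_square G) (?E3 Mod K)"
  using h'(1) by (auto simp: exterior_square_eq[OF assms(1)] hom_def)
 moreover have "h' ` carrier (exterior_square G) \<subseteq> ?k ` carrier E"
  by (simp only: exterior_square_eq[OF assms(1)]) (simp, use hT in blast)
 ultimately obtain f where f: "f : hom (exterior_square G) E" "!!t. t : carrier (exterior_square G) ==> ?k (f t) = h' t"
  using hom_through_mono[OF k_hom k_inj _ _ assms(2)] by metis
 show thesis
 proof (rule that[OF f(1)])
  fix g g' assume g: "g : carrier G" "g' : carrier G"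
  then have t: "wedge G g g' : carrier (exterior_square G)"
  using X.w_T by (simp add: exterior_square_eq[OF assms(1)] wX)
  then have "?k (f (wedge G g g')) = ?k (comm_elt E (s g) (s g'))"
  using f(2)[OF t] h'w[OF g] by simp
  then show "f (wedge G g g') = comm_elt E (s g) (s g')"
  using inj_onD[OF k_inj] hom_in_carrier[OF f(1) t] g by simp
 qed
qed

section \<open>A central extension containing the exterior square\<close>

context exterior_context
begin

text \<open>Expand w (st) (st) = 1 in both arguments; up to conjugation only the two mixed terms
  remain.\<close>

lemma w_skew:
 assumes "s : carrier G" "t : carrier G"
 shows "w t s = inv{:V:} w s t"
proof -
 have "conj_elt V (w s t \<otimes>{:V:} w t s) (l t) = w (s \<otimes>{:G:} t) (s \<otimes>{:G:} t)"
  using assms by (simp add: w_mult_left w_mult_right V.conj_mult del: w_diag) (simp add: V.m_assoc)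
 then have "conj_elt V (w s t \<otimes>{:V:} w t s) (l t) = \<one>{:V:}"
  using assms by simp
 then have "conj_elt V (conj_elt V (w s t \<otimes>{:V:} w t s) (l t)) (inv{:V:} l t) = \<one>{:V:}"
  using assms by simp
 then have "w s t \<otimes>{:V:} w t s = \<one>{:V:}"
  using assms by simp
 then show ?thesis
  using assms by (metis V.inv_equality V.inv_inv V.inv_closed w_closed)
qed

text \<open>The identity behind the exchange of two letters: it compares the corrections from
  multiplying a monomial by s and then t with those from t and then s.\<close>

lemma w_exchange:
 assumes "x : carrier G" "y : carrier G" "s : carrier G" "t : carrier G"
 shows "w (x \<otimes>{:G:} conj_elt G t y) s \<otimes>{:V:} conj_elt V (w y t) (l s) \<otimes>{:V:} w s t
   = w y t \<otimes>{:V:} conj_elt V (w x s) (l t)"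
proof -
 let ?A = "w y t" and ?c = "comm_elt G t y" and ?z = "x \<otimes>{:G:} t"
 have "x \<otimes>{:G:} conj_elt G t y = ?z \<otimes>{:G:} ?c"
  using assms by (simp add: conj_elt_def comm_elt_def G.group_word_simps)
 then have "w (x \<otimes>{:G:} conj_elt G t y) s = conj_elt V (w ?z s) (l ?c) \<otimes>{:V:} w ?c s"
  using assms by (simp add: w_mult_left)
 also have "conj_elt V (w ?z s) (l ?c) = conj_elt V (w ?z s) (inv{:V:} ?A)"
  using assms by (intro conj_T_e) (auto simp flip: w_skew[of y t])
 also have "w ?c s = ?A \<otimes>{:V:} inv{:V:} conj_elt V ?A (l s)"
 proof -
  have "w ?c s = inv{:V:} w t y \<otimes>{:V:} conj_elt V (w t y) (l s)"
  using w_e_left[of "w t y" s] assms by simp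
  then show ?thesis using assms by (simp add: w_skew[of y t] V.conj_inv)
 qed
 finally have 1: "w (x \<otimes>{:G:} conj_elt G t y) s
  = ?A \<otimes>{:V:} w ?z s \<otimes>{:V:} inv{:V:} conj_elt V ?A (l s)"
  using assms by (simp add: conj_elt_def[of V "w ?z s"] V.m_assoc)
 have 2: "w ?z s \<otimes>{:V:} w s t = conj_elt V (w x s) (l t)"
  using assms by (simp add: w_mult_left w_skew[of s t] V.m_assoc)
 have "w (x \<otimes>{:G:} conj_elt G t y) s \<otimes>{:V:} conj_elt V ?A (l s) \<otimes>{:V:} w s t
  = ?A \<otimes>{:V:} (w ?z s \<otimes>{:V:} w s t)"
  using assms by (simp add: 1 V.m_assoc)
 then show ?thesis by (simp add: 2)
qed

end

text \<open>The product applies its left factor first, so that multiplying monomials on the right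
  becomes a homomorphism.\<close>

definition opp_perm_group :: "'c set => ('c => 'c) monoid" where
 "opp_perm_group S = \<lparr>carrier = Bij S, monoid.mult = (%f g. compose S g f), one = (\<lambda>x \<in> S. x)\<rparr>"

lemma group_opp_perm_group: "group (opp_perm_group S)"
proof (rule groupI)
 fix x assume x: "x : carrier (opp_perm_group S)"
 let ?y = "\<lambda>a \<in> S. inv_into S x a"
 have "?y : Bij S" using x by (simp add: opp_perm_group_def restrict_inv_into_Bij)
 moreover have "compose S x ?y = (\<lambda>a \<in> S. a)"
  using x by (auto simp: opp_perm_group_def Bij_def compose_def bij_betw_def f_inv_into_f inv_into_into intro!: restrict_ext)
 ultimately show "EX y:carrier (opp_perm_group S). y \<otimes>{:opp_perm_group S:} x = \<one>{:opp_perm_group S:}"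
  by (auto simp: opp_perm_group_def)
qed (auto simp: opp_perm_group_def compose_Id[OF Bij_imp_funcset Bij_imp_extensional] compose_Bij id_Bij Bij_imp_funcset Bij_imp_extensional compose_assoc [symmetric])

section \<open>Letters acting on sorted monomials\<close>

context exterior_context
begin

text \<open>Despite its name this is a relation: a well-order of the carrier, chosen to fix the
  order in which the letters of a monomial are sorted.\<close>

definition letter_set :: "('a \<times> 'a) set" where
 "letter_set = (SOME R. well_order_on (carrier G) R)"

definition before :: "'a => 'a => bool" where
 "before s t \<longleftrightarrow> (s, t) : letter_set & s ~= t"

lemma before_order:
 assumes "s : carrier G" "t : carrier G"
 shows "s = t | before s t | before t s" "before s t ==> ~ before t s"
  "before s t ==> before t u ==> before s u" "~ before s s"
proof -
 have "EX R. well_order_on (carrier G) R" by (rule well_order_on)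
 then have R: "well_order_on (carrier G) letter_set"
  unfolding letter_set_def by (rule someI_ex)
 then have tot: "total_on (carrier G) letter_set" and anti: "antisym letter_set" and tr: "trans letter_set"
  by (auto simp: order_on_defs)
 show "s = t | before s t | before t s"
  using tot assms by (auto simp: total_on_def before_def)
 show "before s t ==> ~ before t s"
  using anti by (auto simp: before_def antisym_def)
 show "before s t ==> before t u ==> before s u"
  using tr anti unfolding before_def antisym_def trans_def by blast
 show "~ before s s" by (simp add: before_def)
qed

text \<open>Think of \<open>y s\<close> as the value in \<open>G\<close> of the part beyond \<open>s\<close> of an ordered monomial
 in the letters \<open>s \<in> G\<close>. Multiplying the monomial by \<open>t\<close> on the right and sorting changes \<open>y\<close>
 by \<open>shift t\<close> and produces the correction \<open>w (y t) t\<close>.\<close>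

definition shift :: "'a => ('a => 'a) => 'a => 'a" where
 "shift t y = (\<lambda>s \<in> carrier G. if before s t then y s \<otimes>{:G:} conj_elt G t (y t) else y s)"

definition points :: "(('a => 'a) \<times> 'v) set" where
 "points = (carrier G \<rightarrow>\<^sub>E carrier G) \<times> T"

text \<open>The component \<open>ta\<close> in \<open>T\<close> stands to the right of the monomial
  and is conjugated when t passes it on its way to the left.\<close>

definition letter_act :: "'a => ('a => 'a) \<times> 'v => ('a => 'a) \<times> 'v" where
 "letter_act t = (\<lambda>(y, ta) \<in> points. (shift t y, w (y t) t \<otimes>{:V:} conj_elt V ta (l t)))"

definition right_act :: "'v => ('a => 'a) \<times> 'v => ('a => 'a) \<times> 'v" where
 "right_act u = (\<lambda>(y, ta) \<in> points. (y, ta \<otimes>{:V:} u))"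

lemma shift_closed: "y : carrier G \<rightarrow>\<^sub>E carrier G ==> t : carrier G ==> shift t y : carrier G \<rightarrow>\<^sub>E carrier G"
 by (auto simp: shift_def PiE_iff)

lemma letter_act_Bij:
 assumes t: "t : carrier G"
 shows "letter_act t : Bij points"
proof -
 \<comment> \<open>Since t is not before itself, \<open>shift t\<close> leaves the value at t
   unchanged, so the inverse can use y t as well.\<close>
 let ?f = "%(y, ta). (\<lambda>s \<in> carrier G. if before s t then y s \<otimes>{:G:} inv{:G:} conj_elt G t (y t) else y s,
  conj_elt V (inv{:V:} w (y t) t \<otimes>{:V:} ta) (inv{:V:} l t))"
 have "bij_betw (letter_act t) points points"
 proof (rule bij_betw_byWitness[where f' = ?f])
  show "ALL a:points. ?f (letter_act t a) = a"
  proof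
  fix a assume "a : points"
  then obtain y ta where a: "a = (y, ta)" "y : carrier G \<rightarrow>\<^sub>E carrier G" "ta : T"
   by (auto simp: points_def)
  have yt: "shift t y t = y t" "y t : carrier G" using a t before_order(4)[OF t t] by (auto simp: shift_def)
  have "(\<lambda>s \<in> carrier G. if before s t then shift t y s \<otimes>{:G:} inv{:G:} conj_elt G t (shift t y t) else shift t y s) = y"
  proof (rule extensionalityI[where A = "carrier G"])
   have "(if before s t then shift t y s \<otimes>{:G:} inv{:G:} conj_elt G t (shift t y t) else shift t y s) = y s"
    if "s : carrier G" for s
    using that a t yt by (auto simp: shift_def PiE_iff G.m_assoc)
   then show "(\<lambda>s \<in> carrier G. if before s t then shift t y s \<otimes>{:G:} inv{:G:} conj_elt G t (shift t y t) else shift t y s) s = y s"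
    if "s : carrier G" for s using that by simp
  qed (use a in \<open>auto simp: PiE_iff\<close>)
  then show "?f (letter_act t a) = a"
   using a t by (simp add: letter_act_def points_def yt(2)) (simp add: yt)
  qed
  show "ALL a:points. letter_act t (?f a) = a"
  proof
  fix a assume "a : points"
  then obtain y ta where a: "a = (y, ta)" "y : carrier G \<rightarrow>\<^sub>E carrier G" "ta : T"
   by (auto simp: points_def)
  have yt: "y t : carrier G" using a t by (auto simp: PiE_iff)
  let ?y = "\<lambda>s \<in> carrier G. if before s t then y s \<otimes>{:G:} inv{:G:} conj_elt G t (y t) else y s"
  have y't: "?y t = y t" using t before_order(4)[OF t t] by simp
  have yc: "?y : carrier G \<rightarrow>\<^sub>E carrier G" using a t yt by (auto simp: PiE_iff)
  have "shift t ?y = y"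
  proof (rule extensionalityI[where A = "carrier G"])
   show "shift t ?y s = y s" if "s : carrier G" for s
    using that a t yt y't by (auto simp: shift_def PiE_iff G.m_assoc)
  qed (use a in \<open>auto simp: PiE_iff shift_def\<close>)
  moreover have "conj_elt V (inv{:V:} w (y t) t \<otimes>{:V:} ta) (inv{:V:} l t) : T"
   using a t yt by (intro conj_T_closed) auto
  ultimately show "letter_act t (?f a) = a"
   using a t yt y't yc by (simp add: letter_act_def points_def)
  qed
  show "letter_act t ` points \<subseteq> points"
  using t by (auto simp: letter_act_def points_def shift_closed conj_T_l PiE_iff)
   (auto simp: shift_def PiE_iff)
  show "?f ` points \<subseteq> points"
  using t by (auto simp: points_def PiE_iff intro!: conj_T_closed)
 qed
 then show ?thesis by (auto simp: Bij_def letter_act_def)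
qed

lemma right_act_Bij:
 assumes u: "u : T"
 shows "right_act u : Bij points"
proof -
 have "bij_betw (right_act u) points points"
  by (rule bij_betw_byWitness[where f' = "right_act (inv{:V:} u)"])
   (use u in \<open>auto simp: right_act_def points_def V.m_assoc\<close>)
 then show ?thesis by (auto simp: Bij_def right_act_def)
qed

lemma letter_act_apply:
 "y : carrier G \<rightarrow>\<^sub>E carrier G ==> ta : T ==>
  letter_act t (y, ta) = (shift t y, w (y t) t \<otimes>{:V:} conj_elt V ta (l t))"
 "y : carrier G \<rightarrow>\<^sub>E carrier G ==> ta : T ==> right_act u (y, ta) = (y, ta \<otimes>{:V:} u)"
 by (simp_all add: letter_act_def right_act_def points_def)

lemma act_extensional [simp]: "letter_act t : extensional points" "right_act u : extensional points"
 by (simp_all add: letter_act_def right_act_def)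

lemma y_closed: "y : carrier G \<rightarrow>\<^sub>E carrier G ==> t : carrier G ==> y t : carrier G"
 by (auto simp: PiE_iff)

text \<open>The second factor records the value in G. It makes the projection to G a homomorphism
  and allows elements over the identity of G to be recognised.\<close>

definition ambient :: "((('a => 'a) \<times> 'v => ('a => 'a) \<times> 'v) \<times> 'a) monoid" where
 "ambient = opp_perm_group points \<times>\<times> G"

definition letter :: "'a => (('a => 'a) \<times> 'v => ('a => 'a) \<times> 'v) \<times> 'a" where
 "letter t = (letter_act t, t)"

definition embed :: "'v => (('a => 'a) \<times> 'v => ('a => 'a) \<times> 'v) \<times> 'a" where
 "embed u = (right_act u, e u)"

lemma group_ambient: "group ambient"
 unfolding ambient_def by (rule DirProd_group[OF group_opp_perm_group G.is_group])

sublocale A: group ambient by (rule group_ambient)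

lemma letter_closed [simp]: "t : carrier G ==> letter t : carrier ambient"
 by (simp add: letter_def ambient_def opp_perm_group_def letter_act_Bij)

lemma embed_closed [simp]: "u : T ==> embed u : carrier ambient"
 by (simp add: embed_def ambient_def opp_perm_group_def right_act_Bij)

lemma snd_ambient [simp]:
 "p : carrier ambient ==> snd p : carrier G"
 "snd (p \<otimes>{:ambient:} q) = snd p \<otimes>{:G:} snd q"
 "snd (letter t) = t" "snd (embed u) = e u"
 by (auto simp: ambient_def DirProd_def letter_def embed_def split: prod.splits)

lemma snd_hom: "snd : hom ambient G"
 by (rule homI) simp_all

lemma snd_inv [simp]: "p : carrier ambient ==> snd (inv{:ambient:} p) = inv{:G:} snd p"
 using group_hom.hom_inv[of ambient G snd p] snd_hom by (simp add: group_hom_defs)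

lemma ambient_mult: "(f, g) \<otimes>{:ambient:} (f', g') = (compose points f' f, g \<otimes>{:G:} g')"
 by (simp add: ambient_def opp_perm_group_def)

lemma compose_eqI:
 assumes "!!y ta. y : carrier G \<rightarrow>\<^sub>E carrier G ==> ta : T ==> f (f' (y, ta)) = g (y, ta)" "g : extensional points"
 shows "compose points f f' = g"
 by (rule extensionalityI[OF compose_extensional assms(2)]) (use assms(1) in \<open>auto simp: compose_def points_def\<close>)

lemma embed_mult:
 assumes "u : T" "v : T"
 shows "embed (u \<otimes>{:V:} v) = embed u \<otimes>{:ambient:} embed v"
proof -
 have "compose points (right_act v) (right_act u) = right_act (u \<otimes>{:V:} v)"
  by (rule compose_eqI) (use assms in \<open>auto simp: letter_act_apply V.m_assoc\<close>)
 then show ?thesis using assms by (simp add: embed_def ambient_mult)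
qed

lemma embed_one: "embed \<one>{:V:} = \<one>{:ambient:}"
 using embed_mult[of "\<one>{:V:}" "\<one>{:V:}"] by simp

lemma embed_inv: "u : T ==> embed (inv{:V:} u) = inv{:ambient:} embed u"
 using embed_mult[of "inv{:V:} u" u] by (intro A.inv_equality[symmetric]) (auto simp: embed_one)

text \<open>One base point is enough: right multiplication moves the trivial element of
  \<open>T\<close> to the multiplier.\<close>

lemma embed_inj: "inj_on embed T"
proof (rule inj_onI)
 fix u v assume uv: "u : T" "v : T" "embed u = embed v"
 let ?y = "\<lambda>s \<in> carrier G. \<one>{:G:}"
 have "right_act u (?y, \<one>{:V:}) = right_act v (?y, \<one>{:V:})"
  using uv by (simp add: embed_def)
 moreover have "?y : carrier G \<rightarrow>\<^sub>E carrier G" by auto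
 ultimately show "u = v" using uv by (simp add: letter_act_apply)
qed

lemma conj_embed_letter:
 assumes "u : T" "t : carrier G"
 shows "conj_elt ambient (embed u) (letter t) = embed (conj_elt V u (l t))"
proof -
 have eq: "compose points (letter_act t) (right_act u) = compose points (right_act (conj_elt V u (l t))) (letter_act t)"
  by (rule compose_eqI) (use assms in \<open>auto simp: letter_act_apply shift_closed y_closed conj_T_l
   V.conj_mult V.m_assoc compose_def points_def\<close>)
 have "e u \<otimes>{:G:} t = t \<otimes>{:G:} e (conj_elt V u (l t))"
  using assms hom_conj[OF e_hom V.is_group G.is_group, of u "l t"] by (simp add: conj_elt_def G.m_assoc)
 with eq have "embed u \<otimes>{:ambient:} letter t = letter t \<otimes>{:ambient:} embed (conj_elt V u (l t))"
  by (simp add: embed_def letter_def ambient_mult)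
 then show ?thesis
  using assms by (simp add: conj_elt_def[of ambient] A.m_assoc conj_T_l)
qed

lemma shift_commute:
 assumes st: "s : carrier G" "t : carrier G" "before s t" and y: "y : carrier G \<rightarrow>\<^sub>E carrier G"
 shows "shift t (shift s y) = shift s (shift t y)"
proof (rule extensionalityI[where A = "carrier G"])
 fix r assume r: "r : carrier G"
 have n: "~ before t s" "~ before s s" "~ before t t"
  using before_order st by blast+
 have c: "y r : carrier G" "y s : carrier G" "y t : carrier G"
  using y r st by (auto simp: PiE_iff)
 show "shift t (shift s y) r = shift s (shift t y) r"
 proof (cases "before r s")
  case True
  then have "before r t" using before_order(3)[OF r st(1)] st by blast
  then show ?thesis
  using True n r st c by (simp add: shift_def conj_elt_def G.group_word_simps)
 next
  case False
  then show ?thesis using n r st c by (simp add: shift_def)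
 qed
qed (auto simp: shift_def)

text \<open>Both orders of multiplication give the same monomial by \<open>shift_commute\<close>,
  and \<open>w_exchange\<close> accounts for the difference of the corrections.\<close>

lemma letters_commute_before:
 assumes st: "s : carrier G" "t : carrier G" "before s t"
 shows "letter s \<otimes>{:ambient:} letter t = letter t \<otimes>{:ambient:} letter s \<otimes>{:ambient:} embed (w s t)"
proof -
 have "compose points (letter_act t) (letter_act s)
  = compose points (right_act (w s t)) (compose points (letter_act s) (letter_act t))"
 proof (rule compose_eqI)
  fix y ta assume y: "y : carrier G \<rightarrow>\<^sub>E carrier G" and ta: "ta : T"
  have n: "~ before t s" using before_order st by blast
  note c = y_closed[OF y st(1)] y_closed[OF y st(2)]
  have sh: "shift s y t = y t" "shift t y s = y s \<otimes>{:G:} conj_elt G t (y t)"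
  using n st by (auto simp: shift_def)
  let ?x = "conj_elt V ta (l t \<otimes>{:V:} l s)"
  have x: "?x : T" using ta st by (intro conj_T_closed) auto
  have "conj_elt V ?x (w s t) = conj_elt V ta (l t \<otimes>{:V:} l s \<otimes>{:V:} w s t)"
  using ta st by (simp add: V.conj_conj)
  \<comment> \<open>Both conjugating elements lie over the same element of G, since t s [s, t] = s
    t.\<close>
  also have "\<dots> = conj_elt V ta (l s \<otimes>{:V:} l t)"
  using ta st by (intro conj_T_e) (auto simp: comm_elt_def G.m_assoc)
  finally have "conj_elt V ?x (w s t) = conj_elt V ta (l s \<otimes>{:V:} l t)" .
  moreover have "w s t \<otimes>{:V:} conj_elt V ?x (w s t) = ?x \<otimes>{:V:} w s t"
  by (rule V.mult_conj) (use x st in auto)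
  ultimately have xw: "?x \<otimes>{:V:} w s t = w s t \<otimes>{:V:} conj_elt V ta (l s \<otimes>{:V:} l t)"
  by simp
  have "letter_act t (letter_act s (y, ta)) = (shift t (shift s y),
   w (y t) t \<otimes>{:V:} conj_elt V (w (y s) s) (l t) \<otimes>{:V:} conj_elt V ta (l s \<otimes>{:V:} l t))"
  using y ta st c by (simp add: letter_act_apply shift_closed conj_T_l sh V.conj_mult V.conj_conj V.m_assoc)
  also have "\<dots> = (shift s (shift t y), w (y s \<otimes>{:G:} conj_elt G t (y t)) s \<otimes>{:V:}
   conj_elt V (w (y t) t) (l s) \<otimes>{:V:} ?x \<otimes>{:V:} w s t)"
  using w_exchange[of "y s" "y t" s t, symmetric] shift_commute[OF st y] st c ta x
  by (simp add: V.m_assoc xw)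
  also have "\<dots> = right_act (w s t) (letter_act s (letter_act t (y, ta)))"
  using y ta st c conj_T_closed[of "l t \<otimes>{:V:} l s" ta] by (simp add: letter_act_apply shift_closed conj_T_l sh V.conj_mult V.conj_conj V.m_assoc)
  finally show "letter_act t (letter_act s (y, ta)) =
   compose points (right_act (w s t)) (compose points (letter_act s) (letter_act t)) (y, ta)"
  using y ta by (simp add: compose_def points_def)
 qed auto
 moreover have "s \<otimes>{:G:} t = t \<otimes>{:G:} s \<otimes>{:G:} e (w s t)"
  using st by (simp add: comm_elt_def G.m_assoc)
 ultimately show ?thesis
  by (simp add: letter_def embed_def ambient_mult)
qed

lemma comm_letters:
 assumes "s : carrier G" "t : carrier G"
 shows "comm_elt ambient (letter s) (letter t) = embed (w s t)"
proof -
 have *: "comm_elt ambient (letter s) (letter t) = embed (w s t)"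
  if "s : carrier G" "t : carrier G" "before s t" for s t
  using letters_commute_before[OF that] that
  by (simp add: comm_elt_def A.m_assoc)
 consider "s = t" | "before s t" | "before t s" using before_order(1)[OF assms] by blast
 then show ?thesis
 proof cases
  case 1
  then show ?thesis using assms by (simp add: comm_elt_def embed_one A.m_assoc)
 next
  case 2
  then show ?thesis using * assms by simp
 next
  case 3
  have "comm_elt ambient (letter s) (letter t) = inv{:ambient:} comm_elt ambient (letter t) (letter s)"
  using assms by (simp add: comm_elt_def A.group_word_simps)
  then show ?thesis
  using 3 * assms by (simp add: w_skew[of t s] embed_inv)
 qed
qed

text \<open>It plays the part of F/[F, R], where F is the free group on the letters and R the kernel
  of the map from F to G.\<close>

definition cover :: "((('a => 'a) \<times> 'v => ('a => 'a) \<times> 'v) \<times> 'a) monoid" where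
 "cover = ambient\<lparr>carrier := generate ambient (letter ` carrier G \<union> embed ` T)\<rparr>"

lemma cover_gens: "letter ` carrier G \<union> embed ` T \<subseteq> carrier ambient"
 by auto

lemma cover_subgroup: "subgroup (carrier cover) ambient"
 unfolding cover_def using A.generate_is_subgroup[OF cover_gens] by simp

lemma group_cover: "group cover"
 using A.subgroup_imp_group[OF cover_subgroup] by (simp add: cover_def)

lemma cover_ambient: "p : carrier cover ==> p : carrier ambient"
 using cover_subgroup subgroup.mem_carrier by metis

lemma cover_minimal: "subgroup H ambient ==> letter ` carrier G \<subseteq> H ==> embed ` T \<subseteq> H ==> carrier cover \<subseteq> H"
 unfolding cover_def using A.generate_subgroup_incl[of "letter ` carrier G \<union> embed ` T" H] by simp

lemma cover_closed [simp]: "t : carrier G ==> letter t : carrier cover" "u : T ==> embed u : carrier cover"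
 unfolding cover_def by (auto intro: generate.incl)

lemma conj_embed:
 assumes "p : carrier cover" "u : T"
 shows "conj_elt ambient (embed u) p = embed (conj_elt V u (l (snd p)))"
proof -
 let ?H = "{p : carrier ambient. ALL u : T. conj_elt ambient (embed u) p = embed (conj_elt V u (l (snd p)))}"
 have "subgroup ?H ambient"
 proof (rule subgroup.intro)
  show "\<one>{:ambient:} : ?H"
  using group_hom.hom_one[of ambient G snd] snd_hom by (simp add: group_hom_defs)
  show "p \<otimes>{:ambient:} q : ?H" if "p : ?H" "q : ?H" for p q
  using that by (auto simp: V.conj_conj conj_T_l simp flip: A.conj_conj)
  show "inv{:ambient:} p : ?H" if p: "p : ?H" for p
  proof -
  have "conj_elt ambient (embed u) (inv{:ambient:} p) = embed (conj_elt V u (l (snd (inv{:ambient:} p))))"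
   if u: "u : T" for u
  proof -
   let ?u = "conj_elt V u (l (snd (inv{:ambient:} p)))"
   have "?u : T" using p u by (intro conj_T_l) auto
   then have "conj_elt ambient (embed ?u) p = embed (conj_elt V ?u (l (snd p)))"
    using p by blast
   also have "conj_elt V ?u (l (snd p)) = u"
    using p u by simp
   finally have "conj_elt ambient (embed ?u) p = embed u" .
   moreover have "p : carrier ambient" using p by blast
   ultimately show ?thesis
    using A.conj_cancel(1)[OF embed_closed[OF \<open>?u : T\<close>], of p] by simp
  qed
  then show ?thesis using p by auto
  qed
 qed auto
 moreover have "conj_elt ambient (embed u) (embed v) = embed (conj_elt V u (l (e v)))" if "u : T" "v : T" for u v
 proof -
  have "conj_elt ambient (embed u) (embed v) = embed (conj_elt V u v)"
  using that by (simp add: conj_elt_def embed_mult embed_inv)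
  also have "conj_elt V u v = conj_elt V u (l (e v))"
  using that by (intro conj_T) auto
  finally show ?thesis .
 qed
 ultimately have "carrier cover \<subseteq> ?H"
  by (intro cover_minimal) (auto simp: conj_embed_letter)
 then show ?thesis using assms by blast
qed

lemma comm_flip:
 assumes "p : carrier cover" "q : carrier cover" "comm_elt ambient p q = embed (w (snd p) (snd q))"
 shows "comm_elt ambient q p = embed (w (snd q) (snd p))"
proof -
 have "comm_elt ambient q p = inv{:ambient:} comm_elt ambient p q"
  using cover_ambient[OF assms(1)] cover_ambient[OF assms(2)] by (simp add: comm_elt_def A.group_word_simps)
 then show ?thesis using assms cover_ambient by (simp add: w_skew[of "snd p" "snd q"] embed_inv)
qed

text \<open>As functions of p, both sides obey the same expansion rule for products, so agreement on
  generators suffices. Used twice, with \<open>comm_flip\<close> in between, this passes from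
  letters to arbitrary elements in both arguments.\<close>

lemma comm_cover_left:
 assumes q: "q : carrier cover"
  and gens: "!!t. t : carrier G ==> comm_elt ambient (letter t) q = embed (w t (snd q))"
  and p: "p : carrier cover"
 shows "comm_elt ambient p q = embed (w (snd p) (snd q))"
proof -
 let ?H = "{p : carrier cover. comm_elt ambient p q = embed (w (snd p) (snd q))}"
 note C = subgroup.m_closed[OF cover_subgroup] subgroup.m_inv_closed[OF cover_subgroup]
 have qa [simp]: "q : carrier ambient" using q by (rule cover_ambient)
 have "subgroup ?H ambient"
 proof (rule subgroup.intro)
  show "\<one>{:ambient:} : ?H"
  using group_hom.hom_one[of ambient G snd] snd_hom subgroup.one_closed[OF cover_subgroup]
  by (simp add: group_hom_defs embed_one)
  show "x \<otimes>{:ambient:} y : ?H" if xy: "x : ?H" "y : ?H" for x y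
  using xy cover_ambient C(1)
  by (auto simp: A.comm_mult_left conj_embed w_mult_left embed_mult conj_T_l)
  show "inv{:ambient:} x : ?H" if x: "x : ?H" for x
  proof -
  have xa [simp]: "x : carrier ambient" using x cover_ambient by auto
  have "comm_elt ambient (inv{:ambient:} x) q = conj_elt ambient (inv{:ambient:} comm_elt ambient x q) (inv{:ambient:} x)"
   by (simp add: comm_elt_def conj_elt_def A.group_word_simps)
  also have "inv{:ambient:} comm_elt ambient x q = embed (inv{:V:} w (snd x) (snd q))"
   using x by (simp add: embed_inv)
  also have "conj_elt ambient (embed (inv{:V:} w (snd x) (snd q))) (inv{:ambient:} x)
    = embed (conj_elt V (inv{:V:} w (snd x) (snd q)) (l (inv{:G:} snd x)))"
   using x C(2) by (subst conj_embed) auto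
  also have "\<dots> = embed (w (inv{:G:} snd x) (snd q))"
   by (subst w_inv_left) auto
  finally show ?thesis using x C(2) by simp
  qed
 qed (auto simp: cover_ambient)
 moreover have "comm_elt ambient (embed u) q = embed (w (e u) (snd q))" if "u : T" for u
 proof -
  have "comm_elt ambient (embed u) q = inv{:ambient:} embed u \<otimes>{:ambient:} conj_elt ambient (embed u) q"
  using that by (simp add: comm_elt_def conj_elt_def A.m_assoc)
  then show ?thesis
  using that q by (simp add: conj_embed w_e_left embed_mult embed_inv conj_T_l)
 qed
 ultimately have "carrier cover \<subseteq> ?H"
  by (intro cover_minimal) (auto simp: gens)
 then show ?thesis using p by blast
qed

lemma comm_cover:
 assumes "p : carrier cover" "q : carrier cover"
 shows "comm_elt ambient p q = embed (w (snd p) (snd q))"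
proof (rule comm_cover_left[OF assms(2) _ assms(1)])
 fix t assume t: "t : carrier G"
 have "comm_elt ambient q (letter t) = embed (w (snd q) (snd (letter t)))"
  by (rule comm_cover_left) (use assms t comm_letters in auto)
 then show "comm_elt ambient (letter t) q = embed (w t (snd q))"
  using comm_flip[of q "letter t"] assms t by simp
qed

lemma cover_inv: "p : carrier cover ==> inv{:cover:} p = inv{:ambient:} p"
 using A.m_inv_consistent[OF cover_subgroup] by (simp add: cover_def)

lemma cover_mult: "p \<otimes>{:cover:} q = p \<otimes>{:ambient:} q"
 by (simp add: cover_def)

lemma comm_cover_eq: "p : carrier cover ==> q : carrier cover ==> comm_elt cover p q = comm_elt ambient p q"
 by (simp add: comm_elt_def cover_inv cover_mult)

text \<open>All commutators with p are of the form \<open>embed (w g h)\<close> with g = 1, hence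
  trivial.\<close>

lemma cover_central:
 assumes "p : carrier cover" "snd p = \<one>{:G:}"
 shows "p : group_center cover"
proof -
 interpret C: group cover by (rule group_cover)
 have "p \<otimes>{:cover:} q = q \<otimes>{:cover:} p" if q: "q : carrier cover" for q
 proof -
  have "comm_elt cover p q = \<one>{:cover:}"
  using assms q cover_ambient[OF q] by (simp add: comm_cover_eq comm_cover embed_one) (simp add: cover_def)
  then have "inv{:cover:} (q \<otimes>{:cover:} p) \<otimes>{:cover:} (p \<otimes>{:cover:} q) = \<one>{:cover:}"
  using assms q by (simp add: comm_elt_def C.group_word_simps)
  then show ?thesis using assms q by (simp add: C.inv_mult_eq_one_iff)
 qed
 then show ?thesis using assms by (simp add: group_center_def)
qed

lemma cover_lift: "central_lift G cover letter"
 unfolding central_lift_def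
proof (intro conjI ballI)
 interpret C: group cover by (rule group_cover)
 fix g h assume gh: "g : carrier G" "h : carrier G"
 let ?z = "letter g \<otimes>{:cover:} letter h \<otimes>{:cover:} inv{:cover:} letter (g \<otimes>{:G:} h)"
 have "?z : carrier cover" using gh by simp
 moreover have "snd ?z = \<one>{:G:}"
  using gh by (simp add: cover_inv cover_mult)
 ultimately have "?z : group_center cover" by (rule cover_central)
 moreover have "letter g \<otimes>{:cover:} letter h = ?z \<otimes>{:cover:} letter (g \<otimes>{:G:} h)"
  using gh by (simp add: C.m_assoc)
 ultimately show "EX z:group_center cover. letter g \<otimes>{:cover:} letter h = z \<otimes>{:cover:} letter (g \<otimes>{:G:} h)"
  by blast
qed auto

end

lemma wedge_eq: "group G ==> tensor_context.w (ext_nu G) (ext_left G) (ext_right G) = wedge G"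
 by (intro ext) (simp add: wedge_def tensor_context.w_def[OF exterior_context.axioms(1)[OF ext_context]])

lemma group_exterior_square: "group G ==> group (exterior_square G)"
proof -
 assume "group G"
 then interpret X: exterior_context G "ext_nu G" "ext_left G" "ext_right G" "ext_fold G"
  by (rule ext_context)
 show ?thesis
  using X.V.subgroup_imp_group[OF X.T_subgroup] exterior_square_eq[OF \<open>group G\<close>] by simp
qed

lemma exterior_cover:
 fixes G :: "('a, 'b) monoid_scheme"
 assumes "group G"
 obtains P :: "((('a => 'a) \<times> ('a + 'a) gword set set => ('a => 'a) \<times> ('a + 'a) gword set set) \<times> 'a) monoid"
  and s f
 where "group P" "central_lift G P s" "f : hom (exterior_square G) P"
  "inj_on f (carrier (exterior_square G))"
  "!!p q. p : carrier P ==> q : carrier P ==> comm_elt P p q = f (wedge G (snd p) (snd q))"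
  "snd : hom P G" "!!g. g : carrier G ==> snd (s g) = g"
  "!!p. p : carrier P ==> snd p = \<one>{:G:} ==> p : group_center P"
proof -
 interpret X: exterior_context G "ext_nu G" "ext_left G" "ext_right G" "ext_fold G"
  by (rule ext_context[OF assms])
 note eq = exterior_square_eq[OF assms]
 show thesis
 proof (rule that[of X.cover X.letter X.embed])
  show "X.embed : hom (exterior_square G) X.cover"
  unfolding eq by (rule homI) (auto simp: X.embed_mult X.cover_mult)
  show "snd : hom X.cover G"
  by (rule homI) (auto simp: X.cover_mult X.cover_ambient)
  show "comm_elt X.cover p q = X.embed (wedge G (snd p) (snd q))"
  if "p : carrier X.cover" "q : carrier X.cover" for p q
  using that by (simp add: X.comm_cover_eq X.comm_cover wedge_eq[OF assms])
 qed (simp_all add: X.group_cover X.cover_lift eq X.embed_inj X.cover_central)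
qed

section \<open>Finitely supported chains\<close>

definition single :: "'x set => ('c, 'm) monoid_scheme => 'x => 'c => 'x => 'c" where
 "single X B t b = (\<lambda>x\<in>X. if x = t then b else \<one>{:B:})"

text \<open>The homomorphism out of a direct sum that is given by one homomorphism on each summand;
  restricting the product to the support makes it finite.\<close>

definition linext ::
 "'x set => ('c, 'm) monoid_scheme => ('z, 'n) monoid_scheme => ('x => 'c => 'z) => ('x => 'c) => 'z" where
 "linext X B Z phf c = finprod Z (%t. phf t (c t)) {t : X. c t ~= \<one>{:B:}}"

abbreviation FS :: "'x set => ('c, 'm) monoid_scheme => ('x => 'c) monoid" where
 "FS X B \<equiv> sum_group X (%_. B)"

context
 fixes B :: "('c, 'm) monoid_scheme" (structure)
 assumes B: "comm_group B"
begin

interpretation B: comm_group B by (rule B)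

lemma FS_carrier: "carrier (FS X B) = {c : X \<rightarrow>\<^sub>E carrier B. finite {x : X. c x ~= \<one>}}"
 by (simp add: carrier_sum_group)

lemma FS_group: "group (FS X B)"
 by simp

lemma FS_comm_group: "comm_group (FS X B)"
 by (rule group.group_comm_groupI[OF FS_group])
  (auto simp: FS_carrier PiE_iff fun_eq_iff restrict_def B.m_comm)

lemma FS_apply: "c : carrier (FS X B) ==> x : X ==> c x : carrier B"
 by (auto simp: FS_carrier)

lemma FS_eqI: "c : carrier (FS X B) ==> d : carrier (FS X B) ==> (!!x. x : X ==> c x = d x) ==> c = d"
 by (auto simp: FS_carrier intro: PiE_ext)

lemma single_closed [simp]: "b : carrier B ==> single X B t b : carrier (FS X B)"
 by (auto simp: FS_carrier single_def intro: finite_subset[of _ "{t}"])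

lemma single_hom: "t : X ==> single X B t : hom B (FS X B)"
proof (rule homI)
 show "single X B t (x \<otimes> y) = single X B t x \<otimes>{:FS X B:} single X B t y"
  if "t : X" "x : carrier B" "y : carrier B" for x y
  using that by (auto simp: single_def fun_eq_iff restrict_def)
qed simp

lemma linext_support:
 assumes "comm_group Z" "!!t. t : X ==> phf t : hom B Z" "c : carrier (FS X B)"
  "finite F" "{t : X. c t ~= \<one>} \<subseteq> F" "F \<subseteq> X"
 shows "linext X B Z phf c = finprod Z (%t. phf t (c t)) F"
proof -
 interpret Z: comm_group Z by fact
 show ?thesis unfolding linext_def
 proof (rule Z.finprod_mono_neutral_cong_left[OF assms(4,5)])
  show "phf i (c i) = \<one>{:Z:}" if "i : F - {t : X. c t ~= \<one>}" for i
  using that assms(2,6) hom_one[OF _ B.is_group Z.is_group] by auto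
  show "(%t. phf t (c t)) : F \<rightarrow> carrier Z"
  using assms(6) by (auto intro!: hom_in_carrier[OF assms(2) FS_apply[OF assms(3)]])
 qed auto
qed

lemma linext_hom:
 assumes Z: "comm_group Z" and phf: "!!t. t : X ==> phf t : hom B Z"
 shows "linext X B Z phf : hom (FS X B) Z"
proof (rule homI)
 interpret Z: comm_group Z by fact
 have cl: "phf t (c t) : carrier Z" if "c : carrier (FS X B)" "t : X" for c t
  by (rule hom_in_carrier[OF phf[OF that(2)] FS_apply[OF that]])
 show "linext X B Z phf c : carrier Z" if "c : carrier (FS X B)" for c
  unfolding linext_def using cl[OF that] by (intro Z.finprod_closed) auto
 fix c d assume c: "c : carrier (FS X B)" and d: "d : carrier (FS X B)"
 let ?F = "{t : X. c t ~= \<one>} \<union> {t : X. d t ~= \<one>}"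
 have fin: "finite ?F" using c d by (simp add: FS_carrier)
 have cd: "c \<otimes>{:FS X B:} d : carrier (FS X B)"
  using c d FS_group by (simp add: group.is_monoid monoid.m_closed del: mult_sum_group)
 have cda: "(c \<otimes>{:FS X B:} d) t = c t \<otimes> d t" if "t : X" for t
  using that by simp
 have "linext X B Z phf (c \<otimes>{:FS X B:} d) = finprod Z (%t. phf t ((c \<otimes>{:FS X B:} d) t)) ?F"
  by (rule linext_support[OF Z phf cd fin]) (auto simp: cda)
 also have "\<dots> = finprod Z (%t. phf t (c t) \<otimes>{:Z:} phf t (d t)) ?F"
 proof (rule Z.finprod_cong')
  show "phf t ((c \<otimes>{:FS X B:} d) t) = phf t (c t) \<otimes>{:Z:} phf t (d t)" if "t : ?F" for t
  using that hom_mult[OF phf FS_apply[OF c] FS_apply[OF d]] by (auto simp: cda)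
 qed (use cl c d in auto)
 also have "\<dots> = finprod Z (%t. phf t (c t)) ?F \<otimes>{:Z:} finprod Z (%t. phf t (d t)) ?F"
  using cl c d by (intro Z.finprod_multf) auto
 also have "\<dots> = linext X B Z phf c \<otimes>{:Z:} linext X B Z phf d"
  using linext_support[OF Z phf c fin] linext_support[OF Z phf d fin] by auto
 finally show "linext X B Z phf (c \<otimes>{:FS X B:} d) = linext X B Z phf c \<otimes>{:Z:} linext X B Z phf d" .
qed

lemma linext_single:
 assumes Z: "comm_group Z" and phf: "!!t. t : X ==> phf t : hom B Z" and t: "t : X" "b : carrier B"
 shows "linext X B Z phf (single X B t b) = phf t b"
proof -
 interpret Z: comm_group Z by fact
 have "linext X B Z phf (single X B t b) = finprod Z (%x. phf x (single X B t b x)) {t}"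
  by (rule linext_support[OF Z phf single_closed]) (use t in \<open>auto simp: single_def\<close>)
 also have "\<dots> = phf t b"
  using hom_in_carrier[OF phf[OF t(1)] t(2)] t by (simp add: single_def)
 finally show ?thesis .
qed

text \<open>Induction on a finite set containing the support, splitting off one coordinate at a
  time.\<close>

lemma FS_hom_eqI:
 assumes h: "h : hom (FS X B) Z" and k: "k : hom (FS X B) Z" and Z: "group Z"
  and eq: "!!t b. t : X ==> b : carrier B ==> h (single X B t b) = k (single X B t b)"
  and c: "c : carrier (FS X B)"
 shows "h c = k c"
proof -
 have "finite F ==> ALL c : carrier (FS X B). {t : X. c t ~= \<one>} \<subseteq> F --> h c = k c" for F
 proof (induction F rule: finite_induct)
  case empty
  show ?case
  proof (intro ballI impI)
  fix c assume c: "c : carrier (FS X B)" "{t : X. c t ~= \<one>} \<subseteq> {}"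
  have "c = \<one>{:FS X B:}"
   by (rule FS_eqI[OF c(1)]) (use c in \<open>auto simp: FS_carrier\<close>)
  then show "h c = k c"
   using hom_one[OF h FS_group Z] hom_one[OF k FS_group Z] by simp
  qed
 next
  case (insert t F)
  show ?case
  proof (intro ballI impI)
  fix c assume c: "c : carrier (FS X B)" "{t : X. c t ~= \<one>} \<subseteq> insert t F"
  show "h c = k c"
  proof (cases "t : X")
   case True
   let ?d = "\<lambda>x\<in>X. if x = t then \<one> else c x"
   have d: "?d : carrier (FS X B)"
   proof -
    have "{x : X. ?d x ~= \<one>} \<subseteq> {x : X. c x ~= \<one>}" by auto
    then have "finite {x : X. ?d x ~= \<one>}"
    by (rule finite_subset) (use c in \<open>simp add: FS_carrier\<close>)
    moreover have "?d : X \<rightarrow>\<^sub>E carrier B"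
    using FS_apply[OF c(1)] by auto
    ultimately show ?thesis by (simp only: FS_carrier mem_Collect_eq)
   qed
   have "{x : X. ?d x ~= \<one>} \<subseteq> F" using c by auto
   then have eqd: "h ?d = k ?d" using insert.IH d by blast
   have ct: "c t : carrier B" by (rule FS_apply[OF c(1) True])
   have ceq: "c = single X B t (c t) \<otimes>{:FS X B:} ?d"
   proof (rule FS_eqI[OF c(1)])
    show "single X B t (c t) \<otimes>{:FS X B:} ?d : carrier (FS X B)"
    using FS_group ct d by (simp add: group.is_monoid monoid.m_closed del: mult_sum_group)
   qed (use FS_apply[OF c(1)] ct in \<open>auto simp: single_def\<close>)
   have "h c = h (single X B t (c t)) \<otimes>{:Z:} h ?d"
    using HOL.trans[OF arg_cong[OF ceq, of h] hom_mult[OF h single_closed[OF ct] d]] .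
   also have "\<dots> = k (single X B t (c t)) \<otimes>{:Z:} k ?d"
    by (simp only: eq[OF True ct] eqd)
   also have "\<dots> = k c"
    using HOL.trans[OF arg_cong[OF ceq, of k] hom_mult[OF k single_closed[OF ct] d]] by (rule HOL.sym)
   finally show ?thesis .
  next
   case False
   then have "{t : X. c t ~= \<one>} \<subseteq> F" using c by auto
   then show ?thesis using insert.IH c by blast
  qed
  qed
 qed
 then show ?thesis using c by (auto simp: FS_carrier)
qed

text \<open>Additivity may be checked coordinate by coordinate; finiteness of the support is the one
  condition that involves all coordinates at once.\<close>

lemma FS_hom_intro:
 assumes H: "group H" and hx: "!!x. x : X ==> (%c. h c x) : hom H B"
  and h: "!!c. c : carrier H ==> h c : extensional X"
  "!!c. c : carrier H ==> finite {x : X. h c x ~= \<one>}"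
 shows "h : hom H (FS X B)"
proof (rule homI)
 interpret H: group H by fact
 show cl: "h c : carrier (FS X B)" if "c : carrier H" for c
  using that h hx by (auto simp: FS_carrier PiE_iff hom_def Pi_iff)
 fix c d assume cd: "c : carrier H" "d : carrier H"
 show "h (c \<otimes>{:H:} d) = h c \<otimes>{:FS X B:} h d"
 proof (rule FS_eqI[OF cl])
  show "h c \<otimes>{:FS X B:} h d : carrier (FS X B)"
  using FS_group cl cd by (simp add: group.is_monoid monoid.m_closed del: mult_sum_group)
  show "h (c \<otimes>{:H:} d) x = (h c \<otimes>{:FS X B:} h d) x" if "x : X" for x
  using hom_mult[OF hx[OF that] cd] that by simp
 qed (use cd in simp)
qed

text \<open>Writing each coordinate as a linear extension makes the additivity of
  \<open>linext\<close> available for \<open>pushforward\<close>.\<close>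

lemma pushforward_apply:
 assumes "c : carrier (FS X B)" "y : Y"
 shows "pushforward B X Y f c y = linext X B B (%x b. if f x = y then b else \<one>) c"
proof -
 have "finprod B (%x. if f x = y then c x else \<one>) {x : X. c x ~= \<one>} = finprod B c {x : X. f x = y & c x ~= \<one>}"
  by (rule B.finprod_mono_neutral_cong_right) (use assms FS_apply in \<open>auto simp: FS_carrier\<close>)
 then show ?thesis using assms by (simp add: pushforward_def linext_def)
qed

lemma pushforward_hom:
 "pushforward B X Y f : hom (FS X B) (FS Y B)"
proof (rule FS_hom_intro[OF FS_group])
 show "(%c. pushforward B X Y f c y) : hom (FS X B) B" if y: "y : Y" for y
 proof -
  have "linext X B B (%x b. if f x = y then b else \<one>) : hom (FS X B) B"
  by (rule linext_hom[OF B]) (auto intro!: homI)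
  then show ?thesis
  using y FS_group by (auto simp: hom_def pushforward_apply group.is_monoid monoid.m_closed simp del: mult_sum_group)
 qed
 fix c assume c: "c : carrier (FS X B)"
 show "pushforward B X Y f c : extensional Y" by (simp add: pushforward_def)
 have "{y : Y. pushforward B X Y f c y ~= \<one>} \<subseteq> f ` {x : X. c x ~= \<one>}"
 proof
  fix y assume y: "y : {y : Y. pushforward B X Y f c y ~= \<one>}"
  then have "{x : X. f x = y & c x ~= \<one>} ~= {}"
  by (auto simp: pushforward_def) (metis (mono_tags, lifting) B.finprod_empty empty_Collect_eq)
  then show "y : f ` {x : X. c x ~= \<one>}" by blast
 qed
 then show "finite {y : Y. pushforward B X Y f c y ~= \<one>}"
  using c by (auto simp: FS_carrier intro: finite_subset)
qed

lemma pushforward_single: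
 assumes "t : X" "f t : Y" "b : carrier B"
 shows "pushforward B X Y f (single X B t b) = single Y B (f t) b"
proof (rule FS_eqI)
 show "pushforward B X Y f (single X B t b) : carrier (FS Y B)"
  using pushforward_hom assms single_closed hom_in_carrier by metis
 fix y assume y: "y : Y"
 have "pushforward B X Y f (single X B t b) y = (if f t = y then b else \<one>)"
  using linext_single[OF B, of X "%x b. if f x = y then b else \<one>" t b] assms y
  by (simp add: pushforward_apply homI)
 then show "pushforward B X Y f (single X B t b) y = single Y B (f t) b y"
  using y by (simp add: single_def)
qed (use assms in auto)

end

section \<open>The bar complex in low degrees\<close>

lemma (in comm_monoid) finprod_atMost_2:
 "f 0 : carrier G ==> f (Suc 0) : carrier G ==> f (Suc (Suc 0)) : carrier G ==>
  finprod G f {..Suc (Suc 0)} = f (Suc (Suc 0)) \<otimes> (f (Suc 0) \<otimes> f 0)"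
 by (simp add: Pi_iff atMost_Suc)

lemma (in comm_monoid) finprod_atMost_3:
 "f 0 : carrier G ==> f (Suc 0) : carrier G ==> f (Suc (Suc 0)) : carrier G ==> f (Suc (Suc (Suc 0))) : carrier G ==>
  finprod G f {..Suc (Suc (Suc 0))} = f (Suc (Suc (Suc 0))) \<otimes> (f (Suc (Suc 0)) \<otimes> (f (Suc 0) \<otimes> f 0))"
 by (simp add: Pi_iff atMost_Suc)

lemma group_bar_chains [simp]: "group B ==> group (bar_chains Q B n)"
 by (simp add: bar_chains_def)

lemma comm_group_bar_chains: "comm_group B ==> comm_group (bar_chains Q B n)"
 by (simp add: bar_chains_def FS_comm_group)

text \<open>The basic chain b [t], whose degree is read off from the length of t.\<close>

definition bas :: "('g, 'b) monoid_scheme => ('c, 'm) monoid_scheme => 'g list => 'c => 'g list => 'c" where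
 "bas Q B t b = single (tuples (length t) Q) B t b"

lemma bas_closed [simp]: "comm_group B ==> length t = n ==> b : carrier B ==> bas Q B t b : carrier (bar_chains Q B n)"
 by (auto simp: bas_def bar_chains_def)

lemma bas_hom: "comm_group B ==> t : tuples n Q ==> bas Q B t : hom B (bar_chains Q B n)"
 using single_hom[of B t "tuples n Q"] by (auto simp: bas_def[abs_def] bar_chains_def tuples_def)

lemma bar_hom_eqI:
 assumes "comm_group B" "h : hom (bar_chains Q B n) Z" "k : hom (bar_chains Q B n) Z" "group Z"
  and "!!t b. t : tuples n Q ==> b : carrier B ==> h (bas Q B t b) = k (bas Q B t b)"
  and "c : carrier (bar_chains Q B n)"
 shows "h c = k c"
 using FS_hom_eqI[OF assms(1), of h "tuples n Q" Z k c] assms(2-)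
 by (auto simp: bar_chains_def bas_def tuples_def)

lemma tuples_1: "t : tuples (Suc 0) Q \<longleftrightarrow> (EX g : carrier Q. t = [g])"
 by (auto simp: tuples_def length_Suc_conv)

lemma tuples_2: "t : tuples 2 Q \<longleftrightarrow> (EX g : carrier Q. EX h : carrier Q. t = [g, h])"
 by (auto simp: tuples_def length_Suc_conv numeral_2_eq_2)

lemma tuples_3: "t : tuples 3 Q \<longleftrightarrow> (EX g : carrier Q. EX h : carrier Q. EX k : carrier Q. t = [g, h, k])"
 by (auto simp: tuples_def length_Suc_conv numeral_3_eq_3)

lemma bar_face_closed:
 assumes "group Q" "t : tuples (Suc n) Q" "i <= Suc n"
 shows "bar_face Q i t : tuples n Q"
proof -
 interpret Q: group Q by fact
 have t: "length t = Suc n" "set t \<subseteq> carrier Q" using assms(2) by (auto simp: tuples_def)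
 consider "i = 0" | "i = Suc n" | "0 < i" "i < Suc n" using assms(3) by linarith
 then show ?thesis
 proof cases
  case 3
  then have "t ! (i - 1) : carrier Q" "t ! i : carrier Q"
  using t by (auto intro!: subsetD[OF t(2)] nth_mem)
  then show ?thesis
  using 3 t set_take_subset[of "i - 1" t] set_drop_subset[of "i + 1" t] by (auto simp: bar_face_def tuples_def)
 qed (use t in \<open>auto simp: bar_face_def tuples_def dest: in_set_butlastD list.set_sel(2)[rotated]\<close>)
qed

lemma bar_boundary_hom:
 assumes B: "comm_group B" and Q: "group Q"
 shows "bar_boundary Q B (Suc n) : hom (bar_chains Q B (Suc n)) (bar_chains Q B n)"
 unfolding bar_chains_def
proof (rule FS_hom_intro[OF B])
 interpret B: comm_group B by fact
 let ?C = "FS (tuples (Suc n) Q) B" and ?X = "tuples (Suc n) Q" and ?Y = "tuples n Q"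
 let ?p = "%i. pushforward B ?X ?Y (bar_face Q i)"
 have p: "?p i : hom ?C (FS ?Y B)" for i by (rule pushforward_hom[OF B])
 have pc: "?p i c y : carrier B" if "c : carrier ?C" "y : ?Y" for i c y
  using FS_apply[OF B hom_in_carrier[OF p that(1)] that(2)] .
 show "group ?C" by simp
 show "(%c. bar_boundary Q B (Suc n) c y) : hom ?C B" if y: "y : ?Y" for y
 proof (rule homI)
  show "bar_boundary Q B (Suc n) c y : carrier B" if "c : carrier ?C" for c
  using y pc[OF that y] by (auto simp: bar_boundary_def intro!: B.finprod_closed)
  fix c d assume cd: "c : carrier ?C" "d : carrier ?C"
  have "finprod B (%i. ?p i (c \<otimes>{:?C:} d) y [^]{:B:} ((- 1) ^ i :: int)) {..Suc n}
   = finprod B (%i. ?p i c y [^]{:B:} ((- 1) ^ i :: int) \<otimes>{:B:} ?p i d y [^]{:B:} ((- 1) ^ i :: int)) {..Suc n}"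
  proof (rule B.finprod_cong')
  fix i assume "i : {..Suc n}"
  have "?p i (c \<otimes>{:?C:} d) y = ?p i c y \<otimes>{:B:} ?p i d y"
   using hom_mult[OF p cd, of i] y by simp
  then show "?p i (c \<otimes>{:?C:} d) y [^]{:B:} ((- 1) ^ i :: int)
    = ?p i c y [^]{:B:} ((- 1) ^ i :: int) \<otimes>{:B:} ?p i d y [^]{:B:} ((- 1) ^ i :: int)"
   using pc cd y by (simp add: B.int_pow_distrib)
  qed (use pc cd y in auto)
  also have "\<dots> = finprod B (%i. ?p i c y [^]{:B:} ((- 1) ^ i :: int)) {..Suc n} \<otimes>{:B:}
   finprod B (%i. ?p i d y [^]{:B:} ((- 1) ^ i :: int)) {..Suc n}"
  using pc cd y by (intro B.finprod_multf) auto
  finally show "bar_boundary Q B (Suc n) (c \<otimes>{:?C:} d) y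
   = bar_boundary Q B (Suc n) c y \<otimes>{:B:} bar_boundary Q B (Suc n) d y"
  using y by (simp add: bar_boundary_def del: mult_sum_group)
 qed
 fix c assume c: "c : carrier ?C"
 show "bar_boundary Q B (Suc n) c : extensional ?Y" by (simp add: bar_boundary_def)
 have "{y : ?Y. bar_boundary Q B (Suc n) c y ~= \<one>{:B:}} \<subseteq> (UN i: {..Suc n}. {y : ?Y. ?p i c y ~= \<one>{:B:}})"
 proof (rule subsetI, rule ccontr)
  fix y assume y: "y : {y : ?Y. bar_boundary Q B (Suc n) c y ~= \<one>{:B:}}"
  "y ~: (UN i: {..Suc n}. {y : ?Y. ?p i c y ~= \<one>{:B:}})"
  then have "finprod B (%i. ?p i c y [^]{:B:} ((- 1) ^ i :: int)) {..Suc n} = \<one>{:B:}"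
  by (intro B.finprod_one_eqI) auto
  moreover have "bar_boundary Q B (Suc n) c y = finprod B (%i. ?p i c y [^]{:B:} ((- 1) ^ i :: int)) {..Suc n}"
  using y(1) by (simp add: bar_boundary_def)
  ultimately show False using y(1) by simp
 qed
 moreover have "finite (UN i: {..Suc n}. {y : ?Y. ?p i c y ~= \<one>{:B:}})"
  using hom_in_carrier[OF p c] by (auto simp: FS_carrier[OF B])
 ultimately show "finite {y : ?Y. bar_boundary Q B (Suc n) c y ~= \<one>{:B:}}"
  by (rule finite_subset)
qed

lemma bar_boundary_bas:
 assumes B: "comm_group B" and Q: "group Q" and t: "t : tuples (Suc n) Q" and b: "b : carrier B" and y: "y : tuples n Q"
 shows "bar_boundary Q B (Suc n) (bas Q B t b) y
   = finprod B (%i. bas Q B (bar_face Q i t) b y [^]{:B:} ((- 1) ^ i :: int)) {..Suc n}"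
proof -
 interpret B: comm_group B by fact
 have len: "length t = Suc n" using t by (simp add: tuples_def)
 have face: "bar_face Q i t : tuples n Q" if "i <= Suc n" for i
  using bar_face_closed[OF Q t that] .
 have bc: "single (tuples n Q) B u b y : carrier B" for u
  using b y by (simp add: single_def)
 have "finprod B (%i. pushforward B (tuples (Suc n) Q) (tuples n Q) (bar_face Q i) (bas Q B t b) y [^]{:B:} ((- 1) ^ i :: int)) {..Suc n}
  = finprod B (%i. bas Q B (bar_face Q i t) b y [^]{:B:} ((- 1) ^ i :: int)) {..Suc n}"
 proof (rule B.finprod_cong')
  fix i assume i: "i : {..Suc n}"
  then have "length (bar_face Q i t) = n" using face by (simp add: tuples_def)
  then show "pushforward B (tuples (Suc n) Q) (tuples n Q) (bar_face Q i) (bas Q B t b) y [^]{:B:} ((- 1) ^ i :: int)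
   = bas Q B (bar_face Q i t) b y [^]{:B:} ((- 1) ^ i :: int)"
  using i face b t len pushforward_single[OF B, of t "tuples (Suc n) Q" "bar_face Q i" "tuples n Q" b]
  by (simp add: bas_def)
 next
  show "(%i. bas Q B (bar_face Q i t) b y [^]{:B:} ((- 1) ^ i :: int)) : {..Suc n} \<rightarrow> carrier B"
  using face bc by (auto simp: bas_def tuples_def)
 qed simp
 then show ?thesis using y by (simp add: bar_boundary_def)
qed

lemma boundary2:
 assumes B: "comm_group B" and Q: "group Q" and g: "g : carrier Q" "h : carrier Q" and b: "b : carrier B"
 shows "bar_boundary Q B 2 (bas Q B [g, h] b) =
  bas Q B [h] b \<otimes>{:bar_chains Q B (Suc 0):} inv{:bar_chains Q B (Suc 0):} bas Q B [g \<otimes>{:Q:} h] b \<otimes>{:bar_chains Q B (Suc 0):} bas Q B [g] b"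
  (is "?L = ?R")
proof -
 interpret B: comm_group B by fact
 interpret Q: group Q by fact
 interpret C: comm_group "bar_chains Q B (Suc 0)" by (rule comm_group_bar_chains[OF B])
 have t: "[g, h] : tuples (Suc (Suc 0)) Q" using g by (simp add: tuples_def)
 have R: "?R : carrier (bar_chains Q B (Suc 0))" using B b by simp
 have L: "?L : carrier (bar_chains Q B (Suc 0))"
  using hom_in_carrier[OF bar_boundary_hom[OF B Q, of "Suc 0"]] B b by (simp add: numeral_2_eq_2)
 show ?thesis
 proof (rule FS_eqI[OF B, of _ "tuples (Suc 0) Q"])
  fix y assume y: "y : tuples (Suc 0) Q"
  have c: "bas Q B [x] b y : carrier B" for x
  using y b by (simp add: bas_def single_def)
  have "?L y = finprod B (%i. bas Q B (bar_face Q i [g, h]) b y [^]{:B:} ((- 1) ^ i :: int)) {..Suc (Suc 0)}"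
  using bar_boundary_bas[OF B Q t b y] by (simp add: numeral_2_eq_2)
  also have "\<dots> = bas Q B [h] b y \<otimes>{:B:} inv{:B:} bas Q B [g \<otimes>{:Q:} h] b y \<otimes>{:B:} bas Q B [g] b y"
  using c b y by (subst B.finprod_atMost_2) (auto simp: bar_face_def B.int_pow_neg B.m_ac)
  also have "\<dots> = ?R y"
  using y b inv_sum_group[of "tuples (Suc 0) Q" "%_. B" "bas Q B [g \<otimes>{:Q:} h] b"]
   bas_closed[OF B, of "[g \<otimes>{:Q:} h]" "Suc 0" b Q] by (simp add: bar_chains_def)
  finally show "?L y = ?R y" .
 qed (use L R in \<open>simp_all add: bar_chains_def\<close>)
qed

lemma boundary3:
 assumes B: "comm_group B" and Q: "group Q" and g: "g : carrier Q" "h : carrier Q" "k : carrier Q"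
  and b: "b : carrier B"
 shows "bar_boundary Q B 3 (bas Q B [g, h, k] b) =
  bas Q B [h, k] b \<otimes>{:bar_chains Q B 2:} inv{:bar_chains Q B 2:} bas Q B [g \<otimes>{:Q:} h, k] b \<otimes>{:bar_chains Q B 2:}
  bas Q B [g, h \<otimes>{:Q:} k] b \<otimes>{:bar_chains Q B 2:} inv{:bar_chains Q B 2:} bas Q B [g, h] b"
  (is "?L = ?R")
proof -
 interpret B: comm_group B by fact
 interpret Q: group Q by fact
 interpret C: comm_group "bar_chains Q B 2" by (rule comm_group_bar_chains[OF B])
 have t: "[g, h, k] : tuples (Suc 2) Q" using g by (simp add: tuples_def)
 have R: "?R : carrier (bar_chains Q B 2)" using B b by simp
 have L: "?L : carrier (bar_chains Q B 2)"
  using hom_in_carrier[OF bar_boundary_hom[OF B Q, of 2]] B b by (simp add: numeral_3_eq_3 numeral_2_eq_2)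
 show ?thesis
 proof (rule FS_eqI[OF B, of _ "tuples 2 Q"])
  fix y assume y: "y : tuples 2 Q"
  have c: "bas Q B [x, x'] b y : carrier B" for x x'
  using y b by (simp add: bas_def single_def numeral_2_eq_2)
  have "?L y = finprod B (%i. bas Q B (bar_face Q i [g, h, k]) b y [^]{:B:} ((- 1) ^ i :: int)) {..Suc (Suc (Suc 0))}"
  using bar_boundary_bas[OF B Q t b y] by (simp add: numeral_3_eq_3 numeral_2_eq_2)
  also have "\<dots> = bas Q B [h, k] b y \<otimes>{:B:} inv{:B:} bas Q B [g \<otimes>{:Q:} h, k] b y \<otimes>{:B:}
   bas Q B [g, h \<otimes>{:Q:} k] b y \<otimes>{:B:} inv{:B:} bas Q B [g, h] b y"
  using c b y by (subst B.finprod_atMost_3) (auto simp: bar_face_def B.int_pow_neg B.m_ac)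
  also have "\<dots> = ?R y"
  using y b inv_sum_group[of "tuples 2 Q" "%_. B" "bas Q B [g \<otimes>{:Q:} h, k] b"]
   inv_sum_group[of "tuples 2 Q" "%_. B" "bas Q B [g, h] b"]
   bas_closed[OF B, of "[g \<otimes>{:Q:} h, k]" 2 b Q] bas_closed[OF B, of "[g, h]" 2 b Q] by (simp add: bar_chains_def)
  finally show "?L y = ?R y" .
 qed (use L R in \<open>simp_all add: bar_chains_def\<close>)
qed

lemma bar_boundary_hom2:
 assumes "comm_group B" "group Q"
 shows "bar_boundary Q B 2 : hom (bar_chains Q B 2) (bar_chains Q B (Suc 0))"
  "bar_boundary Q B 3 : hom (bar_chains Q B 3) (bar_chains Q B 2)"
 using bar_boundary_hom[OF assms, of "Suc 0"] bar_boundary_hom[OF assms, of 2]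
 by (simp_all add: numeral_2_eq_2 numeral_3_eq_3)

text \<open>By additivity a basic chain [g|h|k] suffices, where the twelve terms cancel in
  pairs.\<close>

lemma boundary_boundary:
 assumes B: "comm_group B" and Q: "group Q" and c: "c : carrier (bar_chains Q B 3)"
 shows "bar_boundary Q B 2 (bar_boundary Q B 3 c) = \<one>{:bar_chains Q B (Suc 0):}"
proof -
 interpret B: comm_group B by fact
 interpret Q: group Q by fact
 interpret C: comm_group "bar_chains Q B (Suc 0)" by (rule comm_group_bar_chains[OF B])
 interpret C2: comm_group "bar_chains Q B 2" by (rule comm_group_bar_chains[OF B])
 interpret d: group_hom "bar_chains Q B 2" "bar_chains Q B (Suc 0)" "bar_boundary Q B 2"
  using bar_boundary_hom2(1)[OF B Q] by unfold_locales
 have [simp]: "bas Q B [x] b : carrier (bar_chains Q B (Suc 0))" "bas Q B [x, y] b : carrier (bar_chains Q B 2)"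
  if "b : carrier B" for x y b
  using B that by simp_all
 have cancel: "x \<otimes>{:bar_chains Q B (Suc 0):} (y \<otimes>{:bar_chains Q B (Suc 0):} inv{:bar_chains Q B (Suc 0):} x) = y"
  if "x : carrier (bar_chains Q B (Suc 0))" "y : carrier (bar_chains Q B (Suc 0))" for x y
  using that by (metis C.inv_closed C.l_cancel_inv(2) C.m_comm)
 show ?thesis
 proof (rule bar_hom_eqI[OF B, where h = "%c. bar_boundary Q B 2 (bar_boundary Q B 3 c)" and k = "%_. \<one>{:bar_chains Q B (Suc 0):}"])
  show "(%c. bar_boundary Q B 2 (bar_boundary Q B 3 c)) : hom (bar_chains Q B 3) (bar_chains Q B (Suc 0))"
  using hom_compose[OF bar_boundary_hom2(2)[OF B Q] bar_boundary_hom2(1)[OF B Q]] by (simp add: comp_def)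
  show "(%_. \<one>{:bar_chains Q B (Suc 0):}) : hom (bar_chains Q B 3) (bar_chains Q B (Suc 0))"
  by (rule homI) auto
  fix t b assume t: "t : tuples 3 Q" and b: "b : carrier B"
  then obtain g h k where "t = [g, h, k]" "g : carrier Q" "h : carrier Q" "k : carrier Q"
  by (auto simp: tuples_3)
  then show "bar_boundary Q B 2 (bar_boundary Q B 3 (bas Q B t b)) = \<one>{:bar_chains Q B (Suc 0):}"
  using b by (simp add: boundary2[OF B Q] boundary3[OF B Q] Q.m_assoc C.inv_mult C.m_ac cancel)
 qed (use c C.is_group in auto)
qed

lemma bar_map_hom:
 assumes B: "comm_group B" and B': "comm_group B'" and Q: "group Q" "group Q'"
  and f: "f : hom Q Q'" and al: "al : hom B B'"
 shows "bar_map Q B Q' f al n : hom (bar_chains Q B n) (bar_chains Q' B' n)"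
 unfolding bar_chains_def
proof (rule FS_hom_intro[OF B'])
 interpret B: comm_group B by fact
 interpret B': comm_group B' by fact
 let ?p = "pushforward B (tuples n Q) (tuples n Q') (map f)"
 have p: "?p : hom (FS (tuples n Q) B) (FS (tuples n Q') B)" by (rule pushforward_hom[OF B])
 show "group (FS (tuples n Q) B)" by simp
 show "(%c. bar_map Q B Q' f al n c y) : hom (FS (tuples n Q) B) B'" if y: "y : tuples n Q'" for y
 proof (rule homI)
  have pc: "?p c y : carrier B" if "c : carrier (FS (tuples n Q) B)" for c
  using FS_apply[OF B hom_in_carrier[OF p that] y] .
  show "bar_map Q B Q' f al n c y : carrier B'" if "c : carrier (FS (tuples n Q) B)" for c
  using pc[OF that] y hom_in_carrier[OF al] by (simp add: bar_map_def)
  show "bar_map Q B Q' f al n (c \<otimes>{:FS (tuples n Q) B:} d) y = bar_map Q B Q' f al n c y \<otimes>{:B':} bar_map Q B Q' f al n d y"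
  if cd: "c : carrier (FS (tuples n Q) B)" "d : carrier (FS (tuples n Q) B)" for c d
  proof -
  have "?p (c \<otimes>{:FS (tuples n Q) B:} d) y = ?p c y \<otimes>{:B:} ?p d y"
   using hom_mult[OF p cd] y by simp
  then show ?thesis
   using y hom_mult[OF al pc[OF cd(1)] pc[OF cd(2)]] by (simp add: bar_map_def del: mult_sum_group)
  qed
 qed
 fix c assume c: "c : carrier (FS (tuples n Q) B)"
 show "bar_map Q B Q' f al n c : extensional (tuples n Q')" by (simp add: bar_map_def)
 have "{y : tuples n Q'. bar_map Q B Q' f al n c y ~= \<one>{:B':}} \<subseteq> {y : tuples n Q'. ?p c y ~= \<one>{:B:}}"
  using hom_one[OF al B.is_group B'.is_group] by (auto simp: bar_map_def)
 then show "finite {y : tuples n Q'. bar_map Q B Q' f al n c y ~= \<one>{:B':}}"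
  using hom_in_carrier[OF p c] by (auto simp: FS_carrier[OF B] intro: finite_subset)
qed

lemma bar_map_bas:
 assumes B: "comm_group B" and B': "comm_group B'"
  and f: "f : hom Q Q'" and al: "al : hom B B'" and t: "t : tuples n Q" and b: "b : carrier B"
 shows "bar_map Q B Q' f al n (bas Q B t b) = bas Q' B' (map f t) (al b)"
proof -
 interpret B: comm_group B by fact
 interpret B': comm_group B' by fact
 have "map f t : tuples n Q'"
  using t hom_in_carrier[OF f] by (auto simp: tuples_def)
 moreover have "length t = n" using t by (simp add: tuples_def)
 ultimately show ?thesis
  using pushforward_single[OF B, of t "tuples n Q" "map f" "tuples n Q'" b] t b hom_one[OF al B.is_group B'.is_group]
  by (auto simp: bar_map_def bas_def single_def fun_eq_iff)
qed

lemma bar_map_boundary: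
 assumes B: "comm_group B" and B': "comm_group B'" and Q: "group Q" "group Q'"
  and f: "f : hom Q Q'" and al: "al : hom B B'"
 shows "c : carrier (bar_chains Q B 2) ==>
  bar_map Q B Q' f al (Suc 0) (bar_boundary Q B 2 c) = bar_boundary Q' B' 2 (bar_map Q B Q' f al 2 c)"
  and "c : carrier (bar_chains Q B 3) ==>
  bar_map Q B Q' f al 2 (bar_boundary Q B 3 c) = bar_boundary Q' B' 3 (bar_map Q B Q' f al 3 c)"
proof -
 interpret B: comm_group B by fact
 interpret B': comm_group B' by fact
 interpret f: group_hom Q Q' f using f Q by (simp add: group_hom_defs)
 note bm = bar_map_hom[OF assms]
 interpret m1: group_hom "bar_chains Q B (Suc 0)" "bar_chains Q' B' (Suc 0)" "bar_map Q B Q' f al (Suc 0)"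
  using bm[of "Suc 0"] by (simp add: group_hom_defs)
 interpret m2: group_hom "bar_chains Q B 2" "bar_chains Q' B' 2" "bar_map Q B Q' f al 2"
  using bm[of 2] by (simp add: group_hom_defs)
 have alc: "al b : carrier B'" if "b : carrier B" for b using al that by (rule hom_in_carrier)
 have [simp]: "bas Q B [x] b : carrier (bar_chains Q B (Suc 0))" "bas Q B [x, y] b : carrier (bar_chains Q B 2)"
  if "b : carrier B" for x y b
  using B that by simp_all
 have map1: "bar_map Q B Q' f al (Suc 0) (bas Q B [g] b) = bas Q' B' [f g] (al b)"
  if "g : carrier Q" "b : carrier B" for g b
  using bar_map_bas[OF B B' f al, of "[g]" "Suc 0" b] that by (simp add: tuples_1)
 have map2: "bar_map Q B Q' f al 2 (bas Q B [g, h] b) = bas Q' B' [f g, f h] (al b)"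
  if "g : carrier Q" "h : carrier Q" "b : carrier B" for g h b
  using bar_map_bas[OF B B' f al, of "[g, h]" 2 b] that by (simp add: tuples_2)
 have map3: "bar_map Q B Q' f al 3 (bas Q B [g, h, k] b) = bas Q' B' [f g, f h, f k] (al b)"
  if "g : carrier Q" "h : carrier Q" "k : carrier Q" "b : carrier B" for g h k b
  using bar_map_bas[OF B B' f al, of "[g, h, k]" 3 b] that by (simp add: tuples_3)
 show "bar_map Q B Q' f al (Suc 0) (bar_boundary Q B 2 c) = bar_boundary Q' B' 2 (bar_map Q B Q' f al 2 c)"
  if c: "c : carrier (bar_chains Q B 2)"
 proof (rule bar_hom_eqI[OF B, where h = "%c. bar_map Q B Q' f al (Suc 0) (bar_boundary Q B 2 c)"
   and k = "%c. bar_boundary Q' B' 2 (bar_map Q B Q' f al 2 c)", OF _ _ _ _ c])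
  show "(%c. bar_map Q B Q' f al (Suc 0) (bar_boundary Q B 2 c)) : hom (bar_chains Q B 2) (bar_chains Q' B' (Suc 0))"
  using hom_compose[OF bar_boundary_hom2(1)[OF B Q(1)] bm] by (simp add: comp_def)
  show "(%c. bar_boundary Q' B' 2 (bar_map Q B Q' f al 2 c)) : hom (bar_chains Q B 2) (bar_chains Q' B' (Suc 0))"
  using hom_compose[OF bm bar_boundary_hom2(1)[OF B' Q(2)]] by (simp add: comp_def)
  fix t b assume t: "t : tuples 2 Q" and b: "b : carrier B"
  then obtain g h where "t = [g, h]" "g : carrier Q" "h : carrier Q"
  by (auto simp: tuples_2)
  then show "bar_map Q B Q' f al (Suc 0) (bar_boundary Q B 2 (bas Q B t b)) = bar_boundary Q' B' 2 (bar_map Q B Q' f al 2 (bas Q B t b))"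
  using b by (simp add: boundary2[OF B Q(1)] boundary2[OF B' Q(2)] map1 map2 alc)
 qed simp
 show "bar_map Q B Q' f al 2 (bar_boundary Q B 3 c) = bar_boundary Q' B' 3 (bar_map Q B Q' f al 3 c)"
  if c: "c : carrier (bar_chains Q B 3)"
 proof (rule bar_hom_eqI[OF B, where h = "%c. bar_map Q B Q' f al 2 (bar_boundary Q B 3 c)"
   and k = "%c. bar_boundary Q' B' 3 (bar_map Q B Q' f al 3 c)", OF _ _ _ _ c])
  show "(%c. bar_map Q B Q' f al 2 (bar_boundary Q B 3 c)) : hom (bar_chains Q B 3) (bar_chains Q' B' 2)"
  using hom_compose[OF bar_boundary_hom2(2)[OF B Q(1)] bm] by (simp add: comp_def)
  show "(%c. bar_boundary Q' B' 3 (bar_map Q B Q' f al 3 c)) : hom (bar_chains Q B 3) (bar_chains Q' B' 2)"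
  using hom_compose[OF bm bar_boundary_hom2(2)[OF B' Q(2)]] by (simp add: comp_def)
  fix t b assume t: "t : tuples 3 Q" and b: "b : carrier B"
  then obtain g h k where "t = [g, h, k]" "g : carrier Q" "h : carrier Q" "k : carrier Q"
  by (auto simp: tuples_3)
  then show "bar_map Q B Q' f al 2 (bar_boundary Q B 3 (bas Q B t b)) = bar_boundary Q' B' 3 (bar_map Q B Q' f al 3 (bas Q B t b))"
  using b by (simp add: boundary3[OF B Q(1)] boundary3[OF B' Q(2)] map2 map3 alc)
 qed simp
qed

lemma hom_agree:
 assumes "h : hom G H" "group G" "!!x. x : carrier G ==> k x = h x"
 shows "k : hom G H"
proof -
 interpret group G by fact
 show ?thesis using assms(1,3) by (auto simp: hom_def Pi_iff)
qed

lemma bar_map_compose: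
 assumes B: "comm_group B" "comm_group B'" "comm_group B''" and Q: "group Q" "group Q'" "group Q''"
  and f: "f : hom Q Q'" "f' : hom Q' Q''" and al: "al : hom B B'" "al' : hom B' B''"
  and g: "!!x. x : carrier Q ==> g x = f' (f x)" and bt: "!!b. b : carrier B ==> bt b = al' (al b)"
  and c: "c : carrier (bar_chains Q B n)"
 shows "bar_map Q' B' Q'' f' al' n (bar_map Q B Q' f al n c) = bar_map Q B Q'' g bt n c"
proof -
 have gh: "g : hom Q Q''" and bth: "bt : hom B B''"
  by (rule hom_agree[OF hom_compose[OF f] Q(1)], simp add: g)
   (rule hom_agree[OF hom_compose[OF al] comm_group.axioms(2)[OF B(1)]], simp add: bt)
 show ?thesis
 proof (rule bar_hom_eqI[OF B(1), where h = "%c. bar_map Q' B' Q'' f' al' n (bar_map Q B Q' f al n c)"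
   and k = "bar_map Q B Q'' g bt n", OF _ _ _ _ c])
  show "(%c. bar_map Q' B' Q'' f' al' n (bar_map Q B Q' f al n c)) : hom (bar_chains Q B n) (bar_chains Q'' B'' n)"
  using hom_compose[OF bar_map_hom[OF B(1,2) Q(1,2) f(1) al(1)] bar_map_hom[OF B(2,3) Q(2,3) f(2) al(2)]]
  by (simp add: comp_def)
  show "bar_map Q B Q'' g bt n : hom (bar_chains Q B n) (bar_chains Q'' B'' n)"
  by (rule bar_map_hom[OF B(1,3) Q(1,3) gh bth])
  show "group (bar_chains Q'' B'' n)" using B(3) by (simp add: comm_group.axioms(2))
  fix t b assume t: "t : tuples n Q" and b: "b : carrier B"
  have "map f t : tuples n Q'" using t hom_in_carrier[OF f(1)] by (auto simp: tuples_def)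
  moreover have "map f' (map f t) = map g t" using t g by (auto simp: tuples_def)
  ultimately show "bar_map Q' B' Q'' f' al' n (bar_map Q B Q' f al n (bas Q B t b)) = bar_map Q B Q'' g bt n (bas Q B t b)"
  using bar_map_bas[OF B(1,2) f(1) al(1) t b] bar_map_bas[OF B(2,3) f(2) al(2), of "map f t" n "al b"]
   bar_map_bas[OF B(1,3) gh bth t b] hom_in_carrier[OF al(1) b] bt[OF b] by (simp del: map_map map_eq_conv)
 qed
qed

section \<open>Extensions defined by cocycles\<close>

abbreviation ZZ :: "int monoid" where "ZZ \<equiv> integer_group"

definition center_group :: "('e, 'c) monoid_scheme => ('e, 'c) monoid_scheme" where
 "center_group E = E\<lparr>carrier := group_center E\<rparr>"

definition zeta :: "('a, 'b) monoid_scheme => ('e, 'c) monoid_scheme => ('a => 'e) => 'a => 'a => 'e" where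
 "zeta G E s g h = s g \<otimes>{:E:} s h \<otimes>{:E:} inv{:E:} s (g \<otimes>{:G:} h)"

text \<open>Evaluation of the cocycle \<open>zeta\<close> on integral 2-chains, that is, the pairing
  of a chain with the extension. The product is formed in \<open>center_group E\<close> because a
  linear extension requires a commutative target.\<close>

definition Phi :: "('a, 'b) monoid_scheme => ('e, 'c) monoid_scheme => ('a => 'e) => ('a list => int) => 'e" where
 "Phi G E s = linext (tuples 2 G) ZZ (center_group E) (%t n. zeta G E s (t ! 0) (t ! 1) [^]{:center_group E:} n)"

lemma comm_center_group: "group E ==> comm_group (center_group E)"
proof -
 assume "group E"
 then interpret E: group E .
 interpret C: group "center_group E"
  unfolding center_group_def by (rule E.subgroup_imp_group[OF E.subgroup_center])
 show ?thesis
  by (rule C.group_comm_groupI) (simp add: center_group_def group_centerD)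
qed

lemma center_group_simps [simp]:
 "carrier (center_group E) = group_center E" "monoid.mult (center_group E) = monoid.mult E"
 "\<one>{:center_group E:} = \<one>{:E:}"
 by (simp_all add: center_group_def)

lemma center_group_inv: "group E ==> x : group_center E ==> inv{:center_group E:} x = inv{:E:} x"
 unfolding center_group_def by (rule group.m_inv_consistent[OF _ group.subgroup_center])

lemma center_group_pow: "group E ==> x : group_center E ==> x [^]{:center_group E:} (n::int) = x [^]{:E:} n"
 unfolding center_group_def by (rule group.int_pow_consistent[OF _ group.subgroup_center, symmetric])

lemma int_pow_hom_ZZ: "group B ==> z : carrier B ==> (%n::int. z [^]{:B:} n) : hom ZZ B"
 by (rule group.hom_integer_group_pow)

lemma linext_bas:
 assumes "comm_group B" "comm_group Z" "!!t. t : tuples 2 Q ==> phf t : hom B Z"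
  "g : carrier Q" "h : carrier Q" "b : carrier B"
 shows "linext (tuples 2 Q) B Z phf (bas Q B [g, h] b) = phf [g, h] b"
proof -
 have "[g, h] : tuples 2 Q" "length [g, h] = 2" using assms by (simp_all add: tuples_2)
 then show ?thesis
  unfolding bas_def using linext_single[OF assms(1,2), of "tuples 2 Q" phf "[g, h]" b] assms(3,6) by metis
qed

text \<open>As d [g|h|k] = [h|k] - [gh|k] + [g|hk] - [g|h], vanishing on the boundary of a basic
  chain is the cocycle identity.\<close>

lemma linext_boundary3:
 assumes B: "comm_group B" and Q: "group Q" and Z: "comm_group Z"
  and phf: "!!t. t : tuples 2 Q ==> phf t : hom B Z"
  and coc: "!!g h k b. [|g : carrier Q; h : carrier Q; k : carrier Q; b : carrier B|] ==>
  phf [h, k] b \<otimes>{:Z:} phf [g, h \<otimes>{:Q:} k] b = phf [g, h] b \<otimes>{:Z:} phf [g \<otimes>{:Q:} h, k] b"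
  and c: "c : carrier (bar_chains Q B 3)"
 shows "linext (tuples 2 Q) B Z phf (bar_boundary Q B 3 c) = \<one>{:Z:}"
proof -
 interpret Z: comm_group Z by fact
 interpret Q: group Q by fact
 interpret B: comm_group B by fact
 let ?L = "linext (tuples 2 Q) B Z phf"
 have L: "?L : hom (bar_chains Q B 2) Z"
  unfolding bar_chains_def by (rule linext_hom[OF B Z phf])
 interpret L: group_hom "bar_chains Q B 2" Z ?L
  using L by (simp add: group_hom_defs)
 have Lb: "?L (bas Q B [g, h] b) = phf [g, h] b" "phf [g, h] b : carrier Z" "bas Q B [g, h] b : carrier (bar_chains Q B 2)"
  if "g : carrier Q" "h : carrier Q" "b : carrier B" for g h b
  using linext_bas[OF B Z phf that] hom_in_carrier[OF phf, of "[g, h]" b] that B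
  by (simp_all add: tuples_2)
 show ?thesis
 proof (rule bar_hom_eqI[OF B, where h = "%c. ?L (bar_boundary Q B 3 c)" and k = "%_. \<one>{:Z:}", OF _ _ _ _ c])
  show "(%c. ?L (bar_boundary Q B 3 c)) : hom (bar_chains Q B 3) Z"
  using hom_compose[OF bar_boundary_hom2(2)[OF B Q] L] by (simp add: comp_def)
  show "(%_. \<one>{:Z:}) : hom (bar_chains Q B 3) Z" by (rule homI) auto
  fix t b assume t: "t : tuples 3 Q" and b: "b : carrier B"
  obtain g h k where g: "t = [g, h, k]" "g : carrier Q" "h : carrier Q" "k : carrier Q"
  using t by (auto simp: tuples_3)
  let ?a = "phf [h, k] b" and ?b = "phf [g \<otimes>{:Q:} h, k] b" and ?c = "phf [g, h \<otimes>{:Q:} k] b" and ?d = "phf [g, h] b"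
  have "?L (bar_boundary Q B 3 (bas Q B t b)) = ?a \<otimes>{:Z:} inv{:Z:} ?b \<otimes>{:Z:} ?c \<otimes>{:Z:} inv{:Z:} ?d"
  using g b by (simp add: boundary3[OF B Q] Lb)
  also have "\<dots> = (?a \<otimes>{:Z:} ?c) \<otimes>{:Z:} inv{:Z:} (?d \<otimes>{:Z:} ?b)"
  using g b Lb by (simp add: Z.inv_mult Z.m_ac)
  also have "\<dots> = \<one>{:Z:}"
  using coc[OF g(2-4) b] g b Lb(2) by simp
  finally show "?L (bar_boundary Q B 3 (bas Q B t b)) = \<one>{:Z:}" .
 qed simp
qed

locale lift_context = G: group G + E: group E
 for G :: "('a, 'b) monoid_scheme" (structure) and E :: "('e, 'c) monoid_scheme" and s :: "'a => 'e" +
 assumes lift: "central_lift G E s"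
begin

lemma s_closed [simp]: "g : carrier G ==> s g : carrier E"
 using lift by (auto simp: central_lift_def)

sublocale Z: comm_group "center_group E" by (rule comm_center_group[OF E.is_group])

lemma zeta_eq:
 assumes "g : carrier G" "h : carrier G"
 shows "zeta G E s g h : group_center E" "s g \<otimes>{:E:} s h = zeta G E s g h \<otimes>{:E:} s (g \<otimes> h)"
proof -
 obtain z where z: "z : group_center E" "s g \<otimes>{:E:} s h = z \<otimes>{:E:} s (g \<otimes> h)"
  using lift assms unfolding central_lift_def by blast
 then have "zeta G E s g h = z"
  using assms group_centerD(1)[OF z(1)] by (simp add: zeta_def E.m_assoc)
 then show "zeta G E s g h : group_center E" "s g \<otimes>{:E:} s h = zeta G E s g h \<otimes>{:E:} s (g \<otimes> h)"
  using z by simp_all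
qed

lemma zeta_closed [simp]: "g : carrier G ==> h : carrier G ==> zeta G E s g h : carrier E"
 using group_centerD(1)[OF zeta_eq(1)] .

text \<open>Multiplied by s (ghk) on the right, both sides become s g s h s k.\<close>

lemma zeta_cocycle:
 assumes g: "g : carrier G" "h : carrier G" "k : carrier G"
 shows "zeta G E s h k \<otimes>{:E:} zeta G E s g (h \<otimes> k) = zeta G E s g h \<otimes>{:E:} zeta G E s (g \<otimes> h) k"
proof -
 have "zeta G E s h k \<otimes>{:E:} zeta G E s g (h \<otimes> k) \<otimes>{:E:} s (g \<otimes> h \<otimes> k)
  = zeta G E s h k \<otimes>{:E:} (s g \<otimes>{:E:} s (h \<otimes> k))"
  using g zeta_eq(2)[of g "h \<otimes> k"] by (simp add: E.m_assoc G.m_assoc)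
 also have "\<dots> = s g \<otimes>{:E:} (zeta G E s h k \<otimes>{:E:} s (h \<otimes> k))"
  using g group_centerD(2)[OF zeta_eq(1)[OF g(2,3)], of "s g"] by (simp flip: E.m_assoc)
 also have "\<dots> = s g \<otimes>{:E:} s h \<otimes>{:E:} s k"
  using g zeta_eq(2)[of h k] by (simp add: E.m_assoc)
 also have "\<dots> = zeta G E s g h \<otimes>{:E:} zeta G E s (g \<otimes> h) k \<otimes>{:E:} s (g \<otimes> h \<otimes> k)"
  using g zeta_eq(2)[of g h] zeta_eq(2)[of "g \<otimes> h" k] by (simp add: E.m_assoc)
 finally show ?thesis using g by simp
qed

lemma phi_hom: "t : tuples 2 G ==> (%n::int. zeta G E s (t ! 0) (t ! 1) [^]{:center_group E:} n) : hom ZZ (center_group E)"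
 using zeta_eq(1) by (intro int_pow_hom_ZZ) (auto simp: tuples_2 Z.is_group)

lemma Phi_hom_center: "Phi G E s : hom (bar_chains G ZZ 2) (center_group E)"
 unfolding Phi_def bar_chains_def by (rule linext_hom[OF abelian_integer_group Z.comm_group_axioms phi_hom])

lemma Phi_hom: "Phi G E s : hom (bar_chains G ZZ 2) E"
proof (rule homI)
 show "Phi G E s x : carrier E" if "x : carrier (bar_chains G ZZ 2)" for x
  using group_centerD(1) hom_in_carrier[OF Phi_hom_center that] by simp
qed (use hom_mult[OF Phi_hom_center] in simp)

lemma Phi_bas:
 assumes "g : carrier G" "h : carrier G"
 shows "Phi G E s (bas G ZZ [g, h] n) = zeta G E s g h [^]{:E:} n"
proof -
 have "Phi G E s (bas G ZZ [g, h] n) = zeta G E s g h [^]{:center_group E:} n"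
  using linext_bas[where b = n, OF abelian_integer_group Z.comm_group_axioms phi_hom assms] by (simp add: Phi_def)
 then show ?thesis by (simp add: center_group_pow[OF E.is_group zeta_eq(1)[OF assms]])
qed

lemma Phi_boundary:
 assumes "c : carrier (bar_chains G ZZ 3)"
 shows "Phi G E s (bar_boundary G ZZ 3 c) = \<one>{:E:}"
proof -
 have "linext (tuples 2 G) ZZ (center_group E) (%t n. zeta G E s (t ! 0) (t ! 1) [^]{:center_group E:} n)
  (bar_boundary G ZZ 3 c) = \<one>{:center_group E:}"
 proof (rule linext_boundary3[OF abelian_integer_group G.is_group Z.comm_group_axioms phi_hom _ assms])
  fix g h k and b :: int assume g: "g : carrier G" "h : carrier G" "k : carrier G"
  note z = zeta_eq(1)[OF g(2,3)] zeta_eq(1)[OF g(1) G.m_closed[OF g(2,3)]] zeta_eq(1)[OF g(1,2)]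
  zeta_eq(1)[OF G.m_closed[OF g(1,2)] g(3)]
  show "zeta G E s ([h, k] ! 0) ([h, k] ! 1) [^]{:center_group E:} b \<otimes>{:center_group E:}
   zeta G E s ([g, h \<otimes> k] ! 0) ([g, h \<otimes> k] ! 1) [^]{:center_group E:} b
  = zeta G E s ([g, h] ! 0) ([g, h] ! 1) [^]{:center_group E:} b \<otimes>{:center_group E:}
   zeta G E s ([g \<otimes> h, k] ! 0) ([g \<otimes> h, k] ! 1) [^]{:center_group E:} b"
  using z zeta_cocycle[OF g] Z.int_pow_distrib[of "zeta G E s h k" "zeta G E s g (h \<otimes> k)" b]
   Z.int_pow_distrib[of "zeta G E s g h" "zeta G E s (g \<otimes> h) k" b] by simp
 qed
 then show ?thesis by (simp add: Phi_def)
qed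

end

text \<open>The cocycle is not assumed to be normalized. Therefore the unit has first component f(1,
  1)^-1, and the inclusion \<open>incl\<close> of M is shifted by the same constant.\<close>

definition cocycle_ext :: "('m, 'n) monoid_scheme => ('q, 'r) monoid_scheme => ('q => 'q => 'm) => ('m \<times> 'q) monoid" where
 "cocycle_ext M Q f = \<lparr>carrier = carrier M \<times> carrier Q,
  monoid.mult = (%(a, g) (b, h). (a \<otimes>{:M:} b \<otimes>{:M:} f g h, g \<otimes>{:Q:} h)),
  one = (inv{:M:} f \<one>{:Q:} \<one>{:Q:}, \<one>{:Q:})\<rparr>"

locale cocycle_context = M: comm_group M + Q: group Q
 for M :: "('m, 'n) monoid_scheme" (structure) and Q :: "('q, 'r) monoid_scheme" and f :: "'q => 'q => 'm" +
 assumes f_closed [simp]: "g : carrier Q ==> h : carrier Q ==> f g h : carrier M"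
  and cocycle: "[|g : carrier Q; h : carrier Q; k : carrier Q|] ==>
  f h k \<otimes> f g (h \<otimes>{:Q:} k) = f g h \<otimes> f (g \<otimes>{:Q:} h) k"
begin

abbreviation X where "X \<equiv> cocycle_ext M Q f"

definition f1 where "f1 = f \<one>{:Q:} \<one>{:Q:}"

lemma f1_closed [simp]: "f1 : carrier M"
 by (simp add: f1_def)

definition incl :: "'m => 'm \<times> 'q" where "incl a = (a \<otimes> inv f1, \<one>{:Q:})"

lemma X_simps [simp]:
 "(a, g) : carrier X \<longleftrightarrow> a : carrier M & g : carrier Q"
 "(a, g) \<otimes>{:X:} (b, h) = (a \<otimes> b \<otimes> f g h, g \<otimes>{:Q:} h)" "\<one>{:X:} = (inv f1, \<one>{:Q:})"
 by (simp_all add: cocycle_ext_def f1_def)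

lemma f_one [simp]: "h : carrier Q ==> f \<one>{:Q:} h = f1" "h : carrier Q ==> f h \<one>{:Q:} = f1"
 using cocycle[of "\<one>{:Q:}" "\<one>{:Q:}" h] cocycle[of h "\<one>{:Q:}" "\<one>{:Q:}"] by (simp_all add: f1_def)

lemma group_X: "group X"
proof (rule groupI)
 fix x y z assume "x : carrier X" "y : carrier X" "z : carrier X"
 then obtain a g b h c k where x: "x = (a, g)" "y = (b, h)" "z = (c, k)" "a : carrier M" "b : carrier M"
  "c : carrier M" and g: "g : carrier Q" "h : carrier Q" "k : carrier Q"
  by (cases x, cases y, cases z) auto
 have "a \<otimes> b \<otimes> f g h \<otimes> c \<otimes> f (g \<otimes>{:Q:} h) k = a \<otimes> b \<otimes> c \<otimes> (f g h \<otimes> f (g \<otimes>{:Q:} h) k)"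
  using x g by (simp add: M.m_ac)
 also have "\<dots> = a \<otimes> (b \<otimes> c \<otimes> f h k) \<otimes> f g (h \<otimes>{:Q:} k)"
  using x g by (simp add: cocycle[OF g, symmetric] M.m_ac)
 finally show "x \<otimes>{:X:} y \<otimes>{:X:} z = x \<otimes>{:X:} (y \<otimes>{:X:} z)"
  using x g by (simp add: Q.m_assoc)
next
 fix x assume "x : carrier X"
 then obtain a g where x: "x = (a, g)" "a : carrier M" "g : carrier Q" by (cases x) auto
 show "\<one>{:X:} \<otimes>{:X:} x = x"
  using x by (simp add: M.m_ac)
 let ?y = "(inv (a \<otimes> f (inv{:Q:} g) g \<otimes> f1), inv{:Q:} g)"
 have "?y \<otimes>{:X:} x = \<one>{:X:}"
  using x by (simp add: M.inv_mult M.m_ac)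
 moreover have "?y : carrier X" using x by simp
 ultimately show "EX y:carrier X. y \<otimes>{:X:} x = \<one>{:X:}" by blast
qed auto

sublocale X: group X by (rule group_X)

lemma incl_center: "a : carrier M ==> incl a : group_center X"
 by (auto simp: group_center_def incl_def M.m_ac)

lemma incl_hom: "incl : hom M X"
 by (rule homI) (simp_all add: incl_def M.m_ac)

lemma incl_inj: "a : carrier M ==> b : carrier M ==> incl a = incl b ==> a = b"
 by (simp add: incl_def)

lemma snd_X_hom: "snd : hom X Q"
 by (rule homI) auto

text \<open>The lift is defined on G and not on Q, so that an extension of a finite quotient Q
  yields a map from the exterior square of G itself.\<close>

lemma lift_X:
 assumes "p : hom G Q" "group G"
 shows "lift_context G X (%g. (\<one>, p g))"
  and "g : carrier G ==> h : carrier G ==> zeta G X (%g. (\<one>, p g)) g h = incl (f (p g) (p h))"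
proof -
 interpret p: group_hom G Q p using assms by (simp add: group_hom_defs)
 have *: "(\<one>, p g) \<otimes>{:X:} (\<one>, p h) = incl (f (p g) (p h)) \<otimes>{:X:} (\<one>, p (g \<otimes>{:G:} h))"
  if "g : carrier G" "h : carrier G" for g h
  using that by (simp add: incl_def M.m_assoc)
 show "lift_context G X (%g. (\<one>, p g))"
  using * incl_center by unfold_locales (auto simp: central_lift_def)
 then interpret L: lift_context G X "%g. (\<one>, p g)" .
 show "zeta G X (%g. (\<one>, p g)) g h = incl (f (p g) (p h))" if g: "g : carrier G" "h : carrier G"
  using L.zeta_eq(2)[OF g] *[OF g] L.zeta_closed[OF g] group_centerD(1)[OF incl_center] g
  X.right_cancel[of "(\<one>, p (g \<otimes>{:G:} h))" "zeta G X (%g. (\<one>, p g)) g h" "incl (f (p g) (p h))"] by simp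
qed

end

section \<open>Extensions by chains modulo boundaries\<close>

abbreviation B2 :: "('q, 'r) monoid_scheme => ('c, 'm) monoid_scheme => ('q list => 'c) set" where
 "B2 Q B \<equiv> bar_boundary Q B 3 ` carrier (bar_chains Q B 3)"

abbreviation chain_cocycle where
 "chain_cocycle Q B L u \<equiv> (%g h. L #>{:bar_chains Q B 2:} bas Q B [g, h] u)"

lemma B2_subgroup: "comm_group B ==> group Q ==> subgroup (B2 Q B) (bar_chains Q B 2)"
 by (intro group_hom.img_is_subgroup) (simp add: group_hom_defs bar_boundary_hom2 comm_group.axioms)

locale chain_ext_context =
 fixes Q :: "('q, 'r) monoid_scheme" and B :: "('c, 'm) monoid_scheme" and L and u
 assumes Q: "group Q" and B: "comm_group B" and u: "u : carrier B"
  and L: "subgroup L (bar_chains Q B 2)" "B2 Q B \<subseteq> L"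
begin

abbreviation C2 where "C2 \<equiv> bar_chains Q B 2"

sublocale Q: group Q by (rule Q)
sublocale B: comm_group B by (rule B)
sublocale C2: comm_group C2 by (rule comm_group_bar_chains[OF B])
sublocale L: normal L C2 by (rule C2.subgroup_imp_normal[OF L(1)])

lemma bas2_closed [simp]: "b : carrier B ==> bas Q B [g, h] b : carrier C2"
 using B by simp

lemma L_hom: "(%c. L #>{:C2:} c) : hom C2 (C2 Mod L)"
 by (rule L.r_coset_hom_Mod)

text \<open>For the classes of [g|h] u the cocycle identity is the relation d [g|h|k] u = 0, which
  holds because \<open>L\<close> contains the boundaries.\<close>

sublocale cocycle_context "C2 Mod L" Q "chain_cocycle Q B L u"
proof (intro cocycle_context.intro cocycle_context_axioms.intro Q)
 show "comm_group (C2 Mod L)" by (rule C2.abelian_FactGroup[OF L(1)])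
 show "L #>{:C2:} bas Q B [g, h] u : carrier (C2 Mod L)" for g h
  using u by (auto simp: carrier_FactGroup)
 interpret l: group_hom C2 "C2 Mod L" "%c. L #>{:C2:} c"
  by (rule group_hom_mod_intro[OF L.normal_axioms])
 fix g h k assume g: "g : carrier Q" "h : carrier Q" "k : carrier Q"
 let ?a = "bas Q B [h, k] u" and ?b = "bas Q B [g \<otimes>{:Q:} h, k] u"
  and ?c = "bas Q B [g, h \<otimes>{:Q:} k] u" and ?d = "bas Q B [g, h] u"
 have "bar_boundary Q B 3 (bas Q B [g, h, k] u) = (?a \<otimes>{:C2:} ?c) \<otimes>{:C2:} inv{:C2:} (?d \<otimes>{:C2:} ?b)"
  using u g by (simp add: boundary3[OF B Q] C2.inv_mult C2.m_ac)
 moreover have "bar_boundary Q B 3 (bas Q B [g, h, k] u) : B2 Q B"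
  using B u by (intro imageI bas_closed) auto
 ultimately have "(?a \<otimes>{:C2:} ?c) \<otimes>{:C2:} inv{:C2:} (?d \<otimes>{:C2:} ?b) : L"
  using L(2) by auto
 then have "L #>{:C2:} (?a \<otimes>{:C2:} ?c) = L #>{:C2:} (?d \<otimes>{:C2:} ?b)"
  by (intro iffD2[OF L.rcos_eq_iff]) (auto simp: u)
 moreover have "L #>{:C2:} (?a \<otimes>{:C2:} ?c) = (L #>{:C2:} ?a) \<otimes>{:C2 Mod L:} (L #>{:C2:} ?c)"
  "L #>{:C2:} (?d \<otimes>{:C2:} ?b) = (L #>{:C2:} ?d) \<otimes>{:C2 Mod L:} (L #>{:C2:} ?b)"
  by (rule l.hom_mult; simp add: u)+
 ultimately show "(L #>{:C2:} ?a) \<otimes>{:C2 Mod L:} (L #>{:C2:} ?c) = (L #>{:C2:} ?d) \<otimes>{:C2 Mod L:} (L #>{:C2:} ?b)"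
  by (simp only:)
qed

text \<open>The extension is tautological: its cocycle sends the pair g, h to the class of [p g|p h]
  u, and basic chains determine the evaluation everywhere.\<close>

lemma Phi_X:
 assumes p: "p : hom G Q" "group G" and al: "al : hom ZZ B" "al 1 = u" and c: "c : carrier (bar_chains G ZZ 2)"
 shows "Phi G X (%g. (\<one>{:C2 Mod L:}, p g)) c = incl (L #>{:C2:} bar_map G ZZ Q p al 2 c)"
proof -
 interpret P: lift_context G X "%g. (\<one>{:C2 Mod L:}, p g)" by (rule lift_X[OF p])
 note bm = bar_map_hom[OF abelian_integer_group B p(2) Q p(1) al(1), of 2]
 have LX: "(%c. incl (L #>{:C2:} c)) : hom C2 X"
  using hom_compose[OF L_hom incl_hom] by (simp add: comp_def)
 interpret al: group_hom ZZ B al using al(1) B.is_group by (simp add: group_hom_defs)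
 show ?thesis
 proof (rule bar_hom_eqI[OF abelian_integer_group P.Phi_hom, where k = "%c. incl (L #>{:C2:} bar_map G ZZ Q p al 2 c)", OF _ _ _ c])
  show "(%c. incl (L #>{:C2:} bar_map G ZZ Q p al 2 c)) : hom (bar_chains G ZZ 2) X"
  using hom_compose[OF bm LX] by (simp add: comp_def)
  fix t and n :: int assume t: "t : tuples 2 G"
  then obtain g h where g: "t = [g, h]" "g : carrier G" "h : carrier G" by (auto simp: tuples_2)
  then have pg: "p g : carrier Q" "p h : carrier Q" using hom_in_carrier[OF p(1)] by auto
  have "al n = u [^]{:B:} n"
  using al.hom_int_pow[of 1 n] al(2) by simp
  then have "bas Q B [p g, p h] (al n) = bas Q B [p g, p h] u [^]{:C2:} n"
  using hom_int_pow[OF bas_hom[OF B, of "[p g, p h]" 2 Q] u B.is_group C2.is_group] pg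
  by (simp add: tuples_2)
  then have "incl (L #>{:C2:} bas Q B [p g, p h] (al n)) = incl (L #>{:C2:} bas Q B [p g, p h] u) [^]{:X:} n"
  using hom_int_pow[OF LX bas2_closed[OF u] C2.is_group X.is_group] by simp
  then show "Phi G X (%g. (\<one>{:C2 Mod L:}, p g)) (bas G ZZ t n) = incl (L #>{:C2:} bar_map G ZZ Q p al 2 (bas G ZZ t n))"
  using g t by (simp add: P.Phi_bas lift_X(2)[OF p] bar_map_bas[OF abelian_integer_group B p(1) al(1) t[unfolded g(1)]]
    del: one_FactGroup)
 qed (rule X.is_group)
qed

end

abbreviation univ_ext where
 "univ_ext G \<equiv> cocycle_ext (bar_chains G ZZ 2 Mod B2 G ZZ) G (chain_cocycle G ZZ (B2 G ZZ) 1)"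

lemma univ_ext_context: "group G ==> chain_ext_context G ZZ (B2 G ZZ) 1"
 by (intro chain_ext_context.intro) (simp_all add: abelian_integer_group B2_subgroup)

text \<open>An element over the identity of G is mapped into the kernel of the universal extension,
  whose elements are classes of 2-chains modulo boundaries; a representing chain is chosen. The
  homomorphism f is quantified inside the choice, as its values on wedges determine it.\<close>

definition cycle_of :: "('a, 'b) monoid_scheme => ('a + 'a) gword set set => 'a list => int" where
 "cycle_of G x = (SOME z. z : carrier (bar_chains G ZZ 2) &
  (EX f : hom (exterior_square G) (univ_ext G).
   (ALL g : carrier G. ALL h : carrier G. f (wedge G g h) =
    comm_elt (univ_ext G) (\<one>{:bar_chains G ZZ 2 Mod B2 G ZZ:}, g) (\<one>{:bar_chains G ZZ 2 Mod B2 G ZZ:}, h)) &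
   f x = cocycle_context.incl (bar_chains G ZZ 2 Mod B2 G ZZ) G (chain_cocycle G ZZ (B2 G ZZ) 1)
    (B2 G ZZ #>{:bar_chains G ZZ 2:} z)))"

lemma exterior_hom_eqI:
 assumes "group G" "f : hom (exterior_square G) E" "f' : hom (exterior_square G) E" "group E"
  and eq: "!!g h. g : carrier G ==> h : carrier G ==> f (wedge G g h) = f' (wedge G g h)"
  and x: "x : carrier (exterior_square G)"
 shows "f x = f' x"
proof -
 interpret X: exterior_context G "ext_nu G" "ext_left G" "ext_right G" "ext_fold G"
  by (rule ext_context[OF assms(1)])
 interpret T: group "exterior_square G" by (rule group_exterior_square[OF assms(1)])
 interpret f: group_hom "exterior_square G" E f using assms T.is_group by (simp add: group_hom_defs)
 interpret f': group_hom "exterior_square G" E f' using assms T.is_group by (simp add: group_hom_defs)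
 note e = exterior_square_eq[OF assms(1)]
 have ce: "carrier (exterior_square G) = X.T" and me: "monoid.mult (exterior_square G) = monoid.mult (ext_nu G)"
  and oe: "\<one>{:exterior_square G:} = \<one>{:ext_nu G:}" by (simp_all add: e)
 have ie: "inv{:exterior_square G:} t = inv{:ext_nu G:} t" if "t : X.T" for t
  unfolding e using X.V.m_inv_consistent[OF X.T_subgroup that] .
 have "x : X.T" using x by (simp add: ce)
 then show ?thesis
 proof (induction rule: X.T_induct)
  case (w g h) then show ?case using eq by (simp add: wedge_eq[OF assms(1)])
 next
  case one show ?case using f.hom_one f'.hom_one by (simp add: oe)
 next
  case (mult s t) then show ?case using f.hom_mult[of s t] f'.hom_mult[of s t] by (simp add: ce me)
 next
  case (inv t) then show ?case using f.hom_inv[of t] f'.hom_inv[of t] by (simp add: ce ie)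
 qed
qed

lemma ext_fold_hom: "group G ==> ext_fold G : hom (exterior_square G) G"
 and ext_fold_wedge: "group G ==> g : carrier G ==> h : carrier G ==> ext_fold G (wedge G g h) = comm_elt G g h"
 and wedge_closed: "group G ==> g : carrier G ==> h : carrier G ==> wedge G g h : carrier (exterior_square G)"
proof -
 assume G: "group G"
 then interpret X: exterior_context G "ext_nu G" "ext_left G" "ext_right G" "ext_fold G"
  by (rule ext_context)
 show "ext_fold G : hom (exterior_square G) G"
  using X.e_hom by (auto simp: exterior_square_eq[OF G] hom_def)
 show "ext_fold G (wedge G g h) = comm_elt G g h" "wedge G g h : carrier (exterior_square G)"
  if "g : carrier G" "h : carrier G"
  using that X.e_w X.w_T by (simp_all add: wedge_eq[OF G] exterior_square_eq[OF G])
qed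

context lift_context
begin

sublocale U: chain_ext_context G ZZ "B2 G ZZ" 1 by (rule univ_ext_context[OF G.is_group])

text \<open>The universal extension maps to the target of any central lift: \<open>Phi\<close>
  factors through chains modulo boundaries, and (a, g) goes to the value at a times s g.\<close>

lemma univ_hom:
 obtains Th where "Th : hom U.X E" "!!g. g : carrier G ==> Th (\<one>{:U.C2 Mod B2 G ZZ:}, g) = s g"
  "!!c. c : carrier U.C2 ==> Th (U.incl (B2 G ZZ #>{:U.C2:} c)) = Phi G E s c"
proof -
 have P1: "Phi G E s c = \<one>{:center_group E:}" if "c : B2 G ZZ" for c
  using that Phi_boundary by auto
 obtain P where P: "P : hom (U.C2 Mod B2 G ZZ) (center_group E)"
  "!!c. c : carrier U.C2 ==> P (B2 G ZZ #>{:U.C2:} c) = Phi G E s c"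
  using FactGroup_hom_universal[OF Phi_hom_center U.L.normal_axioms Z.is_group P1] by blast
 interpret P: group_hom "U.C2 Mod B2 G ZZ" "center_group E" P using P(1) by unfold_locales
 have Pc: "P a : group_center E" "P a : carrier E" if "a : carrier (U.C2 Mod B2 G ZZ)" for a
  using P.hom_closed[OF that] group_centerD(1) by auto
 have Pf: "P (chain_cocycle G ZZ (B2 G ZZ) 1 g h) = zeta G E s g h" if "g : carrier G" "h : carrier G" for g h
  using that P(2)[OF U.bas2_closed, of 1 g h] Phi_bas[OF that, of 1] by simp
 let ?Th = "%(a, g). P a \<otimes>{:E:} s g"
 have hom: "?Th : hom U.X E"
 proof (rule homI)
  show "?Th x : carrier E" if "x : carrier U.X" for x using that Pc by (cases x) auto
  fix x y assume "x : carrier U.X" "y : carrier U.X"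
  then obtain a g b h where x: "x = (a, g)" "y = (b, h)" and a: "a : carrier (U.C2 Mod B2 G ZZ)"
  "b : carrier (U.C2 Mod B2 G ZZ)" and g: "g : carrier G" "h : carrier G"
  by (cases x, cases y) auto
  have "P (a \<otimes>{:U.C2 Mod B2 G ZZ:} b \<otimes>{:U.C2 Mod B2 G ZZ:} chain_cocycle G ZZ (B2 G ZZ) 1 g h)
   = P a \<otimes>{:E:} P b \<otimes>{:E:} zeta G E s g h"
  using a g P.hom_mult[of "a \<otimes>{:U.C2 Mod B2 G ZZ:} b" "chain_cocycle G ZZ (B2 G ZZ) 1 g h"] P.hom_mult[of a b]
  by (simp only: center_group_simps Pf U.f_closed U.M.m_closed)
  then have "?Th (x \<otimes>{:U.X:} y) = P a \<otimes>{:E:} P b \<otimes>{:E:} (zeta G E s g h \<otimes>{:E:} s (g \<otimes> h))"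
  using x a g Pc by (simp add: E.m_assoc del: mult_FactGroup)
  also have "\<dots> = P a \<otimes>{:E:} (P b \<otimes>{:E:} s g) \<otimes>{:E:} s h"
  using a g Pc by (simp add: E.m_assoc flip: zeta_eq(2))
  also have "P b \<otimes>{:E:} s g = s g \<otimes>{:E:} P b"
  using group_centerD(2)[OF Pc(1)[OF a(2)]] g by simp
  finally show "?Th (x \<otimes>{:U.X:} y) = ?Th x \<otimes>{:E:} ?Th y"
  using x a g Pc by (simp add: E.m_assoc)
 qed
 show thesis
 proof (rule that[OF hom])
  show "?Th (\<one>{:U.C2 Mod B2 G ZZ:}, g) = s g" if "g : carrier G" for g
  using that P.hom_one by simp
  fix c assume c: "c : carrier U.C2"
  let ?a = "B2 G ZZ #>{:U.C2:} c"
  have a: "?a : carrier (U.C2 Mod B2 G ZZ)" using c by (auto simp: carrier_FactGroup)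
  \<comment> \<open>The normalizing constant \<open>f1\<close> of the universal extension goes to s
    1, which cancels the s 1 contributed by the second component of \<open>incl\<close>.\<close>
  have z1: "zeta G E s \<one> \<one> = s \<one>" by (simp add: zeta_def E.m_assoc)
  have "P (?a \<otimes>{:U.C2 Mod B2 G ZZ:} inv{:U.C2 Mod B2 G ZZ:} U.f1) = P ?a \<otimes>{:E:} inv{:E:} s \<one>"
  proof -
  have "P U.f1 = s \<one>" using Pf[of \<one> \<one>] z1 by (simp only: U.f1_def G.one_closed)
  moreover have "s \<one> : group_center E" using zeta_eq(1)[of \<one> \<one>] z1 by simp
  ultimately have "P (inv{:U.C2 Mod B2 G ZZ:} U.f1) = inv{:E:} s \<one>"
   using P.hom_inv[OF U.f1_closed] center_group_inv[OF E.is_group] by simp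
  then show ?thesis
   using P.hom_mult[OF a U.M.inv_closed[OF U.f1_closed]] by (simp only: center_group_simps)
  qed
  then have "?Th (U.incl ?a) = P ?a \<otimes>{:E:} inv{:E:} s \<one> \<otimes>{:E:} s \<one>"
  by (simp add: U.incl_def del: mult_FactGroup)
  then show "?Th (U.incl ?a) = Phi G E s c"
  using Pc(2)[OF a] P(2)[OF c] by (simp add: E.m_assoc)
 qed
qed

end

text \<open>The map into the universal extension followed by \<open>univ_hom\<close> agrees with f'
  on wedges, hence everywhere. So a single chain computes the image of x under all central
  lifts.\<close>

lemma cycle_of:
 assumes G: "group G" and x: "x : carrier (exterior_square G)" "ext_fold G x = \<one>{:G:}"
 shows "cycle_of G x : carrier (bar_chains G ZZ 2)"
  and "[|lift_context G E s; f' : hom (exterior_square G) E;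
  !!g h. g : carrier G ==> h : carrier G ==> f' (wedge G g h) = comm_elt E (s g) (s h)|]
  ==> f' x = Phi G E s (cycle_of G x)"
proof -
 interpret U: chain_ext_context G ZZ "B2 G ZZ" 1 by (rule univ_ext_context[OF G])
 let ?s = "%g. (\<one>{:U.C2 Mod B2 G ZZ:}, g)"
 have id: "(%g. g) : hom G G" by (rule homI) auto
 interpret S: lift_context G U.X ?s by (rule U.lift_X(1)[OF id G])
 obtain f where f: "f : hom (exterior_square G) U.X"
  "!!g h. g : carrier G ==> h : carrier G ==> f (wedge G g h) = comm_elt U.X (?s g) (?s h)"
  using central_lift_hom[OF G U.group_X S.lift] by blast
 have "(%x. snd (f x)) : hom (exterior_square G) G"
  using hom_compose[OF f(1) U.snd_X_hom] by (simp add: comp_def)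
 moreover have "snd (f (wedge G g h)) = ext_fold G (wedge G g h)" if "g : carrier G" "h : carrier G" for g h
  using that hom_comm[OF U.snd_X_hom U.X.is_group G, of "?s g" "?s h"] by (simp add: f(2) ext_fold_wedge[OF G] del: one_FactGroup)
 ultimately have "snd (f x) = \<one>{:G:}"
  using exterior_hom_eqI[OF G _ ext_fold_hom[OF G] G, of "%x. snd (f x)" x] x by simp
 moreover have "f x : carrier U.X" using f(1) x(1) by (rule hom_in_carrier)
 ultimately obtain a where a: "f x = (a, \<one>{:G:})" "a : carrier (U.C2 Mod B2 G ZZ)"
  by (cases "f x") auto
 then have "a \<otimes>{:U.C2 Mod B2 G ZZ:} U.f1 : carrier (U.C2 Mod B2 G ZZ)"
  using U.M.m_closed[OF a(2) U.f1_closed] by simp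
 then obtain z where z: "z : carrier U.C2" "a \<otimes>{:U.C2 Mod B2 G ZZ:} U.f1 = B2 G ZZ #>{:U.C2:} z"
  unfolding carrier_FactGroup by blast
 have "a \<otimes>{:U.C2 Mod B2 G ZZ:} U.f1 \<otimes>{:U.C2 Mod B2 G ZZ:} inv{:U.C2 Mod B2 G ZZ:} U.f1 = a"
  using U.M.m_assoc[OF a(2) U.f1_closed U.M.inv_closed[OF U.f1_closed]] U.M.r_inv[OF U.f1_closed] U.M.r_one[OF a(2)]
  by (simp only:)
 then have "f x = U.incl (B2 G ZZ #>{:U.C2:} z)"
  by (simp only: a(1) U.incl_def z(2)[symmetric])
 then have ex: "EX z. z : carrier U.C2 & (EX f : hom (exterior_square G) U.X.
  (ALL g : carrier G. ALL h : carrier G. f (wedge G g h) = comm_elt U.X (?s g) (?s h)) &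
  f x = U.incl (B2 G ZZ #>{:U.C2:} z))"
  using f z(1) by blast
 from someI_ex[OF ex, folded cycle_of_def]
 obtain f where zc: "cycle_of G x : carrier U.C2" and f: "f : hom (exterior_square G) U.X"
  "ALL g : carrier G. ALL h : carrier G. f (wedge G g h) = comm_elt U.X (?s g) (?s h)"
  "f x = U.incl (B2 G ZZ #>{:U.C2:} cycle_of G x)" by blast
 show "cycle_of G x : carrier (bar_chains G ZZ 2)" by (rule zc)
 show "f' x = Phi G E s (cycle_of G x)" if E: "lift_context G E s" and f': "f' : hom (exterior_square G) E"
  "!!g h. g : carrier G ==> h : carrier G ==> f' (wedge G g h) = comm_elt E (s g) (s h)"
 proof -
  interpret E: lift_context G E s by (rule E)
  obtain Th where Th: "Th : hom U.X E" "!!g. g : carrier G ==> Th (?s g) = s g"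
  "!!c. c : carrier U.C2 ==> Th (U.incl (B2 G ZZ #>{:U.C2:} c)) = Phi G E s c"
  using E.univ_hom by blast
  have h: "(%x. Th (f x)) : hom (exterior_square G) E"
  using hom_compose[OF f(1) Th(1)] by (simp add: comp_def)
  have "f' x = Th (f x)"
  proof (rule exterior_hom_eqI[OF G f'(1) h E.E.is_group _ x(1)])
  show "f' (wedge G g h) = Th (f (wedge G g h))" if g: "g : carrier G" "h : carrier G" for g h
  proof -
   have "Th (f (wedge G g h)) = Th (comm_elt U.X (?s g) (?s h))" using f(2) g by simp
   also have "\<dots> = comm_elt E (Th (?s g)) (Th (?s h))"
    by (rule hom_comm[OF Th(1) U.X.is_group E.E.is_group]) (use S.s_closed g in blast)+
   finally show ?thesis using g Th(2) f'(2) by simp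
  qed
  qed
  also have "\<dots> = Phi G E s (cycle_of G x)" using f(3) Th(3)[OF zc] by simp
  finally show ?thesis .
 qed
qed

section \<open>Homology in degree two\<close>

lemma mon_iff_cycles:
 fixes C C' :: "nat => ('c, 'm) monoid_scheme" and d d'
 assumes C: "comm_group (C 2)" "comm_group (C 1)" "comm_group (C 3)" "d 2 : hom (C 2) (C 1)" "d 3 : hom (C 3) (C 2)"
  "ALL c : carrier (C 3). d 2 (d 3 c) = \<one>{:C 1:}"
 shows "subgroup (d 3 ` carrier (C 3)) (C 2)" "d 3 ` carrier (C 3) \<subseteq> kernel (C 2) (C 1) (d 2)"
  "group (homology C d 2)" "\<one>{:homology C d 2:} = d 3 ` carrier (C 3)"
  "carrier (homology C d 2) = (%z. d 3 ` carrier (C 3) #>{:C 2:} z) ` kernel (C 2) (C 1) (d 2)"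
  "!!x y. x : kernel (C 2) (C 1) (d 2) ==> y : kernel (C 2) (C 1) (d 2) ==>
  (d 3 ` carrier (C 3) #>{:C 2:} x) \<otimes>{:homology C d 2:} (d 3 ` carrier (C 3) #>{:C 2:} y) = d 3 ` carrier (C 3) #>{:C 2:} (x \<otimes>{:C 2:} y)"
proof -
 interpret C2: comm_group "C 2" by fact
 interpret C1: comm_group "C 1" by fact
 interpret C3: comm_group "C 3" by fact
 interpret d2: group_hom "C 2" "C 1" "d 2" using C(4) by unfold_locales
 interpret d3: group_hom "C 3" "C 2" "d 3" using C(5) by unfold_locales
 let ?B = "d 3 ` carrier (C 3)" and ?Z = "kernel (C 2) (C 1) (d 2)"
 let ?K = "(C 2)\<lparr>carrier := ?Z\<rparr>"
 show B: "subgroup ?B (C 2)" by (rule d3.img_is_subgroup)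
 show BZ: "?B \<subseteq> ?Z" using C(6) by (auto simp: kernel_def)
 have Z: "subgroup ?Z (C 2)" by (rule d2.subgroup_kernel)
 interpret K: group ?K by (rule C2.subgroup_imp_group[OF Z])
 have "?B \<lhd> ?K"
  by (rule C2.normal_restrict_supergroup[OF Z C2.subgroup_imp_normal[OF B] BZ])
 then interpret N: normal ?B ?K .
 have h: "homology C d 2 = ?K Mod ?B" by (simp add: homology_def numeral_3_eq_3[symmetric])
 \<comment> \<open>Cosets formed in the group of cycles and in the whole chain group are the same
   sets.\<close>
 have rc: "?B #>{:?K:} z = ?B #>{:C 2:} z" for z by (simp add: r_coset_def)
 show "group (homology C d 2)" unfolding h by (rule N.factorgroup_is_group)
 show "\<one>{:homology C d 2:} = ?B" by (simp add: h)
 show "carrier (homology C d 2) = (%z. ?B #>{:C 2:} z) ` ?Z" by (simp add: h carrier_FactGroup rc)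
 show "(?B #>{:C 2:} x) \<otimes>{:homology C d 2:} (?B #>{:C 2:} y) = ?B #>{:C 2:} (x \<otimes>{:C 2:} y)"
  if "x : ?Z" "y : ?Z" for x y
  using N.rcos_sum[of x y] that by (simp add: h rc)
qed

lemma homology_map_class:
 fixes C' :: "nat => ('c, 'm) monoid_scheme"
 assumes "comm_group C" "comm_group (C' 2)" "subgroup B C" "subgroup (d' 3 ` carrier (C' 3)) (C' 2)" "f : hom C (C' 2)"
  and fB: "ALL b : B. f b : d' 3 ` carrier (C' 3)" and z: "z : carrier C"
 shows "homology_map C' d' 2 f (B #>{:C:} z) = d' 3 ` carrier (C' 3) #>{:C' 2:} f z"
proof -
 interpret C: comm_group C by fact
 interpret D: comm_group "C' 2" by fact
 interpret f: group_hom C "C' 2" f using assms by unfold_locales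
 let ?B = "d' 3 ` carrier (C' 3)"
 interpret B: subgroup ?B "C' 2" by fact
 have Bc: "b : carrier C" if "b : B" for b using subgroup.mem_carrier[OF assms(3) that] .
 have "?B <#>{:C' 2:} (f ` (B #>{:C:} z)) = ?B #>{:C' 2:} f z"
 proof
  show "?B <#>{:C' 2:} (f ` (B #>{:C:} z)) \<subseteq> ?B #>{:C' 2:} f z"
  proof
  fix x assume "x : ?B <#>{:C' 2:} (f ` (B #>{:C:} z))"
  then obtain c b where c: "c : ?B" "b : B" "x = c \<otimes>{:C' 2:} f (b \<otimes>{:C:} z)"
   unfolding set_mult_def r_coset_def by blast
  have "x = (c \<otimes>{:C' 2:} f b) \<otimes>{:C' 2:} f z"
   using c Bc z B.mem_carrier[OF c(1)] by (simp add: D.m_assoc)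
  moreover have "c \<otimes>{:C' 2:} f b : ?B" by (rule B.m_closed[OF c(1) bspec[OF fB c(2)]])
  ultimately show "x : ?B #>{:C' 2:} f z" unfolding r_coset_def by blast
  qed
  show "?B #>{:C' 2:} f z \<subseteq> ?B <#>{:C' 2:} (f ` (B #>{:C:} z))"
  using C.rcos_self[OF z assms(3)] unfolding set_mult_def r_coset_def by blast
 qed
 then show ?thesis by (simp add: homology_map_def numeral_3_eq_3[symmetric])
qed

text \<open>The class of z goes to the class of f z, so triviality of the kernel means that f
  reflects boundaries among cycles.\<close>

lemma homology_map_mon_iff:
 fixes C :: "nat => ('c, 'm) monoid_scheme" and C' :: "nat => ('e, 'k) monoid_scheme" and d d'
 assumes C: "comm_group (C 2)" "comm_group (C 1)" "comm_group (C 3)" "d 2 : hom (C 2) (C 1)" "d 3 : hom (C 3) (C 2)"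
  "ALL c : carrier (C 3). d 2 (d 3 c) = \<one>{:C 1:}"
 and C': "comm_group (C' 2)" "comm_group (C' 1)" "comm_group (C' 3)" "d' 2 : hom (C' 2) (C' 1)" "d' 3 : hom (C' 3) (C' 2)"
  "ALL c : carrier (C' 3). d' 2 (d' 3 c) = \<one>{:C' 1:}"
 and f: "f : hom (C 2) (C' 2)" "ALL z : kernel (C 2) (C 1) (d 2). f z : kernel (C' 2) (C' 1) (d' 2)"
  "ALL b : d 3 ` carrier (C 3). f b : d' 3 ` carrier (C' 3)"
 shows "homology_map C' d' 2 f : mon (homology C d 2) (homology C' d' 2) \<longleftrightarrow>
  (ALL z : kernel (C 2) (C 1) (d 2). f z : d' 3 ` carrier (C' 3) --> z : d 3 ` carrier (C 3))"
proof -
 note H = mon_iff_cycles[OF C] and H' = mon_iff_cycles[OF C']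
 let ?Z = "kernel (C 2) (C 1) (d 2)" and ?B = "d 3 ` carrier (C 3)" and ?B' = "d' 3 ` carrier (C' 3)"
 interpret B: normal ?B "C 2" by (rule comm_group.subgroup_imp_normal[OF C(1) H(1)])
 interpret B': normal ?B' "C' 2" by (rule comm_group.subgroup_imp_normal[OF C'(1) H'(1)])
 interpret f: group_hom "C 2" "C' 2" f using f(1) by unfold_locales
 interpret d2: group_hom "C 2" "C 1" "d 2" using C by (simp add: group_hom_defs comm_group_def)
 have Z: "z : carrier (C 2)" if "z : ?Z" for z using that by (simp add: kernel_def)
 have cl: "homology_map C' d' 2 f (?B #>{:C 2:} z) = ?B' #>{:C' 2:} f z" if "z : ?Z" for z
  by (rule homology_map_class[where C' = C' and d' = d', OF C(1) C'(1) H(1) H'(1) f(1,3) Z[OF that]])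
 have hom: "homology_map C' d' 2 f : hom (homology C d 2) (homology C' d' 2)"
 proof (rule homI)
  show "homology_map C' d' 2 f x : carrier (homology C' d' 2)" if "x : carrier (homology C d 2)" for x
  using that cl f(2) by (auto simp: H(5) H'(5))
  fix x y assume "x : carrier (homology C d 2)" "y : carrier (homology C d 2)"
  then obtain a b where x: "x = ?B #>{:C 2:} a" "y = ?B #>{:C 2:} b" and a: "a : ?Z" "b : ?Z"
  by (auto simp: H(5))
  have "a \<otimes>{:C 2:} b : ?Z" using d2.subgroup_kernel a by (simp add: subgroup.m_closed)
  then show "homology_map C' d' 2 f (x \<otimes>{:homology C d 2:} y) = homology_map C' d' 2 f x \<otimes>{:homology C' d' 2:} homology_map C' d' 2 f y"
  using x a Z f(2) by (simp add: H(6) H'(6) cl)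
 qed
 have e: "(homology_map C' d' 2 f (?B #>{:C 2:} z) = ?B') = (f z : ?B')" "(?B #>{:C 2:} z = ?B) = (z : ?B)"
  if "z : ?Z" for z
  using B.rcos_eq_one_iff[OF Z[OF that]] B'.rcos_eq_one_iff[OF f.hom_closed[OF Z[OF that]]] cl[OF that] by simp_all
 have "(ALL x. x : carrier (homology C d 2) & homology_map C' d' 2 f x = ?B' --> x = ?B)
  = (ALL z : ?Z. homology_map C' d' 2 f (?B #>{:C 2:} z) = ?B' --> ?B #>{:C 2:} z = ?B)"
  unfolding H(5) by blast
 also have "\<dots> = (ALL z : ?Z. f z : ?B' --> z : ?B)"
  by (rule ball_cong[OF HOL.refl]) (simp only: e)
 finally show ?thesis
  unfolding mon_iff_hom_one[OF H(3) H'(3)] H(4) H'(4) using hom by simp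
qed

lemma bar_complex:
 assumes "comm_group B" "group Q"
 shows "comm_group (bar_chains Q B n)" "bar_boundary Q B 2 : hom (bar_chains Q B 2) (bar_chains Q B 1)"
  "bar_boundary Q B 3 : hom (bar_chains Q B 3) (bar_chains Q B 2)"
  "ALL c : carrier (bar_chains Q B 3). bar_boundary Q B 2 (bar_boundary Q B 3 c) = \<one>{:bar_chains Q B 1:}"
 using bar_boundary_hom2[OF assms] comm_group_bar_chains[OF assms(1)] boundary_boundary[OF assms] by auto

abbreviation Z2 :: "('q, 'r) monoid_scheme => ('c, 'm) monoid_scheme => ('q list => 'c) set" where
 "Z2 Q B \<equiv> kernel (bar_chains Q B 2) (bar_chains Q B 1) (bar_boundary Q B 2)"

text \<open>Otherwise the class of z and the zero class would have the same image at every index of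
  the limit.\<close>

lemma H2_limit_injective_nonboundary:
 assumes G: "group G" and I: "!!U. U : I ==> U \<lhd> G" and inj: "H2_to_limit_injective G I"
  and z: "z : Z2 G ZZ" "z ~: B2 G ZZ"
 obtains U where "U : I" "bar_map G ZZ (G Mod U) (%g. U #>{:G:} g) id 2 z ~: B2 (G Mod U) ZZ"
proof (rule ccontr)
 note th = that
 assume "~ thesis"
 then have all: "bar_map G ZZ (G Mod U) (%g. U #>{:G:} g) id 2 z : B2 (G Mod U) ZZ" if "U : I" for U
  using th[OF that] by blast
 note A = abelian_integer_group
 note H = mon_iff_cycles[where C = "bar_chains G ZZ" and d = "bar_boundary G ZZ", OF bar_complex(1)[OF A G] bar_complex(1)[OF A G] bar_complex(1)[OF A G] bar_complex(2-)[OF A G]]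
 let ?X = "B2 G ZZ #>{:bar_chains G ZZ 2:} z" and ?O = "B2 G ZZ #>{:bar_chains G ZZ 2:} \<one>{:bar_chains G ZZ 2:}"
 interpret C2: comm_group "bar_chains G ZZ 2" by (rule comm_group_bar_chains[OF A])
 interpret B: normal "B2 G ZZ" "bar_chains G ZZ 2" by (rule C2.subgroup_imp_normal[OF H(1)])
 have one: "\<one>{:bar_chains G ZZ 2:} : Z2 G ZZ" using H(2) B.one_closed by blast
 have zc: "z : carrier (bar_chains G ZZ 2)" using z by (simp add: kernel_def)
 have "to_lim_homology 2 G I ZZ ?X = to_lim_homology 2 G I ZZ ?O"
  unfolding to_lim_homology_def
 proof (rule restrict_ext)
  fix U assume U: "U : I"
  interpret U: normal U G by (rule I[OF U])
  interpret Q: group "G Mod U" by (rule U.factorgroup_is_group)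
  let ?f = "bar_map G ZZ (G Mod U) (%g. U #>{:G:} g) id 2"
  have id: "id : hom ZZ ZZ" by (simp add: hom_def)
  have f: "?f : hom (bar_chains G ZZ 2) (bar_chains (G Mod U) ZZ 2)"
  by (rule bar_map_hom[OF A A G Q.is_group U.r_coset_hom_Mod id])
  interpret C2': comm_group "bar_chains (G Mod U) ZZ 2" by (rule comm_group_bar_chains[OF A])
  interpret B': normal "B2 (G Mod U) ZZ" "bar_chains (G Mod U) ZZ 2"
  by (rule C2'.subgroup_imp_normal[OF B2_subgroup[OF A Q.is_group]])
  have fB: "ALL b : B2 G ZZ. ?f b : B2 (G Mod U) ZZ"
  proof
  fix b assume b: "b : B2 G ZZ"
  obtain c where c: "c : carrier (bar_chains G ZZ 3)" "b = bar_boundary G ZZ 3 c" using b by blast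
  have "?f b = bar_boundary (G Mod U) ZZ 3 (bar_map G ZZ (G Mod U) (%g. U #>{:G:} g) id 3 c)"
   unfolding c(2) by (rule bar_map_boundary(2)[OF A A G Q.is_group U.r_coset_hom_Mod id c(1)])
  then show "?f b : B2 (G Mod U) ZZ"
   using hom_in_carrier[OF bar_map_hom[OF A A G Q.is_group U.r_coset_hom_Mod id] c(1)] by blast
  qed
  note cl = homology_map_class[where C' = "bar_chains (G Mod U) ZZ" and d' = "bar_boundary (G Mod U) ZZ",
   OF C2.comm_group_axioms C2'.comm_group_axioms B.subgroup_axioms B'.subgroup_axioms f fB]
  have "B2 (G Mod U) ZZ #>{:bar_chains (G Mod U) ZZ 2:} ?f z = B2 (G Mod U) ZZ"
  using all[OF U] B'.rcos_eq_one_iff hom_in_carrier[OF f zc] by blast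
  moreover have "B2 (G Mod U) ZZ #>{:bar_chains (G Mod U) ZZ 2:} ?f \<one>{:bar_chains G ZZ 2:} = B2 (G Mod U) ZZ"
  using bspec[OF fB B.one_closed] B'.rcos_eq_one_iff hom_in_carrier[OF f C2.one_closed] by blast
  ultimately show "group_homology_map 2 G (G Mod U) ZZ (%g. U #>{:G:} g) ?X = group_homology_map 2 G (G Mod U) ZZ (%g. U #>{:G:} g) ?O"
  using cl[OF zc] cl[OF C2.one_closed] by (simp only: group_homology_map_def)
 qed
 moreover have "?X : carrier (H2Z G)" "?O : carrier (H2Z G)"
  using z(1) one by (auto simp: group_homology_def H(5))
 moreover have "inj_on (to_lim_homology 2 G I ZZ) (carrier (H2Z G))"
  using inj by (simp add: H2_to_limit_injective_def mon_def)
 ultimately have "?X = ?O" by (simp add: inj_on_eq_iff)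
 then have "?X = B2 G ZZ" using B.rcos_eq_one_iff[OF C2.one_closed] B.one_closed by simp
 then show False using z(2) B.rcos_eq_one_iff[OF zc] by simp
qed

section \<open>Inverse limits\<close>

lemma inverse_limit_carrier:
 "x : carrier (inverse_limit I r F phf) \<longleftrightarrow>
  x : (\<Pi>\<^sub>E i\<in>I. carrier (F i)) & (ALL i:I. ALL j:I. r i j --> phf i j (x i) = x j)"
 by (simp add: inverse_limit_def)

lemma inverse_limit_simps:
 "x \<otimes>{:inverse_limit I r F phf:} y = (\<lambda>i\<in>I. x i \<otimes>{:F i:} y i)" "\<one>{:inverse_limit I r F phf:} = (\<lambda>i\<in>I. \<one>{:F i:})"
 by (simp_all add: inverse_limit_def)

lemma inverse_limit_subgroup:
 assumes F: "!!i. i : I ==> group (F i)" and phf: "!!i j. i : I ==> j : I ==> r i j ==> phf i j : hom (F i) (F j)"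
 shows "subgroup (carrier (inverse_limit I r F phf)) (product_group I F)"
proof (rule subgroup.intro)
 have gh: "group_hom (F i) (F j) (phf i j)" if "i : I" "j : I" "r i j" for i j
  using that F phf by (simp add: group_hom_defs)
 show "x \<otimes>{:product_group I F:} y : carrier (inverse_limit I r F phf)"
  if "x : carrier (inverse_limit I r F phf)" "y : carrier (inverse_limit I r F phf)" for x y
  using that group.is_monoid[OF F] group_hom.hom_mult[OF gh]
  by (auto simp: inverse_limit_carrier PiE_iff monoid.m_closed)
 show "\<one>{:product_group I F:} : carrier (inverse_limit I r F phf)"
  using group.is_monoid[OF F] group_hom.hom_one[OF gh]
  by (auto simp: inverse_limit_carrier PiE_iff monoid.one_closed)
 show "inv{:product_group I F:} x : carrier (inverse_limit I r F phf)"
  if "x : carrier (inverse_limit I r F phf)" for x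
  using that F group.inv_closed[OF F] group_hom.hom_inv[OF gh]
  by (auto simp: inverse_limit_carrier PiE_iff)
qed (auto simp: inverse_limit_def)

lemma inverse_limit_group:
 assumes "!!i. i : I ==> group (F i)" "!!i j. i : I ==> j : I ==> r i j ==> phf i j : hom (F i) (F j)"
 shows "group (inverse_limit I r F phf)"
proof -
 have "group ((product_group I F)\<lparr>carrier := carrier (inverse_limit I r F phf)\<rparr>)"
  by (rule group.subgroup_imp_group[OF product_group inverse_limit_subgroup]) (use assms in auto)
 then show ?thesis by (simp add: inverse_limit_def)
qed

lemma inverse_limit_comm_group:
 assumes F: "!!i. i : I ==> comm_group (F i)" and "!!i j. i : I ==> j : I ==> r i j ==> phf i j : hom (F i) (F j)"
 shows "comm_group (inverse_limit I r F phf)"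
proof (rule group.group_comm_groupI[OF inverse_limit_group])
 have cm: "a \<otimes>{:F i:} b = b \<otimes>{:F i:} a" if "i : I" "a : carrier (F i)" "b : carrier (F i)" for i a b
 proof -
  interpret comm_group "F i" by (rule F[OF that(1)])
  show ?thesis using that m_comm by simp
 qed
 show "x \<otimes>{:inverse_limit I r F phf:} y = y \<otimes>{:inverse_limit I r F phf:} x"
  if "x : carrier (inverse_limit I r F phf)" "y : carrier (inverse_limit I r F phf)" for x y
  using that cm by (auto simp: inverse_limit_simps inverse_limit_carrier PiE_iff intro!: restrict_ext)
qed (use assms in \<open>auto simp: comm_group_def\<close>)

lemma hom_into_inverse_limit:
 assumes "!!i. i : I ==> h i : hom H (F i)"
  and "!!i j x. i : I ==> j : I ==> r i j ==> x : carrier H ==> phf i j (h i x) = h j x"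
 shows "(%x. \<lambda>i\<in>I. h i x) : hom H (inverse_limit I r F phf)"
 using assms hom_mult[OF assms(1)] hom_in_carrier[OF assms(1)]
 by (intro homI) (auto simp: inverse_limit_carrier inverse_limit_simps intro!: restrict_ext)

lemma inverse_limit_proj: "i : I ==> (%x. x i) : hom (inverse_limit I r F phf) (F i)"
 by (intro homI) (auto simp: inverse_limit_carrier inverse_limit_simps)

text \<open>A product of finite discrete sets is compact, compatibility of two coordinates is a
  closed condition, and directedness gives the finite intersection property.\<close>

lemma inverse_limit_nonempty:
 assumes D: "!!i. i : I ==> finite (D i)" "!!i. i : I ==> D i ~= {}" and "I ~= {}"
  and r: "!!i j. i : I ==> j : I ==> EX k:I. r k i & r k j" "!!i j k. r i j ==> r j k ==> r i k"
  and phf: "!!i j x. i : I ==> j : I ==> r i j ==> x : D i ==> phf i j x : D j"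
  "!!i j k x. i : I ==> j : I ==> k : I ==> r i j ==> r j k ==> x : D i ==> phf j k (phf i j x) = phf i k x"
 shows "EX x : (\<Pi>\<^sub>E i\<in>I. D i). ALL i:I. ALL j:I. r i j --> phf i j (x i) = x j"
proof -
 let ?X = "product_topology (%i. discrete_topology (D i)) I"
 have X: "topspace ?X = (\<Pi>\<^sub>E i\<in>I. D i)" by simp
 have compact: "compact_space ?X"
  using D(1) by (simp add: compact_space_product_topology compact_space_discrete_topology)
 define K where "K = (%(i, j). {x : topspace ?X. phf i j (x i) = x j})"
 let ?J = "{(i, j). i : I & j : I & r i j}"
 have closed: "closedin ?X (K p)" if p: "p : ?J" for p
 proof -
  obtain i j where ij: "p = (i, j)" "i : I" "j : I" "r i j" using p by auto
  have pre: "closedin ?X {x : topspace ?X. x l : S}" if "l : I" "S \<subseteq> D l" for l S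
  by (rule closedin_continuous_map_preimage[OF continuous_map_product_projection[OF that(1)]])
   (use that in simp)
  \<comment> \<open>As \<open>D i\<close> is finite, the condition is a finite union of closed
    cylinders.\<close>
  have "K p = (UN a: D i. {x : topspace ?X. x i : {a}} \<inter> {x : topspace ?X. x j : {phf i j a}})"
  using ij by (auto simp: K_def PiE_iff)
  moreover have "closedin ?X ({x : topspace ?X. x i : {a}} \<inter> {x : topspace ?X. x j : {phf i j a}})" if "a : D i" for a
  using that ij phf(1) by (intro closedin_Int pre) auto
  ultimately show ?thesis using D(1)[OF ij(2)] by (auto intro!: closedin_Union)
 qed
 have fip: "\<Inter> (K ` F) \<inter> topspace ?X ~= {}" if F: "finite F" "F \<subseteq> ?J" for F
 proof -
  have "EX k:I. ALL (i, j) : F. r k i & r k j"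
  using F
  proof (induction F)
  case empty then show ?case using \<open>I ~= {}\<close> by auto
  next
  case (insert p F)
  obtain i j where ij: "p = (i, j)" "i : I" "j : I" using insert.prems by auto
  obtain k where k: "k : I" "ALL (i, j) : F. r k i & r k j" using insert by auto
  obtain l where l: "l : I" "r l i" "r l j" using r(1)[OF ij(2,3)] by blast
  obtain m where m: "m : I" "r m k" "r m l" using r(1)[OF k(1) l(1)] by blast
  have "ALL (i, j) : insert p F. r m i & r m j"
   using k(2) ij(1) r(2)[OF m(2)] r(2)[OF m(3) l(2)] r(2)[OF m(3) l(3)] by auto
  then show ?case using m(1) by blast
  qed
  then obtain k where k: "k : I" "ALL (i, j) : F. r k i & r k j" by blast
  obtain d where d: "d : D k" using D(2)[OF k(1)] by blast
  \<comment> \<open>A common index k serves finitely many conditions at once; coordinates not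
    reached from k are filled arbitrarily.\<close>
  define x where "x = (\<lambda>l\<in>I. if r k l then phf k l d else (SOME a. a : D l))"
  have "x l : D l" if "l : I" for l
  using that d k(1) phf(1) D(2) by (auto simp: x_def some_in_eq)
  then have xX: "x : topspace ?X" by (auto simp: x_def)
  moreover have "x : K p" if p: "p : F" for p
  proof -
  obtain i j where ij: "p = (i, j)" "i : I" "j : I" "r i j" using p F(2) by auto
  then have "r k i" "r k j" using k(2) p by auto
  then have "phf i j (x i) = x j" using ij phf(2)[OF k(1) ij(2,3) _ ij(4) d] by (simp add: x_def)
  then show ?thesis using xX ij by (simp add: K_def)
  qed
  ultimately show ?thesis by blast
 qed
 have "\<Inter> (K ` ?J) \<inter> topspace ?X ~= {}"
 proof -
  \<comment> \<open>Adding the whole space to the family keeps the intersection inside it.\<close>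
  let ?U = "insert (topspace ?X) (K ` ?J)"
  have ff: "\<Inter> F ~= {}" if F: "finite F" "F \<subseteq> ?U" for F
  proof -
  have fin: "finite (F - {topspace ?X})" and sub: "F - {topspace ?X} \<subseteq> K ` ?J"
   using F by (simp, simp only: Diff_subset_conv) (simp only: insert_is_Un[symmetric] F(2))
  from finite_subset_image[OF fin sub]
  obtain F' where F': "F' \<subseteq> ?J" "finite F'" "F - {topspace ?X} = K ` F'"
   by (elim exE conjE) (rule that)
  have "x : \<Inter> F" if "x : \<Inter> (K ` F') \<inter> topspace ?X" for x
  proof
   fix Y assume "Y : F"
   then have "Y = topspace ?X | Y : K ` F'" unfolding F'(3)[symmetric] by simp
   then show "x : Y" using that by auto
  qed
  then show ?thesis using fip[OF F'(2,1)] by (metis all_not_in_conv)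
  qed
  have cf: "ALL C : ?U. closedin ?X C" using closed by (auto simp del: topspace_product_topology)
  have ff': "finite F & F \<subseteq> ?U --> \<Inter> F ~= {}" for F
  by (rule impI, rule ff, erule conjunct1, erule conjunct2)
  have "\<Inter> ?U ~= {}"
  by (rule compact_space_fip[THEN iffD1, OF compact, THEN spec, THEN mp, OF conjI[OF cf allI[OF ff']]])
  then show ?thesis by (subst Int_commute) (subst Inter_insert[symmetric])
 qed
 then obtain x where x0: "x : \<Inter> (K ` ?J) \<inter> topspace ?X"
  unfolding ex_in_conv[symmetric] by (rule exE)
 have x: "x : topspace ?X" "!!p. p : ?J ==> x : K p"
  using IntD2[OF x0] INT_D[OF IntD1[OF x0]] by simp_all
 have "phf i j (x i) = x j" if "i : I" "j : I" "r i j" for i j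
  using x(2)[of "(i, j)"] that by (simp add: K_def)
 then show ?thesis using x(1) by auto
qed

section \<open>Completions\<close>

lemma coset_proj_coset:
 assumes "U \<lhd> G" "V \<lhd> G" "U \<subseteq> V" "g : carrier G"
 shows "coset_proj G V (U #>{:G:} g) = V #>{:G:} g"
proof -
 interpret U: normal U G by fact
 interpret V: normal V G by fact
 have "v \<otimes>{:G:} (u \<otimes>{:G:} g) : V #>{:G:} g" if "v : V" "u : U" for u v
 proof -
  have "v \<otimes>{:G:} (u \<otimes>{:G:} g) = (v \<otimes>{:G:} u) \<otimes>{:G:} g" using that assms by (simp add: U.m_assoc)
  moreover have "v \<otimes>{:G:} u : V" using that assms(3) by auto
  ultimately show ?thesis unfolding r_coset_def by blast
 qed
 moreover have "v \<otimes>{:G:} g : V <#>{:G:} (U #>{:G:} g)" if "v : V" for v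
  using that U.rcos_self[OF assms(4) U.subgroup_axioms] by (auto simp: set_mult_def)
 ultimately show ?thesis
  unfolding coset_proj_def by (auto simp: set_mult_def r_coset_def)
qed

lemma coset_proj_hom:
 assumes "U \<lhd> G" "V \<lhd> G" "U \<subseteq> V"
 shows "coset_proj G V : hom (G Mod U) (G Mod V)"
proof (rule homI)
 interpret U: normal U G by fact
 interpret V: normal V G by fact
 show "coset_proj G V x : carrier (G Mod V)" if "x : carrier (G Mod U)" for x
  using that coset_proj_coset[OF assms] by (auto simp: carrier_FactGroup)
 fix x y assume "x : carrier (G Mod U)" "y : carrier (G Mod U)"
 then show "coset_proj G V (x \<otimes>{:G Mod U:} y) = coset_proj G V x \<otimes>{:G Mod V:} coset_proj G V y"
  using coset_proj_coset[OF assms] by (auto simp: carrier_FactGroup U.rcos_sum V.rcos_sum)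
qed

lemma completion_simps:
 "carrier (completion G I) = carrier (inverse_limit I (\<subseteq>) (%U. G Mod U) (%U V. coset_proj G V))"
 "x \<otimes>{:completion G I:} y = (\<lambda>U\<in>I. x U \<otimes>{:G Mod U:} y U)" "\<one>{:completion G I:} = (\<lambda>U\<in>I. \<one>{:G Mod U:})"
 "gtop (completion G I) = subtopology (product_topology (%U. discrete_topology (carrier (G Mod U))) I) (carrier (completion G I))"
 by (simp_all add: completion_def Let_def inverse_limit_simps del: one_FactGroup mult_FactGroup)

text \<open>The completion is a record carrying a topology as well, so the group axioms are carried
  over from the inverse limit by comparing operations.\<close>

lemma group_of_simps:
 assumes "group L" "carrier P = carrier L" "!!x y. x \<otimes>{:P:} y = x \<otimes>{:L:} y" "\<one>{:P:} = \<one>{:L:}"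
 shows "group P"
proof -
 interpret L: group L by fact
 show ?thesis using assms by (intro groupI) (auto simp: L.m_assoc intro: L.l_inv_ex)
qed

locale pi_completion = G: group G for G :: "('a, 'b) monoid_scheme" (structure) +
 fixes ps :: "nat set"
begin

abbreviation I where "I \<equiv> pi_normals ps G"
abbreviation P where "P \<equiv> completion G I"
abbreviation io where "io \<equiv> to_completion G I"

lemma I_normal: "U : I ==> U \<lhd> G" by (simp add: pi_normals_def)

lemma group_P: "group P" and io_hom: "io : hom G P" and proj_hom: "U : I ==> (%x. x U) : hom P (G Mod U)"
proof -
 let ?L = "inverse_limit I (\<subseteq>) (%U. G Mod U) (%U V. coset_proj G V)"
 have m: "!!x y. x \<otimes>{:P:} y = x \<otimes>{:?L:} y" "\<one>{:P:} = \<one>{:?L:}"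
  by (simp_all only: completion_simps inverse_limit_simps)
 have "group ?L"
  by (rule inverse_limit_group) (auto intro: normal.factorgroup_is_group I_normal coset_proj_hom)
 then show "group P" by (rule group_of_simps) (simp_all only: completion_simps(1) m)
 have "io : hom G ?L"
  unfolding to_completion_def[abs_def]
  by (rule hom_into_inverse_limit) (simp_all add: normal.r_coset_hom_Mod I_normal coset_proj_coset)
 then show "io : hom G P" by (simp add: hom_def completion_simps(1) m(1))
 show "(%x. x U) : hom P (G Mod U)" if "U : I"
  using inverse_limit_proj[OF that, of "(\<subseteq>)" "%U. G Mod U"] by (simp add: hom_def completion_simps(1) m(1))
qed

sublocale P: group P by (rule group_P)

lemma io_apply: "U : I ==> io g U = U #> g" by (simp add: to_completion_def)

lemma P_compat: "x : carrier P ==> U : I ==> V : I ==> U \<subseteq> V ==> coset_proj G V (x U) = x V"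
 by (simp add: completion_simps(1) inverse_limit_carrier)

text \<open>A basic neighbourhood of the identity restricts finitely many coordinates, and the
  intersection of the corresponding subgroups is again an index.\<close>

lemma open_contains:
 assumes V: "V : open_normals P"
 obtains U where "U : I" "!!x. x : carrier P ==> x U = U ==> x : V"
proof -
 let ?T = "product_topology (%U. discrete_topology (carrier (G Mod U))) I"
 interpret V: normal V P using V by (simp add: open_normals_def)
 obtain Y where Y: "openin ?T Y" "V = Y \<inter> carrier P"
  using V by (auto simp: open_normals_def completion_simps(4) openin_subtopology)
 have "\<one>{:P:} : Y" using Y V.one_closed by blast
 then obtain N where N: "finite {U : I. N U ~= carrier (G Mod U)}" "\<one>{:P:} : Pi\<^sub>E I N" "Pi\<^sub>E I N \<subseteq> Y"
  using Y(1) unfolding openin_product_topology_alt by force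
 let ?F = "{U : I. N U ~= carrier (G Mod U)}"
 let ?U = "carrier G \<inter> \<Inter> ?F"
 have U: "?U : I" by (rule pi_normals_Inter[OF G.is_group N(1)]) auto
 show thesis
 proof (rule that[OF U])
  fix x assume x: "x : carrier P" "x ?U = ?U"
  have "x W : N W" if W: "W : I" for W
  proof (cases "W : ?F")
  case True
  then have sub: "?U \<subseteq> W" by blast
  interpret W: normal W G by (rule I_normal[OF W])
  have "x W = coset_proj G W ?U" using P_compat[OF x(1) U W sub] x(2) by simp
  also have "?U = ?U #> \<one>" using I_normal[OF U] by (simp add: normal_def subgroup.subset)
  also have "coset_proj G W \<dots> = W #> \<one>"
   by (rule coset_proj_coset[OF I_normal[OF U] I_normal[OF W] sub]) simp
  also have "\<dots> = \<one>{:P:} W" using W W.subset by (simp add: completion_simps(3))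
  finally show ?thesis using N(2) W by (auto simp: PiE_iff)
  next
  case False
  then show ?thesis using W x(1) by (auto simp: completion_simps(1) inverse_limit_carrier PiE_iff)
  qed
  then have "x : Pi\<^sub>E I N" using x(1) by (auto simp: completion_simps(1) inverse_limit_carrier PiE_iff)
  then show "x : V" using N(3) Y(2) x(1) by blast
 qed
qed

lemma proj_kernel_open:
 assumes U: "U : I"
 shows "{x : carrier P. x U = U} : open_normals P"
proof -
 interpret U: normal U G by (rule I_normal[OF U])
 let ?T = "product_topology (%U. discrete_topology (carrier (G Mod U))) I"
 have "group_hom P (G Mod U) (%x. x U)"
  using proj_hom[OF U] by (simp add: group_hom_defs U.factorgroup_is_group P.is_group)
 then have "kernel P (G Mod U) (%x. x U) \<lhd> P" by (rule group_hom.normal_kernel)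
 then have n: "{x : carrier P. x U = U} \<lhd> P" by (simp add: kernel_def)
 have "openin ?T {x : topspace ?T. x U : {U}}"
  by (rule openin_continuous_map_preimage[OF continuous_map_product_projection[OF U]])
   (use monoid.one_closed[OF group.is_monoid[OF U.factorgroup_is_group]] in simp)
 moreover have "{x : carrier P. x U = U} = {x : topspace ?T. x U : {U}} \<inter> carrier P"
  by (auto simp: completion_simps(1) inverse_limit_carrier)
 ultimately have "openin (gtop P) {x : carrier P. x U = U}"
  unfolding completion_simps(4) openin_subtopology by blast
 then show ?thesis using n by (simp add: open_normals_def)
qed

text \<open>An open normal subgroup contains the kernel of the projection to some G/U, and every
  element of the completion has the same U-coordinate as an element of G. Hence the quotient is an
  image of G/U, and every coset is represented in G.\<close>

lemma completion_quotient:
 assumes V: "V : open_normals P"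
 shows "(%g. V #>{:P:} io g) : hom G (P Mod V)" "(%g. V #>{:P:} io g) ` carrier G = carrier (P Mod V)"
  "pi_finite ps (P Mod V)"
proof -
 interpret V: normal V P using V by (simp add: open_normals_def)
 show h: "(%g. V #>{:P:} io g) : hom G (P Mod V)"
  using hom_compose[OF io_hom V.r_coset_hom_Mod] by (simp add: comp_def)
 obtain U where U: "U : I" "!!x. x : carrier P ==> x U = U ==> x : V"
  using open_contains[OF V] by blast
 interpret U: normal U G by (rule I_normal[OF U(1)])
 interpret UQ: group "G Mod U" by (rule U.factorgroup_is_group)
 interpret p: group_hom P "G Mod U" "%x. x U" using proj_hom[OF U(1)] by unfold_locales
 have ioc: "io g : carrier P" if "g : carrier G" for g using io_hom that by (rule hom_in_carrier)
 have inV: "x \<otimes>{:P:} inv{:P:} y : V" if "x : carrier P" "y : carrier P" "x U = y U" for x y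
 proof (rule U(2))
  have "(x \<otimes>{:P:} inv{:P:} y) U = \<one>{:G Mod U:}"
  using that p.hom_mult[of x "inv{:P:} y"] p.hom_inv[of y] UQ.r_inv[OF p.hom_closed[of y]] by (simp only: P.inv_closed)
  then show "(x \<otimes>{:P:} inv{:P:} y) U = U" by simp
 qed (use that in simp)
 show surj: "(%g. V #>{:P:} io g) ` carrier G = carrier (P Mod V)"
 proof
  show "(%g. V #>{:P:} io g) ` carrier G \<subseteq> carrier (P Mod V)" using ioc by (auto simp: carrier_FactGroup)
  show "carrier (P Mod V) \<subseteq> (%g. V #>{:P:} io g) ` carrier G"
  proof
  fix X assume "X : carrier (P Mod V)"
  then obtain x where x: "x : carrier P" "X = V #>{:P:} x" by (auto simp: carrier_FactGroup)
  obtain g where g: "g : carrier G" "x U = U #> g"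
   using p.hom_closed[OF x(1)] by (auto simp: carrier_FactGroup)
  then have "x \<otimes>{:P:} inv{:P:} io g : V" by (intro inV x(1) ioc HOL.trans[OF g(2) io_apply[OF U(1), symmetric]])
  then have "X = V #>{:P:} io g" using x g ioc V.rcos_eq_iff by simp
  then show "X : (%g. V #>{:P:} io g) ` carrier G" using g by blast
  qed
 qed
 have "V #>{:P:} io u = \<one>{:P Mod V:}" if "u : U" for u
 proof -
  have "io u U = U" using that by (simp add: io_apply[OF U(1)] U.rcos_const)
  then show ?thesis using U(2)[OF ioc] that V.rcos_eq_one_iff[OF ioc] by simp
 qed
 then obtain k where k: "k : hom (G Mod U) (P Mod V)" "!!g. g : carrier G ==> k (U #> g) = V #>{:P:} io g"
  using FactGroup_hom_universal[OF h U.normal_axioms V.factorgroup_is_group] by blast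
 have "k ` carrier (G Mod U) = carrier (P Mod V)"
  using k(2) surj by (simp add: carrier_FactGroup image_image cong: image_cong)
 then show "pi_finite ps (P Mod V)"
  using pi_finite_surj[OF k(1) _ V.factorgroup_is_group] U(1) by (simp add: pi_normals_def)
qed

end

section \<open>The completed bar complex\<close>

locale prof_context =
 fixes P :: "('p, 'b) top_group_scheme" and A :: "('q, 'm) top_group_scheme"
 assumes P: "group P" and A: "comm_group A"
begin

sublocale P: group P by (rule P)
sublocale A: comm_group A by (rule A)

abbreviation C where "C \<equiv> prof_chains P A"
abbreviation d where "d \<equiv> prof_boundary P A"
abbreviation R :: "'p set \<times> 'q set => 'p set \<times> 'q set => bool" where "R \<equiv> (%(V, W) (V', W'). V \<subseteq> V' & W \<subseteq> W')"
abbreviation Ch where "Ch n \<equiv> (%(V, W). bar_chains (P Mod V) (A Mod W) n)"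
abbreviation bd where "bd n \<equiv> (%(V, W). bar_boundary (P Mod V) (A Mod W) n)"
abbreviation tr where "tr n \<equiv> (%(V, W) (V', W').
 bar_map (P Mod V) (A Mod W) (P Mod V') (coset_proj P V') (coset_proj A W') n)"

lemma idx:
 assumes "i : prof_index P A"
 obtains V W where "i = (V, W)" "V \<lhd> P" "W \<lhd> A" "group (P Mod V)" "comm_group (A Mod W)"
 using assms by (auto simp: prof_index_def open_normals_def normal.factorgroup_is_group A.abelian_FactGroup normal_imp_subgroup)

lemma Ch_comm: "i : prof_index P A ==> comm_group (Ch n i)"
 by (elim idx) (simp add: comm_group_bar_chains)

lemma tr_hom:
 assumes "i : prof_index P A" "j : prof_index P A" "R i j"
 shows "tr n i j : hom (Ch n i) (Ch n j)"
proof -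
 obtain V W where i: "i = (V, W)" "V \<lhd> P" "W \<lhd> A" "group (P Mod V)" "comm_group (A Mod W)" using assms(1) by (rule idx)
 obtain V' W' where j: "j = (V', W')" "V' \<lhd> P" "W' \<lhd> A" "group (P Mod V')" "comm_group (A Mod W')" using assms(2) by (rule idx)
 have "V \<subseteq> V'" "W \<subseteq> W'" using assms(3) i(1) j(1) by auto
 then show ?thesis
  using bar_map_hom[OF i(5) j(5) i(4) j(4) coset_proj_hom[OF i(2) j(2)] coset_proj_hom[OF i(3) j(3)]] i(1) j(1) by simp
qed

lemma C_comm: "comm_group (C n)"
 unfolding prof_chains_def by (rule inverse_limit_comm_group[OF Ch_comm tr_hom])

lemma C_proj: "i : prof_index P A ==> (%c. c i) : hom (C n) (Ch n i)"
 unfolding prof_chains_def by (rule inverse_limit_proj)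

lemma C_compat: "c : carrier (C n) ==> i : prof_index P A ==> j : prof_index P A ==> R i j ==> tr n i j (c i) = c j"
 unfolding prof_chains_def inverse_limit_carrier by blast

lemma C_closed: "c : carrier (C n) ==> i : prof_index P A ==> c i : carrier (Ch n i)"
 using C_proj hom_in_carrier by fastforce

lemma d_eq: "d n = (%c. \<lambda>i\<in>prof_index P A. bd n i (c i))"
 unfolding prof_boundary_def by (auto simp: fun_eq_iff restrict_def split: prod.splits)

lemma tr_boundary:
 assumes "i : prof_index P A" "j : prof_index P A" "R i j"
 shows "x : carrier (Ch 2 i) ==> tr (Suc 0) i j (bd 2 i x) = bd 2 j (tr 2 i j x)"
  and "x : carrier (Ch 3 i) ==> tr 2 i j (bd 3 i x) = bd 3 j (tr 3 i j x)"
proof -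
 obtain V W where i: "i = (V, W)" "V \<lhd> P" "W \<lhd> A" "group (P Mod V)" "comm_group (A Mod W)" using assms(1) by (rule idx)
 obtain V' W' where j: "j = (V', W')" "V' \<lhd> P" "W' \<lhd> A" "group (P Mod V')" "comm_group (A Mod W')" using assms(2) by (rule idx)
 have s: "V \<subseteq> V'" "W \<subseteq> W'" using assms(3) i(1) j(1) by auto
 note n = bar_map_boundary[OF i(5) j(5) i(4) j(4) coset_proj_hom[OF i(2) j(2) s(1)] coset_proj_hom[OF i(3) j(3) s(2)]]
 show "x : carrier (Ch 2 i) ==> tr (Suc 0) i j (bd 2 i x) = bd 2 j (tr 2 i j x)"
  "x : carrier (Ch 3 i) ==> tr 2 i j (bd 3 i x) = bd 3 j (tr 3 i j x)"
  using n i(1) j(1) by simp_all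
qed

lemma idx_complex:
 assumes "i : prof_index P A"
 shows "bd 2 i : hom (Ch 2 i) (Ch (Suc 0) i)"
  "bd 3 i : hom (Ch 3 i) (Ch 2 i)"
  "x : carrier (Ch 3 i) ==> bd 2 i (bd 3 i x) = \<one>{:Ch (Suc 0) i:}"
proof -
 obtain V W where i: "i = (V, W)" "V \<lhd> P" "W \<lhd> A" "group (P Mod V)" "comm_group (A Mod W)" using assms(1) by (rule idx)
 show "bd 2 i : hom (Ch 2 i) (Ch (Suc 0) i)"
  "bd 3 i : hom (Ch 3 i) (Ch 2 i)"
  "x : carrier (Ch 3 i) ==> bd 2 i (bd 3 i x) = \<one>{:Ch (Suc 0) i:}"
  using bar_boundary_hom2[OF i(5,4)] boundary_boundary[OF i(5,4)] by (simp_all add: i(1))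
qed

lemma d_hom: "d 2 : hom (C 2) (C (Suc 0))" "d 3 : hom (C 3) (C 2)"
proof -
 have c: "(%c. h i (c i)) : hom (C n) (Ch m i)" if "h i : hom (Ch n i) (Ch m i)" "i : prof_index P A" for h i n m
  using hom_compose[OF C_proj[OF that(2)] that(1)] by (simp add: comp_def)
 have "(%c. \<lambda>i\<in>prof_index P A. bd 2 i (c i)) : hom (C 2) (inverse_limit (prof_index P A) R (Ch (Suc 0)) (tr (Suc 0)))"
 proof (rule hom_into_inverse_limit[where h = "%i c. bd 2 i (c i)"])
  show "tr (Suc 0) i j (bd 2 i (x i)) = bd 2 j (x j)"
  if "i : prof_index P A" "j : prof_index P A" "R i j" "x : carrier (C 2)" for i j x
  using tr_boundary(1)[OF that(1-3) C_closed[OF that(4,1)]] C_compat[OF that(4,1,2,3)] by (simp only:)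
 qed (rule c[where h = "bd 2", OF idx_complex(1)])
 then show "d 2 : hom (C 2) (C (Suc 0))" by (simp only: d_eq prof_chains_def[of P A "Suc 0"])
 have "(%c. \<lambda>i\<in>prof_index P A. bd 3 i (c i)) : hom (C 3) (inverse_limit (prof_index P A) R (Ch 2) (tr 2))"
 proof (rule hom_into_inverse_limit[where h = "%i c. bd 3 i (c i)"])
  show "tr 2 i j (bd 3 i (x i)) = bd 3 j (x j)"
  if "i : prof_index P A" "j : prof_index P A" "R i j" "x : carrier (C 3)" for i j x
  using tr_boundary(2)[OF that(1-3) C_closed[OF that(4,1)]] C_compat[OF that(4,1,2,3)] by (simp only:)
 qed (rule c[where h = "bd 3", OF idx_complex(2)])
 then show "d 3 : hom (C 3) (C 2)" by (simp only: d_eq prof_chains_def[of P A 2])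
qed

lemma d_d: "c : carrier (C 3) ==> d 2 (d 3 c) = \<one>{:C (Suc 0):}"
 using idx_complex(3)[OF _ C_closed]
 by (auto simp: d_eq prof_chains_def[of P A "Suc 0"] inverse_limit_simps intro!: restrict_ext)

lemma to_prof_chains_hom:
 assumes G: "group G" and B: "comm_group B" and f: "f : hom G P" and al: "al : hom B A"
 shows "to_prof_chains n G B P A f al : hom (bar_chains G B n) (C n)"
proof -
 let ?h = "%i c. (%(V, W). bar_map G B (P Mod V) (%g. V #>{:P:} f g) (%b. W #>{:A:} al b) n c) i"
 have q: "(%g. V #>{:P:} f g) : hom G (P Mod V)" if "V \<lhd> P" for V
  using hom_compose[OF f normal.r_coset_hom_Mod[OF that]] by (simp add: comp_def)
 have q': "(%b. W #>{:A:} al b) : hom B (A Mod W)" if "W \<lhd> A" for W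
  using hom_compose[OF al normal.r_coset_hom_Mod[OF that]] by (simp add: comp_def)
 have "(%c. \<lambda>i\<in>prof_index P A. ?h i c) : hom (bar_chains G B n) (inverse_limit (prof_index P A) R (Ch n) (tr n))"
 proof (rule hom_into_inverse_limit[where h = ?h])
  show "?h i : hom (bar_chains G B n) (Ch n i)" if i: "i : prof_index P A" for i
  proof -
  obtain V W where i: "i = (V, W)" "V \<lhd> P" "W \<lhd> A" "group (P Mod V)" "comm_group (A Mod W)" using i by (rule idx)
  show ?thesis using bar_map_hom[OF B i(5) G i(4) q[OF i(2)] q'[OF i(3)]] by (simp add: i(1))
  qed
  show "tr n i j (?h i c) = ?h j c"
  if ij: "i : prof_index P A" "j : prof_index P A" "R i j" and c: "c : carrier (bar_chains G B n)" for i j c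
  proof -
  obtain V W where i: "i = (V, W)" "V \<lhd> P" "W \<lhd> A" "group (P Mod V)" "comm_group (A Mod W)" using ij(1) by (rule idx)
  obtain V' W' where j: "j = (V', W')" "V' \<lhd> P" "W' \<lhd> A" "group (P Mod V')" "comm_group (A Mod W')" using ij(2) by (rule idx)
  have s: "V \<subseteq> V'" "W \<subseteq> W'" using ij(3) i(1) j(1) by auto
  have e: "V' #>{:P:} f x = coset_proj P V' (V #>{:P:} f x)" if "x : carrier G" for x
   using coset_proj_coset[OF i(2) j(2) s(1) hom_in_carrier[OF f that]] by simp
  have e': "W' #>{:A:} al b = coset_proj A W' (W #>{:A:} al b)" if "b : carrier B" for b
   using coset_proj_coset[OF i(3) j(3) s(2) hom_in_carrier[OF al that]] by simp
  show ?thesis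
   using bar_map_compose[OF B i(5) j(5) G i(4) j(4) q[OF i(2)] coset_proj_hom[OF i(2) j(2) s(1)] q'[OF i(3)] coset_proj_hom[OF i(3) j(3) s(2)] e e' c]
   by (simp add: i(1) j(1))
  qed
 qed
 moreover have "to_prof_chains n G B P A f al = (%c. \<lambda>i\<in>prof_index P A. ?h i c)"
  by (auto simp: to_prof_chains_def fun_eq_iff restrict_def split: prod.splits)
 ultimately show ?thesis by (simp only: prof_chains_def)
qed

lemma to_prof_boundary:
 assumes G: "group G" and B: "comm_group B" and f: "f : hom G P" and al: "al : hom B A"
 shows "c : carrier (bar_chains G B 2) ==>
  d 2 (to_prof_chains 2 G B P A f al c) = to_prof_chains (Suc 0) G B P A f al (bar_boundary G B 2 c)"
  and "c : carrier (bar_chains G B 3) ==>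
  d 3 (to_prof_chains 3 G B P A f al c) = to_prof_chains 2 G B P A f al (bar_boundary G B 3 c)"
proof -
 have q: "(%g. V #>{:P:} f g) : hom G (P Mod V)" if "V \<lhd> P" for V
  using hom_compose[OF f normal.r_coset_hom_Mod[OF that]] by (simp add: comp_def)
 have q': "(%b. W #>{:A:} al b) : hom B (A Mod W)" if "W \<lhd> A" for W
  using hom_compose[OF al normal.r_coset_hom_Mod[OF that]] by (simp add: comp_def)
 have n: "c : carrier (bar_chains G B 2) ==> bar_boundary (P Mod V) (A Mod W) 2 (bar_map G B (P Mod V) (%g. V #>{:P:} f g) (%b. W #>{:A:} al b) 2 c)
  = bar_map G B (P Mod V) (%g. V #>{:P:} f g) (%b. W #>{:A:} al b) (Suc 0) (bar_boundary G B 2 c)"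
  "c : carrier (bar_chains G B 3) ==> bar_boundary (P Mod V) (A Mod W) 3 (bar_map G B (P Mod V) (%g. V #>{:P:} f g) (%b. W #>{:A:} al b) 3 c)
  = bar_map G B (P Mod V) (%g. V #>{:P:} f g) (%b. W #>{:A:} al b) 2 (bar_boundary G B 3 c)"
  if VW: "(V, W) : prof_index P A" for V W
 proof -
  have "V \<lhd> P" "W \<lhd> A" "group (P Mod V)" "comm_group (A Mod W)" using idx[OF VW] by blast+
  then show "c : carrier (bar_chains G B 2) ==> bar_boundary (P Mod V) (A Mod W) 2 (bar_map G B (P Mod V) (%g. V #>{:P:} f g) (%b. W #>{:A:} al b) 2 c)
  = bar_map G B (P Mod V) (%g. V #>{:P:} f g) (%b. W #>{:A:} al b) (Suc 0) (bar_boundary G B 2 c)"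
  "c : carrier (bar_chains G B 3) ==> bar_boundary (P Mod V) (A Mod W) 3 (bar_map G B (P Mod V) (%g. V #>{:P:} f g) (%b. W #>{:A:} al b) 3 c)
  = bar_map G B (P Mod V) (%g. V #>{:P:} f g) (%b. W #>{:A:} al b) 2 (bar_boundary G B 3 c)"
  using bar_map_boundary[OF B _ G _ q q'] by auto
 qed
 show "c : carrier (bar_chains G B 2) ==>
  d 2 (to_prof_chains 2 G B P A f al c) = to_prof_chains (Suc 0) G B P A f al (bar_boundary G B 2 c)"
  "c : carrier (bar_chains G B 3) ==>
  d 3 (to_prof_chains 3 G B P A f al c) = to_prof_chains 2 G B P A f al (bar_boundary G B 3 c)"
  unfolding prof_boundary_def to_prof_chains_def by (auto simp: n intro!: restrict_ext)
qed

lemma finite_bar_chains: "group (P Mod V) ==> comm_group (A Mod W) ==> finite (carrier (P Mod V)) ==> finite (carrier (A Mod W)) ==>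
  finite (carrier (bar_chains (P Mod V) (A Mod W) n))"
proof -
 assume h: "comm_group (A Mod W)" "finite (carrier (P Mod V))" "finite (carrier (A Mod W))"
 have "tuples n (P Mod V) = {xs. set xs \<subseteq> carrier (P Mod V) & length xs = n}" by (auto simp: tuples_def)
 then have "finite (tuples n (P Mod V))" using finite_lists_length_eq[OF h(2)] by simp
 then have "finite (tuples n (P Mod V) \<rightarrow>\<^sub>E carrier (A Mod W))" using h(3) by (intro finite_PiE) auto
 then show ?thesis unfolding bar_chains_def FS_carrier[OF h(1)] by (rule finite_subset[rotated]) auto
qed

text \<open>The point is the passage from finite levels to the limit: the chains with boundary
  \<open>c\<close> at each level form finite non-empty sets, and by compactness there is a
  compatible family of them, which is a chain of the completed complex.\<close>

lemma prof_boundary_iff: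
 assumes fin: "!!V. V : open_normals P ==> finite (carrier (P Mod V))" "!!W. W : open_normals A ==> finite (carrier (A Mod W))"
  and ne: "prof_index P A ~= {}" and c: "c : carrier (C 2)"
 shows "c : d 3 ` carrier (C 3) \<longleftrightarrow> (ALL (V, W) : prof_index P A. c (V, W) : B2 (P Mod V) (A Mod W))"
proof
 assume "c : d 3 ` carrier (C 3)"
 then obtain x where x: "x : carrier (C 3)" "c = d 3 x" by blast
 show "ALL (V, W) : prof_index P A. c (V, W) : B2 (P Mod V) (A Mod W)"
  using C_closed[OF x(1)] by (auto simp: x(2) prof_boundary_def)
next
 assume all: "ALL (V, W) : prof_index P A. c (V, W) : B2 (P Mod V) (A Mod W)"
 define D where "D i = {x : carrier (Ch 3 i). bd 3 i x = c i}" for i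
 have "EX x : (\<Pi>\<^sub>E i\<in>prof_index P A. D i). ALL i:prof_index P A. ALL j:prof_index P A. R i j --> tr 3 i j (x i) = x j"
 proof (rule inverse_limit_nonempty)
  fix i assume i: "i : prof_index P A"
  obtain V W where v: "i = (V, W)" "V \<lhd> P" "W \<lhd> A" "group (P Mod V)" "comm_group (A Mod W)" using i by (rule idx)
  have "finite (carrier (Ch 3 i))"
  using finite_bar_chains[OF v(4,5)] fin i v(1) by (simp add: prof_index_def)
  then show "finite (D i)" unfolding D_def by simp
  have "c (V, W) : B2 (P Mod V) (A Mod W)" using bspec[OF all i] v(1) by simp
  then show "D i ~= {}" by (auto simp: D_def v(1))
 next
  fix i j assume "i : prof_index P A" "j : prof_index P A"
  then obtain V W V' W' where "i = (V, W)" "j = (V', W')" "V : open_normals P" "V' : open_normals P"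
  "W : open_normals A" "W' : open_normals A" by (auto simp: prof_index_def)
  \<comment> \<open>Intersections of open normal subgroups make the index set directed.\<close>
  then show "EX k:prof_index P A. R k i & R k j"
  by (intro bexI[of _ "(V \<inter> V', W \<inter> W')"])
   (auto simp: prof_index_def open_normals_def intro: P.normal_subgroup_intersect A.normal_subgroup_intersect)
 next
  fix i j x assume ij: "i : prof_index P A" "j : prof_index P A" "R i j" and x: "x : D i"
  have xc: "x : carrier (Ch 3 i)" "bd 3 i x = c i" using x by (simp_all only: D_def mem_Collect_eq)
  have "bd 3 j (tr 3 i j x) = c j"
  using tr_boundary(2)[OF ij xc(1)] xc(2) C_compat[OF c ij] by (simp only:)
  then show "tr 3 i j x : D j"
  using hom_in_carrier[OF tr_hom[OF ij] xc(1)] by (simp only: D_def mem_Collect_eq)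
 next
  fix i j k x assume ij: "i : prof_index P A" "j : prof_index P A" "k : prof_index P A" "R i j" "R j k" and x: "x : D i"
  obtain V W where i: "i = (V, W)" "V \<lhd> P" "W \<lhd> A" "group (P Mod V)" "comm_group (A Mod W)" using ij(1) by (rule idx)
  obtain V' W' where j: "j = (V', W')" "V' \<lhd> P" "W' \<lhd> A" "group (P Mod V')" "comm_group (A Mod W')" using ij(2) by (rule idx)
  obtain V'' W'' where k: "k = (V'', W'')" "V'' \<lhd> P" "W'' \<lhd> A" "group (P Mod V'')" "comm_group (A Mod W'')" using ij(3) by (rule idx)
  have s: "V \<subseteq> V'" "W \<subseteq> W'" "V' \<subseteq> V''" "W' \<subseteq> W''" using ij i(1) j(1) k(1) by auto
  have xc: "x : carrier (bar_chains (P Mod V) (A Mod W) 3)" using x by (simp add: D_def i(1))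
  have pp: "coset_proj K N'' X = coset_proj K N'' (coset_proj K N' X)"
  if "N \<lhd> K" "N' \<lhd> K" "N'' \<lhd> K" "N \<subseteq> N'" "N' \<subseteq> N''" "X : carrier (K Mod N)" for N N' N'' X and K :: "('y, 'z) monoid_scheme"
  using that coset_proj_coset[OF that(1,2,4)] coset_proj_coset[OF that(2,3,5)] coset_proj_coset[OF that(1,3) subset_trans[OF that(4,5)]]
  by (auto simp: carrier_FactGroup)
  show "tr 3 j k (tr 3 i j x) = tr 3 i k x"
  using bar_map_compose[OF i(5) j(5) k(5) i(4) j(4) k(4) coset_proj_hom[OF i(2) j(2) s(1)] coset_proj_hom[OF j(2) k(2) s(3)]
    coset_proj_hom[OF i(3) j(3) s(2)] coset_proj_hom[OF j(3) k(3) s(4)] pp[OF i(2) j(2) k(2) s(1,3)] pp[OF i(3) j(3) k(3) s(2,4)] xc]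
  by (simp add: i(1) j(1) k(1))
 qed (use ne in auto)
 then obtain x where x: "x : (\<Pi>\<^sub>E i\<in>prof_index P A. D i)" "ALL i:prof_index P A. ALL j:prof_index P A. R i j --> tr 3 i j (x i) = x j"
  by blast
 have "x : carrier (C 3)"
  unfolding prof_chains_def inverse_limit_carrier using x by (auto simp: D_def PiE_iff)
 moreover have "d 3 x = c"
 proof -
  have "c : extensional (prof_index P A)"
  using c unfolding prof_chains_def inverse_limit_carrier by (auto simp: PiE_iff)
  then show ?thesis
  using x(1) by (auto simp: d_eq D_def PiE_iff fun_eq_iff restrict_def extensional_def)
 qed
 ultimately show "c : d 3 ` carrier (C 3)" by blast
qed

lemma to_prof_homology_mon_iff:
 assumes G: "group G" and B: "comm_group B" and f: "f : hom G P" and al: "al : hom B A"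
 shows "to_prof_homology 2 G B P A f al : mon (group_homology 2 G B) (prof_homology 2 P A) \<longleftrightarrow>
  (ALL z : Z2 G B. to_prof_chains 2 G B P A f al z : d 3 ` carrier (C 3) --> z : B2 G B)"
proof -
 note th = to_prof_chains_hom[OF assms] and tb = to_prof_boundary[OF assms]
 interpret t1: group_hom "bar_chains G B (Suc 0)" "C (Suc 0)" "to_prof_chains (Suc 0) G B P A f al"
  using th comm_group.axioms(2)[OF C_comm] comm_group.axioms(2)[OF comm_group_bar_chains[OF B]]
  by (simp add: group_hom_defs)
 have 1: "ALL z : Z2 G B. to_prof_chains 2 G B P A f al z : kernel (C 2) (C 1) (d 2)"
  using hom_in_carrier[OF th] tb(1) t1.hom_one by (simp add: kernel_def)
 have 2: "ALL b : B2 G B. to_prof_chains 2 G B P A f al b : d 3 ` carrier (C 3)"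
 proof
  fix b assume "b : B2 G B"
  then obtain c where c: "c : carrier (bar_chains G B 3)" "b = bar_boundary G B 3 c" by blast
  show "to_prof_chains 2 G B P A f al b : d 3 ` carrier (C 3)"
  using tb(2)[OF c(1)] hom_in_carrier[OF th c(1)] c(2) by (metis imageI)
 qed
 have dd: "ALL c : carrier (C 3). d 2 (d 3 c) = \<one>{:C 1:}" using d_d by simp
 have d1: "d 2 : hom (C 2) (C 1)" using d_hom(1) by simp
 show ?thesis
  unfolding to_prof_homology_def group_homology_def prof_homology_def
  by (rule homology_map_mon_iff[where C = "bar_chains G B" and d = "bar_boundary G B" and C' = C and d' = d,
    OF bar_complex(1)[OF B G] bar_complex(1)[OF B G] bar_complex(1)[OF B G] bar_complex(2-)[OF B G]
    C_comm C_comm C_comm d1 d_hom(2) dd th 1 2])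
qed

end

section \<open>Injectivity in degree two implies residual finiteness\<close>

text \<open>Take the abelian group of 1-chains with the lift sending g to [g]. Its cocycle evaluates
  to the boundary map, while commutators are trivial there, so the trivial map is the one to which
  \<open>cycle_of\<close> applies.\<close>

lemma cycle_of_Z2:
 assumes G: "group G" and x: "x : carrier (exterior_square G)" "ext_fold G x = \<one>{:G:}"
 shows "cycle_of G x : Z2 G ZZ"
proof -
 interpret G: group G by fact
 let ?C = "bar_chains G ZZ (Suc 0)"
 note A = abelian_integer_group
 interpret C: comm_group ?C by (rule comm_group_bar_chains[OF A])
 let ?s = "%g. bas G ZZ [g] 1"
 have s [simp]: "bas G ZZ [g] n : carrier ?C" for g n using A by simp
 have cen: "group_center ?C = carrier ?C" by (auto simp: group_center_def C.m_comm)
 have "?s g \<otimes>{:?C:} ?s h = (?s g \<otimes>{:?C:} ?s h \<otimes>{:?C:} inv{:?C:} ?s (g \<otimes>{:G:} h)) \<otimes>{:?C:} ?s (g \<otimes>{:G:} h)" for g h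
  by (simp add: C.m_assoc)
 then have "central_lift G ?C ?s"
  unfolding central_lift_def cen by (intro conjI ballI bexI) auto
 then interpret L: lift_context G ?C ?s
  by (simp add: lift_context_def lift_context_axioms_def G C.is_group)
 let ?f = "%x. \<one>{:?C:}"
 have f: "?f : hom (exterior_square G) ?C" by (rule homI) auto
 have "comm_elt ?C a b = \<one>{:?C:}" if "a : carrier ?C" "b : carrier ?C" for a b
  using that by (simp add: comm_elt_def C.m_comm[of a b] C.m_assoc)
 then have 1: "Phi G ?C ?s (cycle_of G x) = \<one>{:?C:}"
  using cycle_of(2)[OF G x L.lift_context_axioms f] s by simp
 have "bar_boundary G ZZ 2 c = Phi G ?C ?s c" if c: "c : carrier (bar_chains G ZZ 2)" for c
 proof (rule bar_hom_eqI[OF A bar_boundary_hom2(1)[OF A G] L.Phi_hom C.is_group _ c])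
  fix t and n :: int assume "t : tuples 2 G"
  then obtain g h where g: "t = [g, h]" "g : carrier G" "h : carrier G" by (auto simp: tuples_2)
  have pw: "bas G ZZ [y] 1 [^]{:?C:} n = bas G ZZ [y] n" if "y : carrier G" for y
  using hom_int_pow[OF bas_hom[OF A, of "[y]" "Suc 0" G], of 1 n] that by (simp add: tuples_1)
  have "Phi G ?C ?s (bas G ZZ t n) = (?s g \<otimes>{:?C:} ?s h \<otimes>{:?C:} inv{:?C:} ?s (g \<otimes>{:G:} h)) [^]{:?C:} n"
  using g by (simp add: L.Phi_bas zeta_def)
  also have "\<dots> = bas G ZZ [g] n \<otimes>{:?C:} bas G ZZ [h] n \<otimes>{:?C:} inv{:?C:} bas G ZZ [g \<otimes>{:G:} h] n"
  using g by (simp add: C.int_pow_distrib C.int_pow_inv pw)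
  also have "\<dots> = bar_boundary G ZZ 2 (bas G ZZ t n)"
  using g by (simp add: boundary2[OF A G] C.m_ac)
  finally show "bar_boundary G ZZ 2 (bas G ZZ t n) = Phi G ?C ?s (bas G ZZ t n)" by simp
 qed
 then show ?thesis using 1 cycle_of(1)[OF G x] by (simp add: kernel_def)
qed

text \<open>The exterior square embeds into the cover, where the image of x is the value of a
  cocycle at its cycle; on a boundary that value would be trivial.\<close>

lemma cycle_of_not_boundary:
 assumes G: "group G" and x: "x : carrier (exterior_square G)" "ext_fold G x = \<one>{:G:}" "x ~= \<one>{:exterior_square G:}"
 shows "cycle_of G x ~: B2 G ZZ"
proof
 assume "cycle_of G x : B2 G ZZ"
 then obtain c where c: "c : carrier (bar_chains G ZZ 3)" "cycle_of G x = bar_boundary G ZZ 3 c" by blast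
 obtain P :: "((('a => 'a) \<times> ('a + 'a) gword set set => ('a => 'a) \<times> ('a + 'a) gword set set) \<times> 'a) monoid" and s f
  where P: "group P" "central_lift G P s" "f : hom (exterior_square G) P" "inj_on f (carrier (exterior_square G))"
  "!!p q. p : carrier P ==> q : carrier P ==> comm_elt P p q = f (wedge G (snd p) (snd q))"
  "!!g. g : carrier G ==> snd (s g) = g"
  using exterior_cover[OF G] by metis
 interpret L: lift_context G P s by (simp add: lift_context_def lift_context_axioms_def G P)
 have "f (wedge G g h) = comm_elt P (s g) (s h)" if "g : carrier G" "h : carrier G" for g h
  using P(5)[of "s g" "s h"] P(6) that by simp
 then have "f x = \<one>{:P:}"
  using cycle_of(2)[OF G x(1,2) L.lift_context_axioms P(3)] L.Phi_boundary[OF c(1)] c(2) by simp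
 then show False
  using P(3,4) x(1,3) group_exterior_square[OF G] P(1) by (metis inj_on_one_iff')
qed

section \<open>Detection by extensions of finite quotients\<close>

context chain_ext_context
begin

lemma X_detects:
 assumes G: "group G" and p: "p : hom G Q" and al: "al : hom ZZ B" "al 1 = u"
  and x: "x : carrier (exterior_square G)" "ext_fold G x = \<one>{:G:}"
 obtains f where "f : hom (exterior_square G) X" "f x = incl (L #>{:C2:} bar_map G ZZ Q p al 2 (cycle_of G x))"
  "!!g h. g : carrier G ==> h : carrier G ==> f (wedge G g h) = comm_elt X (\<one>{:C2 Mod L:}, p g) (\<one>{:C2 Mod L:}, p h)"
proof -
 interpret S: lift_context G X "%g. (\<one>{:C2 Mod L:}, p g)" by (rule lift_X(1)[OF p G])
 obtain f where f: "f : hom (exterior_square G) X"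
  "!!g h. g : carrier G ==> h : carrier G ==> f (wedge G g h) = comm_elt X (\<one>{:C2 Mod L:}, p g) (\<one>{:C2 Mod L:}, p h)"
  using central_lift_hom[OF G group_X S.lift] by blast
 have "f x = Phi G X (%g. (\<one>{:C2 Mod L:}, p g)) (cycle_of G x)"
  by (rule cycle_of(2)[OF G x S.lift_context_axioms f])
 also have "\<dots> = incl (L #>{:C2:} bar_map G ZZ Q p al 2 (cycle_of G x))"
  by (rule Phi_X[OF p G al cycle_of(1)[OF G x]])
 finally show thesis using that f by blast
qed

lemma X_pi_finite:
 assumes "pi_finite ps Q" "pi_finite ps (C2 Mod L)"
 shows "pi_finite ps X"
proof -
 have "carrier X = carrier (C2 Mod L) \<times> carrier Q" by (simp add: cocycle_ext_def)
 then show ?thesis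
  using assms group_X by (auto simp: pi_finite_def order_def card_cartesian_product intro: pi_number_mult)
qed

text \<open>The image of x in the extension is the class of its cycle in the chains modulo
  \<open>L\<close>, and the extension is pi-finite.\<close>

lemma X_residual:
 assumes fin: "pi_finite ps Q" "pi_finite ps (C2 Mod L)"
  and G: "group G" and p: "p : hom G Q" and al: "al : hom ZZ B" "al 1 = u"
  and x: "x : carrier (exterior_square G)" "ext_fold G x = \<one>{:G:}"
  and n: "bar_map G ZZ Q p al 2 (cycle_of G x) ~: L"
 shows "EX U : pi_normals ps (exterior_square G). x ~: U"
proof -
 obtain f where f: "f : hom (exterior_square G) X" "f x = incl (L #>{:C2:} bar_map G ZZ Q p al 2 (cycle_of G x))"
  by (rule X_detects[OF G p al x]) (rule that)
 let ?z = "bar_map G ZZ Q p al 2 (cycle_of G x)"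
 have z: "?z : carrier C2"
  using hom_in_carrier[OF bar_map_hom[OF abelian_integer_group B G Q p al(1)] cycle_of(1)[OF G x]] .
 have "f x ~= \<one>{:X:}"
 proof
  assume "f x = \<one>{:X:}"
  then have "incl (L #>{:C2:} ?z) = incl \<one>{:C2 Mod L:}"
  using f(2) hom_one[OF incl_hom M.is_group group_X] by simp
  then have "L #>{:C2:} ?z = L"
  using incl_inj[of "L #>{:C2:} ?z" "\<one>{:C2 Mod L:}"] z M.one_closed hom_in_carrier[OF L_hom z] by simp
  then show False using n z L.rcos_eq_one_iff by simp
 qed
 then show ?thesis
  using not_in_pi_normal[OF f(1) group_exterior_square[OF G] X_pi_finite[OF fin] x(1)] by simp
qed

end

text \<open>Common form of the injectivity assumptions for the profinite completion
  (\<open>UNIV\<close>) and the pro-p completion (\<open>{p}\<close>).\<close>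

definition prof_injective :: "nat set => ('a, 'b) monoid_scheme => bool" where
 "prof_injective ps G \<longleftrightarrow> to_prof_homology 2 G ZZ (completion G (pi_normals ps G)) (completion ZZ (pi_normals ps ZZ))
  (to_completion G (pi_normals ps G)) (to_completion ZZ (pi_normals ps ZZ))
 : mon (H2Z G) (prof_homology 2 (completion G (pi_normals ps G)) (completion ZZ (pi_normals ps ZZ)))"

lemma comm_completion_ZZ: "comm_group (completion ZZ (pi_normals ps ZZ))"
proof -
 interpret K: pi_completion ZZ ps by (simp add: pi_completion_def)
 interpret Z: comm_group ZZ by (rule abelian_integer_group)
 have "x \<otimes>{:K.P:} y = y \<otimes>{:K.P:} x" if "x : carrier K.P" "y : carrier K.P" for x y
 proof -
  have "x U \<otimes>{:ZZ Mod U:} y U = y U \<otimes>{:ZZ Mod U:} x U" if U: "U : K.I" for U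
  proof -
  interpret Q: comm_group "ZZ Mod U"
   by (rule Z.abelian_FactGroup[OF normal_imp_subgroup[OF K.I_normal[OF U]]])
  show ?thesis using \<open>x : carrier K.P\<close> \<open>y : carrier K.P\<close> U hom_in_carrier[OF K.proj_hom[OF U]] Q.m_comm by metis
  qed
  then show ?thesis unfolding completion_simps(2) by (intro restrict_ext)
 qed
 then show ?thesis by (intro K.P.group_comm_groupI) auto
qed

text \<open>By compactness a chain is a boundary in the completed complex exactly when it is one at
  each finite level, so injectivity becomes a statement about finite quotients of the group and of
  the coefficients.\<close>

lemma prof_injective_iff:
 fixes G :: "('a, 'b) monoid_scheme" and ps :: "nat set"
 assumes G: "group G"
 defines "P \<equiv> completion G (pi_normals ps G)" and "A \<equiv> completion ZZ (pi_normals ps ZZ)"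
 shows "prof_injective ps G \<longleftrightarrow> (ALL z : Z2 G ZZ. (ALL (V, W) : prof_index P A.
  bar_map G ZZ (P Mod V) (%g. V #>{:P:} to_completion G (pi_normals ps G) g)
  (%n. W #>{:A:} to_completion ZZ (pi_normals ps ZZ) n) 2 z : B2 (P Mod V) (A Mod W)) --> z : B2 G ZZ)"
proof -
 interpret G: pi_completion G ps using G by (simp add: pi_completion_def)
 interpret K: pi_completion ZZ ps by (simp add: pi_completion_def)
 interpret PA: prof_context G.P K.P
  by (simp add: prof_context_def G.group_P comm_completion_ZZ)
 note A = abelian_integer_group
 let ?t = "to_prof_chains 2 G ZZ G.P K.P G.io K.io"
 have "carrier G : G.I" "carrier ZZ : K.I" using carrier_in_pi_normals[OF G, of ps] carrier_in_pi_normals[of ZZ ps] by simp_all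
 then have "prof_index G.P K.P ~= {}"
  using G.proj_kernel_open K.proj_kernel_open by (force simp: prof_index_def)
 moreover have "finite (carrier (G.P Mod V))" if "V : open_normals G.P" for V
  using G.completion_quotient(3)[OF that] by (simp add: pi_finite_def)
 moreover have "finite (carrier (K.P Mod V))" if "V : open_normals K.P" for V
  using K.completion_quotient(3)[OF that] by (simp add: pi_finite_def)
 ultimately have "?t z : PA.d 3 ` carrier (PA.C 3) \<longleftrightarrow> (ALL (V, W) : prof_index G.P K.P. ?t z (V, W) : B2 (G.P Mod V) (K.P Mod W))"
  if "z : Z2 G ZZ" for z
  using PA.prof_boundary_iff hom_in_carrier[OF PA.to_prof_chains_hom[OF G A G.io_hom K.io_hom], of z 2] that
  by (simp add: kernel_def)
 moreover have "(ALL (V, W) : prof_index G.P K.P. ?t z (V, W) : B2 (G.P Mod V) (K.P Mod W)) \<longleftrightarrow>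
  (ALL (V, W) : prof_index G.P K.P. bar_map G ZZ (G.P Mod V) (%g. V #>{:G.P:} G.io g) (%n. W #>{:K.P:} K.io n) 2 z
  : B2 (G.P Mod V) (K.P Mod W))" for z
  by (rule ball_cong[OF HOL.refl]) (auto simp: to_prof_chains_def)
 ultimately show ?thesis
  unfolding prof_injective_def P_def A_def PA.to_prof_homology_mon_iff[OF G A G.io_hom K.io_hom] by simp
qed

theorem residually_pi_exterior_prof:
 assumes G: "group G" and res: "residually_pi ps G" and inj: "prof_injective ps G"
 shows "residually_pi ps (exterior_square G)"
 unfolding residually_pi_def
proof (intro ballI impI)
 fix x assume x: "x : carrier (exterior_square G)" "x ~= \<one>{:exterior_square G:}"
 show "EX U:pi_normals ps (exterior_square G). x ~: U"
 \<comment> \<open>An element outside the kernel of the map to G is already separated by a quotient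
   of G.\<close>
 proof (cases "ext_fold G x = \<one>{:G:}")
  case False
  then show ?thesis
  using residually_pi_pullback[OF res ext_fold_hom[OF G] group_exterior_square[OF G] x(1)] by simp
 next
  case True
  interpret G: pi_completion G ps using G by (simp add: pi_completion_def)
  interpret K: pi_completion ZZ ps by (simp add: pi_completion_def)
  interpret PA: prof_context G.P K.P
  by (simp add: prof_context_def G.group_P comm_completion_ZZ)
  let ?b = "%V W. bar_map G ZZ (G.P Mod V) (%g. V #>{:G.P:} G.io g) (%n. W #>{:K.P:} K.io n) 2 (cycle_of G x)"
  have "~ (ALL (V, W) : prof_index G.P K.P. ?b V W : B2 (G.P Mod V) (K.P Mod W))"
  using inj[unfolded prof_injective_iff[OF G]] cycle_of_Z2[OF G x(1) True] cycle_of_not_boundary[OF G x(1) True x(2)]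
  by blast
  then obtain V W where VW: "(V, W) : prof_index G.P K.P" "?b V W ~: B2 (G.P Mod V) (K.P Mod W)" by blast
  have o: "V : open_normals G.P" "W : open_normals K.P" using VW(1) by (auto simp: prof_index_def)
  have gr: "group (G.P Mod V)" "comm_group (K.P Mod W)" using PA.idx[OF VW(1)] by blast+
  let ?u = "W #>{:K.P:} K.io 1"
  have u: "?u : carrier (K.P Mod W)" using hom_in_carrier[OF K.completion_quotient(1)[OF o(2)], of 1] by simp
  interpret E: chain_ext_context "G.P Mod V" "K.P Mod W" "B2 (G.P Mod V) (K.P Mod W)" ?u
  by (rule chain_ext_context.intro) (use gr u B2_subgroup in auto)
  note fin = G.completion_quotient(3)[OF o(1)] K.completion_quotient(3)[OF o(2)]
  have "finite (carrier E.C2)" using PA.finite_bar_chains[OF gr] fin by (simp add: pi_finite_def)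
  then have "finite (carrier (E.C2 Mod B2 (G.P Mod V) (K.P Mod W)))" by (simp add: carrier_FactGroup)
  \<comment> \<open>The order of the coefficient group is a pi-number and kills every basic chain,
    so it is an exponent for chains modulo boundaries.\<close>
  moreover have "X [^]{:E.C2 Mod B2 (G.P Mod V) (K.P Mod W):} order (K.P Mod W) = \<one>{:E.C2 Mod B2 (G.P Mod V) (K.P Mod W):}"
  if X: "X : carrier (E.C2 Mod B2 (G.P Mod V) (K.P Mod W))" for X
  proof -
  obtain c where c: "c : carrier E.C2" "X = B2 (G.P Mod V) (K.P Mod W) #>{:E.C2:} c" using X by (auto simp: carrier_FactGroup)
  have "(%c. c [^]{:E.C2:} order (K.P Mod W)) : hom E.C2 E.C2"
   by (rule homI) (simp_all add: E.C2.nat_pow_distrib)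
  moreover have "(%c. \<one>{:E.C2:}) : hom E.C2 E.C2" by (rule homI) auto
  moreover have "bas (G.P Mod V) (K.P Mod W) t b [^]{:E.C2:} order (K.P Mod W) = \<one>{:E.C2:}"
   if t: "t : tuples 2 (G.P Mod V)" "b : carrier (K.P Mod W)" for t b
  proof -
   interpret b: group_hom "K.P Mod W" E.C2 "bas (G.P Mod V) (K.P Mod W) t"
    using bas_hom[OF gr(2) t(1)] by unfold_locales
   show ?thesis using b.hom_nat_pow[OF t(2), of "order (K.P Mod W)"] E.B.pow_order_eq_1[OF t(2)] b.hom_one by simp
  qed
  ultimately have "c [^]{:E.C2:} order (K.P Mod W) = \<one>{:E.C2:}"
   by (rule bar_hom_eqI[OF gr(2) _ _ E.C2.is_group _ c(1)])
  then show ?thesis using c E.L.rcos_eq_one_iff[OF E.C2.one_closed] E.L.one_closed by (simp add: E.L.FactGroup_pow)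
  qed
  ultimately have "pi_finite ps (E.C2 Mod B2 (G.P Mod V) (K.P Mod W))"
  using E.M.pi_finite_exponent[of ps "order (K.P Mod W)"] fin(2) by (simp add: pi_finite_def)
  then show ?thesis
  using E.X_residual[OF fin(1) _ G G.completion_quotient(1)[OF o(1)] K.completion_quotient(1)[OF o(2)] HOL.refl x(1) True VW(2)] by blast
 qed
qed

section \<open>The homology of the finite quotients\<close>

lemma finitely_generated_surj:
 assumes "h : hom G H" "h ` carrier G = carrier H" "group G" "group H" "finitely_generated G"
 shows "finitely_generated H"
proof -
 interpret h: group_hom G H h using assms by (simp add: group_hom_defs)
 obtain S where S: "finite S" "S \<subseteq> carrier G" "generate G S = carrier G"
  using assms(5) by (auto simp: finitely_generated_def)
 then have "generate H (h ` S) = carrier H" using h.generate_img[OF S(2)] assms(2) by simp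
 then show ?thesis
  unfolding finitely_generated_def using S hom_in_carrier[OF assms(1)] by (intro exI[of _ "h ` S"]) blast
qed

lemma finitely_generated_Mod:
 assumes "N \<lhd> G" "group G" "finitely_generated G"
 shows "finitely_generated (G Mod N)"
proof (rule finitely_generated_surj[OF normal.r_coset_hom_Mod[OF assms(1)] _ assms(2) normal.factorgroup_is_group[OF assms(1)] assms(3)])
 show "(#>{:G:}) N ` carrier G = carrier (G Mod N)" by (auto simp: carrier_FactGroup)
qed

lemma (in comm_group) comm_elt_trivial: "a : carrier G ==> b : carrier G ==> comm_elt G a b = \<one>"
 by (simp add: comm_elt_def m_comm[of a b] m_assoc)

text \<open>The quotient map by the span of the finitely many chains [g|h] kills all basic chains
  and is therefore trivial.\<close>

lemma finitely_generated_bar_chains: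
 assumes Q: "group Q" "finite (carrier Q)"
 shows "finitely_generated (bar_chains Q ZZ 2)"
proof -
 note A = abelian_integer_group
 let ?C = "bar_chains Q ZZ 2" and ?S = "(%(g, h). bas Q ZZ [g, h] 1) ` (carrier Q \<times> carrier Q)"
 interpret C: comm_group ?C by (rule comm_group_bar_chains[OF A])
 have S: "?S \<subseteq> carrier ?C" using A by auto
 interpret N: normal "generate ?C ?S" ?C
  by (rule C.subgroup_imp_normal[OF C.generate_is_subgroup[OF S]])
 interpret q: group_hom ?C "?C Mod generate ?C ?S" "%c. generate ?C ?S #>{:?C:} c"
  by (rule group_hom_mod_intro[OF N.normal_axioms])
 have "c : generate ?C ?S" if c: "c : carrier ?C" for c
 proof -
  have "generate ?C ?S #>{:?C:} c = \<one>{:?C Mod generate ?C ?S:}"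
  proof (rule bar_hom_eqI[OF A q.homh _ q.H.is_group _ c])
  show "(%c. \<one>{:?C Mod generate ?C ?S:}) : hom ?C (?C Mod generate ?C ?S)"
   by (rule homI) (simp_all del: one_FactGroup mult_FactGroup)
  fix t and n :: int assume "t : tuples 2 Q"
  then obtain g h where g: "t = [g, h]" "g : carrier Q" "h : carrier Q" by (auto simp: tuples_2)
  have "bas Q ZZ [g, h] 1 : generate ?C ?S" using g by (intro generate.incl) force
  then have "bas Q ZZ [g, h] 1 [^]{:?C:} n : generate ?C ?S"
   using C.subgroup_int_pow_closed[OF C.generate_is_subgroup[OF S]] by blast
  moreover have "bas Q ZZ [g, h] 1 [^]{:?C:} n = bas Q ZZ [g, h] n"
   using hom_int_pow[OF bas_hom[OF A, of "[g, h]" 2 Q], of 1 n] g by (simp add: tuples_2)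
  ultimately have "bas Q ZZ t n : generate ?C ?S" using g by simp
  then show "generate ?C ?S #>{:?C:} bas Q ZZ t n = \<one>{:?C Mod generate ?C ?S:}"
   using N.rcos_eq_one_iff N.mem_carrier by simp
  qed
  then show ?thesis using N.rcos_eq_one_iff[OF c] by simp
 qed
 then have "generate ?C ?S = carrier ?C" using C.generate_incl[OF S] by blast
 then show ?thesis
  unfolding finitely_generated_def using S Q(2) by (intro exI[of _ ?S]) blast
qed

section \<open>The transfer to a central subgroup of finite index\<close>

context cocycle_context
begin

text \<open>The transfer to M for the transversal of elements (1, k): since (a, g)(1, k) has second
  component gk and first component a f(g, k), the latter is the factor belonging to k.\<close>

definition transfer :: "'m \<times> 'q => 'm" where
 "transfer = (%(a, g). a [^] order Q \<otimes> finprod M (f g) (carrier Q))"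

text \<open>Multiply the cocycle identity over its third argument; left translation by h only
  permutes the factors.\<close>

lemma transfer_hom:
 assumes "finite (carrier Q)"
 shows "transfer : hom X M"
proof (rule homI)
 fix x y assume "x : carrier X" "y : carrier X"
 then obtain a g b h where x: "x = (a, g)" "y = (b, h)" "a : carrier M" "b : carrier M" "g : carrier Q" "h : carrier Q"
  by (cases x, cases y) auto
 have "bij_betw (%k. h \<otimes>{:Q:} k) (carrier Q) (carrier Q)"
  using x by (intro bij_betw_byWitness[where f' = "%k. inv{:Q:} h \<otimes>{:Q:} k"]) auto
 then have r: "finprod M (%k. f g (h \<otimes>{:Q:} k)) (carrier Q) = finprod M (f g) (carrier Q)"
  using M.finprod_reindex[of "f g" "%k. h \<otimes>{:Q:} k" "carrier Q"] x by (simp add: bij_betw_def Pi_iff)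
 have "finprod M (f h) (carrier Q) \<otimes> finprod M (f g) (carrier Q)
  = finprod M (%k. f h k \<otimes> f g (h \<otimes>{:Q:} k)) (carrier Q)"
  using x by (simp add: M.finprod_multf Pi_iff r)
 also have "\<dots> = finprod M (%k. f g h \<otimes> f (g \<otimes>{:Q:} h) k) (carrier Q)"
  using x by (intro M.finprod_cong) (auto simp: cocycle simp_implies_def)
 also have "\<dots> = f g h [^] order Q \<otimes> finprod M (f (g \<otimes>{:Q:} h)) (carrier Q)"
  using x by (simp add: M.finprod_multf Pi_iff M.finprod_const order_def)
 finally have e: "finprod M (f g) (carrier Q) \<otimes> finprod M (f h) (carrier Q)
  = f g h [^] order Q \<otimes> finprod M (f (g \<otimes>{:Q:} h)) (carrier Q)"
  using x by (simp add: M.m_comm)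
 have c: "finprod M (f k) (carrier Q) : carrier M" if "k : carrier Q" for k
  using that by (intro M.finprod_closed) auto
 have "transfer (x \<otimes>{:X:} y) = a [^] order Q \<otimes> b [^] order Q \<otimes>
  (f g h [^] order Q \<otimes> finprod M (f (g \<otimes>{:Q:} h)) (carrier Q))"
  using x c by (simp add: transfer_def M.nat_pow_distrib M.m_assoc)
 also have "\<dots> = transfer x \<otimes> transfer y"
  unfolding e[symmetric] using x c by (simp add: transfer_def M.m_ac)
 finally show "transfer (x \<otimes>{:X:} y) = transfer x \<otimes> transfer y" .
qed (auto simp: transfer_def intro!: M.finprod_closed)

lemma transfer_incl:
 assumes "finite (carrier Q)" "a : carrier M"
 shows "transfer (incl a) = a [^] order Q"
proof -
 have "finprod M (f \<one>{:Q:}) (carrier Q) = finprod M (%k. f1) (carrier Q)"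
  by (intro M.finprod_cong) (auto simp: simp_implies_def)
 then show ?thesis
  using assms by (simp add: transfer_def incl_def M.finprod_const order_def M.m_assoc M.nat_pow_distrib M.nat_pow_inv)
qed

text \<open>The transfer kills commutators because M is abelian, while on M it is the power with
  exponent |Q|.\<close>

lemma wedge_incl_torsion:
 assumes "finite (carrier Q)" "group G" "h : hom (exterior_square G) X"
  and s: "!!g. g : carrier G ==> s g : carrier X"
  and w: "!!g k. g : carrier G ==> k : carrier G ==> h (wedge G g k) = comm_elt X (s g) (s k)"
  and x: "x : carrier (exterior_square G)" "h x = incl a" "a : carrier M"
 shows "a [^] order Q = \<one>"
proof -
 interpret t: group_hom X M transfer
  using transfer_hom[OF assms(1)] by (simp add: group_hom_defs)
 have "transfer (h x) = \<one>"
 proof (rule exterior_hom_eqI[OF assms(2) _ _ M.is_group _ x(1)])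
  show "(%x. transfer (h x)) : hom (exterior_square G) M"
  using hom_compose[OF assms(3) t.homh] by (simp add: comp_def)
  show "(%x. \<one>) : hom (exterior_square G) M" by (rule homI) auto
  fix g k assume g: "g : carrier G" "k : carrier G"
  have "transfer (comm_elt X (s g) (s k)) = comm_elt M (transfer (s g)) (transfer (s k))"
  using s[OF g(1)] s[OF g(2)] by (simp only: comm_elt_def t.hom_mult t.hom_inv X.m_closed X.inv_closed)
  then show "transfer (h (wedge G g k)) = \<one>"
  using w[OF g] M.comm_elt_trivial[OF t.hom_closed t.hom_closed] s g by simp
 qed
 then show ?thesis using transfer_incl[OF assms(1) x(3)] x(2) by simp
qed

end

theorem residually_pi_exterior_lim:
 assumes G: "group G" and res: "residually_pi ps G" and inj: "H2_to_limit_injective G (pi_normals ps G)"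
 shows "residually_pi ps (exterior_square G)"
 unfolding residually_pi_def
proof (intro ballI impI)
 fix x assume x: "x : carrier (exterior_square G)" "x ~= \<one>{:exterior_square G:}"
 show "EX U:pi_normals ps (exterior_square G). x ~: U"
 proof (cases "ext_fold G x = \<one>{:G:}")
  case False
  then show ?thesis
  using residually_pi_pullback[OF res ext_fold_hom[OF G] group_exterior_square[OF G] x(1)] by simp
 next
  case True
  have nI: "!!U. U : pi_normals ps G ==> U \<lhd> G" by (simp add: pi_normals_def)
  obtain U where U: "U : pi_normals ps G"
  and nb: "bar_map G ZZ (G Mod U) (%g. U #>{:G:} g) id 2 (cycle_of G x) ~: B2 (G Mod U) ZZ"
  by (rule H2_limit_injective_nonboundary[OF G nI inj cycle_of_Z2[OF G x(1) True] cycle_of_not_boundary[OF G x(1) True x(2)]])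
  let ?Q = "G Mod U" and ?z = "bar_map G ZZ (G Mod U) (%g. U #>{:G:} g) id 2 (cycle_of G x)"
  have Q: "group ?Q" "pi_finite ps ?Q" "finite (carrier ?Q)" "pi_number ps (order ?Q)" and p: "(%g. U #>{:G:} g) : hom G ?Q"
  using U normal.factorgroup_is_group[OF nI[OF U]] normal.r_coset_hom_Mod[OF nI[OF U]]
  by (auto simp: pi_normals_def pi_finite_def)
  have id: "id : hom ZZ ZZ" "id (1::int) = 1" by (auto simp: hom_def)
  interpret E: chain_ext_context ?Q ZZ "B2 ?Q ZZ" 1 by (rule univ_ext_context[OF Q(1)])
  let ?y = "B2 ?Q ZZ #>{:E.C2:} ?z"
  obtain f where f: "f : hom (exterior_square G) E.X" "f x = E.incl ?y"
  "!!g h. g : carrier G ==> h : carrier G ==> f (wedge G g h) = comm_elt E.X (\<one>{:E.C2 Mod B2 ?Q ZZ:}, U #>{:G:} g) (\<one>{:E.C2 Mod B2 ?Q ZZ:}, U #>{:G:} h)"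
  by (rule E.X_detects[OF G p id x(1) True]) (rule that)
  have z: "?z : carrier E.C2"
  using hom_in_carrier[OF bar_map_hom[OF abelian_integer_group abelian_integer_group G Q(1) p id(1)] cycle_of(1)[OF G x(1) True]] .
  have y: "?y : carrier (E.C2 Mod B2 ?Q ZZ)" using hom_in_carrier[OF E.L_hom z] .
  have s: "(\<one>{:E.C2 Mod B2 ?Q ZZ:}, U #>{:G:} g) : carrier E.X" if "g : carrier G" for g
  using hom_in_carrier[OF p that] E.M.one_closed by (simp del: one_FactGroup)
  \<comment> \<open>Here the transfer enters: the class lives in an infinite group, yet it is killed
    by the pi-number |G/U|.\<close>
  have pw: "?y [^]{:E.C2 Mod B2 ?Q ZZ:} order ?Q = \<one>{:E.C2 Mod B2 ?Q ZZ:}"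
  by (rule E.wedge_incl_torsion[OF Q(3) G f(1) s f(3) x(1) f(2) y])
  have ne: "?y ~= \<one>{:E.C2 Mod B2 ?Q ZZ:}" using E.L.rcos_eq_one_iff[OF z] nb by simp
  have fg: "finitely_generated E.C2" by (rule finitely_generated_bar_chains[OF Q(1,3)])
  obtain n where n: "pi_number ps n" "?y ~: (%y. y [^]{:E.C2 Mod B2 ?Q ZZ:} n) ` carrier (E.C2 Mod B2 ?Q ZZ)"
  by (rule E.M.torsion_not_power[OF finitely_generated_Mod[OF E.L.normal_axioms E.C2.is_group fg] y ne Q(4) pw])
  \<comment> \<open>The preimage of the n-th powers contains the boundaries and misses the cycle;
    its quotient is pi-finite because the chains are finitely generated.\<close>
  define L where "L = {c : carrier E.C2. B2 ?Q ZZ #>{:E.C2:} c : (%y. y [^]{:E.C2 Mod B2 ?Q ZZ:} n) ` carrier (E.C2 Mod B2 ?Q ZZ)}"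
  interpret l: group_hom E.C2 "E.C2 Mod B2 ?Q ZZ" "%c. B2 ?Q ZZ #>{:E.C2:} c"
  by (rule group_hom_mod_intro[OF E.L.normal_axioms])
  interpret pws: subgroup "(%y. y [^]{:E.C2 Mod B2 ?Q ZZ:} n) ` carrier (E.C2 Mod B2 ?Q ZZ)" "E.C2 Mod B2 ?Q ZZ"
  by (rule E.M.subgroup_powers)
  have L: "subgroup L E.C2"
  proof (rule subgroup.intro)
  show "\<one>{:E.C2:} : L" unfolding L_def using pws.one_closed by (simp only: mem_Collect_eq l.hom_one E.C2.one_closed)
  show "a \<otimes>{:E.C2:} b : L" if "a : L" "b : L" for a b
   using that pws.m_closed unfolding L_def by (simp only: mem_Collect_eq l.hom_mult E.C2.m_closed)
  show "inv{:E.C2:} a : L" if "a : L" for a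
   using that pws.m_inv_closed unfolding L_def by (simp only: mem_Collect_eq l.hom_inv E.C2.inv_closed)
  qed (auto simp: L_def)
  have BL: "B2 ?Q ZZ \<subseteq> L"
  proof
  fix c assume c: "c : B2 ?Q ZZ"
  then have "B2 ?Q ZZ #>{:E.C2:} c = \<one>{:E.C2 Mod B2 ?Q ZZ:}"
   using E.L.rcos_eq_one_iff[OF E.L.mem_carrier[OF c]] by simp
  then show "c : L" unfolding L_def using pws.one_closed E.L.mem_carrier[OF c] by (simp only: mem_Collect_eq)
  qed
  have "c [^]{:E.C2:} n : L" if c: "c : carrier E.C2" for c
  unfolding L_def mem_Collect_eq l.hom_nat_pow[OF c]
  by (rule conjI[OF E.C2.nat_pow_closed[OF c] imageI[OF l.hom_closed[OF c]]])
  then have "L : pi_normals ps E.C2"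
  by (intro E.C2.powers_in_pi_normals[OF fg n(1) L]) blast
  then have fin: "pi_finite ps (E.C2 Mod L)"
  using normal.factorgroup_is_group[of L E.C2] by (auto simp: pi_normals_def pi_finite_def)
  interpret E': chain_ext_context ?Q ZZ L 1
  by (rule chain_ext_context.intro) (use Q L BL abelian_integer_group in auto)
  have "?z ~: L" using n(2) unfolding L_def by blast
  then show ?thesis by (rule E'.X_residual[OF Q(2) fin G p id x(1) True])
 qed
qed

section \<open>Cycles as elements of the exterior square\<close>

lemma (in comm_group) group_center_eq: "group_center G = carrier G"
 by (auto simp: group_center_def m_comm)

text \<open>In a commutative group the cocycle of s is the coboundary of s itself, so its evaluation
  factors through the boundary map and vanishes on cycles.\<close>

lemma Phi_abelian:
 assumes G: "group G" and E: "comm_group E" and s: "s : carrier G \<rightarrow> carrier E"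
 shows "lift_context G E s"
  and "z : Z2 G ZZ ==> Phi G E s z = \<one>{:E:}"
proof -
 note A = abelian_integer_group
 interpret G: group G by (rule G)
 interpret E: comm_group E by (rule E)
 have s': "s g : carrier E" if "g : carrier G" for g using s that by auto
 have "s g \<otimes>{:E:} s h = (s g \<otimes>{:E:} s h \<otimes>{:E:} inv{:E:} s (g \<otimes>{:G:} h)) \<otimes>{:E:} s (g \<otimes>{:G:} h)" if "g : carrier G" "h : carrier G" for g h
  using that by (simp add: E.m_assoc s')
 moreover have "s g \<otimes>{:E:} s h \<otimes>{:E:} inv{:E:} s (g \<otimes>{:G:} h) : carrier E" if "g : carrier G" "h : carrier G" for g h
  using that by (simp add: s')
 ultimately have "central_lift G E s"
  unfolding central_lift_def E.group_center_eq using s by blast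
 then show L: "lift_context G E s"
  by (simp add: lift_context_def lift_context_axioms_def G E.is_group)
 interpret L: lift_context G E s by (rule L)
 let ?C1 = "bar_chains G ZZ (Suc 0)"
 interpret C1: comm_group ?C1 by (rule comm_group_bar_chains[OF A])
 let ?k = "linext (tuples (Suc 0) G) ZZ E (%t n. s (t ! 0) [^]{:E:} n)"
 have ph: "(%n::int. s (t ! 0) [^]{:E:} n) : hom ZZ E" if "t : tuples (Suc 0) G" for t
  using that by (intro int_pow_hom_ZZ[OF E.is_group]) (auto simp: tuples_1 s')
 have k: "?k : hom ?C1 E"
  unfolding bar_chains_def by (rule linext_hom[OF A E ph])
 interpret k: group_hom ?C1 E ?k using k by (simp add: group_hom_defs)
 have kb: "?k (bas G ZZ [g] n) = s g [^]{:E:} n" if "g : carrier G" for g n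
  using linext_single[OF A E, where X = "tuples (Suc 0) G" and phf = "%t n. s (t ! 0) [^]{:E:} n" and t = "[g]" and b = n, OF ph] that by (simp add: tuples_1 bas_def)
 show "Phi G E s z = \<one>{:E:}" if z: "z : Z2 G ZZ"
 proof -
  have zc: "z : carrier (bar_chains G ZZ 2)" "bar_boundary G ZZ 2 z = \<one>{:?C1:}" using z by (simp_all add: kernel_def)
  have "Phi G E s z = ?k (bar_boundary G ZZ 2 z)"
  proof (rule bar_hom_eqI[OF A L.Phi_hom _ E.is_group _ zc(1)])
  show "(%z. ?k (bar_boundary G ZZ 2 z)) : hom (bar_chains G ZZ 2) E"
   using hom_compose[OF bar_boundary_hom2(1)[OF A G] k] by (simp add: comp_def)
  fix t and n :: int assume "t : tuples 2 G"
  then obtain g h where g: "t = [g, h]" "g : carrier G" "h : carrier G" by (auto simp: tuples_2)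
  have b: "bas G ZZ [y] n : carrier ?C1" for y using A by simp
  have "?k (bar_boundary G ZZ 2 (bas G ZZ t n)) = s h [^]{:E:} n \<otimes>{:E:} inv{:E:} (s (g \<otimes>{:G:} h) [^]{:E:} n) \<otimes>{:E:} s g [^]{:E:} n"
   using g b by (simp add: boundary2[OF A G] kb)
  also have "\<dots> = (s g \<otimes>{:E:} s h \<otimes>{:E:} inv{:E:} s (g \<otimes>{:G:} h)) [^]{:E:} n"
   using g s' by (simp add: E.int_pow_distrib E.int_pow_inv E.m_ac)
  finally show "Phi G E s (bas G ZZ t n) = ?k (bar_boundary G ZZ 2 (bas G ZZ t n))"
   using g by (simp add: L.Phi_bas zeta_def)
  qed
  then show ?thesis using zc(2) k.hom_one by simp
 qed
qed

lemma bar_map_id: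
 assumes G: "group G" and c: "c : carrier (bar_chains G ZZ n)"
 shows "bar_map G ZZ G (%g. g) (%n. n) n c = c"
proof -
 note A = abelian_integer_group
 have id: "(%g. g) : hom G G" "(%n. n) : hom ZZ ZZ" by (auto simp: hom_def)
 show ?thesis
 proof (rule bar_hom_eqI[OF A bar_map_hom[OF A A G G id] _ group_bar_chains _ c])
  show "(%c. c) : hom (bar_chains G ZZ n) (bar_chains G ZZ n)" by (auto simp: hom_def monoid.m_closed group.is_monoid A comm_group.axioms)
 qed (simp_all add: bar_map_bas[OF A A id])
qed

lemma Phi_compose:
 assumes L: "lift_context G E s" and M: "lift_context G E' s'" and q: "q : hom E E'"
  and s: "!!g. g : carrier G ==> q (s g) = s' g" and c: "c : carrier (bar_chains G ZZ 2)"
 shows "q (Phi G E s c) = Phi G E' s' c"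
proof -
 interpret L: lift_context G E s by (rule L)
 interpret M: lift_context G E' s' by (rule M)
 interpret q: group_hom E E' q using q by (simp add: group_hom_defs)
 show ?thesis
 proof (rule bar_hom_eqI[OF abelian_integer_group _ M.Phi_hom M.E.is_group _ c])
  show "(%c. q (Phi G E s c)) : hom (bar_chains G ZZ 2) E'"
  using hom_compose[OF L.Phi_hom q] by (simp add: comp_def)
  fix t and n :: int assume "t : tuples 2 G"
  then obtain g h where g: "t = [g, h]" "g : carrier G" "h : carrier G" by (auto simp: tuples_2)
  have "q (zeta G E s g h) = zeta G E' s' g h"
  using g s[symmetric] by (simp add: zeta_def)
  then show "q (Phi G E s (bas G ZZ t n)) = Phi G E' s' (bas G ZZ t n)"
  using g by (simp add: L.Phi_bas M.Phi_bas q.hom_int_pow)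
 qed
qed

lemma comm_central:
 assumes "group E" "c : group_center E" "d : group_center E" "a : carrier E" "b : carrier E"
 shows "comm_elt E (c \<otimes>{:E:} a) (d \<otimes>{:E:} b) = comm_elt E a b"
proof -
 interpret E: group E by fact
 show ?thesis
  using E.comm_central_left(1)[OF assms(2,4), of "d \<otimes>{:E:} b"] E.comm_central_left(2)[OF assms(3,5,4)]
  group_centerD(1)[OF assms(3)] assms(5) by simp
qed

text \<open>The image \<open>N\<close> of the exterior square in the universal extension contains all commutators, and
 modulo \<open>N\<close> the class of a cycle is killed because it is computed in an abelian group.\<close>

lemma cycle_of_surj:
 assumes G: "group G" and z: "z : Z2 G ZZ" "z ~: B2 G ZZ"
 obtains x where "x : carrier (exterior_square G)" "ext_fold G x = \<one>{:G:}" "x ~= \<one>{:exterior_square G:}"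
  "B2 G ZZ #>{:bar_chains G ZZ 2:} cycle_of G x = B2 G ZZ #>{:bar_chains G ZZ 2:} z"
proof -
 note A = abelian_integer_group
 interpret U: chain_ext_context G ZZ "B2 G ZZ" 1 by (rule univ_ext_context[OF G])
 interpret T: group "exterior_square G" by (rule group_exterior_square[OF G])
 let ?s = "%g. (\<one>{:U.C2 Mod B2 G ZZ:}, g)"
 have id: "(%g. g) : hom G G" "(%n. n) : hom ZZ ZZ" by (auto simp: hom_def)
 note liftS = U.lift_X(1)[OF id(1) G]
 interpret S: lift_context G U.X ?s by (rule liftS)
 have PX: "Phi G U.X ?s c = U.incl (B2 G ZZ #>{:U.C2:} c)" if "c : carrier U.C2" for c
  using U.Phi_X[OF id(1) G id(2) HOL.refl that] bar_map_id[OF G that] by simp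
 obtain f where f: "f : hom (exterior_square G) U.X"
  "!!g h. g : carrier G ==> h : carrier G ==> f (wedge G g h) = comm_elt U.X (?s g) (?s h)"
  using central_lift_hom[OF G U.group_X S.lift] by blast
 interpret f: group_hom "exterior_square G" U.X f using f(1) by (simp add: group_hom_defs T.is_group U.group_X)
 let ?N = "f ` carrier (exterior_square G)"
 \<comment> \<open>Every element is a value of the lift up to a central factor; consequently each
   commutator is the image of a single wedge.\<close>
 have sX: "EX c : group_center U.X. p = c \<otimes>{:U.X:} ?s (snd p)" if p: "p : carrier U.X" for p
 proof -
  obtain a g where ag: "p = (a, g)" "a : carrier (U.C2 Mod B2 G ZZ)" "g : carrier G" using p by (cases p) auto
  have "U.incl a \<otimes>{:U.X:} ?s g = (a, g)"
  using ag by (simp add: U.incl_def U.M.m_assoc del: one_FactGroup mult_FactGroup)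
  then show ?thesis using U.incl_center[OF ag(2)] ag(1) by (metis snd_conv)
 qed
 have comm_N: "comm_elt U.X p q : ?N" if p: "p : carrier U.X" "q : carrier U.X" for p q
 proof -
  obtain c d where cd: "c : group_center U.X" "p = c \<otimes>{:U.X:} ?s (snd p)" "d : group_center U.X" "q = d \<otimes>{:U.X:} ?s (snd q)"
  using sX[OF p(1)] sX[OF p(2)] by blast
  have sn: "snd p : carrier G" "snd q : carrier G" using p U.snd_X_hom by (auto simp: hom_def)
  have "comm_elt U.X p q = comm_elt U.X (?s (snd p)) (?s (snd q))"
  using comm_central[OF U.group_X cd(1,3) S.s_closed[OF sn(1)] S.s_closed[OF sn(2)]] cd(2,4) by simp
  then have "comm_elt U.X p q = f (wedge G (snd p) (snd q))" using f(2)[OF sn] by simp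
  then show ?thesis using wedge_closed[OF G sn] by blast
 qed
 have Nsub: "subgroup ?N U.X" by (rule f.img_is_subgroup)
 have Nnorm: "?N \<lhd> U.X"
 proof (rule U.X.normal_invI[OF Nsub])
  fix p t assume t: "t : ?N" and p: "p : carrier U.X"
  have tc: "t : carrier U.X" using subgroup.mem_carrier[OF Nsub t] .
  have "p \<otimes>{:U.X:} t \<otimes>{:U.X:} inv{:U.X:} p = t \<otimes>{:U.X:} comm_elt U.X t (inv{:U.X:} p)"
  using p tc by (simp add: comm_elt_def U.X.m_assoc del: U.X_simps)
  then show "p \<otimes>{:U.X:} t \<otimes>{:U.X:} inv{:U.X:} p : ?N"
  using subgroup.m_closed[OF Nsub t comm_N[OF tc U.X.inv_closed[OF p]]] by (simp only:)
 qed
 interpret N: normal ?N U.X by (rule Nnorm)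
 let ?q = "%p. ?N #>{:U.X:} p" and ?A = "U.X Mod ?N"
 note q = N.r_coset_hom_Mod
 interpret A: group ?A by (rule N.factorgroup_is_group)
 have Acomm: "comm_group ?A"
 proof (rule A.group_comm_groupI)
  fix a b assume "a : carrier ?A" "b : carrier ?A"
  then obtain p r where pr: "a = ?q p" "b = ?q r" "p : carrier U.X" "r : carrier U.X" unfolding carrier_FactGroup by blast
  have "(p \<otimes>{:U.X:} r) \<otimes>{:U.X:} inv{:U.X:} (r \<otimes>{:U.X:} p) = comm_elt U.X (inv{:U.X:} p) (inv{:U.X:} r)"
  using pr by (simp add: comm_elt_def U.X.group_word_simps del: U.X_simps)
  then have "?q (p \<otimes>{:U.X:} r) = ?q (r \<otimes>{:U.X:} p)"
  using N.rcos_eq_iff[OF U.X.m_closed[OF pr(3,4)] U.X.m_closed[OF pr(4,3)]]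
   comm_N[OF U.X.inv_closed[OF pr(3)] U.X.inv_closed[OF pr(4)]] by simp
  then show "a \<otimes>{:?A:} b = b \<otimes>{:?A:} a"
  using pr hom_mult[OF q pr(3,4)] hom_mult[OF q pr(4,3)] by (simp only:)
 qed
 have zc: "z : carrier U.C2" using z(1) by (simp add: kernel_def)
 have sA: "(%g. ?q (?s g)) : carrier G \<rightarrow> carrier ?A"
  using hom_in_carrier[OF q S.s_closed] by blast
 have "?q (Phi G U.X ?s z) = Phi G ?A (%g. ?q (?s g)) z"
  by (rule Phi_compose[OF liftS Phi_abelian(1)[OF G Acomm sA] q HOL.refl zc])
 also have "\<dots> = \<one>{:?A:}" by (rule Phi_abelian(2)[OF G Acomm sA z(1)])
 finally have "Phi G U.X ?s z : ?N"
  using N.rcos_eq_one_iff[OF hom_in_carrier[OF S.Phi_hom zc]] by simp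
 then have "U.incl (B2 G ZZ #>{:U.C2:} z) : ?N" by (simp only: PX[OF zc])
 then obtain x where "U.incl (B2 G ZZ #>{:U.C2:} z) = f x" and x1: "x : carrier (exterior_square G)" by (rule imageE)
 note x = x1 this(1)[symmetric]
 have "ext_fold G x = snd (f x)"
 proof (rule exterior_hom_eqI[OF G ext_fold_hom[OF G] _ G _ x(1)])
  show "(%x. snd (f x)) : hom (exterior_square G) G"
  using hom_compose[OF f(1) U.snd_X_hom] by (simp add: comp_def)
  show "ext_fold G (wedge G g h) = snd (f (wedge G g h))" if "g : carrier G" "h : carrier G" for g h
  using that hom_comm[OF U.snd_X_hom U.X.is_group G, of "?s g" "?s h"] by (simp add: f(2) ext_fold_wedge[OF G] del: one_FactGroup)
 qed
 then have fold: "ext_fold G x = \<one>{:G:}" by (simp add: x(2) U.incl_def)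
 have M: "B2 G ZZ #>{:U.C2:} c : carrier (U.C2 Mod B2 G ZZ)" if "c : carrier U.C2" for c
  using hom_in_carrier[OF U.L_hom that] .
 have "f x = U.incl (B2 G ZZ #>{:U.C2:} cycle_of G x)"
  using cycle_of(2)[OF G x(1) fold liftS f] by (simp only: PX[OF cycle_of(1)[OF G x(1) fold]])
 then have "U.incl (B2 G ZZ #>{:U.C2:} cycle_of G x) = U.incl (B2 G ZZ #>{:U.C2:} z)"
  by (simp only: x(2))
 then have eq: "B2 G ZZ #>{:U.C2:} cycle_of G x = B2 G ZZ #>{:U.C2:} z"
  by (rule U.incl_inj[OF M[OF cycle_of(1)[OF G x(1) fold]] M[OF zc]])
 have "x ~= \<one>{:exterior_square G:}"
 proof
  assume "x = \<one>{:exterior_square G:}"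
  then have "f x = \<one>{:U.X:}" using f.hom_one by (simp only:)
  then have "U.incl (B2 G ZZ #>{:U.C2:} z) = U.incl \<one>{:U.C2 Mod B2 G ZZ:}"
  by (simp only: x(2) hom_one[OF U.incl_hom U.M.is_group U.group_X])
  then have "B2 G ZZ #>{:U.C2:} z = \<one>{:U.C2 Mod B2 G ZZ:}"
  by (rule U.incl_inj[OF M[OF zc] U.M.one_closed])
  then have "B2 G ZZ #>{:U.C2:} z = B2 G ZZ" by (simp only: one_FactGroup)
  then show False using U.L.rcos_eq_one_iff[OF zc] z(2) by blast
 qed
 then show thesis using that x(1) fold eq by blast
qed

text \<open>The cocycle of E can be evaluated on chains with coefficients in B, because powers in E
  depend on the exponent modulo m and \<open>al\<close> determines integers modulo m. This
  evaluation kills boundaries, and on the image of z it gives the value of \<open>Phi\<close> at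
  z.\<close>

lemma not_boundary_of_central_lift:
 assumes G: "group G" and Q: "group Q" and B: "comm_group B"
  and p: "p : hom G Q" "p ` carrier G = carrier Q" and al: "al : hom ZZ B" "al ` UNIV = carrier B"
  and t: "lift_context Q E t" and tp: "lift_context G E (%g. t (p g))"
  and m: "!!e. e : carrier E ==> e [^]{:E:} (m::int) = \<one>{:E:}" "!!n. al n = \<one>{:B:} ==> m dvd n"
  and z: "z : carrier (bar_chains G ZZ 2)" "Phi G E (%g. t (p g)) z ~= \<one>{:E:}"
 shows "bar_map G ZZ Q p al 2 z ~: B2 Q B"
proof
 note A = abelian_integer_group
 interpret Q: group Q by (rule Q)
 interpret B: comm_group B by (rule B)
 interpret t: lift_context Q E t by (rule t)
 interpret tp: lift_context G E "%g. t (p g)" by (rule tp)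
 interpret al: group_hom ZZ B al using al(1) by (simp add: group_hom_defs B.is_group)
 interpret p: group_hom G Q p using p(1) by (simp add: group_hom_defs G Q)
 have pow_eq: "e [^]{:E:} n = e [^]{:E:} n'" if e: "e : carrier E" "al n = al n'" for e n n'
 proof -
  have "al (n - n') = al n \<otimes>{:B:} inv{:B:} al n'"
  using al.hom_mult[of n "- n'"] al.hom_inv[of n'] by simp
  then have "m dvd n - n'" using m(2) e(2) al.hom_closed[of n'] by simp
  then obtain k where "n = n' + m * k" by (metis add.commute diff_add_cancel dvd_def)
  then have "e [^]{:E:} n = e [^]{:E:} n' \<otimes>{:E:} (e [^]{:E:} m) [^]{:E:} k"
  using e by (simp add: t.E.int_pow_pow t.E.int_pow_mult[symmetric])
  then show ?thesis using m(1)[OF e(1)] e(1) by simp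
 qed
 \<comment> \<open>An integer representing the coefficient b; by \<open>pow_eq\<close> the choice
   does not affect powers in E.\<close>
 let ?r = "%b. SOME n. al n = b"
 have r: "al (?r b) = b" if "b : carrier B" for b
 proof -
  have "b : al ` UNIV" using that by (simp only: al(2))
  then obtain n where "b = al n" by (rule imageE)
  then show ?thesis using someI[of "%n. al n = b" n] by simp
 qed
 let ?z = "%t'. zeta Q E t (t' ! 0) (t' ! 1)"
 let ?phf = "%t' b. ?z t' [^]{:center_group E:} ?r b"
 have cen: "?z t' : group_center E" if "t' : tuples 2 Q" for t'
  using that t.zeta_eq(1) by (auto simp: tuples_2)
 have phf: "?phf t' : hom B (center_group E)" if t': "t' : tuples 2 Q" for t'
 proof (rule homI)
  note c = cen[OF t'] group_centerD(1)[OF cen[OF t']]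
  show "?phf t' b : carrier (center_group E)" for b
  using c t.Z.int_pow_closed[of "?z t'"] by simp
  fix b b' assume b: "b : carrier B" "b' : carrier B"
  have "al (?r (b \<otimes>{:B:} b')) = al (?r b + ?r b')"
  using al.hom_mult[of "?r b" "?r b'"] r b by simp
  then have "?z t' [^]{:E:} ?r (b \<otimes>{:B:} b') = ?z t' [^]{:E:} (?r b + ?r b')"
  by (rule pow_eq[OF c(2)])
  then show "?phf t' (b \<otimes>{:B:} b') = ?phf t' b \<otimes>{:center_group E:} ?phf t' b'"
  using c by (simp add: center_group_pow[OF t.E.is_group] t.E.int_pow_mult)
 qed
 let ?L = "linext (tuples 2 Q) B (center_group E) ?phf"
 have L: "?L : hom (bar_chains Q B 2) (center_group E)"
  unfolding bar_chains_def by (rule linext_hom[OF B t.Z.comm_group_axioms phf])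
 have "Phi G E (%g. t (p g)) z = ?L (bar_map G ZZ Q p al 2 z)"
 proof (rule bar_hom_eqI[OF A tp.Phi_hom_center _ t.Z.is_group _ z(1)])
  show "(%z. ?L (bar_map G ZZ Q p al 2 z)) : hom (bar_chains G ZZ 2) (center_group E)"
  using hom_compose[OF bar_map_hom[OF A B G Q p(1) al(1)] L] by (simp add: comp_def)
  fix u and n :: int assume u: "u : tuples 2 G"
  then obtain g h where g: "u = [g, h]" "g : carrier G" "h : carrier G" by (auto simp: tuples_2)
  have pg: "p g : carrier Q" "p h : carrier Q" using g by auto
  have zz: "zeta G E (%g. t (p g)) g h = zeta Q E t (p g) (p h)"
  using g by (simp add: zeta_def)
  have "?L (bar_map G ZZ Q p al 2 (bas G ZZ u n)) = ?phf [p g, p h] (al n)"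
  using linext_bas[OF B t.Z.comm_group_axioms phf pg, where b = "al n"] u g
  by (simp add: bar_map_bas[OF A B p(1) al(1)])
  also have "\<dots> = zeta Q E t (p g) (p h) [^]{:E:} ?r (al n)"
  using center_group_pow[OF t.E.is_group t.zeta_eq(1)[OF pg]] by simp
  also have "\<dots> = zeta Q E t (p g) (p h) [^]{:E:} n"
  by (rule pow_eq[OF t.zeta_closed[OF pg] r]) simp
  finally show "Phi G E (%g. t (p g)) (bas G ZZ u n) = ?L (bar_map G ZZ Q p al 2 (bas G ZZ u n))"
  using g by (simp add: tp.Phi_bas zz)
 qed
 moreover assume "bar_map G ZZ Q p al 2 z : B2 Q B"
 then obtain c where "c : carrier (bar_chains Q B 3)" "bar_map G ZZ Q p al 2 z = bar_boundary Q B 3 c" by blast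
 then have "?L (bar_map G ZZ Q p al 2 z) = \<one>{:center_group E:}"
 proof (simp only:, intro linext_boundary3[OF B Q t.Z.comm_group_axioms phf])
  fix g h k b assume g: "g : carrier Q" "h : carrier Q" "k : carrier Q" "b : carrier B"
  have z: "zeta Q E t g h : carrier (center_group E)" "zeta Q E t h k : carrier (center_group E)"
  "zeta Q E t g (h \<otimes>{:Q:} k) : carrier (center_group E)" "zeta Q E t (g \<otimes>{:Q:} h) k : carrier (center_group E)"
  using g t.zeta_eq(1) by simp_all
  show "?phf [h, k] b \<otimes>{:center_group E:} ?phf [g, h \<otimes>{:Q:} k] b = ?phf [g, h] b \<otimes>{:center_group E:} ?phf [g \<otimes>{:Q:} h, k] b"
  using t.Z.int_pow_distrib[OF z(2,3), of "?r b"] t.Z.int_pow_distrib[OF z(1,4), of "?r b"] t.zeta_cocycle[OF g(1-3)] by simp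
 qed
 ultimately show False using z(2) by simp
qed

section \<open>Residual finiteness implies injectivity\<close>

lemma finite_reps:
 assumes "N \<lhd> G" "finite (carrier (G Mod N))"
 obtains R where "finite R" "R \<subseteq> carrier G"
  "!!g. g : carrier G ==> EX r : R. N #>{:G:} g = N #>{:G:} r"
proof -
 have c: "carrier (G Mod N) = (%g. N #>{:G:} g) ` carrier G" by (auto simp: carrier_FactGroup)
 then have "carrier (G Mod N) \<subseteq> (%g. N #>{:G:} g) ` carrier G" by simp
 from finite_subset_image[OF assms(2) this]
 obtain R where R: "R \<subseteq> carrier G" "finite R" "carrier (G Mod N) = (%g. N #>{:G:} g) ` R" by blast
 show thesis
 proof (rule that[OF R(2,1)])
  fix g assume "g : carrier G"
  then have "N #>{:G:} g : carrier (G Mod N)" unfolding c by (rule imageI)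
  then show "EX r : R. N #>{:G:} g = N #>{:G:} r" unfolding R(3) by blast
 qed
qed

text \<open>Pigeonhole: among the commutators of b with a^0, ..., a^|D| two coincide, so a^k
  commutes with b for some k with 0 < k <= |D|, and such k divides the factorial of |D|.\<close>

lemma (in group) power_central:
 assumes D: "subgroup D G" "finite D" and comm: "!!a b. a : carrier G ==> b : carrier G ==> comm_elt G a b : D"
  and a: "a : carrier G"
 shows "a [^] (fact (card D) :: nat) : group_center G"
proof -
 have "a [^] (fact (card D) :: nat) \<otimes> b = b \<otimes> a [^] (fact (card D) :: nat)" if b: "b : carrier G" for b
 proof -
  let ?h = "%i::nat. comm_elt G b (a [^] i)"
  have "?h ` {..card D} \<subseteq> D" using comm[OF b] a by auto
  then have lt: "card (?h ` {..card D}) < card {..card D}"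
  using card_mono[OF D(2)] by (simp add: le_imp_less_Suc)
  have "~ inj_on ?h {..card D}"
  proof
  assume "inj_on ?h {..card D}"
  then have "card (?h ` {..card D}) = card {..card D}" by (rule card_image)
  then show False using lt by simp
  qed
  then obtain i j where ij: "i < j" "j <= card D" "?h i = ?h j"
  unfolding inj_on_def by (metis atMost_iff linorder_neqE_nat)
  define k where "k = j - i"
  have k: "k > 0" "k <= card D" "a [^] j = a [^] k \<otimes> a [^] i"
  using ij a by (simp_all add: k_def nat_pow_mult)
  have e: "conj_elt G b x = b \<otimes> comm_elt G b x" if "x : carrier G" for x
  using that b by (simp add: conj_elt_def comm_elt_def m_assoc)
  have "conj_elt G (conj_elt G b (a [^] k)) (a [^] i) = conj_elt G b (a [^] i)"
  using e[of "a [^] i"] e[of "a [^] j"] ij(3) conj_conj[of b "a [^] k" "a [^] i"] a b by (simp add: k(3))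
  then have "conj_elt G b (a [^] k) = b"
  using a b by (simp add: conj_elt_def)
  then have kc: "b \<otimes> a [^] k = a [^] k \<otimes> b" using conj_eq_iff[of b "a [^] k"] a b by simp
  have "k dvd fact (card D)" using k(1,2) by (intro dvd_fact) auto
  then obtain l where "fact (card D) = k * l" by blast
  moreover have "b \<otimes> (a [^] k) [^] l = (a [^] k) [^] l \<otimes> b"
  using kc a b by (metis nat_pow_closed group_commutes_pow)
  ultimately show ?thesis using a by (simp add: nat_pow_pow)
 qed
 then show ?thesis using a by (simp add: group_center_def)
qed

text \<open>The separating subgroup \<open>N\<close> consists of the n-th powers of central
  elements, with n = t m, where t kills the torsion of H/D and m = |D|. If y were z^n, then z would
  be torsion modulo D, so z^t would lie in D and y = (z^t)^m = 1. The index is finite because a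
  fixed power of every element lies in \<open>N\<close>, while D is finite and H/D finitely
  generated abelian.\<close>

lemma finite_by_abelian_residual:
 assumes H: "group H" and fg: "finitely_generated H" and D: "subgroup D H" "finite D"
  and comm: "!!a b. a : carrier H ==> b : carrier H ==> comm_elt H a b : D"
  and y: "y : D" "y ~= \<one>{:H:}"
 shows "EX N : pi_normals UNIV H. y ~: N"
proof -
 interpret H: group H by (rule H)
 interpret sD: subgroup D H by (rule D)
 have "D \<lhd> H"
 proof (rule H.normal_invI[OF D(1)])
  fix x d assume x: "x : carrier H" "d : D"
  have "x \<otimes>{:H:} d \<otimes>{:H:} inv{:H:} x = d \<otimes>{:H:} comm_elt H d (inv{:H:} x)"
  using x by (simp add: comm_elt_def H.m_assoc)
  then show "x \<otimes>{:H:} d \<otimes>{:H:} inv{:H:} x : D" using comm[of d "inv{:H:} x"] x by simp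
 qed
 then interpret nD: normal D H .
 let ?A = "H Mod D" and ?q = "%a. D #>{:H:} a"
 interpret A: group ?A by (rule nD.factorgroup_is_group)
 interpret q: group_hom H ?A ?q by (rule group_hom_mod_intro[OF nD.normal_axioms])
 interpret A: comm_group ?A
 proof (rule A.group_comm_groupI)
  fix a b assume "a : carrier ?A" "b : carrier ?A"
  then obtain p r where pr: "a = ?q p" "b = ?q r" "p : carrier H" "r : carrier H" unfolding carrier_FactGroup by blast
  have "(p \<otimes>{:H:} r) \<otimes>{:H:} inv{:H:} (r \<otimes>{:H:} p) = comm_elt H (inv{:H:} p) (inv{:H:} r)"
  using pr by (simp add: comm_elt_def H.group_word_simps)
  then have "?q (p \<otimes>{:H:} r) = ?q (r \<otimes>{:H:} p)"
  using nD.rcos_eq_iff[of "p \<otimes>{:H:} r" "r \<otimes>{:H:} p"] comm[of "inv{:H:} p" "inv{:H:} r"] pr by simp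
  then show "a \<otimes>{:?A:} b = b \<otimes>{:?A:} a"
  using pr q.hom_mult[OF pr(3,4)] q.hom_mult[OF pr(4,3)] by (simp only:)
 qed
 have fgA: "finitely_generated ?A" by (rule finitely_generated_Mod[OF nD.normal_axioms H fg])
 have "EX n. pi_number UNIV n & x [^]{:?A:} n = \<one>{:?A:}" if "x : torsion_elements ?A" for x
  using that by (auto simp: torsion_elements_def pi_number_def)
 then obtain t :: nat where t: "pi_number UNIV t" "!!x. x : torsion_elements ?A ==> x [^]{:?A:} t = \<one>{:?A:}"
  using A.torsion_exponent[OF fgA, of UNIV] by metis
 define m where "m = card D"
 have m: "m > 0" "t > 0" using D(2) y(1) pi_number_pos[OF t(1)] by (auto simp: m_def card_gt_0_iff)
 define n where "n = t * m"
 define N where "N = (%z. z [^]{:H:} n) ` group_center H"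
 interpret Z: subgroup "group_center H" H by (rule H.subgroup_center)
 have NZ: "N \<subseteq> group_center H"
 proof -
  have "z [^]{:H:} n : group_center H" if "z : group_center H" for z
  using H.subgroup_int_pow_closed[OF H.subgroup_center that, of "int n"] by (simp only: int_pow_int)
  then show ?thesis unfolding N_def by blast
 qed
 have Nsub: "subgroup N H"
 proof (rule subgroup.intro)
  show "N \<subseteq> carrier H" using NZ Z.subset by blast
  show "\<one>{:H:} : N" unfolding N_def using Z.one_closed by (intro image_eqI[of _ _ "\<one>{:H:}"]) auto
  show "a \<otimes>{:H:} b : N" if "a : N" "b : N" for a b
  proof -
  obtain x z where x: "a = x [^]{:H:} n" "b = z [^]{:H:} n" "x : group_center H" "z : group_center H"
   using \<open>a : N\<close> \<open>b : N\<close> by (auto simp: N_def)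
  have c: "x : carrier H" "z : carrier H" by (rule group_centerD(1)[OF x(3)], rule group_centerD(1)[OF x(4)])
  have "(x \<otimes>{:H:} z) [^]{:H:} n = x [^]{:H:} n \<otimes>{:H:} z [^]{:H:} n"
   by (rule H.pow_mult_distrib[OF group_centerD(2)[OF x(3) c(2)] c])
  then have "a \<otimes>{:H:} b = (x \<otimes>{:H:} z) [^]{:H:} n" using x(1,2) by (simp only:)
  then show ?thesis unfolding N_def using Z.m_closed[OF x(3,4)] by blast
  qed
  show "inv{:H:} a : N" if "a : N" for a
  proof -
  obtain x where x: "a = x [^]{:H:} n" "x : group_center H" using \<open>a : N\<close> by (auto simp: N_def)
  then have "inv{:H:} a = (inv{:H:} x) [^]{:H:} n" using H.nat_pow_inv[of x n] Z.subset by auto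
  then show ?thesis unfolding N_def using Z.m_inv_closed[OF x(2)] by blast
  qed
 qed
 have Nn: "N \<lhd> H"
 proof (rule H.normal_invI[OF Nsub])
  fix x z assume x: "x : carrier H" "z : N"
  then have "z : group_center H" "z : carrier H" using NZ Z.subset by auto
  note zc = this
  have "x \<otimes>{:H:} z \<otimes>{:H:} inv{:H:} x = z \<otimes>{:H:} x \<otimes>{:H:} inv{:H:} x"
  by (simp only: group_centerD(2)[OF zc(1) x(1)])
  also have "\<dots> = z" using zc(2) x(1) by (simp add: H.m_assoc)
  finally have "x \<otimes>{:H:} z \<otimes>{:H:} inv{:H:} x = z" .
  then show "x \<otimes>{:H:} z \<otimes>{:H:} inv{:H:} x : N" using x by simp
 qed
 interpret N: normal N H by (rule Nn)
 have "y ~: N"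
 proof
  assume "y : N"
  then obtain z where z: "y = z [^]{:H:} n" "z : carrier H" using Z.subset by (auto simp: N_def)
  have qp: "?q (z [^]{:H:} k) = ?q z [^]{:?A:} k" for k :: nat by (rule q.hom_nat_pow[OF z(2)])
  have "?q z [^]{:?A:} n = \<one>{:?A:}"
  using qp[of n] nD.rcos_eq_one_iff[of y] y(1) z sD.subset by auto
  note zn = this
  have "n > 0" using m by (simp add: n_def)
  then have "?q z : torsion_elements ?A"
  unfolding torsion_elements_def using q.hom_closed[OF z(2)] zn by (intro CollectI conjI exI[of _ n])
  then have "?q (z [^]{:H:} t) = D" using t(2) qp[of t] by simp
  then have zt: "z [^]{:H:} t : D" using nD.rcos_eq_one_iff[of "z [^]{:H:} t"] z(2) by simp
  interpret HD: group "H\<lparr>carrier := D\<rparr>" by (rule H.subgroup_imp_group[OF D(1)])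
  have "(z [^]{:H:} t) [^]{:H:} m = \<one>{:H:}"
  using HD.pow_order_eq_1[of "z [^]{:H:} t"] zt H.nat_pow_consistent[of "z [^]{:H:} t" m D] by (simp add: order_def m_def)
  then show False using z y(2) H.nat_pow_pow[OF z(2), of t m] by (simp add: n_def)
 qed
 moreover have "finite (carrier (H Mod N))"
 proof -
  \<comment> \<open>By \<open>power_central\<close> the power with exponent m! is central, so its
    n-th power lies in \<open>N\<close>.\<close>
  define M where "M = (fact m :: nat) * n"
  have M: "a [^]{:H:} M : N" "a [^]{:H:} M : group_center H" if "a : carrier H" for a
  proof -
  have "a [^]{:H:} (fact m :: nat) : group_center H"
   unfolding m_def by (rule H.power_central[OF D comm that])
  then have "(a [^]{:H:} (fact m :: nat)) [^]{:H:} n : N" unfolding N_def by blast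
  then show "a [^]{:H:} M : N" using that by (simp add: M_def H.nat_pow_pow)
  then show "a [^]{:H:} M : group_center H" using NZ by blast
  qed
  let ?L = "(%y. y [^]{:?A:} M) ` carrier ?A"
  have "pi_number UNIV M" using m by (simp add: pi_number_def M_def n_def)
  then have L: "?L : pi_normals UNIV ?A"
  by (intro A.powers_in_pi_normals[OF fgA _ A.subgroup_powers]) auto
  then have Ln: "?L \<lhd> ?A" and Lf: "finite (carrier (?A Mod ?L))" by (simp_all only: pi_normals_def pi_finite_def mem_Collect_eq)
  interpret L: normal ?L ?A by (rule Ln)
  obtain R where R: "finite R" "R \<subseteq> carrier ?A" "!!g. g : carrier ?A ==> EX r : R. ?L #>{:?A:} g = ?L #>{:?A:} r"
  by (rule finite_reps[OF Ln Lf]) (rule that)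
  have "R \<subseteq> ?q ` carrier H" using R(2) by (auto simp: carrier_FactGroup)
  from finite_subset_image[OF R(1) this]
  obtain S where S: "S \<subseteq> carrier H" "finite S" "R = ?q ` S" by blast
  \<comment> \<open>Every a is a product of an M-th power, which lies in \<open>N\<close>, an
    element of \<open>D\<close>, and one of finitely many representatives of H/D modulo its M-th
    powers.\<close>
  have "carrier (H Mod N) \<subseteq> (%(d, r). N #>{:H:} (d \<otimes>{:H:} r)) ` (D \<times> S)"
  proof
  fix c assume "c : carrier (H Mod N)"
  then obtain a where a: "c = N #>{:H:} a" "a : carrier H" unfolding carrier_FactGroup by blast
  obtain r where r: "r : S" "?L #>{:?A:} ?q a = ?L #>{:?A:} ?q r"
   using R(3)[OF q.hom_closed[OF a(2)]] S(3) by blast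
  have rH: "r : carrier H" using r S by blast
  have "?q a \<otimes>{:?A:} inv{:?A:} ?q r : ?L"
   by (rule iffD1[OF L.rcos_eq_iff[OF q.hom_closed[OF a(2)] q.hom_closed[OF rH]] r(2)])
  then obtain X where X: "?q a \<otimes>{:?A:} inv{:?A:} ?q r = X [^]{:?A:} M" "X : carrier ?A" by (rule imageE)
  obtain b where b: "X = ?q b" "b : carrier H" using X(2) unfolding carrier_FactGroup by blast
  have "?q (a \<otimes>{:H:} inv{:H:} r) = ?q (b [^]{:H:} M)"
   using X(1) by (simp only: b(1) q.hom_mult[OF a(2) H.inv_closed[OF rH]] q.hom_inv[OF rH] q.hom_nat_pow[OF b(2)])
  then have "(a \<otimes>{:H:} inv{:H:} r) \<otimes>{:H:} inv{:H:} (b [^]{:H:} M) : D"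
   using nD.rcos_eq_iff[of "a \<otimes>{:H:} inv{:H:} r" "b [^]{:H:} M"] a(2) rH b(2) by simp
  then obtain d where d: "d : D" "(a \<otimes>{:H:} inv{:H:} r) \<otimes>{:H:} inv{:H:} (b [^]{:H:} M) = d" by blast
  let ?b = "b [^]{:H:} M"
  have bc: "?b : carrier H" "d : carrier H" using b d sD.subset by auto
  have "a = d \<otimes>{:H:} ?b \<otimes>{:H:} r" using d(2)[symmetric] a(2) rH bc by (simp add: H.m_assoc)
  also have "\<dots> = ?b \<otimes>{:H:} (d \<otimes>{:H:} r)"
   unfolding group_centerD(2)[OF M(2)[OF b(2)] bc(2), symmetric] by (rule H.m_assoc[OF bc rH])
  finally have "a \<otimes>{:H:} inv{:H:} (d \<otimes>{:H:} r) = ?b" using bc rH by (simp add: H.m_assoc)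
  then have "N #>{:H:} a = N #>{:H:} (d \<otimes>{:H:} r)"
   using N.rcos_eq_iff[of a "d \<otimes>{:H:} r"] M(1)[OF b(2)] a(2) bc rH by simp
  then show "c : (%(d, r). N #>{:H:} (d \<otimes>{:H:} r)) ` (D \<times> S)" using a(1) d(1) r(1) by auto
  qed
  then show ?thesis using D(2) S(2) finite_subset by blast
 qed
 ultimately show ?thesis
  using Nn N.factorgroup_is_group by (auto simp: pi_normals_def pi_finite_UNIV)
qed

lemma hom_eq_on_generate:
 assumes "h : hom G H" "h' : hom G H" "group G" "group H" "S \<subseteq> carrier G" "!!s. s : S ==> h s = h' s"
  and x: "x : generate G S"
 shows "h x = h' x"
proof -
 interpret G: group G by fact
 interpret h: group_hom G H h using assms by (simp add: group_hom_defs)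
 interpret h': group_hom G H h' using assms by (simp add: group_hom_defs)
 have c: "y : carrier G" if "y : generate G S" for y using G.generate_in_carrier[OF assms(5) that] .
 show ?thesis using x
 proof (induction rule: generate.induct)
  case one show ?case using h.hom_one h'.hom_one by simp
 next
  case (incl y) then show ?case using assms(6) by simp
 next
  case (inv y) then show ?case using assms(5,6) h.hom_inv[of y] h'.hom_inv[of y] by auto
 next
  case (eng y z) then show ?case using h.hom_mult[of y z] h'.hom_mult[of y z] c by simp
 qed
qed

text \<open>A finitely generated group has only finitely many homomorphisms to a given finite group.\<close>

lemma endomorphism_invariant_normal:
 assumes T: "group T" "finitely_generated T" "residually_pi UNIV T" and x: "x : carrier T" "x ~= \<one>{:T:}"
 obtains K where "K : pi_normals UNIV T" "x ~: K" "!!a k. a : hom T T ==> k : K ==> a k : K"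
proof -
 obtain N where N: "N : pi_normals UNIV T" "x ~: N" using T(3) x unfolding residually_pi_def by blast
 have Nn: "N \<lhd> T" and Q: "group (T Mod N)" "finite (carrier (T Mod N))" "pi_finite UNIV (T Mod N)"
  using N(1) by (simp_all add: pi_normals_def pi_finite_UNIV)
 interpret N: normal N T by (rule Nn)
 let ?Q = "T Mod N"
 obtain S where S: "finite S" "S \<subseteq> carrier T" "generate T S = carrier T"
  using T(2) by (auto simp: finitely_generated_def)
 \<comment> \<open>Composing a homomorphism to \<open>?Q\<close> with an endomorphism of T gives
   another such homomorphism; hence the intersection of all these kernels is invariant.\<close>
 let ?F = "(%h. kernel T ?Q h) ` hom T ?Q"
 let ?c = "%psi. SOME h. h : hom T ?Q & (ALL s : S. h s = psi s)"
 have "?F \<subseteq> (%psi. kernel T ?Q (?c psi)) ` (S \<rightarrow>\<^sub>E carrier ?Q)"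
 proof
  fix X assume "X : ?F"
  then obtain h where h: "X = kernel T ?Q h" "h : hom T ?Q" by (rule imageE)
  \<comment> \<open>A homomorphism is determined by its values on the generators, so the finitely
    many functions on \<open>S\<close> index all kernels.\<close>
  define h' where "h' = ?c (restrict h S)"
  have "h' : hom T ?Q & (ALL s : S. h' s = restrict h S s)"
  unfolding h'_def by (rule someI[of "%g. g : hom T ?Q & (ALL s : S. g s = restrict h S s)" h]) (simp add: h(2))
  then have h': "h' : hom T ?Q" "h s = h' s" if "s : S" for s using that by simp_all
  have h'h: "h' : hom T ?Q"
  using \<open>h' : hom T ?Q & (ALL s : S. h' s = restrict h S s)\<close> by (rule conjunct1)
  have "h y = h' y" if "y : carrier T" for y
  by (rule hom_eq_on_generate[OF h(2) h'h T(1) Q(1) S(2) h'(2)]) (simp_all only: S(3) that)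
  then have "X = kernel T ?Q h'" unfolding h(1) kernel_def by (intro Collect_cong) metis
  then have "X = kernel T ?Q (?c (restrict h S))" by (simp only: h'_def)
  moreover have "restrict h S : S \<rightarrow>\<^sub>E carrier ?Q" by (simp only: restrict_PiE_iff) (intro ballI hom_in_carrier[OF h(2)] subsetD[OF S(2)])
  ultimately show "X : (%psi. kernel T ?Q (?c psi)) ` (S \<rightarrow>\<^sub>E carrier ?Q)" by (rule image_eqI)
 qed
 then have fin: "finite ?F" using finite_PiE[OF S(1)] Q(2) by (meson finite_imageI finite_subset)
 have sub: "?F \<subseteq> pi_normals UNIV T" using kernel_in_pi_normals[OF _ T(1) Q(3)] by blast
 show thesis
 proof (rule that[OF pi_normals_Inter[OF T(1) fin sub]])
  have "kernel T ?Q (%a. N #>{:T:} a) : ?F" using N.r_coset_hom_Mod by blast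
  moreover have "x ~: kernel T ?Q (%a. N #>{:T:} a)" using N.rcos_eq_one_iff[OF x(1)] N(2) by (simp add: kernel_def)
  ultimately show "x ~: carrier T \<inter> \<Inter> ?F" by blast
  show "a k : carrier T \<inter> \<Inter> ?F" if a: "a : hom T T" and k: "k : carrier T \<inter> \<Inter> ?F" for a k
  proof -
  have "a k : kernel T ?Q h" if h: "h : hom T ?Q" for h
  proof -
   have "k : kernel T ?Q (h \<circ> a)" using k hom_compose[OF a h] by blast
   then show ?thesis using hom_in_carrier[OF a] by (simp add: kernel_def)
  qed
  then show ?thesis using k hom_in_carrier[OF a] by blast
  qed
 qed
qed

type_synonym 'a cover_elt =
 "(('a => 'a) \<times> ('a + 'a) gword set set => ('a => 'a) \<times> ('a + 'a) gword set set) \<times> 'a"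

text \<open>Two obstacles are met. The cover need not be finitely generated, so it is replaced by
  the subgroup generated by lifts of generators of G. A normal subgroup of the exterior square need
  not be normal in the cover, so one that is invariant under endomorphisms is factored out.\<close>

lemma exterior_finite_image:
 fixes G :: "('a, 'b) monoid_scheme"
 assumes G: "group G" and fg: "finitely_generated G" and fgT: "finitely_generated (exterior_square G)"
  and res: "residually_pi UNIV (exterior_square G)"
  and x: "x : carrier (exterior_square G)" "x ~= \<one>{:exterior_square G:}"
 obtains P :: "'a cover_elt monoid" and E :: "'a cover_elt set set monoid" and k f
 where "group P" "group E" "finite (carrier E)" "k : hom P E" "k ` carrier P = carrier E"
  "f : hom (exterior_square G) P" "k (f x) ~= \<one>{:E:}" "snd : hom P G" "snd ` carrier P = carrier G"
  "!!p q. p : carrier P ==> q : carrier P ==> comm_elt P p q = f (wedge G (snd p) (snd q))"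
  "!!p. p : carrier P ==> snd p = \<one>{:G:} ==> p : group_center P"
proof -
 note th = that
 let ?T = "exterior_square G"
 interpret G: group G by (rule G)
 have grT: "group ?T" by (rule group_exterior_square[OF G])
 interpret T: group ?T by (rule grT)
 obtain K where K: "K : pi_normals UNIV ?T" "x ~: K" "!!a k. a : hom ?T ?T ==> k : K ==> a k : K"
  by (rule endomorphism_invariant_normal[OF grT fgT res x]) (rule that)
 have Kn: "K \<lhd> ?T" and Kfin: "finite (carrier (?T Mod K))" using K(1) by (simp_all only: pi_normals_def pi_finite_def mem_Collect_eq)
 interpret K: normal K ?T by (rule Kn)
 obtain P :: "'a cover_elt monoid" and s f
  where P: "group P" "central_lift G P s" "f : hom ?T P" "inj_on f (carrier ?T)"
  "!!p q. p : carrier P ==> q : carrier P ==> comm_elt P p q = f (wedge G (snd p) (snd q))"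
  "snd : hom P G" "!!g. g : carrier G ==> snd (s g) = g"
  "!!p. p : carrier P ==> snd p = \<one>{:G:} ==> p : group_center P"
  by (rule exterior_cover[OF G]) (rule that)
 interpret P: group P by (rule P(1))
 obtain S where S: "finite S" "S \<subseteq> carrier G" "generate G S = carrier G"
  using fg unfolding finitely_generated_def by (elim exE conjE)
 have sP: "s : carrier G \<rightarrow> carrier P" using P(2) unfolding central_lift_def by (rule conjunct1)
 have sS: "s ` S \<subseteq> carrier P" using S(2) by (intro image_subsetI funcset_mem[OF sP]) (rule subsetD)
 define P0 where "P0 = generate P (s ` S)"
 have P0sub: "subgroup P0 P" unfolding P0_def by (rule P.generate_is_subgroup[OF sS])
 define P1 where "P1 = P\<lparr>carrier := P0\<rparr>"
 have P1: "group P1" unfolding P1_def by (rule P.subgroup_imp_group[OF P0sub])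
 interpret P1: group P1 by (rule P1)
 have cP1: "carrier P1 = P0" and mP1: "monoid.mult P1 = monoid.mult P" and oP1: "\<one>{:P1:} = \<one>{:P:}"
  by (simp_all add: P1_def)
 have iP1: "inv{:P1:} p = inv{:P:} p" if "p : P0" for p
  unfolding P1_def by (rule P.m_inv_consistent[OF P0sub that])
 have P0P: "p : carrier P" if "p : P0" for p by (rule subgroup.mem_carrier[OF P0sub that])
 have commP1: "comm_elt P1 p q = comm_elt P p q" if "p : P0" "q : P0" for p q
  by (simp only: comm_elt_def iP1 that mP1)
 have sndP1: "snd : hom P1 G"
  by (rule homI) (simp_all only: cP1 mP1 hom_in_carrier[OF P(6)] hom_mult[OF P(6)] P0P)
 interpret sn: group_hom P G snd using P(6) by (simp add: group_hom_defs G P(1))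
 interpret sn1: group_hom P1 G snd using sndP1 by (simp add: group_hom_defs G P1)
 have "snd ` s ` S = (%g. g) ` S" unfolding image_image
  by (rule image_cong[OF HOL.refl]) (rule P(7)[OF subsetD[OF S(2)]])
 then have snS: "snd ` P0 = carrier G"
  using sn.generate_img[OF sS] S(3) by (simp only: P0_def image_ident)
 define si where "si g = (SOME p. p : P0 & snd p = g)" for g
 have si: "si g : P0 & snd (si g) = g" if "g : carrier G" for g
 proof -
  have "g : snd ` P0" using that by (simp only: snS)
  then obtain p where "g = snd p" "p : P0" by (rule imageE)
  then show ?thesis unfolding si_def by (intro someI[of "%p. p : P0 & snd p = g" p]) simp
 qed
 have cen: "p : group_center P1" if "p : P0" "snd p = \<one>{:G:}" for p
 proof -
  have "p : group_center P" by (rule P(8)[OF P0P[OF that(1)] that(2)])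
  then have "p \<otimes>{:P:} q = q \<otimes>{:P:} p" if "q : P0" for q by (rule group_centerD(2)[OF _ P0P[OF that]])
  then show ?thesis unfolding group_center_def cP1 mP1 using that(1) by blast
 qed
 have lift: "central_lift G P1 si"
  unfolding central_lift_def
 proof (intro conjI ballI)
  show "si : carrier G \<rightarrow> carrier P1" unfolding cP1 using si by blast
  fix g h assume g: "g : carrier G" "h : carrier G"
  have gh: "g \<otimes>{:G:} h : carrier G" using g by simp
  have c: "si g : carrier P1" "si h : carrier P1" "si (g \<otimes>{:G:} h) : carrier P1" unfolding cP1 using si[OF g(1)] si[OF g(2)] si[OF gh] by simp_all
  let ?c = "si g \<otimes>{:P1:} si h \<otimes>{:P1:} inv{:P1:} si (g \<otimes>{:G:} h)"
  have cc: "?c : carrier P1" using c by (intro P1.m_closed P1.inv_closed)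
  have "snd ?c = snd (si g) \<otimes>{:G:} snd (si h) \<otimes>{:G:} inv{:G:} snd (si (g \<otimes>{:G:} h))"
  using c by (simp only: sn1.hom_mult sn1.hom_inv P1.m_closed P1.inv_closed)
  then have "snd ?c = \<one>{:G:}" using si[OF g(1)] si[OF g(2)] si[OF gh] G.r_inv[OF gh] by simp
  then have "?c : group_center P1" using cen cc unfolding cP1 by blast
  moreover have "si g \<otimes>{:P1:} si h = ?c \<otimes>{:P1:} si (g \<otimes>{:G:} h)" using c by (simp add: P1.m_assoc)
  ultimately show "EX z : group_center P1. si g \<otimes>{:P1:} si h = z \<otimes>{:P1:} si (g \<otimes>{:G:} h)" by (rule bexI[rotated])
 qed
 obtain f0 where f0: "f0 : hom ?T P1" "!!g h. g : carrier G ==> h : carrier G ==> f0 (wedge G g h) = comm_elt P1 (si g) (si h)"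
  using central_lift_hom[OF G P1 lift] by blast
 have f0P: "f0 : hom ?T P"
  by (rule homI) (simp_all only: hom_in_carrier[OF f0(1), unfolded cP1, THEN P0P] hom_mult[OF f0(1)] mP1)
 \<comment> \<open>The smaller group still contains the exterior square, with the same embedding,
   because commutators in the cover depend only on the images in G.\<close>
 have f0f: "f0 y = f y" if "y : carrier ?T" for y
 proof (rule exterior_hom_eqI[OF G f0P P(3) P(1) _ that])
  fix g h assume g: "g : carrier G" "h : carrier G"
  note sg = si[OF g(1)] si[OF g(2)]
  have "comm_elt P1 (si g) (si h) = f (wedge G (snd (si g)) (snd (si h)))"
  using commP1[OF conjunct1[OF sg(1)] conjunct1[OF sg(2)]] P(5)[OF P0P[OF conjunct1[OF sg(1)]] P0P[OF conjunct1[OF sg(2)]]]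
  by (simp only:)
  then show "f0 (wedge G g h) = f (wedge G g h)" using f0(2)[OF g] sg by simp
 qed
 interpret f0: group_hom ?T P1 f0 using f0(1) by (simp add: group_hom_defs grT P1)
 have commf: "comm_elt P1 p q = f0 (wedge G (snd p) (snd q))" if p: "p : carrier P1" "q : carrier P1" for p q
 proof -
  have w: "wedge G (snd p) (snd q) : carrier ?T"
  by (rule wedge_closed[OF G sn1.hom_closed[OF p(1)] sn1.hom_closed[OF p(2)]])
  show ?thesis using commP1 P(5) P0P p f0f[OF w] unfolding cP1 by simp
 qed
 have inj0: "inj_on f0 (carrier ?T)" using P(4) f0f by (simp cong: inj_on_cong)
 have Dn: "p \<otimes>{:P1:} f0 t \<otimes>{:P1:} inv{:P1:} p : f0 ` carrier ?T" if p: "p : carrier P1" and t: "t : carrier ?T" for p t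
 proof -
  have w: "wedge G (snd (f0 t)) (snd (inv{:P1:} p)) : carrier ?T"
  using p t by (intro wedge_closed[OF G] sn1.hom_closed) simp_all
  have "p \<otimes>{:P1:} f0 t \<otimes>{:P1:} inv{:P1:} p = f0 t \<otimes>{:P1:} comm_elt P1 (f0 t) (inv{:P1:} p)"
  using p t by (simp add: comm_elt_def P1.m_assoc)
  also have "\<dots> = f0 (t \<otimes>{:?T:} wedge G (snd (f0 t)) (snd (inv{:P1:} p)))"
  by (simp only: commf[OF f0.hom_closed[OF t] P1.inv_closed[OF p]] f0.hom_mult[OF t w])
  finally show ?thesis using T.m_closed[OF t w] by blast
 qed
 let ?K = "f0 ` K"
 have Ksub: "subgroup ?K P1" by (rule f0.subgroup_img_is_subgroup[OF normal_imp_subgroup[OF Kn]])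
 have Knorm: "?K \<lhd> P1"
 proof (rule P1.normal_invI[OF Ksub])
  fix p y assume p: "p : carrier P1" and "y : ?K"
  then obtain t where t: "y = f0 t" "t : K" by blast
  \<comment> \<open>Conjugation by p preserves the embedded exterior square, hence is induced by an
    endomorphism of it, and \<open>K\<close> is invariant under that.\<close>
  let ?h = "%t. p \<otimes>{:P1:} f0 t \<otimes>{:P1:} inv{:P1:} p"
  have h: "?h : hom ?T P1" using p by (intro homI) (simp_all add: P1.m_assoc)
  have "?h ` carrier ?T \<subseteq> f0 ` carrier ?T" using Dn[OF p] by blast
  then obtain a where a: "a : hom ?T ?T" "!!t. t : carrier ?T ==> f0 (a t) = ?h t"
  by (rule hom_through_mono[OF f0(1) inj0 h _ grT]) (rule that)
  have "?h t = f0 (a t)" using a(2)[OF K.mem_carrier[OF t(2)]] by (rule HOL.sym)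
  then show "p \<otimes>{:P1:} y \<otimes>{:P1:} inv{:P1:} p : ?K" using K(3)[OF a(1) t(2)] unfolding t(1) by (rule image_eqI)
 qed
 interpret K': normal ?K P1 by (rule Knorm)
 let ?H = "P1 Mod ?K" and ?q = "%p. ?K #>{:P1:} p"
 have grH: "group ?H" by (rule K'.factorgroup_is_group)
 interpret H: group ?H by (rule grH)
 have qhom: "?q : hom P1 ?H" by (rule K'.r_coset_hom_Mod)
 interpret q: group_hom P1 ?H ?q using qhom by (simp only: group_hom_defs grH P1 simp_thms)
 have "s ` S \<subseteq> P0" unfolding P0_def by (rule subsetI) (rule generate.incl)
 then have "generate P1 (s ` S) = carrier P1" unfolding cP1 unfolding P1_def
  using P.generate_consistent[OF _ P0sub] by (simp only: P0_def)
 then have "finitely_generated P1" unfolding finitely_generated_def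
  using S(1) \<open>s ` S \<subseteq> P0\<close> unfolding cP1 by blast
 then have fgH: "finitely_generated ?H" by (rule finitely_generated_Mod[OF Knorm P1])
 let ?d = "%t. ?q (f0 t)"
 have dhom: "?d : hom ?T ?H" using hom_compose[OF f0(1) qhom] by (simp only: comp_def)
 interpret d: group_hom ?T ?H ?d using dhom by (simp only: group_hom_defs grH grT simp_thms)
 let ?D = "?d ` carrier ?T"
 have Dsub: "subgroup ?D ?H" by (rule d.img_is_subgroup)
 obtain R where R: "finite R" "R \<subseteq> carrier ?T" "!!g. g : carrier ?T ==> EX r : R. K #>{:?T:} g = K #>{:?T:} r"
  by (rule finite_reps[OF Kn Kfin]) (rule that)
 have "?D \<subseteq> ?d ` R"
 proof
  fix y assume "y : ?D"
  then obtain t where t: "y = ?d t" "t : carrier ?T" by (rule imageE)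
  obtain r where r: "r : R" "K #>{:?T:} t = K #>{:?T:} r" using R(3)[OF t(2)] by (rule bexE)
  have rT: "r : carrier ?T" by (rule subsetD[OF R(2) r(1)])
  have "t \<otimes>{:?T:} inv{:?T:} r : K" using K.rcos_eq_iff[OF t(2) rT] r(2) by (rule iffD1)
  then have "f0 (t \<otimes>{:?T:} inv{:?T:} r) : ?K" by (rule imageI)
  then have "f0 t \<otimes>{:P1:} inv{:P1:} f0 r : ?K" by (simp only: f0.hom_mult[OF t(2) T.inv_closed[OF rT]] f0.hom_inv[OF rT])
  then have "?d t = ?d r" by (rule iffD2[OF K'.rcos_eq_iff[OF f0.hom_closed[OF t(2)] f0.hom_closed[OF rT]]])
  then show "y : ?d ` R" unfolding t(1) using r(1) by (rule image_eqI)
 qed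
 then have Dfin: "finite ?D" by (rule finite_subset[OF _ finite_imageI[OF R(1)]])
 have Dcomm: "comm_elt ?H a b : ?D" if "a : carrier ?H" "b : carrier ?H" for a b
 proof -
  have "a : ?q ` carrier P1" "b : ?q ` carrier P1" using that by (simp_all only: carrier_FactGroup)
  then obtain p r where "a = ?q p" "p : carrier P1" "b = ?q r" "r : carrier P1" by (elim imageE)
  note pr = this(2,4,1,3)
  have w: "wedge G (snd p) (snd r) : carrier ?T"
  by (rule wedge_closed[OF G sn1.hom_closed[OF pr(1)] sn1.hom_closed[OF pr(2)]])
  have "comm_elt ?H a b = ?d (wedge G (snd p) (snd r))"
  unfolding pr(3,4) hom_comm[OF qhom P1 grH pr(1,2), symmetric] commf[OF pr(1,2)] by (rule HOL.refl)
  then show ?thesis using w by (rule image_eqI)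
 qed
 have "f0 x ~: ?K" using inj_on_image_mem_iff[OF inj0 x(1) K.subset] K(2) by blast
 then have ne: "?d x ~= \<one>{:?H:}" using K'.rcos_eq_one_iff[OF f0.hom_closed[OF x(1)]] unfolding one_FactGroup by blast
 \<comment> \<open>\<open>?H\<close> is finitely generated and its commutators lie in the finite
   subgroup \<open>?D\<close>.\<close>
 obtain N where N: "N : pi_normals UNIV ?H" "?d x ~: N"
  using finite_by_abelian_residual[OF grH fgH Dsub Dfin Dcomm imageI[OF x(1)] ne] by (rule bexE)
 have Nn: "N \<lhd> ?H" and Nfin: "finite (carrier (?H Mod N))" using N(1) by (simp_all only: pi_normals_def pi_finite_def mem_Collect_eq)
 interpret N: normal N ?H by (rule Nn)
 let ?k = "%p. N #>{:?H:} ?q p"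
 have khom: "?k : hom P1 (?H Mod N)" using hom_compose[OF qhom N.r_coset_hom_Mod] by (simp only: comp_def)
 have ksurj: "?k ` carrier P1 = carrier (?H Mod N)"
  unfolding carrier_FactGroup image_image by (rule HOL.refl)
 have kx: "?k (f0 x) ~= \<one>{:?H Mod N:}"
  using N.rcos_eq_one_iff[OF d.hom_closed[OF x(1)]] N(2) unfolding one_FactGroup by blast
 have c1: "p : group_center P1" if "p : carrier P1" "snd p = \<one>{:G:}" for p using cen that unfolding cP1 by blast
 show thesis
  by (rule th[OF P1 N.factorgroup_is_group Nfin khom ksurj f0(1) kx sndP1 snS[folded cP1] commf c1])
qed

theorem prof_injective_of_residually_finite:
 fixes G :: "('a, 'b) monoid_scheme"
 assumes G: "group G" and fg: "finitely_generated G" and fgT: "finitely_generated (exterior_square G)"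
  and res: "residually_pi UNIV (exterior_square G)"
 shows "prof_injective UNIV G"
proof -
 interpret G: group G by (rule G)
 interpret C: pi_completion G UNIV using G by (simp add: pi_completion_def)
 interpret Z: pi_completion ZZ UNIV by (simp add: pi_completion_def)
 note A = abelian_integer_group
 have "z : B2 G ZZ" if z: "z : Z2 G ZZ" and all: "ALL (V, W) : prof_index C.P Z.P.
  bar_map G ZZ (C.P Mod V) (%g. V #>{:C.P:} C.io g) (%n. W #>{:Z.P:} Z.io n) 2 z : B2 (C.P Mod V) (Z.P Mod W)" for z
 proof (rule ccontr)
  assume nb: "z ~: B2 G ZZ"
  have zc: "z : carrier (bar_chains G ZZ 2)" using z by (simp add: kernel_def)
  obtain x where x: "x : carrier (exterior_square G)" "ext_fold G x = \<one>{:G:}" "x ~= \<one>{:exterior_square G:}"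
  and xz: "B2 G ZZ #>{:bar_chains G ZZ 2:} cycle_of G x = B2 G ZZ #>{:bar_chains G ZZ 2:} z"
  by (rule cycle_of_surj[OF G z nb])
  obtain P :: "'a cover_elt monoid" and E :: "'a cover_elt set set monoid" and k f
  where P: "group P" and E: "group E" "finite (carrier E)" and k: "k : hom P E" "k ` carrier P = carrier E"
  and f: "f : hom (exterior_square G) P" "k (f x) ~= \<one>{:E:}" and sn: "snd : hom P G" "snd ` carrier P = carrier G"
  and comm: "!!p q. p : carrier P ==> q : carrier P ==> comm_elt P p q = f (wedge G (snd p) (snd q))"
  and cen: "!!p. p : carrier P ==> snd p = \<one>{:G:} ==> p : group_center P"
  by (rule exterior_finite_image[OF G fg fgT res x(1,3)]) (rule that)
  interpret P: group P by (rule P)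
  interpret E: group E by (rule E)
  interpret k: group_hom P E k using k(1) by (simp add: group_hom_defs P E(1))
  interpret sn: group_hom P G snd using sn(1) by (simp add: group_hom_defs P G)
  \<comment> \<open>G/U is the common quotient of G and E under P. It is finite as an image of E,
    and the kernel of E onto G/U is the image of the kernel of \<open>snd\<close>, which is
    central.\<close>
  define U where "U = snd ` kernel P E k"
  have Usub: "subgroup U G" unfolding U_def by (rule sn.subgroup_img_is_subgroup[OF k.subgroup_kernel])
  have snE: "EX p : carrier P. snd p = g" if "g : carrier G" for g
  proof -
  have "g : snd ` carrier P" using that by (simp only: sn(2))
  then obtain p where "g = snd p" "p : carrier P" by (rule imageE)
  then show ?thesis by (intro bexI[of _ p]) simp_all
  qed
  have Un: "U \<lhd> G"
  proof (rule G.normal_invI[OF Usub])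
  fix g u assume g: "g : carrier G" and "u : U"
  then obtain r where r: "u = snd r" "r : carrier P" "k r = \<one>{:E:}" unfolding U_def kernel_def by blast
  obtain p where p: "p : carrier P" "snd p = g" using snE[OF g] by blast
  have "k (p \<otimes>{:P:} r \<otimes>{:P:} inv{:P:} p) = \<one>{:E:}" using p r by simp
  then have "p \<otimes>{:P:} r \<otimes>{:P:} inv{:P:} p : kernel P E k" using p r by (simp add: kernel_def)
  moreover have "g \<otimes>{:G:} u \<otimes>{:G:} inv{:G:} g = snd (p \<otimes>{:P:} r \<otimes>{:P:} inv{:P:} p)" using p r by simp
  ultimately show "g \<otimes>{:G:} u \<otimes>{:G:} inv{:G:} g : U" unfolding U_def by (rule rev_image_eqI)
  qed
  interpret U: normal U G by (rule Un)
  have kU: "U #>{:G:} snd p = U #>{:G:} snd p'" if p: "p : carrier P" "p' : carrier P" "k p = k p'" for p p'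
  proof -
  have "k (p \<otimes>{:P:} inv{:P:} p') = \<one>{:E:}" using p by simp
  then have "p \<otimes>{:P:} inv{:P:} p' : kernel P E k" using p by (simp add: kernel_def)
  then have "snd (p \<otimes>{:P:} inv{:P:} p') : U" unfolding U_def by (rule imageI)
  then have "snd p \<otimes>{:G:} inv{:G:} snd p' : U" using p by simp
  then show ?thesis by (rule iffD2[OF U.rcos_eq_iff[OF sn.hom_closed[OF p(1)] sn.hom_closed[OF p(2)]]])
  qed
  have "carrier (G Mod U) \<subseteq> (%e. U #>{:G:} snd (SOME p. p : carrier P & k p = e)) ` carrier E"
  proof
  fix c assume "c : carrier (G Mod U)"
  then obtain g where g: "c = U #>{:G:} g" "g : carrier G" unfolding carrier_FactGroup by blast
  obtain p where p: "p : carrier P" "snd p = g" using snE[OF g(2)] by blast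
  let ?p = "SOME p'. p' : carrier P & k p' = k p"
  have p': "?p : carrier P & k ?p = k p"
   by (rule someI[of "%p'. p' : carrier P & k p' = k p" p]) (simp add: p)
  have "c = U #>{:G:} snd ?p" unfolding g(1) p(2)[symmetric]
   by (rule kU[OF p(1) conjunct1[OF p'] HOL.sym[OF conjunct2[OF p']]])
  then show "c : (%e. U #>{:G:} snd (SOME p. p : carrier P & k p = e)) ` carrier E"
   using k.hom_closed[OF p(1)] by (rule image_eqI)
  qed
  then have "finite (carrier (G Mod U))" by (rule finite_subset[OF _ finite_imageI[OF E(2)]])
  then have UI: "U : pi_normals UNIV G" using Un U.factorgroup_is_group by (simp only: pi_normals_def pi_finite_UNIV mem_Collect_eq simp_thms)
  define V where "V = {xi : carrier C.P. xi U = U}"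
  have V: "V : open_normals C.P" unfolding V_def by (rule C.proj_kernel_open[OF UI])
  have Vn: "V \<lhd> C.P" using V by (simp add: open_normals_def)
  interpret V: normal V C.P by (rule Vn)
  define pr where "pr = (%g. V #>{:C.P:} C.io g)"
  have pr: "pr : hom G (C.P Mod V)" "pr ` carrier G = carrier (C.P Mod V)"
  unfolding pr_def by (rule C.completion_quotient(1)[OF V], rule C.completion_quotient(2)[OF V])
  have Q: "group (C.P Mod V)" by (rule V.factorgroup_is_group)
  interpret pr: group_hom G "C.P Mod V" pr using pr(1) by (simp only: group_hom_defs G Q simp_thms)
  have prU: "g : U" if g: "g : carrier G" "pr g = \<one>{:C.P Mod V:}" for g
  proof -
  have "V #>{:C.P:} C.io g = V" using g(2) by (simp only: pr_def one_FactGroup)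
  then have "C.io g : V" by (rule iffD1[OF V.rcos_eq_one_iff[OF hom_in_carrier[OF C.io_hom g(1)]]])
  then have "C.io g U = U" unfolding V_def by (simp only: mem_Collect_eq)
  then have "U #>{:G:} g = U" by (simp only: C.io_apply[OF UI])
  then show ?thesis by (rule iffD1[OF U.rcos_eq_one_iff[OF g(1)]])
  qed
  \<comment> \<open>Elements of P with the same image in the finite quotient differ by an element
    over the identity of G and one of the kernel of k, so their images in E differ by a central
    factor.\<close>
  have key: "EX c : group_center E. k p = c \<otimes>{:E:} k p'"
  if p: "p : carrier P" "p' : carrier P" "pr (snd p) = pr (snd p')" for p p'
  proof -
  have c: "snd p : carrier G" "snd p' : carrier G" using p by auto
  have "pr (snd p \<otimes>{:G:} inv{:G:} snd p') = \<one>{:C.P Mod V:}"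
   using pr.hom_mult[OF c(1) G.inv_closed[OF c(2)]] pr.hom_inv[OF c(2)] p(3) pr.H.r_inv[OF pr.hom_closed[OF c(2)]] by (simp only:)
  then have "snd p \<otimes>{:G:} inv{:G:} snd p' : U" by (rule prU[OF G.m_closed[OF c(1) G.inv_closed[OF c(2)]]])
  then obtain r where r: "snd r = snd p \<otimes>{:G:} inv{:G:} snd p'" "r : carrier P" "k r = \<one>{:E:}"
   unfolding U_def kernel_def by auto
  let ?c = "p \<otimes>{:P:} inv{:P:} p' \<otimes>{:P:} inv{:P:} r"
  have cP: "?c : carrier P" using p r by simp
  have "snd ?c = snd p \<otimes>{:G:} inv{:G:} snd p' \<otimes>{:G:} inv{:G:} snd r"
   using p r(2) by (simp only: sn.hom_mult sn.hom_inv P.m_closed P.inv_closed)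
  then have "snd ?c = \<one>{:G:}" unfolding r(1)
   using G.r_inv[OF G.m_closed[OF c(1) G.inv_closed[OF c(2)]]] by (simp only:)
  then have cc: "?c : group_center P" by (rule cen[OF cP])
  have "k ?c \<otimes>{:E:} e = e \<otimes>{:E:} k ?c" if "e : carrier E" for e
  proof -
   have "e : k ` carrier P" using that by (simp only: k(2))
   then obtain y where y: "e = k y" "y : carrier P" by (rule imageE)
   show ?thesis unfolding y(1) k.hom_mult[OF cP y(2), symmetric] k.hom_mult[OF y(2) cP, symmetric] group_centerD(2)[OF cc y(2)]
    by (rule HOL.refl)
  qed
  then have "k ?c : group_center E" unfolding group_center_def using k.hom_closed[OF cP] by blast
  moreover have "k p = k ?c \<otimes>{:E:} k p'" using p r by (simp add: E.m_assoc)
  ultimately show ?thesis by (rule bexI[rotated])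
  qed
  define ta where "ta X = (SOME p. p : carrier P & pr (snd p) = X)" for X
  have ta: "ta X : carrier P & pr (snd (ta X)) = X" if "X : carrier (C.P Mod V)" for X
  proof -
  have "X : pr ` carrier G" using that by (simp only: pr(2))
  then obtain g where g: "X = pr g" "g : carrier G" by (rule imageE)
  obtain p where p: "p : carrier P" "snd p = g" using snE[OF g(2)] by blast
  show ?thesis unfolding ta_def
   by (rule someI[of "%p. p : carrier P & pr (snd p) = X" p]) (simp only: g(1) p simp_thms)
  qed
  define t where "t X = k (ta X)" for X
  have t_mult: "EX c : group_center E. t X \<otimes>{:E:} t Y = c \<otimes>{:E:} t (X \<otimes>{:C.P Mod V:} Y)"
  if X: "X : carrier (C.P Mod V)" "Y : carrier (C.P Mod V)" for X Y
  proof -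
  note XY = pr.H.m_closed[OF X]
  note c = conjunct1[OF ta[OF X(1)]] conjunct1[OF ta[OF X(2)]] conjunct1[OF ta[OF XY]]
  have "pr (snd (ta X \<otimes>{:P:} ta Y)) = X \<otimes>{:C.P Mod V:} Y"
   by (simp only: sn.hom_mult[OF c(1,2)] pr.hom_mult[OF sn.hom_closed[OF c(1)] sn.hom_closed[OF c(2)]]
    conjunct2[OF ta[OF X(1)]] conjunct2[OF ta[OF X(2)]])
  then have "EX z : group_center E. k (ta X \<otimes>{:P:} ta Y) = z \<otimes>{:E:} k (ta (X \<otimes>{:C.P Mod V:} Y))"
   by (intro key[OF P.m_closed[OF c(1,2)] c(3)]) (simp only: conjunct2[OF ta[OF XY]])
  then show ?thesis by (simp only: t_def k.hom_mult[OF c(1,2)])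
  qed
  have tc: "t X : carrier E" if "X : carrier (C.P Mod V)" for X
  unfolding t_def by (rule k.hom_closed[OF conjunct1[OF ta[OF that]]])
  have lt: "lift_context (C.P Mod V) E t"
  unfolding lift_context_def lift_context_axioms_def central_lift_def using Q E(1) t_mult tc by blast
  have "central_lift G E (%g. t (pr g))"
  unfolding central_lift_def
  proof (intro conjI ballI)
  show "(%g. t (pr g)) : carrier G \<rightarrow> carrier E" using tc pr.hom_closed by blast
  fix g h assume g: "g : carrier G" "h : carrier G"
  show "EX z : group_center E. t (pr g) \<otimes>{:E:} t (pr h) = z \<otimes>{:E:} t (pr (g \<otimes>{:G:} h))"
   unfolding pr.hom_mult[OF g] by (rule t_mult[OF pr.hom_closed[OF g(1)] pr.hom_closed[OF g(2)]])
  qed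
  then have ltp: "lift_context G E (%g. t (pr g))"
  by (simp only: lift_context_def lift_context_axioms_def G E(1) simp_thms)
  interpret L: lift_context G E "%g. t (pr g)" by (rule ltp)
  have kf: "(%y. k (f y)) : hom (exterior_square G) E" using hom_compose[OF f(1) k(1)] by (simp only: comp_def)
  have kfw: "k (f (wedge G g h)) = comm_elt E (t (pr g)) (t (pr h))" if g: "g : carrier G" "h : carrier G" for g h
  proof -
  obtain p r where p: "p : carrier P" "snd p = g" "r : carrier P" "snd r = h" using snE[OF g(1)] snE[OF g(2)] by blast
  note c = ta[OF pr.hom_closed[OF g(1)]] ta[OF pr.hom_closed[OF g(2)]]
  obtain a where a: "a : group_center E" "k p = a \<otimes>{:E:} k (ta (pr g))"
   using key[OF p(1) conjunct1[OF c(1)]] c(1) p(2) by metis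
  obtain b where b: "b : group_center E" "k r = b \<otimes>{:E:} k (ta (pr h))"
   using key[OF p(3) conjunct1[OF c(2)]] c(2) p(4) by metis
  have "k (f (wedge G g h)) = k (comm_elt P p r)" by (simp only: comm[OF p(1,3)] p(2,4))
  also have "\<dots> = comm_elt E (k p) (k r)" by (rule hom_comm[OF k(1) P E(1) p(1,3)])
  also have "\<dots> = comm_elt E (k (ta (pr g))) (k (ta (pr h)))"
   unfolding a(2) b(2) by (rule comm_central[OF E(1) a(1) b(1) k.hom_closed[OF conjunct1[OF c(1)]] k.hom_closed[OF conjunct1[OF c(2)]]])
  finally show ?thesis by (simp only: t_def)
  qed
  let ?C2 = "bar_chains G ZZ 2" and ?F = "Phi G E (%g. t (pr g))"
  have cy: "cycle_of G x : carrier ?C2" by (rule cycle_of(1)[OF G x(1,2)])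
  have C2: "comm_group ?C2" "group ?C2" by (rule comm_group_bar_chains[OF A], simp)
  have nB: "B2 G ZZ \<lhd> ?C2" by (rule comm_group.subgroup_imp_normal[OF C2(1) B2_subgroup[OF A G]])
  have F: "group_hom ?C2 E ?F" using L.Phi_hom C2(2) E(1) by (simp add: group_hom_defs)
  have "cycle_of G x \<otimes>{:?C2:} inv{:?C2:} z : B2 G ZZ" by (rule iffD1[OF normal.rcos_eq_iff[OF nB cy zc] xz])
  then obtain c where c: "cycle_of G x \<otimes>{:?C2:} inv{:?C2:} z = bar_boundary G ZZ 3 c" "c : carrier (bar_chains G ZZ 3)" by (rule imageE)
  \<comment> \<open>The cycle of x and z are homologous, so the cocycle of E takes the same value on
    both.\<close>
  have "?F (cycle_of G x) \<otimes>{:E:} inv{:E:} ?F z = ?F (cycle_of G x \<otimes>{:?C2:} inv{:?C2:} z)"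
  by (simp only: group_hom.hom_inv[OF F zc] hom_mult[OF L.Phi_hom cy group.inv_closed[OF C2(2) zc]])
  also have "\<dots> = \<one>{:E:}" unfolding c(1) by (rule L.Phi_boundary[OF c(2)])
  finally have "?F (cycle_of G x) = ?F z"
  using E.inv_solve_right'[OF E.one_closed hom_in_carrier[OF L.Phi_hom cy] hom_in_carrier[OF L.Phi_hom zc]]
   hom_in_carrier[OF L.Phi_hom zc] by simp
  moreover have "k (f x) = ?F (cycle_of G x)" by (rule cycle_of(2)[OF G x(1,2) ltp kf kfw])
  ultimately have kz: "k (f x) = ?F z" by simp
  have Fz: "?F z ~= \<one>{:E:}" using f(2) unfolding kz .
  \<comment> \<open>The order of E is an exponent for it, so its cocycle can be evaluated with
    coefficients that determine integers modulo |E|.\<close>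
  let ?m = "int (order E)"
  have m0: "order E > 0" using E(2) E.order_gt_0_iff_finite by blast
  have mh: "(%n. n mod ?m) : hom ZZ (integer_mod_group (order E))"
  using m0 by (intro homI) (simp_all add: carrier_integer_mod_group mod_add_eq)
  have mf: "pi_finite UNIV (integer_mod_group (order E))"
  using m0 by (simp add: pi_finite_UNIV carrier_integer_mod_group)
  define M where "M = kernel ZZ (integer_mod_group (order E)) (%n. n mod ?m)"
  have MI: "M : pi_normals UNIV ZZ" unfolding M_def by (rule kernel_in_pi_normals[OF mh group_integer_group mf])
  have Md: "?m dvd n" if "n : M" for n using that by (simp add: M_def kernel_def dvd_eq_mod_eq_0)
  interpret M: normal M ZZ by (rule Z.I_normal[OF MI])
  define W where "W = {xi : carrier Z.P. xi M = M}"
  have W: "W : open_normals Z.P" unfolding W_def by (rule Z.proj_kernel_open[OF MI])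
  have Wn: "W \<lhd> Z.P" using W by (simp add: open_normals_def)
  interpret W: normal W Z.P by (rule Wn)
  interpret ZP: comm_group Z.P by (rule comm_completion_ZZ)
  have B: "comm_group (Z.P Mod W)" by (rule ZP.abelian_FactGroup[OF normal_imp_subgroup[OF Wn]])
  have al: "(%n. W #>{:Z.P:} Z.io n) : hom ZZ (Z.P Mod W)" "(%n. W #>{:Z.P:} Z.io n) ` UNIV = carrier (Z.P Mod W)"
  using Z.completion_quotient(1,2)[OF W] by simp_all
  have ald: "?m dvd n" if "W #>{:Z.P:} Z.io n = \<one>{:Z.P Mod W:}" for n
  proof -
  have n: "n : carrier ZZ" by simp
  have "W #>{:Z.P:} Z.io n = W" using that by (simp only: one_FactGroup)
  then have "Z.io n : W" by (rule iffD1[OF W.rcos_eq_one_iff[OF hom_in_carrier[OF Z.io_hom n]]])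
  then have "Z.io n M = M" unfolding W_def by (simp only: mem_Collect_eq)
  then have "M #>{:ZZ:} n = M" by (simp only: Z.io_apply[OF MI])
  then show ?thesis by (intro Md) (rule iffD1[OF M.rcos_eq_one_iff[OF n]])
  qed
  have em: "e [^]{:E:} ?m = \<one>{:E:}" if "e : carrier E" for e
  using E.pow_order_eq_1[OF that] by (simp only: int_pow_int)
  have "bar_map G ZZ (C.P Mod V) pr (%n. W #>{:Z.P:} Z.io n) 2 z ~: B2 (C.P Mod V) (Z.P Mod W)"
  by (rule not_boundary_of_central_lift[OF G Q B pr al lt ltp em ald zc Fz])
  moreover have "(V, W) : prof_index C.P Z.P" using V W by (simp add: prof_index_def)
  ultimately show False using all unfolding pr_def by blast
 qed
 then show ?thesis unfolding prof_injective_iff[OF G] by blast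
qed

section \<open>Quadratic maps on finitely generated abelian groups\<close>

definition bihom :: "('a, 'b) monoid_scheme => ('m, 'n) monoid_scheme => ('a => 'a => 'm) => bool" where
 "bihom A M bt \<longleftrightarrow> (ALL x : carrier A. bt x : hom A M) & (ALL y : carrier A. (%x. bt x y) : hom A M)"

text \<open>Here b is the polar form of q. The condition b x x = (q x)^2 makes q homogeneous of
  degree two, that is q (x^n) = (q x)^(n^2) for all integers n, negative ones included.\<close>

definition quadratic ::
 "('a, 'b) monoid_scheme => ('m, 'n) monoid_scheme => ('a => 'm) => ('a => 'a => 'm) => bool" where
 "quadratic A M q b \<longleftrightarrow> bihom A M b & (ALL x : carrier A. q x : carrier M & b x x = q x \<otimes>{:M:} q x) &
  (ALL x : carrier A. ALL y : carrier A. q (x \<otimes>{:A:} y) = q x \<otimes>{:M:} q y \<otimes>{:M:} b x y)"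

locale quadratic_map = A: group A + M: comm_group M
 for A :: "('a, 'b) monoid_scheme" (structure) and M :: "('m, 'n) monoid_scheme" and q b +
 assumes quad: "quadratic A M q b"
begin

lemma q_closed [simp]: "x : carrier A ==> q x : carrier M"
 and b_self: "x : carrier A ==> b x x = q x \<otimes>{:M:} q x"
 and q_mult: "x : carrier A ==> y : carrier A ==> q (x \<otimes> y) = q x \<otimes>{:M:} q y \<otimes>{:M:} b x y"
 and b_hom: "x : carrier A ==> b x : hom A M" "y : carrier A ==> (%x. b x y) : hom A M"
 using quad unfolding quadratic_def bihom_def by simp_all

lemma b_closed [simp]: "x : carrier A ==> y : carrier A ==> b x y : carrier M"
 by (rule hom_in_carrier[OF b_hom(1)])

lemma b_simps:
 assumes "x : carrier A" "y : carrier A"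
 shows "z : carrier A ==> b (x \<otimes> y) z = b x z \<otimes>{:M:} b y z" "z : carrier A ==> b z (x \<otimes> y) = b z x \<otimes>{:M:} b z y"
  "b x \<one> = \<one>{:M:}" "b \<one> x = \<one>{:M:}" "b x (inv y) = inv{:M:} b x y" "b (x [^] (n::nat)) y = b x y [^]{:M:} n"
proof -
 interpret l: group_hom A M "b x" using b_hom(1)[OF assms(1)] by (simp add: group_hom_defs A.is_group M.is_group)
 interpret r: group_hom A M "%z. b z x" using b_hom(2)[OF assms(1)] by (simp add: group_hom_defs A.is_group M.is_group)
 interpret r': group_hom A M "%z. b z y" using b_hom(2)[OF assms(2)] by (simp add: group_hom_defs A.is_group M.is_group)
 show "b x \<one> = \<one>{:M:}" "b \<one> x = \<one>{:M:}" by (rule l.hom_one, rule r.hom_one)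
 show "b x (inv y) = inv{:M:} b x y" by (rule l.hom_inv[OF assms(2)])
 show "b (x [^] n) y = b x y [^]{:M:} n" for n :: nat by (rule r'.hom_nat_pow[OF assms(1)])
 show "b (x \<otimes> y) z = b x z \<otimes>{:M:} b y z" if "z : carrier A" for z by (rule hom_mult[OF b_hom(2)[OF that] assms])
 show "b z (x \<otimes> y) = b z x \<otimes>{:M:} b z y" if "z : carrier A" for z by (rule hom_mult[OF b_hom(1)[OF that] assms])
qed

lemma q_one [simp]: "q \<one> = \<one>{:M:}"
proof -
 have "q \<one> = q \<one> \<otimes>{:M:} q \<one> \<otimes>{:M:} \<one>{:M:}" using q_mult[of \<one> \<one>] b_simps(3)[of \<one> \<one>] by simp
 then have "q \<one> \<otimes>{:M:} q \<one> = q \<one> \<otimes>{:M:} \<one>{:M:}" by simp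
 then show ?thesis using M.Units_l_cancel[of "q \<one>" "q \<one>" "\<one>{:M:}"] by simp
qed

lemma q_inv: "x : carrier A ==> q (inv x) = q x"
proof -
 assume x: "x : carrier A"
 have "q x \<otimes>{:M:} q (inv x) \<otimes>{:M:} inv{:M:} (q x \<otimes>{:M:} q x) = \<one>{:M:}"
  using q_mult[of x "inv x"] b_simps(5)[OF x x] b_self[OF x] x by simp
 then have "q x \<otimes>{:M:} q (inv x) = q x \<otimes>{:M:} q x"
  using M.inv_solve_right'[of "\<one>{:M:}" "q x \<otimes>{:M:} q (inv x)" "q x \<otimes>{:M:} q x"] x by simp
 then show ?thesis using M.Units_l_cancel[of "q x" "q (inv x)" "q x"] x by simp
qed

lemma q_nat_pow: "x : carrier A ==> q (x [^] (n::nat)) = q x [^]{:M:} (n * n)"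
proof (induction n)
 case (Suc n)
 have "q (x [^] Suc n) = q x [^]{:M:} (n * n) \<otimes>{:M:} q x \<otimes>{:M:} (q x \<otimes>{:M:} q x) [^]{:M:} n"
  using Suc q_mult[of "x [^] n" x] b_simps(6)[of x x n] b_self[of x] by simp
 also have "\<dots> = q x [^]{:M:} (n * n) \<otimes>{:M:} q x [^]{:M:} Suc 0 \<otimes>{:M:} (q x [^]{:M:} n \<otimes>{:M:} q x [^]{:M:} n)"
  using Suc.prems by (simp add: M.nat_pow_distrib)
 also have "\<dots> = q x [^]{:M:} (n * n + Suc 0 + (n + n))"
  using Suc.prems by (simp only: M.nat_pow_mult q_closed)
 also have "n * n + Suc 0 + (n + n) = Suc n * Suc n" by simp
 finally show ?case .
qed simp

lemma q_int_pow: "x : carrier A ==> q (x [^] (i::int)) = q x [^]{:M:} (i * i)"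
proof (cases i rule: int_cases2)
 case (nonneg n)
 assume "x : carrier A"
 then show ?thesis using q_nat_pow[of x n] by (simp add: nonneg int_pow_int flip: of_nat_mult)
next
 case (nonpos n)
 assume "x : carrier A"
 then show ?thesis using q_nat_pow[of x n] q_inv[of "x [^] n"] by (simp add: nonpos A.int_pow_neg_int int_pow_int flip: of_nat_mult)
qed

end

text \<open>If no choice of generators splits off a cyclic factor freely, take \<open>y\<close> and \<open>S\<close> with \<open>y\<^sup>m \<in> \<langle>S\<rangle>\<close> and
 \<open>m > 0\<close> least; by minimality \<open>m\<close> divides the exponents of \<open>y\<^sup>m\<close>, so that \<open>y\<close> can be corrected to have order \<open>m\<close>.\<close>

lemma (in comm_group) split_off_generator:
 assumes S: "finite S" "S \<subseteq> carrier G" "y : carrier G" "generate G (insert y S) = carrier G"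
 obtains y' S' where "y' : carrier G" "finite S'" "S' \<subseteq> carrier G" "card S' <= card S"
  "generate G (insert y' S') = carrier G" "!!k::int. y' [^] k : generate G S' ==> y' [^] k = \<one>"
proof -
 note th = that
 let ?g = "%y' S'. y' : carrier G & finite S' & S' \<subseteq> carrier G & card S' <= card S & generate G (insert y' S') = carrier G"
 \<comment> \<open>All generating systems of bounded size compete here, so that a relation found
   after exchanging generators can contradict the minimality of m.\<close>
 let ?P = "%m::nat. m > 0 & (EX y' S'. ?g y' S' & y' [^] m : generate G S')"
 have int_nat: "EX m::nat. m > 0 & y' [^] m : generate G S' & int m = \<bar>k\<bar>"
  if "?g y' S'" "y' [^] (k::int) : generate G S'" "k ~= 0" for y' S' k
 proof -
  have sub: "subgroup (generate G S') G" using that(1) by (intro generate_is_subgroup) blast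
  have "y' [^] \<bar>k\<bar> : generate G S'"
  proof (cases "k >= 0")
  case False
  then have "y' [^] \<bar>k\<bar> = inv (y' [^] k)" using that(1) by (simp add: int_pow_neg)
  then show ?thesis using subgroup.m_inv_closed[OF sub that(2)] by simp
  qed (use that(2) in simp)
  then show ?thesis using that(3) by (intro exI[of _ "nat \<bar>k\<bar>"]) (simp flip: int_pow_int)
 qed
 show thesis
 proof (cases "EX m. ?P m")
  case False
  have "k = 0" if "y [^] (k::int) : generate G S" for k
  using int_nat[of y S k] S that False by blast
  then show ?thesis using th[of y S] S by fastforce
 next
  case True
  define m where "m = (LEAST m. ?P m)"
  have m: "?P m" unfolding m_def using LeastI_ex[OF True] .
  have least: "~ ?P k" if "k < m" for k using that not_less_Least unfolding m_def by blast
  obtain y0 S0 where g0: "?g y0 S0" and y0: "y0 [^] m : generate G S0" using m by blast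
  have m0: "m > 0" using m by blast
  have c0: "y0 : carrier G" "finite S0" "S0 \<subseteq> carrier G" "card S0 <= card S" "generate G (insert y0 S0) = carrier G"
  using g0 by blast+
  have sub: "subgroup (generate G F) G" if "F \<subseteq> carrier G" for F by (rule generate_is_subgroup[OF that])
  note sub0 = sub[OF c0(3)]
  \<comment> \<open>The generators in \<open>S0\<close> are eliminated one after another from the
    expression of (y0 u)^m by adjusting u.\<close>
  have step: "EX u : generate G S0. (y0 \<otimes> u) [^] m : generate G (S0 - F)" if "finite F" "F \<subseteq> S0" for F
  using that
  proof (induction F rule: finite_induct)
  case empty
  show ?case using y0 c0 by (intro bexI[of _ \<one>]) (auto intro: generate.one)
  next
  case (insert s F)
  let ?R = "S0 - insert s F"
  have sR: "S0 - F = insert s ?R" "?R \<subseteq> carrier G" "s : S0" using insert c0(3) by auto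
  have sc: "s : carrier G" using sR(3) c0(3) by blast
  obtain u where u: "u : generate G S0" "(y0 \<otimes> u) [^] m : generate G (S0 - F)" using insert by blast
  have uc: "u : carrier G" using subgroup.mem_carrier[OF sub0 u(1)] .
  obtain a :: int and k where ak: "(y0 \<otimes> u) [^] m = s [^] a \<otimes> k" "k : generate G ?R"
   using u(2) unfolding sR(1) generate_insert_comm[OF sR(2) sc] by blast
  have kc: "k : carrier G" using subgroup.mem_carrier[OF sub[OF sR(2)] ak(2)] .
  let ?c = "a div int m" and ?r = "nat (a mod int m)"
  let ?u = "u \<otimes> inv (s [^] ?c)"
  have sg: "s [^] i : generate G S0" for i :: int by (rule subgroup_int_pow_closed[OF sub0 generate.incl[OF sR(3)]])
  have u': "?u : generate G S0" by (rule subgroup.m_closed[OF sub0 u(1) subgroup.m_inv_closed[OF sub0 sg]])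
  have uc': "?u : carrier G" using subgroup.mem_carrier[OF sub0 u'] .
  have "(y0 \<otimes> ?u) [^] m = ((y0 \<otimes> u) \<otimes> inv (s [^] ?c)) [^] m" using c0(1) uc sc by (simp add: m_assoc)
  also have "\<dots> = (y0 \<otimes> u) [^] m \<otimes> (inv (s [^] ?c)) [^] m" using c0(1) uc sc by (simp add: nat_pow_distrib)
  also have "(inv (s [^] ?c)) [^] m = inv (s [^] (?c * int m))"
   using sc by (simp add: int_pow_inv int_pow_pow flip: int_pow_int)
  also have "(y0 \<otimes> u) [^] m \<otimes> inv (s [^] (?c * int m)) = s [^] a \<otimes> inv (s [^] (?c * int m)) \<otimes> k"
   unfolding ak(1) using sc kc by (simp add: m_ac)
  also have "s [^] a \<otimes> inv (s [^] (?c * int m)) = s [^] (a - ?c * int m)" using sc by (simp add: int_pow_diff)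
  also have "a - ?c * int m = int ?r" using m0 by (simp add: minus_div_mult_eq_mod)
  finally have e: "(y0 \<otimes> ?u) [^] m = s [^] ?r \<otimes> k" by (simp only: int_pow_int)
  \<comment> \<open>Otherwise s and the corrected generator exchange roles: a power of s with
    exponent \<open>?r\<close> below m lies in the span of the others, against minimality.\<close>
  have "?r = 0"
  proof (rule ccontr)
   assume r: "?r ~= 0"
   let ?y = "y0 \<otimes> ?u" and ?S = "insert (y0 \<otimes> ?u) (S0 - {s})"
   have yc: "?y : carrier G" using c0(1) uc' by simp
   have Sc: "?S \<subseteq> carrier G" "finite ?S" using yc c0 by auto
   have "card ?S <= Suc (card (S0 - {s}))" using c0(2) by (simp add: card_insert_if)
   then have "card ?S <= card S" using card_Suc_Diff1[OF c0(2) sR(3)] c0(4) by linarith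
   moreover have "carrier G \<subseteq> generate G (insert s ?S)"
   proof -
    have sb: "subgroup (generate G (insert s ?S)) G" using Sc sc by (intro sub) auto
    have S0s: "S0 \<subseteq> generate G (insert s ?S)" by (rule subsetI, rule generate.incl) blast
    then have "generate G S0 \<subseteq> generate G (insert s ?S)" by (rule generate_subgroup_incl[OF _ sb])
    then have "?u : generate G (insert s ?S)" using u' by blast
    moreover have "?y : generate G (insert s ?S)" by (rule generate.incl) blast
    ultimately have "?y \<otimes> inv ?u : generate G (insert s ?S)" using subgroup.m_closed[OF sb] subgroup.m_inv_closed[OF sb] by blast
    moreover have "?y \<otimes> inv ?u = y0" using c0(1) uc' by (simp add: m_assoc)
    ultimately have "insert y0 S0 \<subseteq> generate G (insert s ?S)" using S0s by simp
    then have "generate G (insert y0 S0) \<subseteq> generate G (insert s ?S)" by (rule generate_subgroup_incl[OF _ sb])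
    then show ?thesis unfolding c0(5) .
   qed
   moreover have "generate G (insert s ?S) \<subseteq> carrier G" using Sc sc by (intro generate_incl) auto
   moreover have "s [^] ?r : generate G ?S"
   proof -
    have sb: "subgroup (generate G ?S) G" by (rule sub[OF Sc(1)])
    have "generate G ?R \<subseteq> generate G ?S" by (rule mono_generate) auto
    then have "k : generate G ?S" using ak(2) by blast
    moreover have "?y [^] m : generate G ?S"
    using subgroup_int_pow_closed[OF sb generate.incl[of ?y ?S], of "int m"] by (simp add: int_pow_int)
    ultimately have "?y [^] m \<otimes> inv k : generate G ?S" using subgroup.m_closed[OF sb] subgroup.m_inv_closed[OF sb] by blast
    moreover have "?y [^] m \<otimes> inv k = s [^] ?r" unfolding e using sc kc by (simp add: m_assoc)
    ultimately show ?thesis by simp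
   qed
   ultimately have "?P ?r" using r sc Sc by blast
   moreover have "?r < m" using m0 by (simp add: nat_less_iff)
   ultimately show False using least by blast
  qed
  then have "(y0 \<otimes> ?u) [^] m : generate G ?R" unfolding e using ak(2) kc by simp
  then show ?case using u' by blast
  qed
  obtain u where u: "u : generate G S0" "(y0 \<otimes> u) [^] m : generate G (S0 - S0)" using step[OF c0(2) subset_refl] by blast
  have uc: "u : carrier G" using subgroup.mem_carrier[OF sub0 u(1)] .
  let ?y = "y0 \<otimes> u"
  have yc: "?y : carrier G" using c0(1) uc by simp
  have ym: "?y [^] m = \<one>" using u(2) by (simp add: generate_empty)
  have gy: "generate G (insert ?y S0) = carrier G"
  proof
  have Sc: "insert ?y S0 \<subseteq> carrier G" using yc c0(3) by blast
  have sb: "subgroup (generate G (insert ?y S0)) G" by (rule sub[OF Sc])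
  show "generate G (insert ?y S0) \<subseteq> carrier G" by (rule generate_incl[OF Sc])
  have "u : generate G (insert ?y S0)" using u(1) mono_generate[of S0 "insert ?y S0"] by blast
  moreover have "?y : generate G (insert ?y S0)" by (rule generate.incl) blast
  ultimately have "?y \<otimes> inv u : generate G (insert ?y S0)" using subgroup.m_closed[OF sb] subgroup.m_inv_closed[OF sb] by blast
  moreover have "?y \<otimes> inv u = y0" using c0(1) uc by (simp add: m_assoc)
  ultimately have "insert y0 S0 \<subseteq> generate G (insert ?y S0)" using generate.incl[of _ "insert ?y S0"] by auto
  then have "generate G (insert y0 S0) \<subseteq> generate G (insert ?y S0)" by (rule generate_subgroup_incl[OF _ sb])
  then show "carrier G \<subseteq> generate G (insert ?y S0)" unfolding c0(5) .
  qed
  have triv: "?y [^] k = \<one>" if k: "?y [^] (k::int) : generate G S0" for k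
  proof -
  let ?r = "k mod int m"
  have ym': "?y [^] (int m) = \<one>" using ym by (simp only: int_pow_int)
  have "?y [^] (int m * (k div int m) + ?r) = (?y [^] int m) [^] (k div int m) \<otimes> ?y [^] ?r"
   using yc by (simp only: int_pow_mult int_pow_pow)
  then have kr: "?y [^] k = ?y [^] ?r" unfolding ym' using yc by simp
  have "?r = 0"
  proof (rule ccontr)
   assume "?r ~= 0"
   then obtain n :: nat where n: "n > 0" "?y [^] n : generate G S0" "int n = \<bar>?r\<bar>"
    using int_nat[of ?y S0 ?r] k kr yc c0 gy by auto
   have "int n < int m" using n(3) m0 by simp
   then have "~ ?P n" using least by simp
   then show False using n(1,2) yc c0 gy by blast
  qed
  then show ?thesis using kr by simp
  qed
  show thesis by (rule th[of ?y S0]) (use yc c0 gy triv in auto)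
 qed
qed

text \<open>Split A into the cyclic group of y and a subgroup B with fewer generators, and take a
  triangular form: powers of q y on the cyclic part, the form given by induction on B, and b once
  between the two. On the diagonal the three terms recombine to q by its product rule. The torsion
  assumption on q makes the first term independent of the chosen exponents of y.\<close>

lemma quadratic_bihom:
 fixes A :: "('a, 'b) monoid_scheme" and M :: "('m, 'n) monoid_scheme"
 assumes M: "comm_group M"
 shows "comm_group A ==> finite S ==> S \<subseteq> carrier A ==> generate A S = carrier A ==> card S <= n ==>
  quadratic A M q b ==> (!!x k. x : carrier A ==> x [^]{:A:} (k::nat) = \<one>{:A:} ==> q x [^]{:M:} k = \<one>{:M:}) ==>
  EX bt. bihom A M bt & (ALL x : carrier A. bt x x = q x)"
proof (induction n arbitrary: A S)
 case (0 A S)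
 interpret A: comm_group A by (rule "0.prems"(1))
 interpret M: comm_group M by (rule M)
 have "S = {}" using "0.prems"(2,5) by simp
 then have "carrier A = {\<one>{:A:}}" using "0.prems"(4) A.generate_empty by simp
 moreover have "q \<one>{:A:} = \<one>{:M:}"
  using "0.prems"(7)[OF A.one_closed, of 1] "0.prems"(6) by (simp add: quadratic_def)
 moreover have "bihom A M (%x y. \<one>{:M:})" by (auto simp: bihom_def hom_def)
 ultimately show ?case by (intro exI[of _ "%x y. \<one>{:M:}"]) simp
next
 case (Suc n A S)
 note pr = Suc.prems
 interpret A: comm_group A by (rule pr(1))
 interpret M: comm_group M by (rule M)
 interpret Q: quadratic_map A M q b by (simp add: quadratic_map_def quadratic_map_axioms_def A.is_group M pr(6))
 obtain y0 S0 where yS: "y0 : carrier A" "finite S0" "S0 \<subseteq> carrier A" "card S0 <= n" "generate A (insert y0 S0) = carrier A"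
 proof (cases "S = {}")
  case True
  then have "generate A (insert \<one>{:A:} {}) = carrier A" using pr(4) A.generate_one A.generate_empty by simp
  then show thesis using that[of "\<one>{:A:}" "{}"] by simp
 next
  case False
  then obtain s where s: "s : S" by blast
  then have "insert s (S - {s}) = S" by blast
  moreover have "card (S - {s}) <= n" using pr(2,5) s by (simp add: card_Diff_singleton)
  ultimately show thesis using that[of s "S - {s}"] pr(2-4) s by auto
 qed
 obtain y S' where y: "y : carrier A" and S': "finite S'" "S' \<subseteq> carrier A" "card S' <= card S0"
  and gen: "generate A (insert y S') = carrier A" and ind: "!!k::int. y [^]{:A:} k : generate A S' ==> y [^]{:A:} k = \<one>{:A:}"
  by (rule A.split_off_generator[OF yS(2,3,1,5)]) (rule that)
 define Bc where "Bc = generate A S'"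
 define B where "B = A\<lparr>carrier := Bc\<rparr>"
 have Bsub: "subgroup Bc A" unfolding Bc_def by (rule A.generate_is_subgroup[OF S'(2)])
 have BA: "x : carrier A" if "x : Bc" for x by (rule subgroup.mem_carrier[OF Bsub that])
 have B: "comm_group B" unfolding B_def by (rule group.group_comm_groupI[OF A.subgroup_imp_group[OF Bsub]]) (simp add: A.m_comm BA)
 have cB: "carrier B = Bc" "monoid.mult B = monoid.mult A" "\<one>{:B:} = \<one>{:A:}" by (simp_all add: B_def)
 have S'B: "S' \<subseteq> Bc" unfolding Bc_def by (rule subsetI) (rule generate.incl)
 have genB: "generate B S' = carrier B"
  unfolding cB unfolding B_def using A.generate_consistent[OF S'B Bsub] by (simp only: Bc_def)
 have qB: "quadratic B M q b"
  using pr(6) BA unfolding quadratic_def bihom_def hom_def cB by auto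
 have tB: "q x [^]{:M:} k = \<one>{:M:}" if "x : carrier B" "x [^]{:B:} (k::nat) = \<one>{:B:}" for x k
 proof -
  have "x [^]{:A:} k = \<one>{:A:}" using that(2) A.nat_pow_consistent[of x k Bc] by (simp only: B_def[symmetric] cB)
  then show ?thesis using pr(7)[of x k] BA that(1) by (simp only: cB)
 qed
 obtain ga where ga: "bihom B M ga" "ALL x : carrier B. ga x x = q x"
  using Suc.IH[OF B S'(1) S'B[folded cB(1)] genB le_trans[OF S'(3) yS(4)] qB tB] by blast
 \<comment> \<open>The exponent of the y-component is determined only modulo the order of y; for
   this reason additivity is stated for powers of y and not for \<open>i\<close>.\<close>
 define i where "i x = (SOME j::int. EX k : Bc. x = y [^]{:A:} j \<otimes>{:A:} k)" for x
 define Y where "Y x = y [^]{:A:} i x" for x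
 define c where "c x = inv{:A:} Y x \<otimes>{:A:} x" for x
 have Yc: "Y x : carrier A" for x unfolding Y_def by (rule A.int_pow_closed[OF y])
 have dec: "c x : Bc" "x = Y x \<otimes>{:A:} c x" if x: "x : carrier A" for x
 proof -
  have "EX j::int. EX k : Bc. x = y [^]{:A:} j \<otimes>{:A:} k"
  using x unfolding gen[symmetric] A.generate_insert_comm[OF S'(2) y] Bc_def by blast
  from someI_ex[OF this] obtain k where k: "k : Bc" "x = Y x \<otimes>{:A:} k" unfolding Y_def i_def by blast
  have "c x = inv{:A:} Y x \<otimes>{:A:} (Y x \<otimes>{:A:} k)" unfolding c_def using k(2) by simp
  then have "c x = k" using A.l_cancel_inv(1)[OF Yc BA[OF k(1)], of x] by simp
  then show "c x : Bc" "x = Y x \<otimes>{:A:} c x" using k by simp_all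
 qed
 have cA: "c x : carrier A" if "x : carrier A" for x by (rule BA[OF dec(1)[OF that]])
 have Ymult: "y [^]{:A:} i (x \<otimes>{:A:} x') = y [^]{:A:} (i x + i x')" and cmult: "c (x \<otimes>{:A:} x') = c x \<otimes>{:A:} c x'"
  if x: "x : carrier A" "x' : carrier A" for x x'
 proof -
  let ?z = "x \<otimes>{:A:} x'"
  have z: "?z : carrier A" using x by simp
  note cc = cA[OF x(1)] cA[OF x(2)] cA[OF z]
  have "Y ?z \<otimes>{:A:} c ?z = (Y x \<otimes>{:A:} c x) \<otimes>{:A:} (Y x' \<otimes>{:A:} c x')"
  using dec(2)[OF z] dec(2)[OF x(1)] dec(2)[OF x(2)] by simp
  also have "\<dots> = (Y x \<otimes>{:A:} Y x') \<otimes>{:A:} (c x \<otimes>{:A:} c x')" using cc Yc by (simp add: A.m_ac)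
  finally have e: "Y ?z \<otimes>{:A:} c ?z = (Y x \<otimes>{:A:} Y x') \<otimes>{:A:} (c x \<otimes>{:A:} c x')" .
  have YY: "Y x \<otimes>{:A:} Y x' = y [^]{:A:} (i x + i x')" unfolding Y_def by (rule A.int_pow_mult[OF y, symmetric])
  have "inv{:A:} (Y x \<otimes>{:A:} Y x') \<otimes>{:A:} Y ?z = (inv{:A:} (Y x \<otimes>{:A:} Y x') \<otimes>{:A:} (Y ?z \<otimes>{:A:} c ?z)) \<otimes>{:A:} inv{:A:} c ?z"
  using cc Yc by (simp add: A.m_assoc)
  also have "\<dots> = (c x \<otimes>{:A:} c x') \<otimes>{:A:} inv{:A:} c ?z" unfolding e by (simp only: A.l_cancel_inv(1)[OF A.m_closed[OF Yc Yc] A.m_closed[OF cc(1,2)]])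
  finally have d: "inv{:A:} (Y x \<otimes>{:A:} Y x') \<otimes>{:A:} Y ?z = (c x \<otimes>{:A:} c x') \<otimes>{:A:} inv{:A:} c ?z" .
  have "(c x \<otimes>{:A:} c x') \<otimes>{:A:} inv{:A:} c ?z : Bc"
  by (rule subgroup.m_closed[OF Bsub subgroup.m_closed[OF Bsub dec(1)[OF x(1)] dec(1)[OF x(2)]] subgroup.m_inv_closed[OF Bsub dec(1)[OF z]]])
  moreover have "inv{:A:} (Y x \<otimes>{:A:} Y x') \<otimes>{:A:} Y ?z = y [^]{:A:} (- (i x + i x') + i ?z)"
  unfolding YY unfolding Y_def using y by (simp add: A.int_pow_neg[symmetric] A.int_pow_mult[symmetric])
  ultimately have one: "inv{:A:} (Y x \<otimes>{:A:} Y x') \<otimes>{:A:} Y ?z = \<one>{:A:}"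
  using ind[of "- (i x + i x') + i ?z"] d unfolding Bc_def by simp
  then have Yz: "Y ?z = Y x \<otimes>{:A:} Y x'"
  using A.inv_mult_eq_one_iff[of "Y x \<otimes>{:A:} Y x'" "Y ?z"] Yc by simp
  then show "y [^]{:A:} i ?z = y [^]{:A:} (i x + i x')" unfolding YY by (simp only: Y_def)
  show "c ?z = c x \<otimes>{:A:} c x'" using e unfolding Yz using cc Yc by simp
 qed
 have qy: "q y : carrier M" by (rule Q.q_closed[OF y])
 have qpow: "q y [^]{:M:} j = q y [^]{:M:} k" if jk: "y [^]{:A:} (j::int) = y [^]{:A:} (k::int)" for j k
 proof -
  have "y [^]{:A:} (j - k) = \<one>{:A:}" using jk y by (simp add: A.int_pow_diff)
  then have "y [^]{:A:} nat \<bar>j - k\<bar> = \<one>{:A:}" using y A.int_pow_neg[of y "j - k"] by (cases "j >= k") (simp_all flip: int_pow_int)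
  then have "q y [^]{:M:} nat \<bar>j - k\<bar> = \<one>{:M:}" by (rule pr(7)[OF y])
  then have "q y [^]{:M:} \<bar>j - k\<bar> = \<one>{:M:}" by (simp flip: int_pow_int)
  then have "q y [^]{:M:} (j - k) = \<one>{:M:}" using qy M.int_pow_neg[of "q y" "j - k"] M.inv_eq_1_iff[of "q y [^]{:M:} (j - k)"]
  by (cases "j >= k") simp_all
  then show ?thesis using qy M.int_pow_mult[of "q y" "j - k" k] by simp
 qed
 have qi: "q y [^]{:M:} (i (x \<otimes>{:A:} x') * j) = q y [^]{:M:} (i x * j) \<otimes>{:M:} q y [^]{:M:} (i x' * j)"
  if "x : carrier A" "x' : carrier A" for x x' j
 proof -
  have "q y [^]{:M:} i (x \<otimes>{:A:} x') = q y [^]{:M:} (i x + i x')" by (rule qpow[OF Ymult[OF that]])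
  then have "(q y [^]{:M:} i (x \<otimes>{:A:} x')) [^]{:M:} j = (q y [^]{:M:} (i x + i x')) [^]{:M:} j" by simp
  then show ?thesis using qy by (simp add: M.int_pow_mult M.int_pow_distrib M.int_pow_pow)
 qed
 have gah: "ga u (v \<otimes>{:A:} v') = ga u v \<otimes>{:M:} ga u v'" "ga (v \<otimes>{:A:} v') u = ga v u \<otimes>{:M:} ga v' u" "ga u v : carrier M"
  if "u : Bc" "v : Bc" "v' : Bc" for u v v'
  using ga(1) that unfolding bihom_def hom_def cB by auto
 have YY: "Y (x \<otimes>{:A:} x') = Y x \<otimes>{:A:} Y x'" if "x : carrier A" "x' : carrier A" for x x'
  using Ymult[OF that] y by (simp add: Y_def A.int_pow_mult)
 let ?bt = "%x x'. q y [^]{:M:} (i x * i x') \<otimes>{:M:} b (Y x) (c x') \<otimes>{:M:} ga (c x) (c x')"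
 have qc: "q y [^]{:M:} (j::int) : carrier M" for j by (rule M.int_pow_closed[OF qy])
 have bc: "b (Y x) (c x') : carrier M" if "x' : carrier A" for x x' by (rule Q.b_closed[OF Yc cA[OF that]])
 have gc: "ga (c x) (c x') : carrier M" if "x : carrier A" "x' : carrier A" for x x'
  by (rule gah(3)[OF dec(1)[OF that(1)] dec(1)[OF that(2)] dec(1)[OF that(2)]])
 have "bihom A M ?bt"
  unfolding bihom_def
 proof (intro conjI ballI homI)
  fix x x' assume x: "x : carrier A" "x' : carrier A"
  show "?bt x x' : carrier M" using qc bc[OF x(2)] gc[OF x] by simp_all
  show "?bt x' x : carrier M" using qc bc[OF x(1)] gc[OF x(2,1)] by simp
  fix x'' assume x'': "x'' : carrier A"
  have 1: "q y [^]{:M:} (i x * i (x' \<otimes>{:A:} x'')) = q y [^]{:M:} (i x * i x') \<otimes>{:M:} q y [^]{:M:} (i x * i x'')"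
  using qi[OF x(2) x'', of "i x"] by (simp only: mult.commute[of _ "i x"])
  have 2: "b (Y x) (c (x' \<otimes>{:A:} x'')) = b (Y x) (c x') \<otimes>{:M:} b (Y x) (c x'')"
  by (simp only: cmult[OF x(2) x''] Q.b_simps(2)[OF cA[OF x(2)] cA[OF x''] Yc])
  have 3: "ga (c x) (c (x' \<otimes>{:A:} x'')) = ga (c x) (c x') \<otimes>{:M:} ga (c x) (c x'')"
  by (simp only: cmult[OF x(2) x''] gah(1)[OF dec(1)[OF x(1)] dec(1)[OF x(2)] dec(1)[OF x'']])
  show "?bt x (x' \<otimes>{:A:} x'') = ?bt x x' \<otimes>{:M:} ?bt x x''"
  unfolding 1 2 3 using qc bc gc x x'' by (simp add: M.m_ac)
  have 4: "q y [^]{:M:} (i (x' \<otimes>{:A:} x'') * i x) = q y [^]{:M:} (i x' * i x) \<otimes>{:M:} q y [^]{:M:} (i x'' * i x)"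
  by (rule qi[OF x(2) x''])
  have 5: "b (Y (x' \<otimes>{:A:} x'')) (c x) = b (Y x') (c x) \<otimes>{:M:} b (Y x'') (c x)"
  by (simp only: YY[OF x(2) x''] Q.b_simps(1)[OF Yc Yc cA[OF x(1)]])
  have 6: "ga (c (x' \<otimes>{:A:} x'')) (c x) = ga (c x') (c x) \<otimes>{:M:} ga (c x'') (c x)"
  by (simp only: cmult[OF x(2) x''] gah(2)[OF dec(1)[OF x(1)] dec(1)[OF x(2)] dec(1)[OF x'']])
  show "?bt (x' \<otimes>{:A:} x'') x = ?bt x' x \<otimes>{:M:} ?bt x'' x"
  unfolding 4 5 6 using qc bc gc x x'' by (simp add: M.m_ac)
 qed
 moreover have "?bt x x = q x" if x: "x : carrier A" for x
 proof -
  have "q x = q (Y x) \<otimes>{:M:} q (c x) \<otimes>{:M:} b (Y x) (c x)"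
  using Q.q_mult[OF Yc cA[OF x], of x] dec(2)[OF x] by simp
  also have "q (Y x) = q y [^]{:M:} (i x * i x)" unfolding Y_def by (rule Q.q_int_pow[OF y])
  also have "q (c x) = ga (c x) (c x)" using ga(2) dec(1)[OF x] by (simp add: cB)
  finally show ?thesis using qc bc[OF x] gc[OF x x] by (simp add: M.m_ac)
 qed
 ultimately show ?case by blast
qed

section \<open>The diagonal subgroup as a retract of the tensor square\<close>

lemma (in comm_group) hom_kills_derived:
 assumes h: "h : hom H G" and H: "group H"
 shows "c : derived H (carrier H) ==> h c = \<one>"
  and "x : carrier H ==> y : carrier H ==> h (conj_elt H x y) = h x"
proof -
 interpret H: group H by (rule H)
 interpret h: group_hom H G h using h by (simp add: group_hom_defs H is_group)
 show "h c = \<one>" if c: "c : derived H (carrier H)"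
 proof (rule hom_eq_on_generate[OF h _ H is_group H.derived_set_in_carrier[OF subset_refl] _ c[unfolded derived_def]])
  show "(%c. \<one>) : hom H G" by (rule homI) auto
  fix s assume "s : (UN h1:carrier H. UN h2:carrier H. {h1 \<otimes>{:H:} h2 \<otimes>{:H:} inv{:H:} h1 \<otimes>{:H:} inv{:H:} h2})"
  then obtain a b where s: "s = a \<otimes>{:H:} b \<otimes>{:H:} inv{:H:} a \<otimes>{:H:} inv{:H:} b" "a : carrier H" "b : carrier H" by blast
  have "h s = h a \<otimes> h b \<otimes> inv h a \<otimes> inv h b" using s by simp
  also have "h a \<otimes> h b = h b \<otimes> h a" by (rule m_comm[OF h.hom_closed[OF s(2)] h.hom_closed[OF s(3)]])
  also have "h b \<otimes> h a \<otimes> inv h a \<otimes> inv h b = \<one>" using s(2,3) by (simp add: m_assoc)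
  finally show "h s = \<one>" .
 qed
 show "h (conj_elt H x y) = h x" if xy: "x : carrier H" "y : carrier H"
 proof -
  have "h (conj_elt H x y) = inv h y \<otimes> h x \<otimes> h y" using xy by (simp add: conj_elt_def)
  also have "\<dots> = h x \<otimes> (inv h y \<otimes> h y)"
  using h.hom_closed[OF xy(1)] h.hom_closed[OF xy(2)] m_comm[of "inv h y" "h x"] by (simp only: m_assoc inv_closed)
  finally show ?thesis using xy by simp
 qed
qed

context tensor_context
begin

abbreviation Dg where "Dg \<equiv> V\<lparr>carrier := D\<rparr>"

definition sq :: "'a => 'v" where "sq g = w g g"

text \<open>The polar form of \<open>sq\<close>. Although w is only a crossed pairing, this product
  turns out to be bilinear with values in \<open>D\<close>.\<close>

definition sym :: "'a => 'a => 'v" where "sym g h = w g h \<otimes>{:V:} w h g"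

lemma comm_Dg: "comm_group Dg"
proof -
 interpret Dg: group Dg by (rule V.subgroup_imp_group[OF D_subgroup])
 show ?thesis by (rule Dg.group_comm_groupI) (simp add: D_central)
qed

lemma Dg_inv: "d : D ==> inv{:Dg:} d = inv{:V:} d"
 by (rule V.m_inv_consistent[OF D_subgroup])

lemma sq_D [simp]: "g : carrier G ==> sq g : D"
 unfolding sq_def D_def by (rule generate.incl) blast

lemma conj_D: "d : D ==> v : carrier V ==> conj_elt V d v = d"
 using V.conj_eq_iff[of d v] D_central[of d v] by simp

text \<open>Its image in G is [g, h] [h, g] = 1, and elements of \<open>T\<close> over the identity
  are fixed by conjugation.\<close>

lemma sym_fixed:
 assumes "g : carrier G" "h : carrier G" "v : carrier V"
 shows "conj_elt V (sym g h) v = sym g h"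
proof (rule q_conj[OF _ _ assms(3)])
 show "sym g h : T" using assms by (simp add: sym_def)
 have "e (sym g h) = comm_elt G g h \<otimes>{:G:} comm_elt G h g"
  unfolding sym_def using hom_mult[OF e_hom w_closed[OF assms(1,2)] w_closed[OF assms(2,1)]] assms by simp
 also have "\<dots> = \<one>{:G:}" using assms by (simp add: comm_elt_def G.group_word_simps)
 finally show "e (sym g h) = \<one>{:G:}" .
qed

lemma conj_mult_V:
 "a : carrier V ==> b : carrier V ==> c : carrier V ==> conj_elt V (a \<otimes>{:V:} b) c = conj_elt V a c \<otimes>{:V:} conj_elt V b c"
 by (simp add: conj_elt_def V.m_assoc)

lemma l_closed' [simp]: "g : carrier G ==> l g : carrier V"
 by (rule hom_in_carrier[OF l_hom])

text \<open>Expand w (gh) (gh) in both arguments; the two diagonal terms are central and can be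
  collected in front.\<close>

lemma sq_mult:
 assumes g: "g : carrier G" "h : carrier G"
 shows "sq (g \<otimes>{:G:} h) = sq g \<otimes>{:V:} sq h \<otimes>{:V:} sym g h"
proof -
 let ?C = "%v. conj_elt V v (l h)"
 let ?a = "?C (w g h)" and ?b = "?C (w h g)"
 have c: "?a : carrier V" "?b : carrier V" "sq g : carrier V" "sq h : carrier V" "w g h : carrier V" "w h g : carrier V"
  using g by simp_all
 have 1: "w g (g \<otimes>{:G:} h) = w g h \<otimes>{:V:} sq g"
  using w_mult_right[OF g(1,1,2)] conj_D[OF sq_D[OF g(1)] l_closed'[OF g(2)]] by (simp only: sq_def)
 have 2: "w h (g \<otimes>{:G:} h) = sq h \<otimes>{:V:} ?b"
  using w_mult_right[OF g(2,1,2)] by (simp only: sq_def)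
 have "sq (g \<otimes>{:G:} h) = ?C (w g h \<otimes>{:V:} sq g) \<otimes>{:V:} (sq h \<otimes>{:V:} ?b)"
  using w_mult_left[OF g G.m_closed[OF g]] by (simp only: 1 2 sq_def[of "g \<otimes>{:G:} h"])
 also have "?C (w g h \<otimes>{:V:} sq g) = ?a \<otimes>{:V:} sq g"
  by (simp only: conj_mult_V[OF c(5,3) l_closed'[OF g(2)]] conj_D[OF sq_D[OF g(1)] l_closed'[OF g(2)]])
 also have "\<dots> = sq g \<otimes>{:V:} ?a" by (rule D_central[OF sq_D[OF g(1)] c(1), symmetric])
 also have "sq g \<otimes>{:V:} ?a \<otimes>{:V:} (sq h \<otimes>{:V:} ?b) = sq g \<otimes>{:V:} ((?a \<otimes>{:V:} sq h) \<otimes>{:V:} ?b)"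
  using c by (simp only: V.m_assoc V.m_closed)
 also have "?a \<otimes>{:V:} sq h = sq h \<otimes>{:V:} ?a" by (rule D_central[OF sq_D[OF g(2)] c(1), symmetric])
 also have "sq g \<otimes>{:V:} (sq h \<otimes>{:V:} ?a \<otimes>{:V:} ?b) = sq g \<otimes>{:V:} sq h \<otimes>{:V:} (?a \<otimes>{:V:} ?b)"
  using c by (simp only: V.m_assoc V.m_closed)
 also have "?a \<otimes>{:V:} ?b = sym g h"
  using sym_fixed[OF g l_closed'[OF g(2)]] unfolding sym_def by (simp only: conj_mult_V[OF c(5,6) l_closed'[OF g(2)]])
 finally show ?thesis .
qed

lemma sym_closed [simp]: "g : carrier G ==> h : carrier G ==> sym g h : carrier V"
 by (simp add: sym_def)

text \<open>Solve \<open>sq_mult\<close> for its last factor.\<close>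

lemma sym_D [simp]: assumes g: "g : carrier G" "h : carrier G" shows "sym g h : D"
proof -
 have "inv{:V:} (sq g \<otimes>{:V:} sq h) \<otimes>{:V:} sq (g \<otimes>{:G:} h) : D"
  by (intro subgroup.m_closed[OF D_subgroup] subgroup.m_inv_closed[OF D_subgroup] sq_D G.m_closed g)
 moreover have "inv{:V:} (sq g \<otimes>{:V:} sq h) \<otimes>{:V:} sq (g \<otimes>{:G:} h) = sym g h"
  unfolding sq_mult[OF g]
  by (rule V.l_cancel_inv(1)[OF V.m_closed[OF D_closed[OF sq_D[OF g(1)]] D_closed[OF sq_D[OF g(2)]]] sym_closed[OF g]])
 ultimately show ?thesis by simp
qed

lemma sym_mult_left:
 assumes g: "g : carrier G" "g' : carrier G" "h : carrier G"
 shows "sym (g \<otimes>{:G:} g') h = sym g h \<otimes>{:V:} sym g' h"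
proof -
 let ?C = "%v. conj_elt V v (l g')"
 let ?a = "?C (w g h)" and ?b = "?C (w h g)"
 have c: "?a : carrier V" "?b : carrier V" "w g h : carrier V" "w h g : carrier V" "w g' h : carrier V" "w h g' : carrier V"
  using g by simp_all
 have "sym (g \<otimes>{:G:} g') h = (?a \<otimes>{:V:} w g' h) \<otimes>{:V:} (w h g' \<otimes>{:V:} ?b)"
  by (simp only: sym_def w_mult_left[OF g] w_mult_right[OF g(3,1,2)])
 also have "\<dots> = ?a \<otimes>{:V:} (sym g' h \<otimes>{:V:} ?b)"
  unfolding sym_def using c by (simp only: V.m_assoc V.m_closed)
 also have "sym g' h \<otimes>{:V:} ?b = ?b \<otimes>{:V:} sym g' h" by (rule D_central[OF sym_D[OF g(2,3)] c(2)])
 also have "?a \<otimes>{:V:} (?b \<otimes>{:V:} sym g' h) = (?a \<otimes>{:V:} ?b) \<otimes>{:V:} sym g' h"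
  using c sym_closed[OF g(2,3)] by (simp only: V.m_assoc)
 also have "?a \<otimes>{:V:} ?b = sym g h"
  using sym_fixed[OF g(1,3) l_closed'[OF g(2)]] unfolding sym_def by (simp only: conj_mult_V[OF c(3,4) l_closed'[OF g(2)]])
 finally show ?thesis .
qed

lemma sq_conj: "g : carrier G ==> s : carrier G ==> sq (conj_elt G g s) = sq g"
 using w_conj(1)[of g g s] conj_D[OF sq_D[of g] l_closed'[of s]] by (simp only: sq_def)

text \<open>The elements gh and hg are conjugate and thus have the same \<open>sq\<close>; compare
  the two expansions.\<close>

lemma sym_commute:
 assumes g: "g : carrier G" "h : carrier G"
 shows "sym g h = sym h g"
proof -
 have c: "sq g \<otimes>{:V:} sq h : carrier V" using g by simp
 have "conj_elt G (g \<otimes>{:G:} h) g = h \<otimes>{:G:} g" using g by (simp add: conj_elt_def G.m_assoc)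
 then have "sq (h \<otimes>{:G:} g) = sq (g \<otimes>{:G:} h)" using sq_conj[OF G.m_closed[OF g] g(1)] by simp
 moreover have "sq h \<otimes>{:V:} sq g = sq g \<otimes>{:V:} sq h" using g by (simp add: D_central)
 ultimately have "sq g \<otimes>{:V:} sq h \<otimes>{:V:} sym h g = sq g \<otimes>{:V:} sq h \<otimes>{:V:} sym g h"
  using sq_mult[OF g] sq_mult[OF g(2,1)] by simp
 then show ?thesis using V.Units_l_cancel[of "sq g \<otimes>{:V:} sq h" "sym h g" "sym g h"] c sym_closed[OF g(2,1)] sym_closed[OF g] by simp
qed

lemma quadratic_sq: "quadratic_map G Dg sq sym"
proof -
 have "(%x. sym x y) : hom G Dg" if "y : carrier G" for y
  using that by (intro homI) (simp_all add: sym_mult_left)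
 moreover have "sym y : hom G Dg" if "y : carrier G" for y
  using that by (intro homI) (simp_all add: sym_mult_left sym_commute[of y])
 moreover have "sym x x = sq x \<otimes>{:V:} sq x" for x by (simp only: sym_def sq_def)
 ultimately have "quadratic G Dg sq sym"
  unfolding quadratic_def bihom_def by (simp add: sq_mult)
 then show ?thesis
  by (simp add: quadratic_map_def quadratic_map_axioms_def G.is_group comm_Dg)
qed

sublocale Q: quadratic_map G Dg sq sym by (rule quadratic_sq)

lemma sym_derived:
 assumes "c : derived G (carrier G)" "g : carrier G"
 shows "sym c g = \<one>{:V:}" "sym g c = \<one>{:V:}"
 using comm_group.hom_kills_derived(1)[OF comm_Dg Q.b_hom(2)[OF assms(2)] G.is_group assms(1)]
  comm_group.hom_kills_derived(1)[OF comm_Dg Q.b_hom(1)[OF assms(2)] G.is_group assms(1)] by simp_all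

lemma derived_closed: "c : derived G (carrier G) ==> c : carrier G"
 using G.derived_in_carrier[OF subset_refl] by blast

text \<open>The commutator is a times a conjugate of a^-1, and neither \<open>sq\<close> nor
  \<open>sym a\<close> distinguishes conjugates, so the value is the one at a a^-1.\<close>

lemma sq_commutator:
 assumes a: "a : carrier G" "b : carrier G"
 shows "sq (a \<otimes>{:G:} b \<otimes>{:G:} inv{:G:} a \<otimes>{:G:} inv{:G:} b) = \<one>{:V:}"
proof -
 let ?k = "conj_elt G (inv{:G:} a) (inv{:G:} b)"
 have ai: "inv{:G:} a : carrier G" "inv{:G:} b : carrier G" using a by simp_all
 have k: "?k : carrier G" by (rule G.conj_closed[OF ai])
 have "a \<otimes>{:G:} b \<otimes>{:G:} inv{:G:} a \<otimes>{:G:} inv{:G:} b = a \<otimes>{:G:} ?k"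
  using a by (simp add: conj_elt_def G.m_assoc)
 then have "sq (a \<otimes>{:G:} b \<otimes>{:G:} inv{:G:} a \<otimes>{:G:} inv{:G:} b) = sq a \<otimes>{:V:} sq ?k \<otimes>{:V:} sym a ?k"
  by (simp only: sq_mult[OF a(1) k])
 also have "sq ?k = sq (inv{:G:} a)" by (rule sq_conj[OF ai])
 also have "sym a ?k = sym a (inv{:G:} a)"
  by (rule comm_group.hom_kills_derived(2)[OF comm_Dg Q.b_hom(1)[OF a(1)] G.is_group ai])
 also have "sq a \<otimes>{:V:} sq (inv{:G:} a) \<otimes>{:V:} sym a (inv{:G:} a) = sq (a \<otimes>{:G:} inv{:G:} a)"
  by (rule sq_mult[OF a(1) ai(1), symmetric])
 also have "\<dots> = \<one>{:V:}" using a Q.q_one by simp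
 finally show ?thesis .
qed

lemma sq_derived: "c : derived G (carrier G) ==> sq c = \<one>{:V:}"
proof -
 have S: "derived_set G (carrier G) \<subseteq> carrier G" by (rule G.derived_set_in_carrier[OF subset_refl])
 assume c: "c : derived G (carrier G)"
 then show ?thesis unfolding derived_def
 proof (induction rule: generate.induct)
  case one show ?case using Q.q_one by simp
 next
  case (incl h) then show ?case using sq_commutator by blast
 next
  case (inv h)
  then have "h : carrier G" "sq h = \<one>{:V:}" using S sq_commutator by blast+
  then show ?case using Q.q_inv[of h] by simp
 next
  case (eng h1 h2)
  then have d: "h1 : derived G (carrier G)" "h2 : derived G (carrier G)" by (simp_all only: derived_def)
  show ?case using sq_mult[OF derived_closed[OF d(1)] derived_closed[OF d(2)]] eng.IH sym_derived(1)[OF d(1) derived_closed[OF d(2)]] by simp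
 qed
qed

lemma sq_mult_derived:
 assumes "c : derived G (carrier G)" "g : carrier G"
 shows "sq (c \<otimes>{:G:} g) = sq g" "h : carrier G ==> sym (c \<otimes>{:G:} g) h = sym g h"
 using sq_mult[OF derived_closed[OF assms(1)] assms(2)] sq_derived[OF assms(1)] sym_derived[OF assms(1)] assms(2)
  sym_mult_left[OF derived_closed[OF assms(1)] assms(2)] by simp_all

text \<open>The compatibility with torsion that \<open>quadratic_bihom\<close> demands; this is
  where the condition on the abelianization or the complement is spent.\<close>

lemma sq_pow_eq_one:
 assumes "no_2_torsion (abelianization G) | has_complement G (derived G (carrier G))"
  and g: "g : carrier G" "g [^]{:G:} (n::nat) : derived G (carrier G)"
 shows "sq g [^]{:Dg:} n = \<one>{:V:}"
proof -
 let ?N = "derived G (carrier G)"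
 interpret N: normal ?N G by (rule G.derived_self_is_normal)
 interpret p: group_hom G "G Mod ?N" "%g. ?N #>{:G:} g" by (rule group_hom_mod_intro[OF N.normal_axioms])
 have sc: "sq g : carrier Dg" if "g : carrier G" for g using sq_D[OF that] by simp
 from assms(1) show ?thesis
 proof
  assume no2: "no_2_torsion (abelianization G)"
  show ?thesis using g(2)
  proof (induction n rule: less_induct)
  case (less n)
  show ?case
  proof (cases "even n")
   \<comment> \<open>For n = 2k the square of g^k lies in the derived subgroup. Without 2-torsion in
     the abelianization so does g^k, and the induction hypothesis for k applies.\<close>
   case True
   then obtain k where k: "n = k + k" by (metis evenE mult_2)
   show ?thesis
   proof (cases "k = 0")
    case False
    let ?x = "?N #>{:G:} (g [^]{:G:} k)"
    have gk: "g [^]{:G:} k : carrier G" using g(1) by simp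
    have "?x \<otimes>{:G Mod ?N:} ?x = ?N #>{:G:} (g [^]{:G:} n)"
    using p.hom_mult[OF gk gk] G.nat_pow_mult[OF g(1), of k k] by (simp only: k)
    also have "\<dots> = \<one>{:G Mod ?N:}"
    unfolding one_FactGroup by (rule iffD2[OF N.rcos_eq_one_iff[OF G.nat_pow_closed[OF g(1)]] less.prems])
    finally have "?x [^]{:G Mod ?N:} (2::nat) = \<one>{:G Mod ?N:}"
    using p.H.l_one[OF p.hom_closed[OF gk]] by (simp only: numeral_2_eq_2 p.H.nat_pow_Suc p.H.nat_pow_0)
    then have "?x = \<one>{:G Mod ?N:}"
    using no2 p.hom_closed[OF gk] unfolding no_2_torsion_def abelianization_def by blast
    then have "g [^]{:G:} k : ?N" using N.rcos_eq_one_iff[OF gk] unfolding one_FactGroup by blast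
    then have "sq g [^]{:Dg:} k = \<one>{:V:}" using less.IH[of k] False k by simp
    then show ?thesis using Q.M.nat_pow_mult[OF sc[OF g(1)], of k k] by (simp add: k)
   qed (simp add: k)
  next
   case False
   \<comment> \<open>For odd n = 2k + 1 the exponent 2n comes from the polar form and n^2 from the
     quadratic map; both kill, and n^2 = 2n k + n.\<close>
   then obtain k where k: "n = Suc (2 * k)" by (metis oddE Suc_eq_plus1)
   have "sym (g [^]{:G:} n) g = \<one>{:V:}" by (rule sym_derived(1)[OF less.prems g(1)])
   then have "(sq g \<otimes>{:Dg:} sq g) [^]{:Dg:} n = \<one>{:Dg:}"
    using Q.b_simps(6)[OF g(1) g(1), of n] Q.b_self[OF g(1)] by simp
   then have 2: "sq g [^]{:Dg:} (n + n) = \<one>{:Dg:}"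
    by (simp only: Q.M.nat_pow_distrib[OF sc[OF g(1)] sc[OF g(1)]] Q.M.nat_pow_mult[OF sc[OF g(1)]])
   have "sq g [^]{:Dg:} (n * n) = \<one>{:Dg:}"
    using Q.q_nat_pow[OF g(1), of n] sq_derived[OF less.prems] by simp
   moreover have "n * n = (n + n) * k + n" by (simp add: k algebra_simps)
   moreover have "sq g [^]{:Dg:} ((n + n) * k + n) = (sq g [^]{:Dg:} (n + n)) [^]{:Dg:} k \<otimes>{:Dg:} sq g [^]{:Dg:} n"
    by (simp only: Q.M.nat_pow_mult[OF sc[OF g(1)]] Q.M.nat_pow_pow[OF sc[OF g(1)]])
   ultimately have "\<one>{:Dg:} = \<one>{:Dg:} \<otimes>{:Dg:} sq g [^]{:Dg:} n" using Q.M.nat_pow_one[of k] by (simp only: 2)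
   then show ?thesis using Q.M.l_one[OF Q.M.nat_pow_closed[OF sc[OF g(1)]], of n] by simp
  qed
  qed
 next
  \<comment> \<open>Up to the derived subgroup g equals some h in the complement, for which h^n = 1
    holds in G itself; then 1 = w (h^n) h = (sq h)^n.\<close>
  assume "has_complement G ?N"
  then obtain H where H: "subgroup H G" "H \<inter> ?N = {\<one>{:G:}}" "H <#>{:G:} ?N = carrier G"
  unfolding has_complement_def by blast
  have "g : H <#>{:G:} ?N" using g(1) by (simp only: H(3))
  then obtain h c where h: "h : H" "c : ?N" "g = h \<otimes>{:G:} c"
  unfolding set_mult_def by blast
  have hG: "h : carrier G" by (rule subgroup.mem_carrier[OF H(1) h(1)])
  have cG: "c : carrier G" by (rule derived_closed[OF h(2)])
  let ?c = "h \<otimes>{:G:} c \<otimes>{:G:} inv{:G:} h"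
  have c': "?c : ?N" by (rule N.inv_op_closed2[OF hG h(2)])
  have gc: "g = ?c \<otimes>{:G:} h" using h(3) hG cG by (simp add: G.m_assoc)
  have sg: "sq g = sq h" unfolding gc by (rule sq_mult_derived(1)[OF c' hG])
  have "g \<otimes>{:G:} inv{:G:} h = ?c" using h(3) by simp
  then have gh: "?N #>{:G:} g = ?N #>{:G:} h" using c' N.rcos_eq_iff[OF g(1) hG] by simp
  have "?N #>{:G:} (h [^]{:G:} n) = ?N #>{:G:} (g [^]{:G:} n)"
  by (simp only: p.hom_nat_pow[OF hG] p.hom_nat_pow[OF g(1)] gh)
  also have "\<dots> = ?N" by (rule iffD2[OF N.rcos_eq_one_iff[OF G.nat_pow_closed[OF g(1)]] g(2)])
  finally have "h [^]{:G:} n : ?N" by (rule iffD1[OF N.rcos_eq_one_iff[OF G.nat_pow_closed[OF hG]]])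
  moreover have "h [^]{:G:} n : H"
  using G.subgroup_int_pow_closed[OF H(1) h(1), of "int n"] by (simp only: int_pow_int)
  ultimately have hn: "h [^]{:G:} n = \<one>{:G:}" using H(2) by blast
  have "w (h [^]{:G:} k) h = sq h [^]{:Dg:} k" for k :: nat
  proof (induction k)
  case 0 show ?case using hG by simp
  next
  case (Suc k)
  have d: "sq h [^]{:Dg:} k : D" using Q.M.nat_pow_closed[OF sc[OF hG], of k] by simp
  have "w (h [^]{:G:} Suc k) h = conj_elt V (w (h [^]{:G:} k) h) (l h) \<otimes>{:V:} w h h"
   using w_mult_left[OF G.nat_pow_closed[OF hG] hG hG, of k] by (simp only: G.nat_pow_Suc)
  also have "\<dots> = sq h [^]{:Dg:} k \<otimes>{:V:} sq h"
   by (simp only: Suc conj_D[OF d l_closed'[OF hG]] flip: sq_def)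
  finally show ?case by simp
  qed
  from this[of n] have "sq h [^]{:Dg:} n = \<one>{:V:}" using hn hG by simp
  then show ?thesis by (simp only: sg)
 qed
qed

text \<open>Factors from the derived subgroup change neither \<open>sq\<close> nor
  \<open>sym\<close>, so both descend to the abelianization through arbitrary
  representatives.\<close>

lemma diagonal_bihom:
 assumes fg: "finitely_generated (abelianization G)"
  and c: "no_2_torsion (abelianization G) | has_complement G (derived G (carrier G))"
 obtains bt where "bihom (abelianization G) Dg bt"
  "!!g. g : carrier G ==> bt (derived G (carrier G) #>{:G:} g) (derived G (carrier G) #>{:G:} g) = sq g"
proof -
 let ?N = "derived G (carrier G)" and ?A = "abelianization G"
 interpret N: normal ?N G by (rule G.derived_self_is_normal)
 interpret p: group_hom G "G Mod ?N" "%g. ?N #>{:G:} g" by (rule group_hom_mod_intro[OF N.normal_axioms])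
 have A: "comm_group ?A" unfolding abelianization_def by (rule G.derived_quot_is_comm_group)
 have cA: "carrier ?A = (%g. ?N #>{:G:} g) ` carrier G" unfolding abelianization_def by (auto simp: carrier_FactGroup)
 define rep where "rep X = (SOME g. g : carrier G & ?N #>{:G:} g = X)" for X
 have rep: "rep (?N #>{:G:} g) : carrier G & ?N #>{:G:} rep (?N #>{:G:} g) = ?N #>{:G:} g" if "g : carrier G" for g
  unfolding rep_def by (rule someI[of "%h. h : carrier G & ?N #>{:G:} h = ?N #>{:G:} g" g]) (simp add: that)
 have rc: "EX c : ?N. rep (?N #>{:G:} g) = c \<otimes>{:G:} g" if g: "g : carrier G" for g
 proof
  note r = rep[OF g]
  show "rep (?N #>{:G:} g) \<otimes>{:G:} inv{:G:} g : ?N" using N.rcos_eq_iff[OF conjunct1[OF r] g] r by blast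
  show "rep (?N #>{:G:} g) = rep (?N #>{:G:} g) \<otimes>{:G:} inv{:G:} g \<otimes>{:G:} g" using r g by (simp add: G.m_assoc)
 qed
 have sr: "sq (rep (?N #>{:G:} g)) = sq g" if g: "g : carrier G" for g
 proof -
  obtain c where "c : ?N" "rep (?N #>{:G:} g) = c \<otimes>{:G:} g" using rc[OF g] by (rule bexE)
  then show ?thesis using sq_mult_derived(1)[OF _ g] by (simp only:)
 qed
 have sym1: "sym (rep (?N #>{:G:} g)) h = sym g h" if g: "g : carrier G" "h : carrier G" for g h
 proof -
  obtain c where "c : ?N" "rep (?N #>{:G:} g) = c \<otimes>{:G:} g" using rc[OF g(1)] by (rule bexE)
  then show ?thesis using sq_mult_derived(2)[OF _ g] by (simp only:)
 qed
 have sym2: "sym (rep (?N #>{:G:} g)) (rep (?N #>{:G:} h)) = sym g h" if g: "g : carrier G" "h : carrier G" for g h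
 proof -
  note r = conjunct1[OF rep[OF g(2)]]
  have "sym (rep (?N #>{:G:} g)) (rep (?N #>{:G:} h)) = sym (rep (?N #>{:G:} h)) g"
  unfolding sym1[OF g(1) r] by (rule sym_commute[OF g(1) r])
  then show ?thesis unfolding sym1[OF g(2,1)] sym_commute[OF g(2,1)] .
 qed
 have mA: "(?N #>{:G:} g) \<otimes>{:?A:} (?N #>{:G:} h) = ?N #>{:G:} (g \<otimes>{:G:} h)" if "g : carrier G" "h : carrier G" for g h
  unfolding abelianization_def by (rule p.hom_mult[OF that, symmetric])
 have pA: "(?N #>{:G:} g) [^]{:?A:} (k::nat) = ?N #>{:G:} (g [^]{:G:} k)" if "g : carrier G" for g k
  unfolding abelianization_def by (rule p.hom_nat_pow[OF that, symmetric])
 let ?q = "%X. sq (rep X)" and ?b = "%X Y. sym (rep X) (rep Y)"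
 have im: "EX g : carrier G. X = ?N #>{:G:} g" if "X : carrier ?A" for X
  using that unfolding cA image_iff .
 have bD: "?b X Y : D" if XY: "X : carrier ?A" "Y : carrier ?A" for X Y
 proof -
  obtain x where x: "x : carrier G" "X = ?N #>{:G:} x" using im[OF XY(1)] by (rule bexE)
  obtain y where y: "y : carrier G" "Y = ?N #>{:G:} y" using im[OF XY(2)] by (rule bexE)
  show ?thesis unfolding x(2) y(2) sym2[OF x(1) y(1)] by (rule sym_D[OF x(1) y(1)])
 qed
 have bl: "?b (X \<otimes>{:?A:} Y) Z = ?b X Z \<otimes>{:V:} ?b Y Z" and br: "?b Z (X \<otimes>{:?A:} Y) = ?b Z X \<otimes>{:V:} ?b Z Y"
  if XY: "X : carrier ?A" "Y : carrier ?A" "Z : carrier ?A" for X Y Z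
 proof -
  obtain x where x: "x : carrier G" "X = ?N #>{:G:} x" using im[OF XY(1)] by (rule bexE)
  obtain y where y: "y : carrier G" "Y = ?N #>{:G:} y" using im[OF XY(2)] by (rule bexE)
  obtain z where z: "z : carrier G" "Z = ?N #>{:G:} z" using im[OF XY(3)] by (rule bexE)
  note xy = G.m_closed[OF x(1) y(1)]
  show "?b (X \<otimes>{:?A:} Y) Z = ?b X Z \<otimes>{:V:} ?b Y Z"
  unfolding x(2) y(2) z(2) mA[OF x(1) y(1)] sym2[OF xy z(1)] sym2[OF x(1) z(1)] sym2[OF y(1) z(1)]
  by (rule sym_mult_left[OF x(1) y(1) z(1)])
  show "?b Z (X \<otimes>{:?A:} Y) = ?b Z X \<otimes>{:V:} ?b Z Y"
  unfolding x(2) y(2) z(2) mA[OF x(1) y(1)] sym2[OF z(1) xy] sym2[OF z(1) x(1)] sym2[OF z(1) y(1)]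
   sym_commute[OF z(1) xy] sym_commute[OF z(1) x(1)] sym_commute[OF z(1) y(1)]
  by (rule sym_mult_left[OF x(1) y(1) z(1)])
 qed
 have qm: "?q (X \<otimes>{:?A:} Y) = ?q X \<otimes>{:V:} ?q Y \<otimes>{:V:} ?b X Y" if XY: "X : carrier ?A" "Y : carrier ?A" for X Y
 proof -
  obtain x where x: "x : carrier G" "X = ?N #>{:G:} x" using im[OF XY(1)] by (rule bexE)
  obtain y where y: "y : carrier G" "Y = ?N #>{:G:} y" using im[OF XY(2)] by (rule bexE)
  show ?thesis
  unfolding x(2) y(2) mA[OF x(1) y(1)] sym2[OF x(1) y(1)] sr[OF x(1)] sr[OF y(1)] sr[OF G.m_closed[OF x(1) y(1)]]
  by (rule sq_mult[OF x(1) y(1)])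
 qed
 have qD: "?q X : D" if XY: "X : carrier ?A" for X
 proof -
  obtain x where x: "x : carrier G" "X = ?N #>{:G:} x" using im[OF XY] by (rule bexE)
  show ?thesis unfolding x(2) sr[OF x(1)] by (rule sq_D[OF x(1)])
 qed
 have self: "?b X X = ?q X \<otimes>{:V:} ?q X" for X by (simp only: sym_def sq_def)
 have "?b X : hom ?A Dg" if "X : carrier ?A" for X
  by (rule homI) (simp_all add: bD[OF that] br[OF _ _ that])
 moreover have "(%X. ?b X Y) : hom ?A Dg" if "Y : carrier ?A" for Y
  by (rule homI) (simp_all add: bD[OF _ that] bl[OF _ _ that])
 ultimately have "quadratic ?A Dg ?q ?b"
  unfolding quadratic_def bihom_def by (simp add: qD self qm)
 moreover have "?q X [^]{:Dg:} k = \<one>{:Dg:}" if X: "X : carrier ?A" "X [^]{:?A:} (k::nat) = \<one>{:?A:}" for X k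
 proof -
  obtain g where g: "X = ?N #>{:G:} g" "g : carrier G" using X(1) unfolding cA by (rule imageE)
  have "?N #>{:G:} (g [^]{:G:} k) = ?N" using X(2) unfolding g(1) pA[OF g(2)] by (simp add: abelianization_def)
  then have "g [^]{:G:} k : ?N" by (rule iffD1[OF N.rcos_eq_one_iff[OF G.nat_pow_closed[OF g(2)]]])
  then show ?thesis using sq_pow_eq_one[OF c g(2)] by (simp add: g(1) sr[OF g(2)])
 qed
 moreover obtain S where "finite S" "S \<subseteq> carrier ?A" "generate ?A S = carrier ?A"
  using fg unfolding finitely_generated_def by (elim exE conjE)
 ultimately obtain bt where bt: "bihom ?A Dg bt" "ALL x : carrier ?A. bt x x = ?q x"
  using quadratic_bihom[OF comm_Dg A _ _ _ le_refl, of S ?q ?b] by blast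
 have "bt (?N #>{:G:} g) (?N #>{:G:} g) = sq g" if g: "g : carrier G" for g
  using bt(2) g sr[OF g] unfolding cA by simp
 then show thesis using that[of bt] bt(1) by blast
qed

text \<open>The finitely many values of the bilinear form at pairs of generators span all its
  values, among them the diagonal ones that generate \<open>D\<close>.\<close>

lemma finitely_generated_D:
 assumes fg: "finitely_generated (abelianization G)" and bt: "bihom (abelianization G) Dg bt"
  and btq: "!!g. g : carrier G ==> bt (derived G (carrier G) #>{:G:} g) (derived G (carrier G) #>{:G:} g) = sq g"
 shows "finitely_generated Dg"
proof -
 let ?A = "abelianization G"
 interpret N: normal "derived G (carrier G)" G by (rule G.derived_self_is_normal)
 interpret A: comm_group ?A unfolding abelianization_def by (rule G.derived_quot_is_comm_group)
 obtain S where S: "finite S" "S \<subseteq> carrier ?A" "generate ?A S = carrier ?A"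
  using fg unfolding finitely_generated_def by (elim exE conjE)
 let ?W = "(%(s, t). bt s t) ` (S \<times> S)"
 have bc: "bt x y : carrier Dg" if "x : carrier ?A" "y : carrier ?A" for x y
  using bt that hom_in_carrier unfolding bihom_def by fast
 have W: "?W \<subseteq> carrier Dg"
 proof (rule subsetI)
  fix v assume "v : ?W"
  then obtain s t where st: "v = bt s t" "s : S" "t : S" by auto
  show "v : carrier Dg" unfolding st(1) by (rule bc[OF subsetD[OF S(2) st(2)] subsetD[OF S(2) st(3)]])
 qed
 let ?G = "generate Dg ?W"
 interpret W: normal ?G Dg by (rule Q.M.subgroup_imp_normal[OF Q.M.generate_is_subgroup[OF W]])
 interpret M: group "Dg Mod ?G" by (rule W.factorgroup_is_group)
 have triv: "(%x. \<one>{:Dg Mod ?G:}) : hom ?A (Dg Mod ?G)" using M.one_closed M.l_one by (intro homI) (simp_all only:)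
 have ext: "f x : ?G" if f: "f : hom ?A Dg" and s: "!!s. s : S ==> f s : ?G" and x: "x : carrier ?A" for f x
 proof -
  have h: "(%x. ?G #>{:Dg:} f x) : hom ?A (Dg Mod ?G)"
  using hom_compose[OF f W.r_coset_hom_Mod] by (simp only: comp_def)
  have "?G #>{:Dg:} f s = \<one>{:Dg Mod ?G:}" if "s : S" for s
  unfolding one_FactGroup by (rule iffD2[OF W.rcos_eq_one_iff[OF W.mem_carrier[OF s[OF that]]] s[OF that]])
  then have "?G #>{:Dg:} f x = \<one>{:Dg Mod ?G:}"
  by (rule hom_eq_on_generate[OF h triv A.is_group M.is_group S(2)]) (simp_all only: S(3) x)
  then show ?thesis unfolding one_FactGroup by (rule iffD1[OF W.rcos_eq_one_iff[OF hom_in_carrier[OF f x]]])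
 qed
 have 1: "bt s y : ?G" if "s : S" "y : carrier ?A" for s y
 proof (rule ext[OF _ _ that(2)])
  show "bt s : hom ?A Dg" using bt S(2) that(1) unfolding bihom_def by blast
  show "bt s t : ?G" if "t : S" for t using \<open>s : S\<close> that by (intro generate.incl) force
 qed
 have 2: "bt x y : ?G" if "x : carrier ?A" "y : carrier ?A" for x y
  using bt that 1 unfolding bihom_def by (intro ext[OF _ _ that(1), of "%x. bt x y"]) auto
 have "{w g g | g. g : carrier G} \<subseteq> ?G"
 proof clarify
  fix g assume g: "g : carrier G"
  have "derived G (carrier G) #>{:G:} g : carrier ?A" using g unfolding abelianization_def carrier_FactGroup by blast
  then show "w g g : ?G" using 2 btq[OF g] by (metis sq_def)
 qed
 then have "generate Dg {w g g | g. g : carrier G} \<subseteq> ?G"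
  by (rule Q.M.generate_subgroup_incl[OF _ Q.M.generate_is_subgroup[OF W]])
 moreover have "generate Dg {w g g | g. g : carrier G} = D"
  using V.generate_consistent[OF _ D_subgroup, of "{w g g | g. g : carrier G}"] sq_D unfolding sq_def D_def[symmetric] by blast
 ultimately have "generate Dg ?W = carrier Dg" using Q.M.generate_incl[OF W] by auto
 then show ?thesis unfolding finitely_generated_def using W S(1) by (intro exI[of _ ?W]) blast
qed

end

lemma (in group) comm_elt_eqI:
 "a : carrier G ==> b : carrier G ==> c : carrier G ==> a \<otimes> b = b \<otimes> a \<otimes> c ==> comm_elt G a b = c"
 by (simp add: comm_elt_def m_assoc)

text \<open>The bihomomorphism \<open>\<beta>\<close> makes \<open>\<Delta> \<times> G \<times> G\<close> a Heisenberg group, in which the two copies of \<open>G\<close>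
 satisfy the relations of \<open>\<nu>(G)\<close> and \<open>[g, h\<^sup>\<phi>]\<close> becomes \<open>\<beta>(g, h)\<close>.\<close>

lemma Delta_retract:
 fixes G :: "('a, 'b) monoid_scheme"
 assumes G: "group G" and fg: "finitely_generated (abelianization G)"
  and c: "no_2_torsion (abelianization G) | has_complement G (derived G (carrier G))"
 obtains rh where "rh : hom (tensor_square G) (Delta G)" "!!d. d : carrier (Delta G) ==> rh d = d"
  "finitely_generated (Delta G)"
proof -
 note th = that
 interpret N: tensor_context G "nu G" "nu_left G" "nu_right G" "nu_fold G" by (rule nu_context[OF G])
 let ?N = "derived G (carrier G)" and ?A = "abelianization G"
 interpret n: normal ?N G by (rule N.G.derived_self_is_normal)
 interpret p: group_hom G "G Mod ?N" "%g. ?N #>{:G:} g" by (rule group_hom_mod_intro[OF n.normal_axioms])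
 obtain bt' where bt': "bihom ?A N.Dg bt'" "!!g. g : carrier G ==> bt' (?N #>{:G:} g) (?N #>{:G:} g) = N.sq g"
  by (rule N.diagonal_bihom[OF fg c]) (rule that)
 have fgD: "finitely_generated N.Dg" by (rule N.finitely_generated_D[OF fg bt'])
 define bt where "bt g h = bt' (?N #>{:G:} g) (?N #>{:G:} h)" for g h
 have ph: "(%g. ?N #>{:G:} g) : hom G ?A" unfolding abelianization_def by (rule p.homh)
 have h1: "bt g : hom G N.Dg" if "g : carrier G" for g
 proof -
  have "bt' (?N #>{:G:} g) : hom ?A N.Dg" using bt'(1) hom_in_carrier[OF ph that] unfolding bihom_def by blast
  from hom_compose[OF ph this] show ?thesis unfolding bt_def comp_def .
 qed
 have h2: "(%g. bt g h) : hom G N.Dg" if "h : carrier G" for h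
 proof -
  have "(%x. bt' x (?N #>{:G:} h)) : hom ?A N.Dg" using bt'(1) hom_in_carrier[OF ph that] unfolding bihom_def by blast
  from hom_compose[OF ph this] show ?thesis unfolding bt_def comp_def .
 qed
 have bc: "bt g h : N.D" if "g : carrier G" "h : carrier G" for g h
  using hom_in_carrier[OF h1[OF that(1)] that(2)] by simp
 have b1: "bt g \<one>{:G:} = \<one>{:nu G:}" "bt \<one>{:G:} g = \<one>{:nu G:}" if "g : carrier G" for g
  using hom_one[OF h1[OF that] G N.Q.M.is_group] hom_one[OF h2[OF that] G N.Q.M.is_group] by simp_all
 \<comment> \<open>The inverse and the order of arguments in the cocycle are chosen so that the
   commutator of the two copies is \<open>bt g h\<close> and not its inverse.\<close>
 let ?Q = "G \<times>\<times> G" and ?f = "%x y. inv{:N.Dg:} bt (fst y) (snd x)"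
 have Q: "group ?Q" by (rule DirProd_group[OF G G])
 interpret X: cocycle_context N.Dg ?Q ?f
 proof (intro cocycle_context.intro cocycle_context_axioms.intro N.comm_Dg Q)
  show "?f x y : carrier N.Dg" if "x : carrier ?Q" "y : carrier ?Q" for x y
  using that bc by (intro N.Q.M.inv_closed) auto
  fix x y z assume "x : carrier ?Q" "y : carrier ?Q" "z : carrier ?Q"
  then obtain x1 x2 y1 y2 z1 z2 where x: "x = (x1, x2)" "y = (y1, y2)" "z = (z1, z2)"
  and xc: "x1 : carrier G" "x2 : carrier G" "y1 : carrier G" "y2 : carrier G" "z1 : carrier G" "z2 : carrier G"
  by (cases x, cases y, cases z) auto
  have 1: "bt (y1 \<otimes>{:G:} z1) x2 = bt y1 x2 \<otimes>{:N.Dg:} bt z1 x2" by (rule hom_mult[OF h2[OF xc(2)] xc(3,5)])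
  have 2: "bt z1 (x2 \<otimes>{:G:} y2) = bt z1 x2 \<otimes>{:N.Dg:} bt z1 y2" by (rule hom_mult[OF h1[OF xc(5)] xc(2,4)])
  have d: "bt y1 x2 : carrier N.Dg" "bt z1 x2 : carrier N.Dg" "bt z1 y2 : carrier N.Dg" using bc xc by simp_all
  have "inv{:N.Dg:} bt z1 y2 \<otimes>{:N.Dg:} inv{:N.Dg:} (bt y1 x2 \<otimes>{:N.Dg:} bt z1 x2)
   = inv{:N.Dg:} bt y1 x2 \<otimes>{:N.Dg:} inv{:N.Dg:} (bt z1 x2 \<otimes>{:N.Dg:} bt z1 y2)"
  by (simp only: N.Q.M.inv_mult[OF d(1,2)] N.Q.M.inv_mult[OF d(2,3)] N.Q.M.m_lcomm[OF N.Q.M.inv_closed[OF d(3)] N.Q.M.inv_closed[OF d(1)] N.Q.M.inv_closed[OF d(2)]]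
    N.Q.M.m_comm[OF N.Q.M.inv_closed[OF d(3)] N.Q.M.inv_closed[OF d(2)]])
  then show "?f y z \<otimes>{:N.Dg:} ?f x (y \<otimes>{:?Q:} z) = ?f x y \<otimes>{:N.Dg:} ?f (x \<otimes>{:?Q:} y) z"
  unfolding x mult_DirProd fst_conv snd_conv 1 2 .
 qed
 have one: "\<one>{:nu G:} : N.D" "inv{:N.Dg:} \<one>{:nu G:} = \<one>{:nu G:}"
  using N.Q.M.one_closed N.Q.M.inv_one by simp_all
 have f1: "X.f1 = \<one>{:N.Dg:}" unfolding X.f1_def by (simp add: b1 one)
 have incl: "X.incl d = (d, (\<one>{:G:}, \<one>{:G:}))" if "d : N.D" for d
  using that by (simp add: X.incl_def f1 one)
 let ?a = "%g. (\<one>{:N.Dg:}, (g, \<one>{:G:}))" and ?b = "%g. (\<one>{:N.Dg:}, (\<one>{:G:}, g))"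
 have ac: "?a g : carrier X.X" "?b g : carrier X.X" if "g : carrier G" for g using that by (simp_all add: one)
 have ah: "?a : hom G X.X" by (rule homI) (simp_all add: b1 one)
 have bh: "?b : hom G X.X" by (rule homI) (simp_all add: b1 one)
 have ic: "X.incl (bt g h) : group_center X.X" if "g : carrier G" "h : carrier G" for g h
  using X.incl_center[of "bt g h"] bc[OF that] by simp
 have ab: "comm_elt X.X (?a g) (?b h) = X.incl (bt g h)" if g: "g : carrier G" "h : carrier G" for g h
 proof (rule X.X.comm_elt_eqI[OF ac(1)[OF g(1)] ac(2)[OF g(2)] group_centerD(1)[OF ic[OF g]]])
  show "?a g \<otimes>{:X.X:} ?b h = ?b h \<otimes>{:X.X:} ?a g \<otimes>{:X.X:} X.incl (bt g h)"
  using g bc[OF g] by (simp add: incl b1 one N.Dg_inv)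
 qed
 have cj: "conj_elt X.X (X.incl (bt g h)) v = X.incl (bt g h)" if "g : carrier G" "h : carrier G" "v : carrier X.X" for g h v
  by (rule iffD2[OF X.X.conj_eq_iff[OF group_centerD(1)[OF ic[OF that(1,2)]] that(3)] group_centerD(2)[OF ic[OF that(1,2)] that(3)]])
 obtain h where h: "h : hom (nu G) X.X" "!!g. g : carrier G ==> h (nu_left G g) = ?a g" "!!g. g : carrier G ==> h (nu_right G g) = ?b g"
 proof (rule nu_hom[OF G X.group_X ah bh])
  fix g1 g2 g3 assume g: "g1 : carrier G" "g2 : carrier G" "g3 : carrier G"
  show "conj_elt X.X (comm_elt X.X (?a g1) (?b g2)) (?a g3) = conj_elt X.X (comm_elt X.X (?a g1) (?b g2)) (?b g3)"
  by (simp only: ab[OF g(1,2)] cj[OF g(1,2) ac(1)[OF g(3)]] cj[OF g(1,2) ac(2)[OF g(3)]])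
  note cc = N.G.conj_closed[OF g(1,3)] N.G.conj_closed[OF g(2,3)]
  \<comment> \<open>Each argument of \<open>bt\<close> enters through a homomorphism to an abelian
    group, so conjugation does not change the value.\<close>
  have "bt (conj_elt G g1 g3) (conj_elt G g2 g3) = bt (conj_elt G g1 g3) g2"
  by (rule N.Q.M.hom_kills_derived(2)[OF h1[OF cc(1)] G g(2,3)])
  also have "\<dots> = bt g1 g2" by (rule N.Q.M.hom_kills_derived(2)[OF h2[OF g(2)] G g(1,3)])
  finally show "conj_elt X.X (comm_elt X.X (?a g1) (?b g2)) (?b g3) = comm_elt X.X (?a (conj_elt G g1 g3)) (?b (conj_elt G g2 g3))"
  by (simp only: ab[OF g(1,2)] ab[OF cc] cj[OF g(1,2) ac(2)[OF g(3)]])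
 qed (rule that)
 interpret h: group_hom "nu G" X.X h using h(1) by (simp add: group_hom_defs X.group_X)
 have hw: "h (N.w g k) = X.incl (bt g k)" if g: "g : carrier G" "k : carrier G" for g k
  unfolding N.w_def hom_comm[OF h(1) N.V.is_group X.group_X hom_in_carrier[OF N.l_hom g(1)] hom_in_carrier[OF N.r_hom g(2)]]
  h(2)[OF g(1)] h(3)[OF g(2)] by (rule ab[OF g])
 interpret i: group_hom N.Dg X.X X.incl using X.incl_hom by (simp add: group_hom_defs X.group_X N.Q.M.is_group)
 have i1: "h \<one>{:nu G:} = X.incl \<one>{:nu G:}" using h.hom_one i.hom_one by simp
 have im: "X.incl (d \<otimes>{:nu G:} d') = X.incl d \<otimes>{:X.X:} X.incl d'" if "d : N.D" "d' : N.D" for d d'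
  using i.hom_mult[of d d'] that by simp
 have ii: "X.incl (inv{:nu G:} d) = inv{:X.X:} X.incl d" if "d : N.D" for d
  using i.hom_inv[of d] that by (simp add: N.Dg_inv)
 note Dc = subgroup.m_closed[OF N.D_subgroup] subgroup.m_inv_closed[OF N.D_subgroup]
 have hT: "EX d : N.D. h t = X.incl d" if "t : N.T" for t
  using that
 proof (induction rule: N.T_induct)
  case (w g k) then show ?case using hw[OF w] bc[OF w] by blast
 next
  case one show ?case using i1 subgroup.one_closed[OF N.D_subgroup] by blast
 next
  case (mult s t)
  then obtain d d' where d: "d : N.D" "h s = X.incl d" "d' : N.D" "h t = X.incl d'" by blast
  have "h (s \<otimes>{:nu G:} t) = X.incl (d \<otimes>{:nu G:} d')"
  by (simp only: h.hom_mult[OF N.T_closed[OF mult(1)] N.T_closed[OF mult(2)]] d(2,4) im[OF d(1,3)])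
  then show ?case using Dc(1)[OF d(1,3)] by (rule bexI)
 next
  case (inv t)
  then obtain d where d: "d : N.D" "h t = X.incl d" by blast
  have "h (inv{:nu G:} t) = X.incl (inv{:nu G:} d)"
  by (simp only: h.hom_inv[OF N.T_closed[OF inv(1)]] d(2) ii[OF d(1)])
  then show ?case using Dc(2)[OF d(1)] by (rule bexI)
 qed
 let ?r = "%t. fst (h t)"
 have r: "?r t : N.D" "h t = X.incl (?r t)" if "t : N.T" for t
  using hT[OF that] incl by (metis fst_conv)+
 \<comment> \<open>The diagonal of \<open>bt\<close> was made to be \<open>sq\<close>, so the
   generators of \<open>N.D\<close>, and hence all its elements, are fixed.\<close>
 have hD: "h d = X.incl d" if "d : N.D" for d
 proof -
  have "d : generate (nu G) {N.w g g | g. g : carrier G}" using that by (simp only: N.D_def)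
  then show ?thesis
  proof (induction rule: generate.induct)
  case one show ?case by (rule i1)
 next
  case (incl x)
  then obtain g where g: "x = N.w g g" "g : carrier G" by blast
  have "bt g g = x" using bt'(2)[OF g(2)] by (simp only: bt_def N.sq_def g(1))
  then show ?case using hw[OF g(2,2)] g(1) by simp
 next
  case (inv x)
  then obtain g where g: "x = N.w g g" "g : carrier G" by blast
  have "bt g g = x" using bt'(2)[OF g(2)] by (simp only: bt_def N.sq_def g(1))
  then have "h x = X.incl x" using hw[OF g(2,2)] g(1) by simp
  moreover have "x : N.D" using N.sq_D[OF g(2)] by (simp only: N.sq_def g(1))
  ultimately show ?case using ii h.hom_inv[of x] by simp
 next
  case (eng x y)
  then have d: "x : N.D" "y : N.D" by (simp_all only: N.D_def)
  show ?case by (simp only: h.hom_mult[OF N.D_closed[OF d(1)] N.D_closed[OF d(2)]] eng.IH im[OF d])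
  qed
 qed
 note te = tensor_square_eq[OF G]
 show thesis
 proof (rule th[of ?r])
  show "?r : hom (tensor_square G) (Delta G)"
  unfolding te
  proof (rule homI)
  fix s t assume "s : carrier (nu G\<lparr>carrier := N.T\<rparr>)" "t : carrier (nu G\<lparr>carrier := N.T\<rparr>)"
  then have st: "s : N.T" "t : N.T" by simp_all
  show "?r s : carrier N.Dg" using r(1)[OF st(1)] by simp
  have "h (s \<otimes>{:nu G:} t) = X.incl (?r s \<otimes>{:nu G:} ?r t)"
   unfolding h.hom_mult[OF N.T_closed[OF st(1)] N.T_closed[OF st(2)]] im[OF r(1)[OF st(1)] r(1)[OF st(2)]]
   using r(2)[OF st(1)] r(2)[OF st(2)] by simp
  then show "?r (s \<otimes>{:nu G\<lparr>carrier := N.T\<rparr>:} t) = ?r s \<otimes>{:N.Dg:} ?r t"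
   using incl[OF Dc(1)[OF r(1)[OF st(1)] r(1)[OF st(2)]]] by simp
  qed
  show "?r d = d" if "d : carrier (Delta G)" for d
  using that hD[of d] incl[of d] unfolding te by simp
  show "finitely_generated (Delta G)" unfolding te by (rule fgD)
 qed
qed

section \<open>Residual properties of the tensor square\<close>

lemma Delta_central:
 fixes G :: "('a, 'b) monoid_scheme"
 assumes G: "group G"
 shows "comm_group (Delta G)" "group (tensor_square G)" "carrier (Delta G) \<lhd> tensor_square G"
  "monoid.mult (Delta G) = monoid.mult (tensor_square G)" "\<one>{:Delta G:} = \<one>{:tensor_square G:}"
  "d : carrier (Delta G) ==> t : carrier (tensor_square G) ==> d \<otimes>{:tensor_square G:} t = t \<otimes>{:tensor_square G:} d"
proof -
 interpret N: tensor_context G "nu G" "nu_left G" "nu_right G" "nu_fold G" by (rule nu_context[OF G])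
 note te = tensor_square_eq[OF G]
 show "comm_group (Delta G)" unfolding te by (rule N.comm_Dg)
 show T: "group (tensor_square G)" unfolding te by (rule N.V.subgroup_imp_group[OF N.T_subgroup])
 show "monoid.mult (Delta G) = monoid.mult (tensor_square G)" "\<one>{:Delta G:} = \<one>{:tensor_square G:}" by (simp_all add: te)
 have cen: "d \<otimes>{:nu G:} t = t \<otimes>{:nu G:} d" if "d : N.D" "t : N.T" for d t by (rule N.D_central[OF that(1) N.T_closed[OF that(2)]])
 then show "d : carrier (Delta G) ==> t : carrier (tensor_square G) ==> d \<otimes>{:tensor_square G:} t = t \<otimes>{:tensor_square G:} d"
  by (simp add: te)
 interpret T: group "tensor_square G" by (rule T)
 have s: "subgroup N.D (tensor_square G)" unfolding te by (rule N.V.subgroup_incl[OF N.D_subgroup N.T_subgroup N.D_T])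
 have "N.D \<lhd> tensor_square G"
 proof (rule T.normal_invI[OF s])
  fix x d assume x: "x : carrier (tensor_square G)" and d: "d : N.D"
  have dT: "d : carrier (tensor_square G)" by (rule subgroup.mem_carrier[OF s d])
  have "x \<otimes>{:tensor_square G:} d = d \<otimes>{:tensor_square G:} x" using cen[OF d, of x] x by (simp add: te)
  then have "x \<otimes>{:tensor_square G:} d \<otimes>{:tensor_square G:} inv{:tensor_square G:} x = d \<otimes>{:tensor_square G:} x \<otimes>{:tensor_square G:} inv{:tensor_square G:} x"
  by (simp only:)
  also have "\<dots> = d" using x dT by (simp add: T.m_assoc)
  finally show "x \<otimes>{:tensor_square G:} d \<otimes>{:tensor_square G:} inv{:tensor_square G:} x : N.D" using d by simp
 qed
 then show "carrier (Delta G) \<lhd> tensor_square G" by (simp add: te)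
qed

text \<open>The retraction splits off the central subgroup: sending t to the pair of rh t and t (rh
  t)^-1 identifies the tensor square with the product of \<open>Delta G\<close> and a copy of the
  exterior square.\<close>

lemma residually_pi_tensor_iff:
 fixes G :: "('a, 'b) monoid_scheme"
 assumes G: "group G" and rh: "rh : hom (tensor_square G) (Delta G)" "!!d. d : carrier (Delta G) ==> rh d = d"
 shows "residually_pi ps (tensor_square G) \<longleftrightarrow> residually_pi ps (exterior_square G) & residually_pi ps (Delta G)"
proof -
 note D = Delta_central[OF G]
 let ?T = "tensor_square G" and ?D = "Delta G"
 interpret T: group ?T by (rule D(2))
 interpret D: comm_group ?D by (rule D(1))
 interpret n: normal "carrier ?D" ?T by (rule D(3))
 interpret rh: group_hom ?T ?D rh using rh(1) by (simp add: group_hom_defs T.is_group D.is_group)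
 have DT: "d : carrier ?T" if "d : carrier ?D" for d by (rule n.mem_carrier[OF that])
 have rhT: "rh t : carrier ?T" if "t : carrier ?T" for t by (rule DT[OF rh.hom_closed[OF that]])
 have id: "(%d. d) : hom ?D ?T" by (rule homI) (simp_all add: DT D(4))
 have qh: "(%t. carrier ?D #>{:?T:} t) : hom ?T (exterior_square G)"
  unfolding exterior_square_def by (rule n.r_coset_hom_Mod)
 have gE: "group (exterior_square G)" by (rule group_exterior_square[OF G])
 show ?thesis
 proof (intro iffI conjI)
  assume res: "residually_pi ps ?T"
  show "residually_pi ps ?D" by (rule residually_pi_inj[OF res id D.is_group T.is_group]) simp
  \<comment> \<open>This is a homomorphism because \<open>Delta G\<close> is central; it kills
    \<open>Delta G\<close> and so induces an embedding of the exterior square into the tensor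
    square.\<close>
  let ?k = "%t. t \<otimes>{:?T:} inv{:?T:} rh t"
  have "?k : hom ?T ?T"
  proof (rule homI)
  fix s t assume st: "s : carrier ?T" "t : carrier ?T"
  show "?k s : carrier ?T" using st rhT by simp
  note r = rhT[OF st(1)] rhT[OF st(2)]
  have isD: "inv{:?T:} rh s : carrier ?D" by (rule n.m_inv_closed[OF rh.hom_closed[OF st(1)]])
  have "rh (s \<otimes>{:?T:} t) = rh s \<otimes>{:?T:} rh t" using rh.hom_mult[OF st] by (simp only: D(4))
  also have "\<dots> = rh t \<otimes>{:?T:} rh s" by (rule D(6)[OF rh.hom_closed[OF st(1)] r(2)])
  finally have "?k (s \<otimes>{:?T:} t) = s \<otimes>{:?T:} (t \<otimes>{:?T:} (inv{:?T:} rh s \<otimes>{:?T:} inv{:?T:} rh t))"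
   using st r by (simp add: T.inv_mult_group T.m_assoc)
  also have "t \<otimes>{:?T:} (inv{:?T:} rh s \<otimes>{:?T:} inv{:?T:} rh t) = (t \<otimes>{:?T:} inv{:?T:} rh s) \<otimes>{:?T:} inv{:?T:} rh t"
   using st r by (simp add: T.m_assoc)
  also have "t \<otimes>{:?T:} inv{:?T:} rh s = inv{:?T:} rh s \<otimes>{:?T:} t" by (rule D(6)[OF isD st(2), symmetric])
  finally show "?k (s \<otimes>{:?T:} t) = ?k s \<otimes>{:?T:} ?k t" using st r by (simp add: T.m_assoc)
  qed
  moreover have "?k d = \<one>{:?T:}" if "d : carrier ?D" for d using that DT rh(2) by simp
  ultimately obtain ka where ka: "ka : hom (?T Mod carrier ?D) ?T" "!!t. t : carrier ?T ==> ka (carrier ?D #>{:?T:} t) = ?k t"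
  using FactGroup_hom_universal[OF _ D(3) T.is_group, of ?k] by blast
  interpret ka: group_hom "exterior_square G" ?T ka using ka(1) gE by (simp add: group_hom_defs T.is_group exterior_square_def)
  have "inj_on ka (carrier (exterior_square G))"
  proof (rule ka.inj_on_one_iff[THEN iffD2], intro allI impI ballI)
  fix X assume X: "X : carrier (exterior_square G)" "ka X = \<one>{:?T:}"
  then obtain t where t: "X = carrier ?D #>{:?T:} t" "t : carrier ?T" unfolding exterior_square_def carrier_FactGroup by blast
  have "t \<otimes>{:?T:} inv{:?T:} rh t = \<one>{:?T:}" using X(2) ka(2)[OF t(2)] by (simp only: t(1))
  then have "t = rh t" using t(2) rhT[OF t(2)] by (metis T.inv_equality T.inv_inv T.inv_closed)
  then have "t : carrier ?D" using rh.hom_closed[OF t(2)] by simp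
  then show "X = \<one>{:exterior_square G:}" unfolding exterior_square_def one_FactGroup t(1) by (rule iffD2[OF n.rcos_eq_one_iff[OF t(2)]])
  qed
  then show "residually_pi ps (exterior_square G)"
  by (rule residually_pi_inj[OF res ka.homh gE T.is_group])
 next
  assume res: "residually_pi ps (exterior_square G) & residually_pi ps ?D"
  show "residually_pi ps ?T"
  unfolding residually_pi_def
  proof (intro ballI impI)
  fix t assume t: "t : carrier ?T" "t ~= \<one>{:?T:}"
  show "EX U : pi_normals ps ?T. t ~: U"
  proof (cases "t : carrier ?D")
   case True
   then have "rh t ~= \<one>{:?D:}" using rh(2) t(2) D(5) by simp
   then show ?thesis by (rule residually_pi_pullback[OF conjunct2[OF res] rh(1) T.is_group t(1)])
  next
   case False
   then have "carrier ?D #>{:?T:} t ~= \<one>{:exterior_square G:}"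
    unfolding exterior_square_def one_FactGroup using n.rcos_eq_one_iff[OF t(1)] by blast
   then show ?thesis by (rule residually_pi_pullback[OF conjunct1[OF res] qh T.is_group t(1)])
  qed
  qed
 qed
qed

lemma residual_tensor_square:
 assumes G: "group G" and fg: "finitely_generated (abelianization G)"
  and c: "no_2_torsion (abelianization G) | has_complement G (derived G (carrier G))"
 shows "residually_finite (tensor_square G) \<longleftrightarrow> residually_finite (exterior_square G)"
  and "Factorial_Ring.prime p ==> residually_p_finite p (tensor_square G) \<longleftrightarrow>
  residually_p_finite p (exterior_square G) & p_finite p ((Delta G)\<lparr>carrier := torsion_elements (Delta G)\<rparr>)"
  and "(ALL q::nat. Factorial_Ring.prime q --> residually_p_finite q (tensor_square G)) \<longleftrightarrow>
  torsion_elements (Delta G) = {\<one>{:Delta G:}} & (ALL q::nat. Factorial_Ring.prime q --> residually_p_finite q (exterior_square G))"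
proof -
 interpret D: comm_group "Delta G" by (rule Delta_central(1)[OF G])
 let ?t = "torsion_elements (Delta G)"
 obtain rh where rh: "rh : hom (tensor_square G) (Delta G)" "!!d. d : carrier (Delta G) ==> rh d = d" "finitely_generated (Delta G)"
  by (rule Delta_retract[OF G fg c]) (rule that)
 have iff: "residually_pi ps (tensor_square G) \<longleftrightarrow> residually_pi ps (exterior_square G) & residually_pi ps (Delta G)" for ps
  by (rule residually_pi_tensor_iff[OF G rh(1)]) (rule rh(2))
 have "EX n. pi_number UNIV n & x [^]{:Delta G:} n = \<one>{:Delta G:}" if "x : ?t" for x
  using that by (auto simp: torsion_elements_def pi_number_def)
 \<comment> \<open>Every finitely generated abelian group is residually finite; 2 serves as the
   prime that the criterion asks for.\<close>
 then have "residually_pi UNIV (Delta G)"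
  using D.residually_pi_iff_torsion[OF rh(3) two_is_prime_nat UNIV_I] by blast
 then show "residually_finite (tensor_square G) \<longleftrightarrow> residually_finite (exterior_square G)"
  unfolding residually_finite_eq iff by blast
 show pt: "residually_p_finite p (tensor_square G) \<longleftrightarrow>
  residually_p_finite p (exterior_square G) & p_finite p ((Delta G)\<lparr>carrier := ?t\<rparr>)" if p: "Factorial_Ring.prime p" for p
  unfolding residually_p_finite_eq[OF p] iff D.residually_pi_iff_pi_finite_torsion[OF rh(3) p singletonI] pi_finite_singleton[OF p]
  by (rule HOL.refl)
 have one: "\<one>{:Delta G:} : ?t" by (rule subgroup.one_closed[OF D.torsion_subgroup])
 show "(ALL q::nat. Factorial_Ring.prime q --> residually_p_finite q (tensor_square G)) \<longleftrightarrow>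
  ?t = {\<one>{:Delta G:}} & (ALL q::nat. Factorial_Ring.prime q --> residually_p_finite q (exterior_square G))"
 proof (intro iffI conjI)
  assume all: "ALL q::nat. Factorial_Ring.prime q --> residually_p_finite q (tensor_square G)"
  show "ALL q::nat. Factorial_Ring.prime q --> residually_p_finite q (exterior_square G)" using all pt by blast
  \<comment> \<open>Two primes are enough: an order that is both a power of 2 and a power of 3 is
    1.\<close>
  have p3: "Factorial_Ring.prime (3::nat)" by simp
  have pf: "p_finite 2 ((Delta G)\<lparr>carrier := ?t\<rparr>)" "p_finite 3 ((Delta G)\<lparr>carrier := ?t\<rparr>)"
  using all pt[OF two_is_prime_nat] pt[OF p3] two_is_prime_nat p3 by blast+
  obtain k where k: "card ?t = 2 ^ k" using pf(1) by (auto simp: p_finite_def order_def)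
  obtain l where l: "card ?t = 3 ^ l" using pf(2) by (auto simp: p_finite_def order_def)
  note kl = k l
  have "k = 0"
  proof (rule ccontr)
  assume "k ~= 0"
  then have "even (card ?t)" by (simp add: kl(1))
  then show False by (simp add: kl(2))
  qed
  then obtain x where "?t = {x}" using kl(1) by (auto simp: card_1_singleton_iff)
  then show "?t = {\<one>{:Delta G:}}" using one by auto
 next
  assume a: "?t = {\<one>{:Delta G:}} & (ALL q::nat. Factorial_Ring.prime q --> residually_p_finite q (exterior_square G))"
  have "p_finite q ((Delta G)\<lparr>carrier := ?t\<rparr>)" for q :: nat
  using D.subgroup_imp_group[OF D.torsion_subgroup] conjunct1[OF a] by (auto simp: p_finite_def order_def intro!: exI[of _ 0])
  then show "ALL q::nat. Factorial_Ring.prime q --> residually_p_finite q (tensor_square G)" using a pt by blast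
 qed
qed

theorem theoremA:
  fixes G :: "('a, 'b) monoid_scheme" and p :: nat
  assumes "group G" and "Factorial_Ring.prime p"
  shows
    "(residually_finite G \<and> H2_to_profinite_injective G
        \<longrightarrow> residually_finite (exterior_square G))
     \<and>
     (residually_finite G \<and> H2_to_limit_injective G (fin_index_normals G)
        \<longrightarrow> residually_finite (exterior_square G))
     \<and>
     (finitely_generated G \<and> residually_finite G \<and> finitely_generated (exterior_square G)
        \<longrightarrow> (residually_finite (exterior_square G) \<longleftrightarrow> H2_to_profinite_injective G))
     \<and>
     (residually_p_finite p G \<and> H2_to_limit_injective G (p_index_normals p G)
        \<longrightarrow> residually_p_finite p (exterior_square G))
     \<and>
     (residually_p_finite p G \<and> H2_to_pro_p_injective p G
        \<longrightarrow> residually_p_finite p (exterior_square G))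
     \<and>
     (finitely_generated (abelianization G) \<and>
      (no_2_torsion (abelianization G) \<or> has_complement G (derived G (carrier G)))
        \<longrightarrow> (residually_finite (tensor_square G) \<longleftrightarrow> residually_finite (exterior_square G)))
     \<and>
     (finitely_generated (abelianization G) \<and>
      (no_2_torsion (abelianization G) \<or> has_complement G (derived G (carrier G)))
        \<longrightarrow> (residually_p_finite p (tensor_square G) \<longleftrightarrow>
               residually_p_finite p (exterior_square G) \<and>
               p_finite p ((Delta G)\<lparr>carrier := torsion_elements (Delta G)\<rparr>)))
     \<and>
     (finitely_generated (abelianization G) \<and>
      (no_2_torsion (abelianization G) \<or> has_complement G (derived G (carrier G)))
        \<longrightarrow> ((\<forall>q::nat. Factorial_Ring.prime q \<longrightarrow> residually_p_finite q (tensor_square G)) \<longleftrightarrow>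
               torsion_elements (Delta G) = {\<one>\<^bsub>Delta G\<^esub>} \<and>
               (\<forall>q::nat. Factorial_Ring.prime q \<longrightarrow> residually_p_finite q (exterior_square G))))"
proof -
  have G: "group G" and p: "Factorial_Ring.prime p" by (rule assms)+
  \<comment> \<open>Specialising the set of primes to \<open>UNIV\<close> or \<open>{p}\<close>
    turns both injectivity assumptions into \<open>prof_injective\<close>.\<close>
  have prof: "H2_to_profinite_injective G \<longleftrightarrow> prof_injective UNIV G"
    unfolding H2_to_profinite_injective_def prof_injective_def fin_index_normals_eq ..
  have pro_p: "H2_to_pro_p_injective p G \<longleftrightarrow> prof_injective {p} G"
    unfolding H2_to_pro_p_injective_def prof_injective_def p_index_normals_eq[OF p] ..
  note rf = residually_finite_eq fin_index_normals_eq and rp = residually_p_finite_eq[OF p] p_index_normals_eq[OF p]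
  show ?thesis
  proof (intro conjI)
    show "residually_finite G \<and> H2_to_profinite_injective G \<longrightarrow> residually_finite (exterior_square G)"
      unfolding prof rf using residually_pi_exterior_prof[OF G] by blast
    show "residually_finite G \<and> H2_to_limit_injective G (fin_index_normals G) \<longrightarrow> residually_finite (exterior_square G)"
      unfolding rf using residually_pi_exterior_lim[OF G] by blast
    show "finitely_generated G \<and> residually_finite G \<and> finitely_generated (exterior_square G)
        \<longrightarrow> (residually_finite (exterior_square G) \<longleftrightarrow> H2_to_profinite_injective G)"
      unfolding prof rf using residually_pi_exterior_prof[OF G] prof_injective_of_residually_finite[OF G] by blast
    show "residually_p_finite p G \<and> H2_to_limit_injective G (p_index_normals p G) \<longrightarrow> residually_p_finite p (exterior_square G)"
      unfolding rp using residually_pi_exterior_lim[OF G] by blast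
    show "residually_p_finite p G \<and> H2_to_pro_p_injective p G \<longrightarrow> residually_p_finite p (exterior_square G)"
      unfolding pro_p rp using residually_pi_exterior_prof[OF G] by blast
  qed (use residual_tensor_square[OF G] p in blast)+
qed

end
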